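(* Let $M$ be a complex manifold with $\dim M=n\geq 2$, let $E=\frac{T(\det(TM))}{\mathbb{C}\setminus\{0\}}$, and let $\rho:E\to TM$ be the projection. There exists a natural (one-to-one) correspondence between the following: (i) Projective structures on $M$. (ii) Torsion free $\rho$-connections $\nabla$ on $E$ satisfying: (ii1) $\nabla_{\mathbf 1}s=-\frac{1}{n+1}\,s$ for any local section $s$ of $E$, where $\mathbf 1$ is the section of $E$ given by $x\mapsto (x,1)\in M\times\mathbb{C}\subseteq E$; (ii2) the $\rho$-connection induced by $\nabla$ on $\Lambda^{n+1}E$ corresponds, under the isomorphism $\Lambda^{n+1}E=\Lambda^n(TM)$, to the canonical $\rho$-connection of $\Lambda^n(TM)$; (ii3) $\mathrm{Ric}=0$, where $\mathrm{Ric}(s_1,s_2)=\mathrm{trace}\bigl(t\mapsto R(t,s_2)s_1\bigr)$ for any $s_1,s_2\in E$, with $R$ the curvature form of $\nabla$. Here the correspondence associates to $\nabla$ as in (ii) the projective structure on $M$ given by $\nabla$.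
   Context: Everything is in the category of complex manifolds: vector bundles, sections, functions, forms, connections are holomorphic; $T M$ is the holomorphic tangent bundle; "dimension" is complex dimension. Projective structures. Two connections on (the tangent bundle of) a manifold are projectively equivalent if they have the same geodesics up to parametrizations. A projective covering on $M$ is a family $\{\nabla^U\}_{U\in\mathcal U}$, where $\mathcal U$ is an open covering of $M$, $\nabla^U$ is a torsion free connection on $U$ for each nonempty $U\in\mathcal U$, and $\nabla^U,\nabla^V$ are projectively equivalent on $U\cap V$ for any overlapping $U,V\in\mathcal U$. Two projective coverings are equivalent if their union is a projective covering. A projective structure is an equivalence class of projective coverings. The bundle $E$. $\det(TM)$ denotes the principal $\mathbb{C}\setminus\{0\}$-bundle of nonzero elements of $\Lambda^n(TM)$. $E=T(\det(TM))/(\mathbb{C}\setminus\{0\})$ is the vector bundle over $M$ of rank $n+1$ whose sections over an open set are the $\mathbb{C}\setminus\{0\}$-invariant vector fields on the corresponding restriction of $\det(TM)$; $\rho:E\to TM$ is induced by the differential of the projection $\det(TM)\to M$, and there is an exact sequence $0\to M\times\mathbb{C}\to E\overset{\rho}{\to}TM\to 0$, in which the constant section $1$ of $M\times\mathbb{C}$ is mapped to the section $\mathbf 1$ of $E$ given by the Euler vector field (infinitesimal generator of the fibrewise scaling $p\mapsto \lambda p$). The bracket $[\cdot,\cdot]$ of local sections of $E$ is the Lie bracket of the corresponding invariant vector fields. $\rho$-connections. A $\rho$-connection on a vector bundle $F$ over $M$ is a linear sheaf morphism $\nabla:\Gamma(F)\to\Gamma(\mathrm{Hom}(E,F))$ such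 that $\nabla_s(ft)=\rho(s)(f)\,t+f\nabla_s t$ for any local function $f$ on $M$ and local sections $s$ of $E$ and $t$ of $F$. Its curvature form is $R(s_1,s_2)t=[\nabla_{s_1},\nabla_{s_2}]t-\nabla_{[s_1,s_2]}t$. The torsion of a $\rho$-connection on $E$ is $T(s_1,s_2)=\nabla_{s_1}s_2-\nabla_{s_2}s_1-[s_1,s_2]$; $\nabla$ is torsion free if $T=0$. $\rho$-connections induce $\rho$-connections on tensor, exterior and dual bundles by the Leibniz rule. Canonical $\rho$-connection of $\Lambda^n(TM)$. A local section $\omega$ of $\Lambda^n(T^*M)$ is a function $f_\omega$, linear on fibres, on $\det(TM)$; the canonical $\rho$-connection of $\Lambda^n(T^*M)$ is the one for which $\nabla_s\omega$ is the section corresponding to the function $s(f_\omega)$, where the section $s$ of $E$ is seen as an invariant vector field. The canonical $\rho$-connection of $\Lambda^n(TM)$ is its dual. Isomorphism $\Lambda^{n+1}E=\Lambda^n(TM)$. It is the one whose dual $\Lambda^n(T^*M)\to\Lambda^{n+1}E^*$ is $\omega\mapsto\alpha\wedge\rho^*\omega$, where $\alpha$ is any local section of $E^*$ with $\alpha(\mathbf 1)=1$. Projective structure given by $\nabla$. Let $\nabla$ be a torsion free $\rho$-connection on $E$ satisfying (ii1). The geodesics of $\nabla$ are the immersed (complex) curves $c$ in $M$ for which, locally, there is a section $s$ of $E$ over $c$ with $\rho\circ s=\dot c$ and $\nabla_s s=0$. The projective structure given by $\nabla$ is the one whose geodesics are those of $\nabla$; concretely, over any open $U\subseteq M$ for which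 there is a section $c_U:TU\to E|_U$ of $\rho$ (equivalently, a connection on $\det(TU)$), it is represented by the torsion free connection $\nabla^U_XY=\rho\bigl(\nabla_{c_U(X)}(c_U(Y))\bigr)$. *)

theory Defs
  imports "HOL-Analysis.Analysis" "HOL-Library.Function_Algebras"
begin

section \<open>Complex vector spaces of functions\<close>

text \<open>
  All fibres of the bundles below (tangent spaces, fibres of \<open>E\<close>, their exterior powers) are complex
  subspaces of function types whose final result type is \<^typ>\<open>complex\<close>.
\<close>

class complex_vector = ab_group_add +
  fixes scaleC :: "complex \<Rightarrow> 'a \<Rightarrow> 'a"  (infixr "*\<^sub>C" 75)
  assumes scaleC_add_right: "c *\<^sub>C (v + w) = c *\<^sub>C v + c *\<^sub>C w"
    and scaleC_add_left: "(c + d) *\<^sub>C v = c *\<^sub>C v + d *\<^sub>C v"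
    and scaleC_scaleC: "c *\<^sub>C (d *\<^sub>C v) = (c * d) *\<^sub>C v"
    and scaleC_one: "1 *\<^sub>C v = v"

instantiation complex :: complex_vector
begin
definition scaleC_complex :: "complex \<Rightarrow> complex \<Rightarrow> complex"
  where "scaleC_complex c z = c * z"
instance by standard (simp_all add: scaleC_complex_def algebra_simps)
end

instantiation "fun" :: (type, complex_vector) complex_vector
begin
definition scaleC_fun :: "complex \<Rightarrow> ('a \<Rightarrow> 'b) \<Rightarrow> 'a \<Rightarrow> 'b"
  where "scaleC_fun c f = (\<lambda>x. c *\<^sub>C f x)"
instance
  by standard
    (simp_all add: scaleC_fun_def plus_fun_def scaleC_add_right scaleC_add_left
      scaleC_scaleC scaleC_one)
end

interpretation complex_vector:
  vector_space "scaleC :: complex \<Rightarrow> 'a \<Rightarrow> 'a::complex_vector"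
  by standard
    (simp_all add: scaleC_add_right scaleC_add_left scaleC_scaleC scaleC_one)

text \<open>Linear maps between subspaces, set to zero outside their domain so that they are determined by
  their restriction to it.\<close>

definition linear_maps ::
    "'a::complex_vector set \<Rightarrow> 'b::complex_vector set \<Rightarrow> ('a \<Rightarrow> 'b) set" where
  "linear_maps S T = {h.
     (\<forall>v. v \<notin> S \<longrightarrow> h v = 0) \<and>
     (\<forall>v\<in>S. h v \<in> T) \<and>
     (\<forall>v\<in>S. \<forall>w\<in>S. h (v + w) = h v + h w) \<and>
     (\<forall>c. \<forall>v\<in>S. h (c *\<^sub>C v) = c *\<^sub>C h v)}"

text \<open>Alternating multilinear forms in \<^term>\<open>CARD('k)\<close> arguments; the arguments are indexed by the finite
  type \<open>'k\<close>.\<close>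

definition alternating_forms ::
    "'a::complex_vector set \<Rightarrow> (('k::finite \<Rightarrow> 'a) \<Rightarrow> complex) set" where
  "alternating_forms S = {\<beta>.
     (\<forall>t. \<not> range t \<subseteq> S \<longrightarrow> \<beta> t = 0) \<and>
     (\<forall>t i. \<forall>u\<in>S. \<forall>v\<in>S. range t \<subseteq> S \<longrightarrow>
        \<beta> (t(i := u + v)) = \<beta> (t(i := u)) + \<beta> (t(i := v))) \<and>
     (\<forall>t i c. \<forall>u\<in>S. range t \<subseteq> S \<longrightarrow> \<beta> (t(i := c *\<^sub>C u)) = c * \<beta> (t(i := u))) \<and>
     (\<forall>t i j. i \<noteq> j \<and> t i = t j \<longrightarrow> \<beta> t = 0)}"

text \<open>Wedge product of a 1-form with a form in arguments indexed by \<open>'k\<close>; the index type \<^typ>\<open>'k option\<close>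
  of the result puts the additional argument \<^term>\<open>None\<close> in front. In ordered notation this is
  \<open>\<Sum>\<^sub>i (-1)\<^sup>i \<alpha>(t\<^sub>i) \<beta>(t\<^sub>0, \<dots>, omit t\<^sub>i, \<dots>, t\<^sub>k)\<close>: moving \<open>t\<^sub>0\<close> into the place of the omitted \<open>t\<^sub>i\<close>
  contributes \<open>(-1)\<^sup>i\<^sup>-\<^sup>1\<close>.\<close>

definition wedge1 ::
    "'a set \<Rightarrow> ('a \<Rightarrow> complex) \<Rightarrow> (('k::finite \<Rightarrow> 'a) \<Rightarrow> complex) \<Rightarrow> ('k option \<Rightarrow> 'a) \<Rightarrow> complex" where
  "wedge1 S \<alpha> \<beta> = (\<lambda>t. if range t \<subseteq> S
     then \<alpha> (t None) * \<beta> (\<lambda>j. t (Some j))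
          - (\<Sum>j\<in>UNIV. \<alpha> (t (Some j)) * \<beta> ((\<lambda>i. t (Some i))(j := t None)))
     else 0)"

definition pullback_form ::
    "'a set \<Rightarrow> ('a \<Rightarrow> 'b) \<Rightarrow> (('k::finite \<Rightarrow> 'b) \<Rightarrow> complex) \<Rightarrow> ('k \<Rightarrow> 'a) \<Rightarrow> complex" where
  "pullback_form S h \<omega> = (\<lambda>t. if range t \<subseteq> S then \<omega> (\<lambda>i. h (t i)) else 0)"

text \<open>Trace of an endomorphism of a finite dimensional subspace.\<close>

definition trace_on :: "'a::complex_vector set \<Rightarrow> ('a \<Rightarrow> 'a) \<Rightarrow> complex" where
  "trace_on S h =
     (let B = (SOME B. \<not> complex_vector.dependent B \<and> complex_vector.span B = S)
      in \<Sum>b\<in>B. complex_vector.representation B (h b) b)"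


section \<open>Complex manifolds\<close>

definition holomorphic_fun_on :: "(complex^'d \<Rightarrow> complex) \<Rightarrow> (complex^'d::finite) set \<Rightarrow> bool" where
  "holomorphic_fun_on f S \<longleftrightarrow>
     (\<forall>z\<in>S. \<exists>f'. (f has_derivative f') (at z) \<and> (\<forall>c v. f' (c *s v) = c * f' v))"

text \<open>A complex manifold is given by a holomorphic atlas, that is a set of pairs \<open>(U, \<phi>)\<close>; its points
  and its topology are determined by the atlas. A chart \<open>\<phi>\<close> is a total function of which only the
  restriction to \<open>U\<close> is relevant.\<close>

type_synonym ('p, 'd) atlas = "('p set \<times> ('p \<Rightarrow> complex^'d)) set"

definition manifold_points :: "('p, 'd) atlas \<Rightarrow> 'p set" where
  "manifold_points A = (\<Union>(U, \<phi>)\<in>A. U)"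

definition manifold_topology :: "('p, 'd::finite) atlas \<Rightarrow> 'p topology" where
  "manifold_topology A =
     topology (\<lambda>W. W \<subseteq> manifold_points A \<and> (\<forall>(U, \<phi>)\<in>A. open (\<phi> ` (W \<inter> U))))"

definition holomorphic_atlas :: "('p, 'd::finite) atlas \<Rightarrow> bool" where
  "holomorphic_atlas A \<longleftrightarrow>
     (\<forall>(U, \<phi>)\<in>A. inj_on \<phi> U \<and> open (\<phi> ` U)) \<and>
     (\<forall>(U, \<phi>)\<in>A. \<forall>(V, \<psi>)\<in>A. open (\<phi> ` (U \<inter> V)) \<and>
        (\<forall>j. holomorphic_fun_on (\<lambda>z. \<psi> (inv_into U \<phi> z) $ j) (\<phi> ` (U \<inter> V))))"

lemma openin_manifold_topology:
  assumes "holomorphic_atlas A"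
  shows "openin (manifold_topology A) W \<longleftrightarrow>
     W \<subseteq> manifold_points A \<and> (\<forall>(U, \<phi>)\<in>A. open (\<phi> ` (W \<inter> U)))"
proof -
  have "istopology (\<lambda>W. W \<subseteq> manifold_points A \<and> (\<forall>(U, \<phi>)\<in>A. open (\<phi> ` (W \<inter> U))))"
    unfolding istopology_def
  proof (intro conjI allI impI)
    fix S T
    assume S: "S \<subseteq> manifold_points A \<and> (\<forall>(U, \<phi>)\<in>A. open (\<phi> ` (S \<inter> U)))"
      and T: "T \<subseteq> manifold_points A \<and> (\<forall>(U, \<phi>)\<in>A. open (\<phi> ` (T \<inter> U)))"
    show "S \<inter> T \<subseteq> manifold_points A" using S by blast
    show "\<forall>(U, \<phi>)\<in>A. open (\<phi> ` (S \<inter> T \<inter> U))"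
    proof (intro ballI, clarify)
      fix U \<phi> assume U: "(U, \<phi>) \<in> A"
      then have "inj_on \<phi> U" using assms by (auto simp: holomorphic_atlas_def)
      then have "\<phi> ` (S \<inter> T \<inter> U) = \<phi> ` (S \<inter> U) \<inter> \<phi> ` (T \<inter> U)"
        by (auto simp: inj_on_def)
      then show "open (\<phi> ` (S \<inter> T \<inter> U))" using S T U by auto
    qed
  next
    fix \<K> :: "'a set set"
    assume K: "\<forall>K\<in>\<K>. K \<subseteq> manifold_points A \<and> (\<forall>(U, \<phi>)\<in>A. open (\<phi> ` (K \<inter> U)))"
    then show "\<Union>\<K> \<subseteq> manifold_points A" by blast
    show "\<forall>(U, \<phi>)\<in>A. open (\<phi> ` (\<Union>\<K> \<inter> U))"
    proof (intro ballI, clarify)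
      fix U \<phi> assume U: "(U, \<phi>) \<in> A"
      have "\<phi> ` (\<Union>\<K> \<inter> U) = (\<Union>K\<in>\<K>. \<phi> ` (K \<inter> U))" by blast
      moreover have "open (\<phi> ` (K \<inter> U))" if "K \<in> \<K>" for K using K U that by blast
      ultimately show "open (\<phi> ` (\<Union>\<K> \<inter> U))" by auto
    qed
  qed
  then show ?thesis by (simp add: manifold_topology_def)
qed

definition complex_manifold :: "('p, 'd::finite) atlas \<Rightarrow> bool" where
  "complex_manifold A \<longleftrightarrow> holomorphic_atlas A \<and>
     Hausdorff_space (manifold_topology A) \<and> second_countable (manifold_topology A)"

text \<open>Functions and sections on an open set \<open>V\<close> are total functions with arbitrary values outside \<open>V\<close>.\<close>

definition holomorphic_functions :: "('p, 'd::finite) atlas \<Rightarrow> 'p set \<Rightarrow> ('p \<Rightarrow> complex) set" where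
  "holomorphic_functions A V =
     {f. \<forall>(U, \<phi>)\<in>A. holomorphic_fun_on (f \<circ> inv_into U \<phi>) (\<phi> ` (U \<inter> V))}"

definition holomorphic_near :: "('p, 'd::finite) atlas \<Rightarrow> 'p \<Rightarrow> ('p \<Rightarrow> complex) \<Rightarrow> bool" where
  "holomorphic_near A p f \<longleftrightarrow>
     (\<exists>V. openin (manifold_topology A) V \<and> p \<in> V \<and> f \<in> holomorphic_functions A V)"

text \<open>Tangent vectors at \<open>p\<close> are the operators \<open>\<Sum>\<^sub>i w\<^sub>i \<partial>/\<partial>\<phi>\<^sup>i\<close> on germs of holomorphic functions at \<open>p\<close>
  (with value zero on functions that are not holomorphic near \<open>p\<close>).\<close>

type_synonym 'p tangent = "('p \<Rightarrow> complex) \<Rightarrow> complex"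

definition tangent_space :: "('p, 'd::finite) atlas \<Rightarrow> 'p \<Rightarrow> 'p tangent set" where
  "tangent_space A p = {v. \<exists>(U, \<phi>)\<in>A. p \<in> U \<and> (\<exists>w.
     v = (\<lambda>f. if holomorphic_near A p f
              then frechet_derivative (f \<circ> inv_into U \<phi>) (at (\<phi> p)) w else 0))}"

definition pushforward ::
    "('q, 'e::finite) atlas \<Rightarrow> ('p \<Rightarrow> 'q) \<Rightarrow> 'p \<Rightarrow> 'p tangent \<Rightarrow> 'q tangent" where
  "pushforward B F p v = (\<lambda>f. if holomorphic_near B (F p) f then v (f \<circ> F) else 0)"

definition vector_fields :: "('p, 'd::finite) atlas \<Rightarrow> 'p set \<Rightarrow> ('p \<Rightarrow> 'p tangent) set" where
  "vector_fields A U = {X. (\<forall>p\<in>U. X p \<in> tangent_space A p) \<and>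
     (\<forall>V f. openin (manifold_topology A) V \<and> V \<subseteq> U \<and> f \<in> holomorphic_functions A V
        \<longrightarrow> (\<lambda>p. X p f) \<in> holomorphic_functions A V)}"

definition lie_bracket ::
    "('p, 'd::finite) atlas \<Rightarrow> ('p \<Rightarrow> 'p tangent) \<Rightarrow> ('p \<Rightarrow> 'p tangent) \<Rightarrow> 'p \<Rightarrow> 'p tangent" where
  "lie_bracket A X Y p = (\<lambda>f. if holomorphic_near A p f
     then X p (\<lambda>q. Y q f) - Y p (\<lambda>q. X q f) else 0)"


section \<open>Vector bundles\<close>

text \<open>A holomorphic vector bundle is represented by its fibres and its sheaf of local sections.\<close>

record ('m, 'v) vbundle =
  fibre :: "'m \<Rightarrow> 'v set"
  sections :: "'m set \<Rightarrow> ('m \<Rightarrow> 'v) set"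

text \<open>Bundles with an anchor to the tangent bundle and a bracket of local sections. Both \<open>TM\<close>, whose
  anchor is the identity, and \<open>E\<close>, whose anchor is \<open>\<rho>\<close>, are of this kind; ordinary connections are the
  special case \<open>TM\<close> of \<open>\<rho>\<close>-connections.\<close>

record ('m, 'v) algebroid = "('m, 'v) vbundle" +
  anchor :: "'m \<Rightarrow> 'v \<Rightarrow> 'm tangent"
  bracket :: "('m \<Rightarrow> 'v) \<Rightarrow> ('m \<Rightarrow> 'v) \<Rightarrow> 'm \<Rightarrow> 'v"

definition trivial_bundle :: "('m, 'd::finite) atlas \<Rightarrow> ('m, complex) vbundle" where
  "trivial_bundle A = \<lparr>fibre = (\<lambda>x. UNIV), sections = holomorphic_functions A\<rparr>"

definition hom_bundle ::
    "('m, 'd::finite) atlas \<Rightarrow> ('m, 'v::complex_vector, 'z) vbundle_scheme \<Rightarrow>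
     ('m, 'w::complex_vector, 'y) vbundle_scheme \<Rightarrow> ('m, 'v \<Rightarrow> 'w) vbundle" where
  "hom_bundle A L F =
     \<lparr>fibre = (\<lambda>x. linear_maps (fibre L x) (fibre F x)),
      sections = (\<lambda>U. {h. (\<forall>x\<in>U. h x \<in> linear_maps (fibre L x) (fibre F x)) \<and>
        (\<forall>V s. openin (manifold_topology A) V \<and> V \<subseteq> U \<and> s \<in> sections L V
           \<longrightarrow> (\<lambda>x. h x (s x)) \<in> sections F V)})\<rparr>"

definition dual_bundle ::
    "('m, 'd::finite) atlas \<Rightarrow> ('m, 'v::complex_vector, 'z) vbundle_scheme \<Rightarrow>
     ('m, 'v \<Rightarrow> complex) vbundle" where
  "dual_bundle A F = hom_bundle A F (trivial_bundle A)"

text \<open>\<open>\<Lambda>\<^sup>k(F\<^sup>*)\<close> with \<open>k = CARD('k)\<close>, as the bundle of alternating forms on \<open>F\<close>, and \<open>\<Lambda>\<^sup>k F\<close> as its dual.\<close>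

definition form_bundle ::
    "('m, 'd::finite) atlas \<Rightarrow> ('m, 'v::complex_vector, 'z) vbundle_scheme \<Rightarrow>
     ('m, ('k::finite \<Rightarrow> 'v) \<Rightarrow> complex) vbundle" where
  "form_bundle A F =
     \<lparr>fibre = (\<lambda>x. alternating_forms (fibre F x)),
      sections = (\<lambda>U. {\<beta>. (\<forall>x\<in>U. \<beta> x \<in> alternating_forms (fibre F x)) \<and>
        (\<forall>V t. openin (manifold_topology A) V \<and> V \<subseteq> U \<and> (\<forall>i. t i \<in> sections F V)
           \<longrightarrow> (\<lambda>x. \<beta> x (\<lambda>i. t i x)) \<in> holomorphic_functions A V)})\<rparr>"

definition exterior_power ::
    "('m, 'd::finite) atlas \<Rightarrow> ('m, 'v::complex_vector, 'z) vbundle_scheme \<Rightarrow>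
     ('m, (('k::finite \<Rightarrow> 'v) \<Rightarrow> complex) \<Rightarrow> complex) vbundle" where
  "exterior_power A F = dual_bundle A (form_bundle A F)"

definition tangent_bundle :: "('m, 'd::finite) atlas \<Rightarrow> ('m, 'm tangent) algebroid" where
  "tangent_bundle A =
     \<lparr>fibre = tangent_space A, sections = vector_fields A,
      anchor = (\<lambda>x v. v), bracket = lie_bracket A\<rparr>"

definition local_section ::
    "('m, 'd::finite) atlas \<Rightarrow> ('m, 'v, 'z) vbundle_scheme \<Rightarrow> 'm \<Rightarrow> ('m \<Rightarrow> 'v) \<Rightarrow> bool" where
  "local_section A F x t \<longleftrightarrow>
     (\<exists>V. openin (manifold_topology A) V \<and> x \<in> V \<and> t \<in> sections F V)"

text \<open>Some local section with prescribed value at a point, used only for expressions that do not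
  depend on the choice.\<close>

definition extend_vector ::
    "('m, 'd::finite) atlas \<Rightarrow> ('m, 'v, 'z) vbundle_scheme \<Rightarrow> 'm \<Rightarrow> 'v \<Rightarrow> 'm \<Rightarrow> 'v" where
  "extend_vector A F x v = (SOME t. local_section A F x t \<and> t x = v)"


section \<open>Connections\<close>

text \<open>A connection \<open>D\<close> over \<open>U\<close> of an anchored bundle \<open>L\<close> on a bundle \<open>F\<close> maps a local section \<open>t\<close> of \<open>F\<close> to
  the local section \<open>D t\<close> of \<open>Hom(L, F)\<close>; thus \<open>D t x e\<close> is the value of \<open>\<nabla>\<^sub>e t\<close> at \<open>x\<close>, for \<open>e \<in> L\<^sub>x\<close>.
  It depends only on the germ of \<open>t\<close> at \<open>x\<close>, which makes \<open>D\<close> a morphism of sheaves. Where \<open>D t x\<close> has no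
  meaning it is zero, so that a connection is determined by its action on local sections.\<close>

type_synonym ('m, 'v, 'w) conn = "('m \<Rightarrow> 'w) \<Rightarrow> 'm \<Rightarrow> 'v \<Rightarrow> 'w"

definition connection_on ::
    "('m, 'd::finite) atlas \<Rightarrow> ('m, 'v::complex_vector, 'z) algebroid_scheme \<Rightarrow>
     ('m, 'w::complex_vector, 'y) vbundle_scheme \<Rightarrow> 'm set \<Rightarrow> ('m, 'v, 'w) conn \<Rightarrow> bool" where
  "connection_on A L F U D \<longleftrightarrow>
     (\<forall>t x. \<not> (x \<in> U \<and> local_section A F x t) \<longrightarrow> D t x = 0) \<and>
     (\<forall>V. openin (manifold_topology A) V \<and> V \<subseteq> U \<longrightarrow>
        (\<forall>t\<in>sections F V. D t \<in> sections (hom_bundle A L F) V) \<and>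
        (\<forall>t\<in>sections F V. \<forall>t'\<in>sections F V. (\<forall>y\<in>V. t y = t' y) \<longrightarrow> (\<forall>x\<in>V. D t x = D t' x)) \<and>
        (\<forall>t\<in>sections F V. \<forall>t'\<in>sections F V. \<forall>x\<in>V. \<forall>e\<in>fibre L x.
           D (\<lambda>y. t y + t' y) x e = D t x e + D t' x e) \<and>
        (\<forall>f\<in>holomorphic_functions A V. \<forall>t\<in>sections F V. \<forall>x\<in>V. \<forall>e\<in>fibre L x.
           D (\<lambda>y. f y *\<^sub>C t y) x e = anchor L x e f *\<^sub>C t x + f x *\<^sub>C D t x e))"

definition torsion_free_on ::
    "('m, 'd::finite) atlas \<Rightarrow> ('m, 'v::complex_vector, 'z) algebroid_scheme \<Rightarrow> 'm set \<Rightarrow>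
     ('m, 'v, 'v) conn \<Rightarrow> bool" where
  "torsion_free_on A L U D \<longleftrightarrow>
     (\<forall>V s1 s2. openin (manifold_topology A) V \<and> V \<subseteq> U \<and> s1 \<in> sections L V \<and> s2 \<in> sections L V \<longrightarrow>
        (\<forall>x\<in>V. D s2 x (s1 x) - D s1 x (s2 x) - bracket L s1 s2 x = 0))"

definition curvature ::
    "('m, 'v::complex_vector, 'z) algebroid_scheme \<Rightarrow> ('m, 'v, 'w::complex_vector) conn \<Rightarrow>
     ('m \<Rightarrow> 'v) \<Rightarrow> ('m \<Rightarrow> 'v) \<Rightarrow> ('m \<Rightarrow> 'w) \<Rightarrow> 'm \<Rightarrow> 'w" where
  "curvature L D s1 s2 t x =
     D (\<lambda>y. D t y (s2 y)) x (s1 x) - D (\<lambda>y. D t y (s1 y)) x (s2 x) - D t x (bracket L s1 s2 x)"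

definition ricci ::
    "('m, 'd::finite) atlas \<Rightarrow> ('m, 'v::complex_vector, 'z) algebroid_scheme \<Rightarrow> ('m, 'v, 'v) conn \<Rightarrow>
     'm \<Rightarrow> 'v \<Rightarrow> 'v \<Rightarrow> complex" where
  "ricci A L D x e1 e2 = trace_on (fibre L x)
     (\<lambda>e. curvature L D (extend_vector A L x e) (extend_vector A L x e2) (extend_vector A L x e1) x)"

text \<open>Leibniz rule: \<open>(\<nabla>\<^sub>e \<sigma>)(t) = \<rho>(e)(\<sigma>(t)) - \<sigma>(\<nabla>\<^sub>e t)\<close> and
  \<open>(\<nabla>\<^sub>e \<beta>)(t\<^sub>1, \<dots>, t\<^sub>k) = \<rho>(e)(\<beta>(t\<^sub>1, \<dots>, t\<^sub>k)) - \<Sum>\<^sub>i \<beta>(t\<^sub>1, \<dots>, \<nabla>\<^sub>e t\<^sub>i, \<dots>, t\<^sub>k)\<close>.\<close>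

definition dual_connection ::
    "('m, 'd::finite) atlas \<Rightarrow> ('m, 'v, 'z) algebroid_scheme \<Rightarrow> ('m, 'w, 'y) vbundle_scheme \<Rightarrow>
     ('m, 'v, 'w) conn \<Rightarrow> ('m, 'v, 'w \<Rightarrow> complex) conn" where
  "dual_connection A L F D \<sigma> x e = (\<lambda>w. if w \<in> fibre F x
     then let t = extend_vector A F x w in anchor L x e (\<lambda>y. \<sigma> y (t y)) - \<sigma> x (D t x e)
     else 0)"

definition form_connection ::
    "('m, 'd::finite) atlas \<Rightarrow> ('m, 'v, 'z) algebroid_scheme \<Rightarrow> ('m, 'w, 'y) vbundle_scheme \<Rightarrow>
     ('m, 'v, 'w) conn \<Rightarrow> ('m, 'v, ('k::finite \<Rightarrow> 'w) \<Rightarrow> complex) conn" where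
  "form_connection A L F D \<beta> x e = (\<lambda>w. if range w \<subseteq> fibre F x
     then let t = (\<lambda>i. extend_vector A F x (w i)) in
       anchor L x e (\<lambda>y. \<beta> y (\<lambda>i. t i y)) - (\<Sum>i\<in>UNIV. \<beta> x (w(i := D (t i) x e)))
     else 0)"

definition exterior_power_connection ::
    "('m, 'd::finite) atlas \<Rightarrow> ('m, 'v, 'z) algebroid_scheme \<Rightarrow>
     ('m, 'w::complex_vector, 'y) vbundle_scheme \<Rightarrow> ('m, 'v, 'w) conn \<Rightarrow>
     ('m, 'v, (('k::finite \<Rightarrow> 'w) \<Rightarrow> complex) \<Rightarrow> complex) conn" where
  "exterior_power_connection A L F D =
     dual_connection A L (form_bundle A F) (form_connection A L F D)"


section \<open>Projective structures\<close>

definition velocity :: "('m, 'd::finite) atlas \<Rightarrow> (complex \<Rightarrow> 'm) \<Rightarrow> complex \<Rightarrow> 'm tangent" where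
  "velocity A c t = (\<lambda>f. if holomorphic_near A (c t) f then deriv (f \<circ> c) t else 0)"

definition immersed_curve ::
    "('m, 'd::finite) atlas \<Rightarrow> complex set \<Rightarrow> (complex \<Rightarrow> 'm) \<Rightarrow> bool" where
  "immersed_curve A W c \<longleftrightarrow> open W \<and> c ` W \<subseteq> manifold_points A \<and>
     (\<forall>V. openin (manifold_topology A) V \<longrightarrow> open {t\<in>W. c t \<in> V} \<and>
        (\<forall>f\<in>holomorphic_functions A V. (f \<circ> c) holomorphic_on {t\<in>W. c t \<in> V})) \<and>
     (\<forall>t\<in>W. velocity A c t \<noteq> 0)"

text \<open>Parametrized geodesics. Since \<open>c\<close> is immersed, its velocity extends locally to a vector field \<open>X\<close>
  on \<open>M\<close>, and the derivative of \<open>X\<close> in the direction of \<open>c\<close> does not depend on the extension.\<close>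

definition geodesic ::
    "('m, 'd::finite) atlas \<Rightarrow> ('m, 'm tangent, 'm tangent) conn \<Rightarrow> complex set \<Rightarrow>
     (complex \<Rightarrow> 'm) \<Rightarrow> bool" where
  "geodesic A D W c \<longleftrightarrow> immersed_curve A W c \<and>
     (\<forall>t0\<in>W. \<exists>N V X. open N \<and> t0 \<in> N \<and> N \<subseteq> W \<and>
        openin (manifold_topology A) V \<and> c ` N \<subseteq> V \<and> X \<in> vector_fields A V \<and>
        (\<forall>t\<in>N. X (c t) = velocity A c t \<and> D X (c t) (velocity A c t) = 0))"

text \<open>Complex curves admit in general only local reparametrizations.\<close>

definition geodesic_up_to_parametrization ::
    "('m, 'd::finite) atlas \<Rightarrow> ('m, 'm tangent, 'm tangent) conn \<Rightarrow> complex set \<Rightarrow>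
     (complex \<Rightarrow> 'm) \<Rightarrow> bool" where
  "geodesic_up_to_parametrization A D W c \<longleftrightarrow>
     (\<forall>t0\<in>W. \<exists>N h. open N \<and> h holomorphic_on N \<and> inj_on h N \<and> h ` N \<subseteq> W \<and> t0 \<in> h ` N \<and>
        geodesic A D N (c \<circ> h))"

definition projectively_equivalent_on ::
    "('m, 'd::finite) atlas \<Rightarrow> 'm set \<Rightarrow> ('m, 'm tangent, 'm tangent) conn \<Rightarrow>
     ('m, 'm tangent, 'm tangent) conn \<Rightarrow> bool" where
  "projectively_equivalent_on A U D D' \<longleftrightarrow>
     (\<forall>W c. c ` W \<subseteq> U \<longrightarrow>
        (geodesic A D W c \<longrightarrow> geodesic_up_to_parametrization A D' W c) \<and>
        (geodesic A D' W c \<longrightarrow> geodesic_up_to_parametrization A D W c))"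

text \<open>Families of connections are sets of pairs; the same open set may occur with several connections, as
  it does in the union of two families.\<close>

type_synonym 'm connection_family = "('m set \<times> ('m, 'm tangent, 'm tangent) conn) set"

definition projective_covering ::
    "('m, 'd::finite) atlas \<Rightarrow> 'm connection_family \<Rightarrow> bool" where
  "projective_covering A C \<longleftrightarrow>
     (\<Union>(U, D)\<in>C. U) = manifold_points A \<and>
     (\<forall>(U, D)\<in>C. openin (manifold_topology A) U \<and>
        connection_on A (tangent_bundle A) (tangent_bundle A) U D \<and>
        torsion_free_on A (tangent_bundle A) U D) \<and>
     (\<forall>(U, D)\<in>C. \<forall>(V, D')\<in>C. projectively_equivalent_on A (U \<inter> V) D D')"

definition projective_covering_rel ::
    "('m, 'd::finite) atlas \<Rightarrow> ('m connection_family \<times> 'm connection_family) set" where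
  "projective_covering_rel A = {(C, C').
     projective_covering A C \<and> projective_covering A C' \<and> projective_covering A (C \<union> C')}"

definition projective_structures ::
    "('m, 'd::finite) atlas \<Rightarrow> 'm connection_family set set" where
  "projective_structures A = {C. projective_covering A C} // projective_covering_rel A"


section \<open>The bundle \<open>E\<close>\<close>

type_synonym ('m, 'n) polyvector = "(('n \<Rightarrow> 'm tangent) \<Rightarrow> complex) \<Rightarrow> complex"

type_synonym ('m, 'n) det_point = "'m \<times> ('m, 'n) polyvector"

abbreviation top_polyvectors ::
    "('m, 'n::finite) atlas \<Rightarrow> ('m, ('m, 'n) polyvector) vbundle" where
  "top_polyvectors A \<equiv> exterior_power A (tangent_bundle A)"

text \<open>The total space of \<open>det(TM)\<close>\<close>

definition det_space :: "('m, 'n::finite) atlas \<Rightarrow> ('m, 'n) det_point set" where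
  "det_space A = {(x, \<xi>). x \<in> manifold_points A \<and> \<xi> \<in> fibre (top_polyvectors A) x \<and> \<xi> \<noteq> 0}"

definition coordinate_volume_form ::
    "('m, 'n::finite) atlas \<Rightarrow> ('m \<Rightarrow> complex^'n) \<Rightarrow> 'm \<Rightarrow> ('n \<Rightarrow> 'm tangent) \<Rightarrow> complex" where
  "coordinate_volume_form A \<phi> x = (\<lambda>v. if range v \<subseteq> tangent_space A x
     then det (\<chi> i j. v i (\<lambda>y. \<phi> y $ j)) else 0)"

text \<open>The chart \<open>(U, \<phi>)\<close> of \<open>M\<close> induces the chart \<open>(x, \<xi>) \<mapsto> (\<phi>(x), \<xi>(d\<phi>\<^sup>1 \<and> \<dots> \<and> d\<phi>\<^sup>n))\<close> of
  \<open>det(TM)\<close>, where \<open>\<xi>(d\<phi>\<^sup>1 \<and> \<dots> \<and> d\<phi>\<^sup>n)\<close> is the coefficient of \<open>\<xi>\<close> with respect to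
  \<open>\<partial>\<^sub>1 \<and> \<dots> \<and> \<partial>\<^sub>n\<close>. The index type \<^typ>\<open>'n option\<close> has \<open>n + 1\<close> elements.\<close>

definition det_atlas ::
    "('m, 'n::finite) atlas \<Rightarrow> (('m, 'n) det_point, 'n option) atlas" where
  "det_atlas A = (\<lambda>(U, \<phi>).
     ({(x, \<xi>) \<in> det_space A. x \<in> U},
      \<lambda>(x, \<xi>). \<chi> i. case i of None \<Rightarrow> \<xi> (coordinate_volume_form A \<phi> x) | Some j \<Rightarrow> \<phi> x $ j)) ` A"

text \<open>An element of \<open>E\<^sub>x = T(det(TM))/\<complex>\<^sup>*\<close> over \<open>x\<close>, a \<open>\<complex>\<^sup>*\<close>-orbit of tangent vectors of \<open>det(TM)\<close>, is
  represented by the invariant vector field along the fibre of \<open>det(TM)\<close> over \<open>x\<close> which it forms.\<close>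

type_synonym ('m, 'n) atiyah = "('m, 'n) polyvector \<Rightarrow> ('m, 'n) det_point tangent"

definition atiyah_fibre :: "('m, 'n::finite) atlas \<Rightarrow> 'm \<Rightarrow> ('m, 'n) atiyah set" where
  "atiyah_fibre A x = {e.
     (\<forall>\<xi>. (x, \<xi>) \<notin> det_space A \<longrightarrow> e \<xi> = 0) \<and>
     (\<forall>\<xi>. (x, \<xi>) \<in> det_space A \<longrightarrow> e \<xi> \<in> tangent_space (det_atlas A) (x, \<xi>) \<and>
        (\<forall>c. c \<noteq> 0 \<longrightarrow>
           e (c *\<^sub>C \<xi>) = pushforward (det_atlas A) (\<lambda>(y, \<zeta>). (y, c *\<^sub>C \<zeta>)) (x, \<xi>) (e \<xi>)))}"

definition invariant_field ::
    "('m \<Rightarrow> ('m, 'n) atiyah) \<Rightarrow> ('m, 'n) det_point \<Rightarrow> ('m, 'n) det_point tangent" where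
  "invariant_field s = (\<lambda>(x, \<xi>). s x \<xi>)"

definition atiyah_sections ::
    "('m, 'n::finite) atlas \<Rightarrow> 'm set \<Rightarrow> ('m \<Rightarrow> ('m, 'n) atiyah) set" where
  "atiyah_sections A U = {s. (\<forall>x\<in>U. s x \<in> atiyah_fibre A x) \<and>
     invariant_field s \<in> vector_fields (det_atlas A) {(x, \<xi>) \<in> det_space A. x \<in> U}}"

text \<open>By invariance the choice of \<open>\<xi>\<close> is irrelevant.\<close>

definition atiyah_anchor :: "('m, 'n::finite) atlas \<Rightarrow> 'm \<Rightarrow> ('m, 'n) atiyah \<Rightarrow> 'm tangent" where
  "atiyah_anchor A x e =
     (let \<xi> = (SOME \<xi>. (x, \<xi>) \<in> det_space A) in pushforward A fst (x, \<xi>) (e \<xi>))"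

definition atiyah_bracket ::
    "('m, 'n::finite) atlas \<Rightarrow> ('m \<Rightarrow> ('m, 'n) atiyah) \<Rightarrow> ('m \<Rightarrow> ('m, 'n) atiyah) \<Rightarrow>
     'm \<Rightarrow> ('m, 'n) atiyah" where
  "atiyah_bracket A s1 s2 x =
     (\<lambda>\<xi>. lie_bracket (det_atlas A) (invariant_field s1) (invariant_field s2) (x, \<xi>))"

definition atiyah_bundle :: "('m, 'n::finite) atlas \<Rightarrow> ('m, ('m, 'n) atiyah) algebroid" where
  "atiyah_bundle A =
     \<lparr>fibre = atiyah_fibre A, sections = atiyah_sections A,
      anchor = atiyah_anchor A, bracket = atiyah_bracket A\<rparr>"

text \<open>The section \<open>\<one>\<close> of \<open>E\<close>: the Euler vector field.\<close>

definition euler_section :: "('m, 'n::finite) atlas \<Rightarrow> 'm \<Rightarrow> ('m, 'n) atiyah" where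
  "euler_section A x = (\<lambda>\<xi> f. if holomorphic_near (det_atlas A) (x, \<xi>) f
     then deriv (\<lambda>c. f (x, c *\<^sub>C \<xi>)) 1 else 0)"

text \<open>The canonical \<open>\<rho>\<close>-connections of \<open>\<Lambda>\<^sup>n(T\<^sup>*M)\<close> and \<open>\<Lambda>\<^sup>n(TM)\<close>; \<open>f\<^sub>\<omega>(y, \<zeta>) = \<zeta>(\<omega>(y))\<close>.\<close>

definition canonical_form_connection ::
    "('m, 'n::finite) atlas \<Rightarrow> ('m, ('m, 'n) atiyah, ('n \<Rightarrow> 'm tangent) \<Rightarrow> complex) conn" where
  "canonical_form_connection A \<omega> x e =
     (THE \<eta>. \<eta> \<in> alternating_forms (tangent_space A x) \<and>
        (\<forall>\<xi>. (x, \<xi>) \<in> det_space A \<longrightarrow> \<xi> \<eta> = e \<xi> (\<lambda>(y, \<zeta>). \<zeta> (\<omega> y))))"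

definition canonical_connection ::
    "('m, 'n::finite) atlas \<Rightarrow> ('m, ('m, 'n) atiyah, ('m, 'n) polyvector) conn" where
  "canonical_connection A =
     dual_connection A (atiyah_bundle A) (form_bundle A (tangent_bundle A))
       (canonical_form_connection A)"

text \<open>The isomorphism \<open>\<Lambda>\<^sup>n\<^sup>+\<^sup>1E \<rightarrow> \<Lambda>\<^sup>n(TM)\<close> at \<open>x\<close>, the transpose of \<open>\<omega> \<mapsto> \<alpha> \<and> \<rho>\<^sup>*\<omega>\<close> where
  \<open>\<alpha>(\<one>) = 1\<close>.\<close>

definition det_isomorphism ::
    "('m, 'n::finite) atlas \<Rightarrow> 'm \<Rightarrow>
     ((('n option \<Rightarrow> ('m, 'n) atiyah) \<Rightarrow> complex) \<Rightarrow> complex) \<Rightarrow> ('m, 'n) polyvector" where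
  "det_isomorphism A x \<theta> =
     (let S = atiyah_fibre A x;
          \<alpha> = (SOME \<alpha>. \<alpha> \<in> fibre (dual_bundle A (atiyah_bundle A)) x \<and> \<alpha> (euler_section A x) = 1)
      in (\<lambda>\<omega>. if \<omega> \<in> alternating_forms (tangent_space A x)
              then \<theta> (wedge1 S \<alpha> (pullback_form S (atiyah_anchor A x) \<omega>)) else 0))"


section \<open>The normalized \<open>\<rho>\<close>-connections and their projective structures\<close>

definition rho_connection ::
    "('m, 'n::finite) atlas \<Rightarrow> ('m, ('m, 'n) atiyah, ('m, 'n) atiyah) conn \<Rightarrow> bool" where
  "rho_connection A D \<longleftrightarrow>
     connection_on A (atiyah_bundle A) (atiyah_bundle A) (manifold_points A) D"

definition euler_normalized ::
    "('m, 'n::finite) atlas \<Rightarrow> ('m, ('m, 'n) atiyah, ('m, 'n) atiyah) conn \<Rightarrow> bool" where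
  "euler_normalized A D \<longleftrightarrow>
     (\<forall>U s. openin (manifold_topology A) U \<and> s \<in> atiyah_sections A U \<longrightarrow>
        (\<forall>x\<in>U. D s x (euler_section A x) = (- 1 / (of_nat CARD('n) + 1)) *\<^sub>C s x))"

definition induces_canonical_connection ::
    "('m, 'n::finite) atlas \<Rightarrow> ('m, ('m, 'n) atiyah, ('m, 'n) atiyah) conn \<Rightarrow> bool" where
  "induces_canonical_connection A D \<longleftrightarrow>
     (\<forall>U \<theta>. openin (manifold_topology A) U \<and>
        \<theta> \<in> sections (exterior_power A (atiyah_bundle A)) U \<longrightarrow>
        (\<forall>x\<in>U. \<forall>e\<in>atiyah_fibre A x.
           det_isomorphism A x
             (exterior_power_connection A (atiyah_bundle A) (atiyah_bundle A) D \<theta> x e) =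
           canonical_connection A (\<lambda>y. det_isomorphism A y (\<theta> y)) x e))"

definition ricci_flat ::
    "('m, 'n::finite) atlas \<Rightarrow> ('m, ('m, 'n) atiyah, ('m, 'n) atiyah) conn \<Rightarrow> bool" where
  "ricci_flat A D \<longleftrightarrow>
     (\<forall>x\<in>manifold_points A. \<forall>e1\<in>atiyah_fibre A x. \<forall>e2\<in>atiyah_fibre A x.
        ricci A (atiyah_bundle A) D x e1 e2 = 0)"

text \<open>Holomorphic sections \<open>TU \<rightarrow> E|\<^sub>U\<close> of \<open>\<rho>\<close>\<close>

definition anchor_splittings ::
    "('m, 'n::finite) atlas \<Rightarrow> 'm set \<Rightarrow> ('m \<Rightarrow> 'm tangent \<Rightarrow> ('m, 'n) atiyah) set" where
  "anchor_splittings A U =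
     {c \<in> sections (hom_bundle A (tangent_bundle A) (atiyah_bundle A)) U.
        \<forall>x\<in>U. \<forall>v\<in>tangent_space A x. atiyah_anchor A x (c x v) = v}"

text \<open>\<open>\<nabla>\<^sup>U\<^sub>X Y = \<rho>(\<nabla>\<^bsub>c(X)\<^esub> c(Y))\<close>\<close>

definition induced_connection ::
    "('m, 'n::finite) atlas \<Rightarrow> 'm set \<Rightarrow> ('m \<Rightarrow> 'm tangent \<Rightarrow> ('m, 'n) atiyah) \<Rightarrow>
     ('m, ('m, 'n) atiyah, ('m, 'n) atiyah) conn \<Rightarrow> ('m, 'm tangent, 'm tangent) conn" where
  "induced_connection A U c D Y x v =
     (if x \<in> U \<and> local_section A (tangent_bundle A) x Y \<and> v \<in> tangent_space A x
      then atiyah_anchor A x (D (\<lambda>y. c y (Y y)) x (c x v)) else 0)"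

definition induced_covering ::
    "('m, 'n::finite) atlas \<Rightarrow> ('m, ('m, 'n) atiyah, ('m, 'n) atiyah) conn \<Rightarrow>
     'm connection_family" where
  "induced_covering A D = {(U, induced_connection A U c D) |U c.
     openin (manifold_topology A) U \<and> c \<in> anchor_splittings A U}"

definition projective_structure_given_by ::
    "('m, 'n::finite) atlas \<Rightarrow> ('m, ('m, 'n) atiyah, ('m, 'n) atiyah) conn \<Rightarrow>
     'm connection_family set" where
  "projective_structure_given_by A D = projective_covering_rel A `` {induced_covering A D}"

end

theory Submission
  imports Defs "HOL-Complex_Analysis.Conformal_Mappings"
begin

text \<open>In a chart of \<open>M\<close>, with the fibre coordinate of \<open>det(TM)\<close> it induces, a \<open>\<rho>\<close>-connection on \<open>E\<close> has Christoffel
  symbols \<open>\<Gamma>\<^sub>a\<^sub>b\<^sup>c\<close> whose indices run over the Euler direction \<open>0\<close> (\<^term>\<open>None\<close>) and the coordinate directions.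
  Given symmetry, (ii1) prescribes all \<open>\<Gamma>\<^sub>a\<^sub>b\<^sup>c\<close> with \<open>0\<close> among the lower indices, (ii2) says that the spatial part
  \<open>\<Gamma>\<^sub>i\<^sub>j\<^sup>k\<close> is trace free, and (ii3) then becomes the equation
  \<open>(n - 1)/(n + 1) \<Gamma>\<^sub>i\<^sub>j\<^sup>0 = \<Sum>\<^sub>k \<partial>\<^sub>k\<Gamma>\<^sub>i\<^sub>j\<^sup>k - \<Sum>\<^sub>k\<^sub>l \<Gamma>\<^sub>k\<^sub>j\<^sup>l \<Gamma>\<^sub>i\<^sub>l\<^sup>k\<close>. As \<open>n \<ge> 2\<close>, the connection is determined by its spatial part,
  which can be any symmetric trace free family. A splitting of \<open>\<rho>\<close> turns it into a torsion free connection on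
  \<open>TM\<close> with the same symbols up to pure trace terms \<open>\<delta>\<^sub>j\<^sup>k \<psi>\<^sub>i + \<delta>\<^sub>i\<^sup>k \<psi>\<^sub>j\<close>. By Weyl's theorem two torsion free
  connections are projectively equivalent iff they differ by pure trace terms, that is, iff the trace free parts
  of their Christoffel symbols (Thomas's projective parameters) agree. Since the solution is unique over every
  chart, the local ones glue.\<close>

section \<open>Holomorphic functions of several variables\<close>

text \<open>The constant of (ii1) is forced by (ii2): along the Euler field the canonical connection
  has the zero order term -1, so \<nabla> along that field, a multiple of the identity on a bundle
  of rank n + 1, must have trace -1. Invariant fields commute with the Euler field, so without
  torsion \<nabla>_s of the Euler section is known as well. Two splittings of \<rho> differ by a
  one-form times the Euler section, and these two facts reduce the effect of such a change to pure
  trace terms. The coefficient (n - 1)/(n + 1) is 1 - 2/(n + 1), the correction coming from the two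
  contractions of the quadratic term through the index 0; it vanishes for n = 1. The conditions
  speak of all sections over all open sets, whereas solutions are found chart by chart. They are
  therefore restated at single points in terms of germs, and gluing compares germs only. Weyl's
  theorem serves in both directions: necessity takes a geodesic in every direction, hence an
  existence theorem for holomorphic differential equations, and sufficiency an explicit
  reparametrization.\<close>

definition has_gradient :: "(complex^'d::finite \<Rightarrow> complex) \<Rightarrow> ('d \<Rightarrow> complex) \<Rightarrow> complex^'d \<Rightarrow> bool" where
  "has_gradient f a z \<longleftrightarrow> (f has_derivative (\<lambda>w. \<Sum>i\<in>UNIV. w $ i * a i)) (at z)"

definition partial :: "'d::finite \<Rightarrow> (complex^'d \<Rightarrow> complex) \<Rightarrow> complex^'d \<Rightarrow> complex" where
  "partial i f z = frechet_derivative f (at z) (axis i 1)"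

lemma has_gradient_partial: "has_gradient f a z \<Longrightarrow> partial i f z = a i"
  unfolding has_gradient_def partial_def
  by (subst frechet_derivative_at[symmetric], assumption)
    (simp add: axis_def if_distrib[of "\<lambda>x. x * _"] cong: if_cong)

lemma has_gradient_frechet:
  "has_gradient f a z \<Longrightarrow> frechet_derivative f (at z) w = (\<Sum>i\<in>UNIV. w $ i * a i)"
  unfolding has_gradient_def by (subst frechet_derivative_at[symmetric], assumption) simp

text \<open>Complex homogeneity of the derivative is what lets it be expanded over the axes with
  complex coefficients; conversely every such combination is complex homogeneous.\<close>

lemma holomorphic_fun_on_iff:
  "holomorphic_fun_on f S \<longleftrightarrow> (\<forall>z\<in>S. \<exists>a. has_gradient f a z)"
proof
  assume f: "holomorphic_fun_on f S"
  show "\<forall>z\<in>S. \<exists>a. has_gradient f a z"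
  proof
    fix z assume "z \<in> S"
    then obtain f' where f': "(f has_derivative f') (at z)" "\<And>c v. f' (c *s v) = c * f' v"
      using f unfolding holomorphic_fun_on_def by blast
    have "f' w = (\<Sum>i\<in>UNIV. w $ i * f' (axis i 1))" for w
    proof -
      interpret f': bounded_linear f' using f'(1) by (rule has_derivative_bounded_linear)
      have "f' w = f' (\<Sum>i\<in>UNIV. w $ i *s axis i 1)" by (simp add: basis_expansion)
      then show ?thesis by (simp add: f'.sum f'(2))
    qed
    then have "f' = (\<lambda>w. \<Sum>i\<in>UNIV. w $ i * f' (axis i 1))" by blast
    then show "\<exists>a. has_gradient f a z" using f'(1) unfolding has_gradient_def by metis
  qed
next
  assume "\<forall>z\<in>S. \<exists>a. has_gradient f a z"
  then show "holomorphic_fun_on f S"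
    unfolding holomorphic_fun_on_def has_gradient_def
    by (metis (mono_tags, lifting) mult.assoc sum.cong sum_distrib_left vector_smult_component)
qed

lemma holomorphic_has_gradient:
  "\<lbrakk>holomorphic_fun_on f S; z \<in> S\<rbrakk> \<Longrightarrow> has_gradient f (\<lambda>i. partial i f z) z"
  unfolding holomorphic_fun_on_iff using has_gradient_partial
  by (metis (no_types, lifting) ext)

lemma holomorphic_fun_on_subset: "\<lbrakk>holomorphic_fun_on f S; T \<subseteq> S\<rbrakk> \<Longrightarrow> holomorphic_fun_on f T"
  unfolding holomorphic_fun_on_def by blast

lemma has_gradient_cong:
  "\<lbrakk>has_gradient f a z; open S; z \<in> S; \<And>w. w \<in> S \<Longrightarrow> f w = g w\<rbrakk> \<Longrightarrow> has_gradient g a z"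
  unfolding has_gradient_def using has_derivative_transform_within_open by blast

lemma partial_cong:
  assumes "open S" "z \<in> S" "\<And>w. w \<in> S \<Longrightarrow> f w = g w"
  shows "partial i f z = partial i g z"
  unfolding partial_def frechet_derivative_def
  using has_derivative_transform_within_open[OF _ assms(1,2)] assms(3) by metis

lemma holomorphic_fun_on_cong:
  assumes "holomorphic_fun_on f S" "open S" "\<And>w. w \<in> S \<Longrightarrow> f w = g w"
  shows "holomorphic_fun_on g S"
  using assms has_gradient_cong unfolding holomorphic_fun_on_iff by metis

lemma has_gradient_const: "has_gradient (\<lambda>_. c) (\<lambda>_. 0) z"
  unfolding has_gradient_def by simp

lemma has_gradient_nth: "has_gradient (\<lambda>z. z $ j) (\<lambda>i. if i = j then 1 else 0) z"
  unfolding has_gradient_def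
  by (simp add: if_distrib cong: if_cong)
    (rule bounded_linear_imp_has_derivative, rule bounded_linear_vec_nth)

lemma has_gradient_add:
  "\<lbrakk>has_gradient f a z; has_gradient g b z\<rbrakk> \<Longrightarrow> has_gradient (\<lambda>z. f z + g z) (\<lambda>i. a i + b i) z"
  unfolding has_gradient_def by (auto intro!: derivative_eq_intros simp: algebra_simps sum.distrib)

lemma has_gradient_mult:
  "\<lbrakk>has_gradient f a z; has_gradient g b z\<rbrakk> \<Longrightarrow>
   has_gradient (\<lambda>z. f z * g z) (\<lambda>i. a i * g z + f z * b i) z"
  unfolding has_gradient_def
  by (auto intro!: derivative_eq_intros simp: algebra_simps sum.distrib sum_distrib_left)

lemma has_derivative_vec_lambda:
  fixes g :: "'e::finite \<Rightarrow> 'a::real_normed_vector \<Rightarrow> complex"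
  assumes "\<And>j. (g j has_derivative g' j) (at z)"
  shows "((\<lambda>z. \<chi> j. g j z) has_derivative (\<lambda>w. \<chi> j. g' j w)) (at z)"
proof (subst has_derivative_componentwise_within, intro ballI)
  fix i :: "complex^'e" assume "i \<in> Basis"
  then obtain j b where i: "i = axis j b" unfolding Basis_vec_def by blast
  show "((\<lambda>x. (\<chi> j. g j x) \<bullet> i) has_derivative (\<lambda>x. (\<chi> j. g' j x) \<bullet> i)) (at z)"
    unfolding i inner_axis
    using bounded_linear.has_derivative[OF bounded_linear_inner_left assms] by simp
qed

lemma has_gradient_compose:
  fixes f :: "complex^'e::finite \<Rightarrow> complex"
  assumes "has_gradient f a (\<chi> j. g j z)" "\<And>j. has_gradient (g j) (b j) z"
  shows "has_gradient (\<lambda>z. f (\<chi> j. g j z)) (\<lambda>i. \<Sum>j\<in>UNIV. a j * b j i) z"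
proof -
  have "((\<lambda>z. \<chi> j. g j z) has_derivative (\<lambda>w. \<chi> j. \<Sum>i\<in>UNIV. w $ i * b j i)) (at z)"
    using assms(2) unfolding has_gradient_def by (rule has_derivative_vec_lambda)
  from has_derivative_compose[OF this assms(1)[unfolded has_gradient_def]] show ?thesis
    unfolding has_gradient_def
    by (rule has_derivative_eq_rhs)
      (simp add: fun_eq_iff sum_distrib_left sum_distrib_right mult_ac, intro allI sum.swap)
qed

lemma has_gradient_curve:
  fixes f :: "complex^'e::finite \<Rightarrow> complex"
  assumes "has_gradient f a (\<chi> j. g j t)" "\<And>j. (g j has_field_derivative g' j) (at t)"
  shows "((\<lambda>t. f (\<chi> j. g j t)) has_field_derivative (\<Sum>j\<in>UNIV. a j * g' j)) (at t)"
proof -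
  have "((\<lambda>z. \<chi> j. g j z) has_derivative (\<lambda>w. \<chi> j. g' j * w)) (at t)"
    using assms(2) unfolding has_field_derivative_def by (rule has_derivative_vec_lambda)
  from has_derivative_compose[OF this assms(1)[unfolded has_gradient_def]] show ?thesis
    unfolding has_field_derivative_def
    by (rule has_derivative_eq_rhs) (simp add: fun_eq_iff sum_distrib_left mult_ac)
qed

section \<open>Cauchy's formula and higher partial derivatives\<close>

lemma holomorphic_fun_on_continuous: "holomorphic_fun_on f S \<Longrightarrow> continuous_on S f"
  unfolding holomorphic_fun_on_iff has_gradient_def
  by (meson continuous_at_imp_continuous_on has_derivative_continuous)

text \<open>Cauchy's formula for the first derivative, parametrized over the unit interval. The
  offset from the centre and the factor that multiplies \<open>g\<close> do not depend on
  \<open>z\<close>, so the formula can be differentiated under the integral sign.\<close>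

lemma deriv_circle_integral:
  fixes g :: "complex \<Rightarrow> complex" and r :: real
  assumes "g holomorphic_on ball z R" "0 < r" "r < R"
  shows "deriv g z =
    integral {0..1} (\<lambda>t. g (z + r * exp (2 * of_real pi * \<i> * of_real t)) *
                         (1 / (r * exp (2 * of_real pi * \<i> * of_real t))))"
proof -
  define E where "E t = exp (2 * of_real pi * \<i> * of_real t)" for t :: real
  have nz: "E t \<noteq> 0" for t by (simp add: E_def)
  have sub: "cball z r \<subseteq> ball z R" "ball z r \<subseteq> ball z R" using assms by auto
  have "continuous_on (cball z r) g" "g holomorphic_on ball z r" "z \<in> ball z r"
    using holomorphic_on_imp_continuous_on[OF assms(1)] continuous_on_subset sub 
      holomorphic_on_subset[OF assms(1)] assms(2) by auto
  from Cauchy_has_contour_integral_higher_derivative_circlepath[OF this, of 1]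
  have "((\<lambda>u. g u / (u - z)\<^sup>2) has_contour_integral (2 * pi * \<i>) * deriv g z) (circlepath z r)"
    by (simp add: numeral_2_eq_2)
  then have "((\<lambda>t. g (circlepath z r t) / (circlepath z r t - z)\<^sup>2 *
       vector_derivative (circlepath z r) (at t within {0..1})) has_integral (2 * pi * \<i>) * deriv g z) {0..1}"
    unfolding has_contour_integral_def .
  then have "((\<lambda>t. (2 * pi * \<i>) * (g (z + r * E t) * (1 / (r * E t)))) has_integral
      (2 * pi * \<i>) * deriv g z) {0..1}"
  proof (rule has_integral_eq[rotated])
    fix t :: real assume "t \<in> {0..1}"
    then have "vector_derivative (circlepath z r) (at t within {0..1}) = 2 * pi * \<i> * r * E t"
      using vector_derivative_circlepath01[of t z r] by (simp add: E_def)
    moreover have "circlepath z r t = z + r * E t" by (simp add: circlepath E_def)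
    ultimately show "g (circlepath z r t) / (circlepath z r t - z)\<^sup>2 *
        vector_derivative (circlepath z r) (at t within {0..1}) =
        (2 * pi * \<i>) * (g (z + r * E t) * (1 / (r * E t)))"
      using assms(2) nz[of t] by (simp add: power2_eq_square field_simps)
  qed
  then have "((\<lambda>t. g (z + r * E t) * (1 / (r * E t))) has_integral deriv g z) {0..1}"
    by (rule has_integral_mult_right[where c = "1 / (2 * pi * \<i>)", THEN has_integral_cong[THEN iffD1, rotated], 
        THEN has_integral_eq_rhs]) simp_all
  then show ?thesis unfolding E_def by (simp add: integral_unique)
qed

lemma has_gradient_slice:
  assumes "has_gradient f a (z + \<zeta> *s axis i 1)"
  shows "((\<lambda>\<zeta>. f (z + \<zeta> *s axis i 1)) has_field_derivative a i) (at \<zeta>)"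
proof -
  let ?g = "\<lambda>j w. z $ j + w * (if j = i then 1 else 0)"
  have eq: "z + w *s axis i 1 = (\<chi> j. ?g j w)" for w
    by (simp add: vec_eq_iff axis_def)
  have "((\<lambda>\<zeta>. f (\<chi> j. ?g j \<zeta>)) has_field_derivative (\<Sum>j\<in>UNIV. a j * (if j = i then 1 else 0))) (at \<zeta>)"
    by (rule has_gradient_curve) (use assms eq in \<open>auto intro!: derivative_eq_intros\<close>)
  then show ?thesis unfolding eq by (simp add: if_distrib cong: if_cong)
qed

text \<open>By Cauchy's formula along the \<open>i\<close>-th axis, \<open>partial i\<close> is
  locally an integral operator that is the same for all functions holomorphic on \<open>S\<close>.
  Differentiation under the integral gives \<open>partial i f\<close> a gradient whose
  \<open>j\<close>-th coefficient is this operator applied to \<open>partial j f\<close>; that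
  coefficient is therefore both mixed derivatives at once.\<close>

lemma
  fixes f :: "complex^'d::finite \<Rightarrow> complex"
  assumes f: "holomorphic_fun_on f S" and S: "open S"
  shows holomorphic_partial: "holomorphic_fun_on (partial i f) S"
    and partial_commute: "z \<in> S \<Longrightarrow> partial i (partial j f) z = partial j (partial i f) z"
proof -
  \<comment> \<open>The circles have radius \<open>\<rho>/2\<close> and centres within distance
    \<open>\<rho>\<close> of \<open>z0\<close>, so they stay in \<open>ball z0 (2 * \<rho>)\<close>.
    One offset \<open>p\<close> and one kernel \<open>k\<close> serve every \<open>g\<close> and
    every centre.\<close>
  have main: "\<exists>r>0. \<exists>k. continuous_on {0..1} k \<and> ball z0 r \<subseteq> S \<and>
      (\<forall>z\<in>ball z0 r. \<forall>t\<in>{0..1}. z + p t *s axis i 1 \<in> S) \<and> continuous_on {0..1} p \<and>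
      (\<forall>g. holomorphic_fun_on g S \<longrightarrow> (\<forall>z\<in>ball z0 r. partial i g z = 
         integral {0..1} (\<lambda>t. g (z + p t *s axis i 1) * k t)))"
    if "z0 \<in> S" "p = (\<lambda>t. (\<rho>/2) * exp (2 * of_real pi * \<i> * of_real t))"
       "0 < \<rho>" "ball z0 (2 * \<rho>) \<subseteq> S" for z0 i p and \<rho> :: real
  proof (intro exI conjI ballI allI impI)
    let ?k = "\<lambda>t::real. 1 / ((\<rho>/2) * exp (2 * of_real pi * \<i> * of_real t))"
    show "continuous_on {0..1} ?k" using that by (intro continuous_intros) auto
    show "0 < \<rho>" "ball z0 \<rho> \<subseteq> S" using that by auto
    show "continuous_on {0..1} p" unfolding that(2) by (intro continuous_intros) auto
    have inS: "z + \<zeta> *s axis i 1 \<in> S" if "z \<in> ball z0 \<rho>" "norm \<zeta> < \<rho>" for z \<zeta>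
    proof -
      have "norm (\<zeta> *s (axis i 1 :: complex^'d)) = norm \<zeta>"
        by (simp add: norm_vec_def L2_set_def axis_def if_distrib[of norm] if_distrib[of "\<lambda>x. x^2"] 
             if_distrib[of "\<lambda>x. _ * x"] cong: if_cong)
      then have "dist z0 (z + \<zeta> *s axis i 1) < 2 * \<rho>"
        using norm_triangle_ineq[of "z - z0" "\<zeta> *s axis i 1"] that
        by (simp add: dist_norm norm_minus_commute algebra_simps)
      then show ?thesis using \<open>ball z0 (2 * \<rho>) \<subseteq> S\<close> by auto
    qed
    have np: "norm (p t) < \<rho>" for t using that by (simp add: norm_mult)
    show "z + p t *s axis i 1 \<in> S" if "z \<in> ball z0 \<rho>" for z t using inS np that by blast
    fix g z assume g: "holomorphic_fun_on g S" and z: "z \<in> ball z0 \<rho>"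
    have der: "((\<lambda>\<zeta>. g (z + \<zeta> *s axis i 1)) has_field_derivative partial i g (z + \<zeta> *s axis i 1)) (at \<zeta>)"
      if "norm \<zeta> < \<rho>" for \<zeta>
      using has_gradient_slice[OF holomorphic_has_gradient[OF g inS[OF z that]]] .
    have "(\<lambda>\<zeta>. g (z + \<zeta> *s axis i 1)) holomorphic_on ball 0 \<rho>"
      unfolding holomorphic_on_open[OF open_ball] using der by (metis dist_0_norm mem_ball)
    from deriv_circle_integral[OF this, of "\<rho>/2"] \<open>0 < \<rho>\<close> DERIV_imp_deriv[OF der[of 0]]
    show "partial i g z = integral {0..1} (\<lambda>t. g (z + p t *s axis i 1) * ?k t)"
      unfolding that(2) by simp
  qed
  have ex\<rho>: "\<exists>\<rho>>0. ball z0 (2 * \<rho>) \<subseteq> S" if "z0 \<in> S" for z0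
    using S that by (metis open_contains_ball half_gt_zero mult.commute nonzero_mult_div_cancel_left
        times_divide_eq_left times_divide_eq_right zero_neq_numeral)
  have shift: "continuous_on (B \<times> {0..1}) (\<lambda>(z, t). g (z + p t *s axis i 1) * k t)"
    if "\<And>z t. z \<in> B \<Longrightarrow> t \<in> {0..1} \<Longrightarrow> z + p t *s axis i 1 \<in> S" "continuous_on {0..1} p"
      "continuous_on {0..1} k" "continuous_on S g" for B and p k :: "real \<Rightarrow> complex" and g i
  proof -
    have eq: "z + c *s axis i 1 = z + (\<chi> j. c * (if j = i then 1 else 0))" for z :: "complex^'d" and c
      by (simp add: vec_eq_iff axis_def)
    have c: "continuous_on (B \<times> {0..1}) (\<lambda>x. k (snd x))" "continuous_on (B \<times> {0..1}) (\<lambda>x. p (snd x))"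
      by (rule continuous_on_compose2[OF that(3)] continuous_on_compose2[OF that(2)]; 
          auto intro!: continuous_intros)+
    have "continuous_on (B \<times> {0..1}) (\<lambda>x. g (fst x + p (snd x) *s axis i 1))"
      by (rule continuous_on_compose2[OF that(4)])
        (use that(1) c in \<open>auto simp: eq intro!: continuous_intros\<close>)
    then show ?thesis using c by (auto simp: case_prod_unfold intro!: continuous_intros)
  qed
  \<comment> \<open>Continuity of the partial derivatives follows from the integral representation
    alone. It has to precede their differentiability, because Leibniz's rule asks for a continuous
    derivative of the integrand.\<close>
  have cont: "continuous_on S (partial i g)" if g: "holomorphic_fun_on g S" for i g
  proof -
    have "\<exists>r>0. continuous_on (ball z0 r) (partial i g)" if "z0 \<in> S" for z0
    proof -
      obtain \<rho> where \<rho>: "\<rho> > 0" "ball z0 (2 * \<rho>) \<subseteq> S" using ex\<rho>[OF \<open>z0 \<in> S\<close>] by blast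
      from main[OF \<open>z0 \<in> S\<close> refl \<rho>, of i] obtain r k where
        r: "r > 0" and k: "continuous_on {0..1} k" and sub: "ball z0 r \<subseteq> S" and 
        inS: "\<And>z t. z\<in>ball z0 r \<Longrightarrow> t\<in>{0..1} \<Longrightarrow> z + (\<rho>/2 * exp (2 * of_real pi * \<i> * of_real t)) *s axis i 1 \<in> S" and
        p: "continuous_on {0..1} (\<lambda>t. \<rho>/2 * exp (2 * of_real pi * \<i> * of_real t))" and
        rep: "\<And>g z. holomorphic_fun_on g S \<Longrightarrow> z\<in>ball z0 r \<Longrightarrow> partial i g z = 
         integral {0..1} (\<lambda>t. g (z + (\<rho>/2 * exp (2 * of_real pi * \<i> * of_real t)) *s axis i 1) * k t)"
        by blast
      have "continuous_on (ball z0 r) (\<lambda>z. integral (cbox 0 1) 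
          (\<lambda>t. g (z + (\<rho>/2 * exp (2 * of_real pi * \<i> * of_real t)) *s axis i 1) * k t))"
        by (rule integral_continuous_on_param)
          (use shift[where B = "ball z0 r", OF inS p k holomorphic_fun_on_continuous[OF g]] in \<open>simp add: case_prod_unfold\<close>)
      then have "continuous_on (ball z0 r) (partial i g)"
        by (rule continuous_on_eq) (use rep[OF g] in auto)
      then show ?thesis using r by blast
    qed
    then show ?thesis
      by (metis S continuous_at_imp_continuous_on continuous_on_eq_continuous_at open_ball centre_in_ball)
  qed
  have grad: "\<exists>(k::real \<Rightarrow> complex) p r. 0 < r \<and> ball z0 r \<subseteq> S \<and> (\<forall>g. holomorphic_fun_on g S \<longrightarrow> (\<forall>z\<in>ball z0 r. partial i g z = 
         integral {0..1} (\<lambda>t. g (z + p t *s axis i 1) * k t))) \<and>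
        has_gradient (partial i f) (\<lambda>j. integral {0..1} (\<lambda>t. partial j f (z0 + p t *s axis i 1) * k t)) z0"
    if z0: "z0 \<in> S" for z0 i
  proof -
    obtain \<rho> where \<rho>: "\<rho> > 0" "ball z0 (2 * \<rho>) \<subseteq> S" using ex\<rho>[OF z0] by blast
    define p where "p t = \<rho>/2 * exp (2 * of_real pi * \<i> * of_real t)" for t
    from main[OF z0 _ \<rho>, of p i] obtain r k where
      r: "r > 0" and k: "continuous_on {0..1} k" and sub: "ball z0 r \<subseteq> S" and 
      inS: "\<And>z t. z\<in>ball z0 r \<Longrightarrow> t\<in>{0..1} \<Longrightarrow> z + p t *s axis i 1 \<in> S" and
      p: "continuous_on {0..1} p" and
      rep: "\<And>g z. holomorphic_fun_on g S \<Longrightarrow> z\<in>ball z0 r \<Longrightarrow> partial i g z = 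
       integral {0..1} (\<lambda>t. g (z + p t *s axis i 1) * k t)"
      unfolding p_def by blast
    define prj :: "'d \<Rightarrow> (complex^'d) \<Rightarrow>\<^sub>L complex" where "prj j = Blinfun (\<lambda>w. w $ j)" for j
    have prj: "blinfun_apply (prj j) w = w $ j" for j w
      unfolding prj_def by (subst bounded_linear_Blinfun_apply, rule bounded_linear_vec_nth) simp
    \<comment> \<open>The derivative of the integrand with respect to \<open>z\<close>, as a bounded
      linear map, since Leibniz's rule integrates it in the space of such maps.\<close>
    define F where "F z t = (\<Sum>j\<in>UNIV. blinfun_mult_left (partial j f (z + p t *s axis i 1) * k t) o\<^sub>L prj j)" for z t
    have F: "blinfun_apply (F z t) w = (\<Sum>j\<in>UNIV. w $ j * (partial j f (z + p t *s axis i 1) * k t))" for z t w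
      unfolding F_def by (simp add: blinfun.sum_left prj)
    have contF: "continuous_on (ball z0 r \<times> cbox 0 1) (\<lambda>(z, t). F z t)"
      unfolding F_def case_prod_unfold
    proof (intro continuous_on_sum bounded_bilinear.continuous_on[OF bounded_bilinear_blinfun_compose]
        bounded_linear.continuous_on[OF bounded_linear_blinfun_mult_left] continuous_on_const)
      fix j
      show "continuous_on (ball z0 r \<times> cbox 0 1)
          (\<lambda>x. partial j f (fst x + p (snd x) *s axis i 1) * k (snd x))"
        using shift[where B = "ball z0 r", OF inS p k cont[OF f]]
        unfolding case_prod_unfold cbox_interval .
    qed
    have int: "(\<lambda>t. g (z + p t *s axis i 1) * k t) integrable_on cbox 0 1"
      if "continuous_on S g" "z \<in> ball z0 r" for g z
    proof (rule integrable_continuous)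
      show "continuous_on (cbox 0 1) (\<lambda>t. g (z + p t *s axis i 1) * k t)"
        using continuous_on_compose2[OF shift[where B = "ball z0 r", OF inS p k that(1)], of "cbox 0 1" "\<lambda>t. (z, t)"] that(2)
          continuous_on_Pair[OF continuous_on_const continuous_on_id, of "{0..1}" z]
        by (simp add: image_subset_iff)
    qed
    have intF: "(\<lambda>t. F z0 t) integrable_on cbox 0 1"
    proof (rule integrable_continuous)
      show "continuous_on (cbox 0 1) (F z0)"
        using continuous_on_compose2[OF contF, of "cbox 0 1" "\<lambda>t. (z0, t)"] r
          continuous_on_Pair[OF continuous_on_const continuous_on_id, of "{0..1}" z0]
        by (simp add: image_subset_iff)
    qed
    have "((\<lambda>z. integral (cbox 0 1) (\<lambda>t. f (z + p t *s axis i 1) * k t)) has_derivative 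
        integral (cbox 0 1) (F z0)) (at z0 within ball z0 r)"
    proof (rule leibniz_rule)
      fix z t assume zt: "z \<in> ball z0 r" "t \<in> cbox (0::real) 1"
      have "has_gradient f (\<lambda>j. partial j f (z + p t *s axis i 1)) (z + p t *s axis i 1)"
        using zt inS by (intro holomorphic_has_gradient[OF f]) auto
      then have "(f has_derivative (\<lambda>w. \<Sum>j\<in>UNIV. w $ j * partial j f (z + p t *s axis i 1))) (at (z + p t *s axis i 1))"
        unfolding has_gradient_def .
      then have "((\<lambda>z. f (z + p t *s axis i 1)) has_derivative (\<lambda>w. \<Sum>j\<in>UNIV. w $ j * partial j f (z + p t *s axis i 1))) (at z)"
        by (rule has_derivative_compose[rotated])
          (rule has_derivative_eq_rhs[OF has_derivative_add[OF has_derivative_ident has_derivative_const]], simp)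
      then have "((\<lambda>z. f (z + p t *s axis i 1) * k t) has_derivative blinfun_apply (F z t)) (at z)"
        by (rule has_derivative_eq_rhs[OF has_derivative_mult_left])
          (simp add: fun_eq_iff F sum_distrib_left mult_ac)
      then show "((\<lambda>z. f (z + p t *s axis i 1) * k t) has_derivative blinfun_apply (F z t)) (at z within ball z0 r)"
        by (rule has_derivative_at_withinI)
    next
      show "(\<lambda>t. f (z + p t *s axis i 1) * k t) integrable_on cbox 0 1" if "z \<in> ball z0 r" for z
        by (rule int[OF holomorphic_fun_on_continuous[OF f] that])
      show "continuous_on (ball z0 r \<times> cbox 0 1) (\<lambda>(z, t). F z t)" by (rule contF)
      show "z0 \<in> ball z0 r" "convex (ball z0 r)" using r by simp_all
    qed
    moreover have "at z0 within ball z0 r = at z0"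
      by (rule at_within_open) (use r in simp_all)
    ultimately have "((\<lambda>z. integral (cbox 0 1) (\<lambda>t. f (z + p t *s axis i 1) * k t)) has_derivative 
        blinfun_apply (integral (cbox 0 1) (F z0))) (at z0)"
      by (simp only:)
    then have "(partial i f has_derivative blinfun_apply (integral (cbox 0 1) (F z0))) (at z0)"
      by (rule has_derivative_transform_within_open[where s = "ball z0 r"])
        (use r rep[OF f] in \<open>simp_all add: cbox_interval\<close>)
    moreover have "blinfun_apply (integral (cbox 0 1) (F z0)) w = 
       (\<Sum>j\<in>UNIV. w $ j * integral {0..1} (\<lambda>t. partial j f (z0 + p t *s axis i 1) * k t))" for w
    proof -
      have *: "(\<lambda>t. w $ j * (partial j f (z0 + p t *s axis i 1) * k t)) integrable_on {0..1}" for j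
        using int[OF cont[OF f], of z0 j] r by (intro integrable_on_mult_right) auto
      show ?thesis
        by (subst blinfun_apply_integral[OF intF]) (simp add: F integral_sum *)
    qed
    ultimately have "has_gradient (partial i f) (\<lambda>j. integral {0..1} (\<lambda>t. partial j f (z0 + p t *s axis i 1) * k t)) z0"
      unfolding has_gradient_def by (elim has_derivative_eq_rhs) (simp add: fun_eq_iff)
    then show ?thesis using r sub rep by (intro exI[of _ k] exI[of _ p] exI[of _ r]) auto
  qed
  show hol: "holomorphic_fun_on (partial i f) S" for i
    using grad unfolding holomorphic_fun_on_iff by meson
  fix i j
  assume z: "z \<in> S"
  obtain k p :: "real \<Rightarrow> complex" and r where r: "0 < r" and rep: "\<And>g z'. holomorphic_fun_on g S \<Longrightarrow> z'\<in>ball z r \<Longrightarrow> partial i g z' = 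
         integral {0..1} (\<lambda>t. g (z' + p t *s axis i 1) * k t)" and
        "has_gradient (partial i f) (\<lambda>j. integral {0..1} (\<lambda>t. partial j f (z + p t *s axis i 1) * k t)) z"
    using grad[OF z, of i] by (elim exE conjE) blast
  \<comment> \<open>The kernel that represents \<open>partial i\<close> on \<open>f\<close> also
    represents it on \<open>partial j f\<close>, which is holomorphic by the first claim.\<close>
  then show "partial i (partial j f) z = partial j (partial i f) z"
    using rep[OF hol[of j], of z] r by (simp add: has_gradient_partial)
qed

section \<open>Germs and tangent vectors on a manifold\<close>

lemma holomorphic_fun_on_const: "holomorphic_fun_on (\<lambda>_. c) S"
  unfolding holomorphic_fun_on_iff using has_gradient_const by blast

lemma holomorphic_fun_on_nth: "holomorphic_fun_on (\<lambda>z. z $ j) S"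
  unfolding holomorphic_fun_on_iff using has_gradient_nth by blast

lemma holomorphic_fun_on_add:
  "\<lbrakk>holomorphic_fun_on f S; holomorphic_fun_on g S\<rbrakk> \<Longrightarrow> holomorphic_fun_on (\<lambda>z. f z + g z) S"
  unfolding holomorphic_fun_on_iff by (blast intro: has_gradient_add)

lemma holomorphic_fun_on_mult:
  "\<lbrakk>holomorphic_fun_on f S; holomorphic_fun_on g S\<rbrakk> \<Longrightarrow> holomorphic_fun_on (\<lambda>z. f z * g z) S"
  unfolding holomorphic_fun_on_iff by (blast intro: has_gradient_mult)

lemma holomorphic_fun_on_compose:
  fixes h :: "complex^'e::finite \<Rightarrow> complex"
  assumes "holomorphic_fun_on h T" "\<And>j. holomorphic_fun_on (g j) S" "\<And>z. z \<in> S \<Longrightarrow> (\<chi> j. g j z) \<in> T"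
  shows "holomorphic_fun_on (\<lambda>z. h (\<chi> j. g j z)) S"
  unfolding holomorphic_fun_on_iff
proof
  fix z assume z: "z \<in> S"
  show "\<exists>a. has_gradient (\<lambda>z. h (\<chi> j. g j z)) a z"
    using has_gradient_compose[OF holomorphic_has_gradient[OF assms(1) assms(3)[OF z]]
        holomorphic_has_gradient[OF assms(2) z]] by blast
qed

lemma has_gradient_compose1:
  assumes "(k has_field_derivative k') (at (g z))" "has_gradient g b z"
  shows "has_gradient (\<lambda>z. k (g z)) (\<lambda>i. k' * b i) z"
  unfolding has_gradient_def
  by (rule has_derivative_eq_rhs[OF has_derivative_compose[OF assms(2)[unfolded has_gradient_def]
        assms(1)[unfolded has_field_derivative_def]]])
    (simp add: fun_eq_iff sum_distrib_left mult_ac)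

lemma scaleC_fun_apply [simp]: "(c *\<^sub>C f) x = c *\<^sub>C f x"
  by (simp add: scaleC_fun_def)

lemma scaleC_complex [simp]: "c *\<^sub>C (z :: complex) = c * z"
  by (simp add: scaleC_complex_def)

lemma sum_fun_apply: "(\<Sum>i\<in>I. F i) x = (\<Sum>i\<in>I. F i x)"
  for F :: "'i \<Rightarrow> 'a \<Rightarrow> 'b::comm_monoid_add"
  by (induction I rule: infinite_finite_induct) auto

locale hol_atlas =
  fixes A :: "('m, 'd::finite) atlas"
  assumes atlas: "holomorphic_atlas A"
begin

abbreviation mopen where "mopen \<equiv> openin (manifold_topology A)"
abbreviation pts where "pts \<equiv> manifold_points A"
text \<open>Germs are handled through this filter: two functions have the same germ at
  \<open>x\<close> when they agree eventually along \<open>NH x\<close>, and facts valid near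
  \<open>x\<close> are combined without naming neighbourhoods.\<close>

abbreviation NH where "NH \<equiv> nhdsin (manifold_topology A)"
abbreviation hn where "hn \<equiv> holomorphic_near A"
abbreviation pinv :: "'m set \<times> ('m \<Rightarrow> complex^'d) \<Rightarrow> complex^'d \<Rightarrow> 'm"
  where "pinv K \<equiv> inv_into (fst K) (snd K)"
abbreviation xi :: "'m set \<times> ('m \<Rightarrow> complex^'d) \<Rightarrow> 'd \<Rightarrow> 'm \<Rightarrow> complex"
  where "xi K j \<equiv> \<lambda>y. snd K y $ j"

lemma chart_inj: "K \<in> A \<Longrightarrow> inj_on (snd K) (fst K)"
  using atlas unfolding holomorphic_atlas_def by (auto simp: case_prod_unfold)

lemma pinv [simp]: "K \<in> A \<Longrightarrow> x \<in> fst K \<Longrightarrow> pinv K (snd K x) = x"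
  by (simp add: chart_inj)

lemma open_overlap: "K \<in> A \<Longrightarrow> \<mu> \<in> A \<Longrightarrow> open (snd K ` (fst K \<inter> fst \<mu>))"
  using atlas unfolding holomorphic_atlas_def by (auto simp: case_prod_unfold)

lemma transition:
  "K \<in> A \<Longrightarrow> \<mu> \<in> A \<Longrightarrow> holomorphic_fun_on (\<lambda>z. snd \<mu> (pinv K z) $ j) (snd K ` (fst K \<inter> fst \<mu>))"
  using atlas unfolding holomorphic_atlas_def by (auto simp: case_prod_unfold)

lemma chart_pts: "K \<in> A \<Longrightarrow> x \<in> fst K \<Longrightarrow> x \<in> pts"
  unfolding manifold_points_def by (auto simp: case_prod_unfold)

lemma pts_chart: "x \<in> pts \<Longrightarrow> \<exists>K\<in>A. x \<in> fst K"
  unfolding manifold_points_def by (auto simp: case_prod_unfold)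

lemma mopen_iff: "mopen W \<longleftrightarrow> W \<subseteq> pts \<and> (\<forall>K\<in>A. open (snd K ` (W \<inter> fst K)))"
  using openin_manifold_topology[OF atlas] by (simp add: case_prod_unfold)

lemma mopen_chart: "K \<in> A \<Longrightarrow> mopen (fst K)"
  unfolding mopen_iff using chart_pts[of K] open_overlap[of _ K] by (simp add: Int_commute subset_iff)

lemma open_chart_image: "mopen V \<Longrightarrow> K \<in> A \<Longrightarrow> open (snd K ` (fst K \<inter> V))"
  unfolding mopen_iff by (simp add: Int_commute)

lemma topspace_pts [simp]: "topspace (manifold_topology A) = pts"
proof -
  have "mopen pts" unfolding mopen_iff
    using open_overlap[of _ _] chart_pts by (metis Int_absorb1 Int_absorb order_refl subsetI)
  then show ?thesis
    by (metis mopen_iff openin_subset openin_topspace subset_antisym)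
qed

lemma mopen_pts: "mopen V \<Longrightarrow> x \<in> V \<Longrightarrow> x \<in> pts"
  using mopen_iff by blast

lemma mopen_preimage:
  assumes K: "K \<in> A" and O: "open S"
  shows "mopen {x \<in> fst K. snd K x \<in> S}"
  unfolding mopen_iff
proof (intro conjI ballI)
  show "{x \<in> fst K. snd K x \<in> S} \<subseteq> pts" using chart_pts[OF K] by blast
  fix \<mu> assume \<mu>: "\<mu> \<in> A"
  let ?W = "snd \<mu> ` (fst \<mu> \<inter> fst K)"
  have "continuous_on ?W (\<lambda>z. \<chi> j. snd K (pinv \<mu> z) $ j)"
    using holomorphic_fun_on_continuous[OF transition[OF \<mu> K]] by (intro continuous_on_vec_lambda)
  then have "continuous_on ?W (\<lambda>z. snd K (pinv \<mu> z))" by simp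
  then have "open (?W \<inter> (\<lambda>z. snd K (pinv \<mu> z)) -` S)"
    using open_overlap[OF \<mu> K] O by (rule continuous_open_preimage)
  moreover have "?W \<inter> (\<lambda>z. snd K (pinv \<mu> z)) -` S = snd \<mu> ` ({x \<in> fst K. snd K x \<in> S} \<inter> fst \<mu>)"
    using \<mu> by auto
  ultimately show "open (snd \<mu> ` ({x \<in> fst K. snd K x \<in> S} \<inter> fst \<mu>))" by simp
qed

lemma hn_pts: "hn x f \<Longrightarrow> x \<in> pts"
  unfolding holomorphic_near_def using mopen_pts by blast

text \<open>Holomorphy is defined by a test in all charts; the holomorphic transition maps carry it
  from one chart to the others.\<close>

lemma hn_iff:
  assumes K: "K \<in> A" and x: "x \<in> fst K"
  shows "hn x f \<longleftrightarrow> (\<exists>S. open S \<and> snd K x \<in> S \<and> holomorphic_fun_on (f \<circ> pinv K) S)"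
proof
  assume "hn x f"
  then obtain V where "mopen V" "x \<in> V" "f \<in> holomorphic_functions A V"
    unfolding holomorphic_near_def by blast
  then show "\<exists>S. open S \<and> snd K x \<in> S \<and> holomorphic_fun_on (f \<circ> pinv K) S"
    using K x open_chart_image unfolding holomorphic_functions_def
    by (intro exI[of _ "snd K ` (fst K \<inter> V)"]) (auto simp: case_prod_unfold)
next
  assume "\<exists>S. open S \<and> snd K x \<in> S \<and> holomorphic_fun_on (f \<circ> pinv K) S"
  then obtain S where S: "open S" "snd K x \<in> S" "holomorphic_fun_on (f \<circ> pinv K) S" by blast
  let ?V = "{y \<in> fst K. snd K y \<in> S}"
  have "f \<in> holomorphic_functions A ?V"
    unfolding holomorphic_functions_def
  proof (clarify)
    fix U \<phi> assume "(U, \<phi>) \<in> A"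
    then obtain \<mu> where \<mu>: "\<mu> \<in> A" "\<mu> = (U, \<phi>)" by blast
    have o: "open (snd \<mu> ` (fst \<mu> \<inter> ?V))" by (intro open_chart_image mopen_preimage K S \<mu>)
    have "holomorphic_fun_on (\<lambda>z. (f \<circ> pinv K) (\<chi> j. snd K (pinv \<mu> z) $ j)) (snd \<mu> ` (fst \<mu> \<inter> ?V))"
      by (rule holomorphic_fun_on_compose[OF S(3)], rule holomorphic_fun_on_subset[OF transition[OF \<mu>(1) K]])
        (use pinv[OF \<mu>(1)] in auto)
    then have "holomorphic_fun_on (f \<circ> pinv \<mu>) (snd \<mu> ` (fst \<mu> \<inter> ?V))"
      using o by (rule holomorphic_fun_on_cong) (use pinv[OF \<mu>(1)] pinv[OF K] in auto)
    then show "holomorphic_fun_on (f \<circ> inv_into U \<phi>) (\<phi> ` (U \<inter> ?V))" by (simp add: \<mu>)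
  qed
  then show "hn x f" unfolding holomorphic_near_def
    using mopen_preimage[OF K S(1)] x S(2) by blast
qed

lemma holfun_iff: "mopen V \<Longrightarrow> f \<in> holomorphic_functions A V \<longleftrightarrow> (\<forall>x\<in>V. hn x f)"
proof
  assume "mopen V" "f \<in> holomorphic_functions A V"
  then show "\<forall>x\<in>V. hn x f" unfolding holomorphic_near_def by blast
next
  assume V: "mopen V" and f: "\<forall>x\<in>V. hn x f"
  have "holomorphic_fun_on (f \<circ> pinv \<mu>) (snd \<mu> ` (fst \<mu> \<inter> V))" if \<mu>: "\<mu> \<in> A" for \<mu>
    unfolding holomorphic_fun_on_iff
  proof
    fix z assume "z \<in> snd \<mu> ` (fst \<mu> \<inter> V)"
    then obtain x where x: "z = snd \<mu> x" "x \<in> fst \<mu>" "x \<in> V" by blast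
    with f have "hn x f" by blast
    with hn_iff[OF \<mu> x(2)] x show "\<exists>a. has_gradient (f \<circ> pinv \<mu>) a z"
      unfolding holomorphic_fun_on_iff by blast
  qed
  then show "f \<in> holomorphic_functions A V"
    unfolding holomorphic_functions_def by fastforce
qed

section \<open>Germs as eventual properties\<close>

lemma eventually_NH: "x \<in> pts \<Longrightarrow> eventually P (NH x) \<longleftrightarrow> (\<exists>V. mopen V \<and> x \<in> V \<and> (\<forall>y\<in>V. P y))"
  by (simp add: eventually_nhdsin)

lemma eventually_mopen: "mopen V \<Longrightarrow> x \<in> V \<Longrightarrow> eventually (\<lambda>y. y \<in> V) (NH x)"
  using eventually_nhdsin by fast

lemma eventually_chart: "K \<in> A \<Longrightarrow> x \<in> fst K \<Longrightarrow> eventually (\<lambda>y. y \<in> fst K) (NH x)"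
  by (rule eventually_mopen[OF mopen_chart])

text \<open>Off the manifold the filter is trivial and everything holds eventually, hence the
  assumption \<open>x \<in> pts\<close>.\<close>

lemma NH_self: "eventually P (NH x) \<Longrightarrow> x \<in> pts \<Longrightarrow> P x"
  by (auto simp: eventually_NH)

lemma NH_NH: "eventually P (NH x) \<Longrightarrow> x \<in> pts \<Longrightarrow> eventually (\<lambda>y. eventually P (NH y)) (NH x)"
  unfolding eventually_NH by (metis eventually_nhdsin)

lemma hn_eventually: "hn x f \<Longrightarrow> eventually (\<lambda>y. hn y f) (NH x)"
  unfolding holomorphic_near_def[of A x] eventually_nhdsin holomorphic_near_def by blast

lemma eventually_coords:
  assumes K: "K \<in> A" "x \<in> fst K" and ev: "eventually P (NH x)"
  shows "\<exists>S. open S \<and> snd K x \<in> S \<and> S \<subseteq> snd K ` fst K \<and> (\<forall>z\<in>S. P (pinv K z))"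
proof -
  obtain V where "mopen V" "x \<in> V" "\<forall>y\<in>V. P y" using ev chart_pts[OF K] by (auto simp: eventually_NH)
  then show ?thesis using K open_chart_image[of V K]
    by (intro exI[of _ "snd K ` (fst K \<inter> V)"]) auto
qed

lemma hn_cong:
  assumes ev: "eventually (\<lambda>y. f y = g y) (NH x)"
  shows "hn x f \<longleftrightarrow> hn x g"
proof -
  have *: "hn x g" if hf: "hn x f" and e: "eventually (\<lambda>y. f y = g y) (NH x)" for f g
  proof -
    have x: "x \<in> pts" using hf hn_pts by blast
    then obtain K where K: "K \<in> A" "x \<in> fst K" using pts_chart by blast
    obtain S where S: "open S" "snd K x \<in> S" "holomorphic_fun_on (f \<circ> pinv K) S"
      using hn_iff[OF K] hf by blast
    obtain S' where S': "open S'" "snd K x \<in> S'" "\<forall>z\<in>S'. f (pinv K z) = g (pinv K z)"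
      using eventually_coords[OF K e] by blast
    have "holomorphic_fun_on (g \<circ> pinv K) (S \<inter> S')"
      by (rule holomorphic_fun_on_cong[OF holomorphic_fun_on_subset[OF S(3)]]) (use S S' in auto)
    then show ?thesis unfolding hn_iff[OF K] using S S' by blast
  qed
  have "eventually (\<lambda>y. g y = f y) (NH x)" using ev by (simp add: eq_commute)
  then show ?thesis using *[OF _ ev] *[of g f] by blast
qed

lemma hn_const: "x \<in> pts \<Longrightarrow> hn x (\<lambda>_. c)"
proof -
  assume "x \<in> pts"
  then obtain K where K: "K \<in> A" "x \<in> fst K" using pts_chart by blast
  show ?thesis unfolding hn_iff[OF K] comp_def
    by (intro exI[of _ UNIV]) (simp add: holomorphic_fun_on_const)
qed

lemma hn_coord: "K \<in> A \<Longrightarrow> x \<in> fst K \<Longrightarrow> hn x (xi K j)"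
  unfolding hn_iff
  by (intro exI[of _ "snd K ` (fst K \<inter> fst K)"] conjI open_overlap)
    (use transition[of K K j] in \<open>auto simp: comp_def\<close>)

lemma hn_binop:
  assumes "hn x f" "hn x g"
    and op: "\<And>(f :: complex^'d \<Rightarrow> complex) g S. \<lbrakk>holomorphic_fun_on f S; holomorphic_fun_on g S\<rbrakk> \<Longrightarrow> holomorphic_fun_on (\<lambda>z. op (f z) (g z)) S"
  shows "hn x (\<lambda>y. op (f y) (g y))"
proof -
  obtain K where K: "K \<in> A" "x \<in> fst K" using pts_chart hn_pts assms by blast
  obtain S where S: "open S" "snd K x \<in> S" "holomorphic_fun_on (f \<circ> pinv K) S"
    using hn_iff[OF K] assms by blast
  obtain S' where S': "open S'" "snd K x \<in> S'" "holomorphic_fun_on (g \<circ> pinv K) S'"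
    using hn_iff[OF K] assms by blast
  have "holomorphic_fun_on (\<lambda>z. op ((f \<circ> pinv K) z) ((g \<circ> pinv K) z)) (S \<inter> S')"
    by (intro op holomorphic_fun_on_subset[OF S(3)] holomorphic_fun_on_subset[OF S'(3)]) auto
  then show ?thesis unfolding hn_iff[OF K] using S S'
    by (intro exI[of _ "S \<inter> S'"]) (auto simp: comp_def)
qed

lemma hn_add: "\<lbrakk>hn x f; hn x g\<rbrakk> \<Longrightarrow> hn x (\<lambda>y. f y + g y)"
  by (rule hn_binop[OF _ _ holomorphic_fun_on_add])

lemma hn_mult: "\<lbrakk>hn x f; hn x g\<rbrakk> \<Longrightarrow> hn x (\<lambda>y. f y * g y)"
  by (rule hn_binop[OF _ _ holomorphic_fun_on_mult])

lemma hn_minus: "hn x f \<Longrightarrow> hn x (\<lambda>y. - f y)"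
  using hn_mult[OF hn_const[OF hn_pts], of x f f "-1"] by simp

lemma hn_diff: "\<lbrakk>hn x f; hn x g\<rbrakk> \<Longrightarrow> hn x (\<lambda>y. f y - g y)"
  using hn_add[OF _ hn_minus, of x f g] by simp

lemma hn_sum: "x \<in> pts \<Longrightarrow> (\<And>i. i \<in> I \<Longrightarrow> hn x (f i)) \<Longrightarrow> hn x (\<lambda>y. \<Sum>i\<in>I. f i y)"
  by (induction I rule: infinite_finite_induct) (auto intro: hn_const hn_add)

lemma hn_prod: "x \<in> pts \<Longrightarrow> (\<And>i. i \<in> I \<Longrightarrow> hn x (f i)) \<Longrightarrow> hn x (\<lambda>y. \<Prod>i\<in>I. f i y)"
  by (induction I rule: infinite_finite_induct) (auto intro: hn_const hn_mult)

lemma hn_det: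
  assumes "x \<in> pts" "\<And>i j. hn x (f i j)"
  shows "hn x (\<lambda>y. det (\<chi> i j. f i j y :: complex^'k::finite^'k))"
  unfolding det_def using assms by (simp add: hn_sum hn_mult hn_const hn_prod)

lemma hn_compose:
  fixes h :: "complex^'e::finite \<Rightarrow> complex"
  assumes x: "x \<in> pts" and h: "holomorphic_fun_on h T" "open T" "(\<chi> j. g j x) \<in> T"
    and g: "\<And>j. hn x (g j)"
  shows "hn x (\<lambda>y. h (\<chi> j. g j y))"
proof -
  obtain K where K: "K \<in> A" "x \<in> fst K" using pts_chart x by blast
  obtain S where S: "\<And>j. open (S j)" "\<And>j. snd K x \<in> S j" "\<And>j. holomorphic_fun_on (g j \<circ> pinv K) (S j)"
    using g unfolding hn_iff[OF K] by metis
  define S' where "S' = (\<Inter>j. S j)"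
  have S': "open S'" "snd K x \<in> S'" "\<And>j. holomorphic_fun_on (g j \<circ> pinv K) S'"
    unfolding S'_def using S by (auto intro: holomorphic_fun_on_subset[OF S(3)])
  let ?G = "\<lambda>z. \<chi> j. (g j \<circ> pinv K) z"
  have "continuous_on S' ?G"
    using holomorphic_fun_on_continuous[OF S'(3)] by (intro continuous_on_vec_lambda)
  then have o: "open (S' \<inter> ?G -` T)" using S'(1) h(2) by (rule continuous_open_preimage)
  have "holomorphic_fun_on (\<lambda>z. h (\<chi> j. (g j \<circ> pinv K) z)) (S' \<inter> ?G -` T)"
    by (rule holomorphic_fun_on_compose[OF h(1)], rule holomorphic_fun_on_subset[OF S'(3)]) auto
  then show ?thesis unfolding hn_iff[OF K] using o h(3) S'(2) K
    by (intro exI[of _ "S' \<inter> ?G -` T"]) (auto simp: comp_def)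
qed

lemma hn_compose1:
  assumes "k holomorphic_on T" "open T" "g x \<in> T" "hn x g"
  shows "hn x (\<lambda>y. k (g y))"
proof -
  \<comment> \<open>The function of one variable is viewed on \<open>complex^unit\<close>, which
    makes this a case of \<open>hn_compose\<close>.\<close>
  have "holomorphic_fun_on (\<lambda>z::complex^unit. k (z $ ())) {z. z $ () \<in> T}"
    unfolding holomorphic_fun_on_iff
  proof
    fix z :: "complex^unit" assume "z \<in> {z. z $ () \<in> T}"
    then have "(k has_field_derivative deriv k (z $ ())) (at (z $ ()))"
      using assms(1,2) holomorphic_derivI by blast
    from has_gradient_compose1[OF this has_gradient_nth]
    show "\<exists>a. has_gradient (\<lambda>z. k (z $ ())) a z" by blast
  qed
  moreover have "open {z::complex^unit. z $ () \<in> T}"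
    using open_vimage_vec_nth[OF assms(2), of "()"] by (simp add: vimage_def)
  ultimately show ?thesis
    using hn_compose[of x "\<lambda>z::complex^unit. k (z $ ())" "{z. z $ () \<in> T}" "\<lambda>_. g"] assms hn_pts by auto
qed

section \<open>Coordinate derivatives of germs\<close>

definition dd :: "'m set \<times> ('m \<Rightarrow> complex^'d) \<Rightarrow> 'd \<Rightarrow> 'm \<Rightarrow> 'm tangent" where
  "dd K i x f = (if hn x f then partial i (f \<circ> pinv K) (snd K x) else 0)"

lemma dd_gradient:
  assumes K: "K \<in> A" "x \<in> fst K" and f: "hn x f"
  shows "has_gradient (f \<circ> pinv K) (\<lambda>i. dd K i x f) (snd K x)"
proof -
  obtain S where "snd K x \<in> S" "holomorphic_fun_on (f \<circ> pinv K) S" using f hn_iff[OF K] by blast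
  then show ?thesis using holomorphic_has_gradient f unfolding dd_def by simp
qed

lemma dd_eqI:
  assumes K: "K \<in> A" "x \<in> fst K" and f: "hn x f" "has_gradient (f \<circ> pinv K) a (snd K x)"
  shows "dd K i x f = a i"
  using f has_gradient_partial unfolding dd_def by auto

lemma dd_cong:
  assumes K: "K \<in> A" "x \<in> fst K" and ev: "eventually (\<lambda>y. f y = g y) (NH x)"
  shows "dd K i x f = dd K i x g"
proof -
  obtain S where S: "open S" "snd K x \<in> S" "\<forall>z\<in>S. f (pinv K z) = g (pinv K z)"
    using eventually_coords[OF K ev] by blast
  have "partial i (f \<circ> pinv K) (snd K x) = partial i (g \<circ> pinv K) (snd K x)"
    by (rule partial_cong[OF S(1,2)]) (use S(3) in simp)
  then show ?thesis unfolding dd_def hn_cong[OF ev] by simp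
qed

lemma dd_const: "K \<in> A \<Longrightarrow> x \<in> fst K \<Longrightarrow> dd K i x (\<lambda>_. c) = 0"
proof -
  assume K: "K \<in> A" "x \<in> fst K"
  have "has_gradient ((\<lambda>_. c) \<circ> pinv K) (\<lambda>_. 0) (snd K x)"
    unfolding comp_def by (rule has_gradient_const)
  from dd_eqI[OF K hn_const[OF chart_pts[OF K]] this] show ?thesis .
qed

lemma dd_add:
  assumes "K \<in> A" "x \<in> fst K" "hn x f" "hn x g"
  shows "dd K i x (\<lambda>y. f y + g y) = dd K i x f + dd K i x g"
  using has_gradient_add[OF dd_gradient[OF assms(1-3)] dd_gradient[OF assms(1,2,4)]]
  by (intro dd_eqI[OF assms(1,2) hn_add[OF assms(3,4)], where a = "\<lambda>i. dd K i x f + dd K i x g"])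
    (simp add: comp_def)

lemma dd_mult:
  assumes "K \<in> A" "x \<in> fst K" "hn x f" "hn x g"
  shows "dd K i x (\<lambda>y. f y * g y) = dd K i x f * g x + f x * dd K i x g"
  using has_gradient_mult[OF dd_gradient[OF assms(1-3)] dd_gradient[OF assms(1,2,4)]] assms(1,2)
  by (intro dd_eqI[OF assms(1,2) hn_mult[OF assms(3,4)], where a = "\<lambda>i. dd K i x f * g x + f x * dd K i x g"])
    (simp add: comp_def)

lemma dd_coord: "K \<in> A \<Longrightarrow> x \<in> fst K \<Longrightarrow> dd K i x (xi K j) = (if i = j then 1 else 0)"
proof (rule dd_eqI[OF _ _ hn_coord])
  assume K: "K \<in> A" "x \<in> fst K"
  show "has_gradient (xi K j \<circ> pinv K) (\<lambda>i. if i = j then 1 else 0) (snd K x)"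
    by (rule has_gradient_cong[OF has_gradient_nth open_overlap[OF K(1) K(1)]]) (use K in auto)
qed

lemma dd_compose:
  fixes h :: "complex^'e::finite \<Rightarrow> complex"
  assumes K: "K \<in> A" "x \<in> fst K" and h: "holomorphic_fun_on h T" "open T" "(\<chi> j. g j x) \<in> T"
    and g: "\<And>j. hn x (g j)"
  shows "dd K i x (\<lambda>y. h (\<chi> j. g j y)) = (\<Sum>j\<in>UNIV. partial j h (\<chi> j. g j x) * dd K i x (g j))"
proof (rule dd_eqI[OF K hn_compose[OF chart_pts[OF K] h g]])
  show "has_gradient ((\<lambda>y. h (\<chi> j. g j y)) \<circ> pinv K)
      (\<lambda>i. \<Sum>j\<in>UNIV. partial j h (\<chi> j. g j x) * dd K i x (g j)) (snd K x)"
    using has_gradient_compose[of h "\<lambda>j. partial j h (\<chi> j. g j x)" "\<lambda>j. g j \<circ> pinv K" "snd K x"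
        "\<lambda>j i. dd K i x (g j)"] holomorphic_has_gradient[OF h(1,3)] dd_gradient[OF K g] K
    by (simp add: comp_def)
qed

lemma hn_dd:
  assumes K: "K \<in> A" "x \<in> fst K" and f: "hn x f"
  shows "hn x (\<lambda>y. dd K i y f)"
    and "dd K i x (\<lambda>y. dd K j y f) = dd K j x (\<lambda>y. dd K i y f)"
proof -
  obtain S where S: "open S" "snd K x \<in> S" "holomorphic_fun_on (f \<circ> pinv K) S"
    using hn_iff[OF K] f by blast
  have "eventually (\<lambda>y. y \<in> fst K \<and> hn y f) (NH x)"
    using hn_eventually[OF f] eventually_chart[OF K] by eventually_elim simp
  from eventually_coords[OF K this] obtain S' where
    S': "open S'" "snd K x \<in> S'" "S' \<subseteq> snd K ` fst K" "\<forall>z\<in>S'. hn (pinv K z) f" by blast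
  have eq: "partial i (f \<circ> pinv K) z = ((\<lambda>y. dd K i y f) \<circ> pinv K) z" if "z \<in> S \<inter> S'" for z i
    using that S' K unfolding dd_def by (auto simp: comp_def)
  have "holomorphic_fun_on ((\<lambda>y. dd K i y f) \<circ> pinv K) (S \<inter> S')" for i
    by (rule holomorphic_fun_on_cong[OF holomorphic_fun_on_subset[OF holomorphic_partial[OF S(3,1)]]])
      (use S S' eq in auto)
  then show hn: "hn x (\<lambda>y. dd K i y f)" for i unfolding hn_iff[OF K] using S S' by blast
  have "dd K i x (\<lambda>y. dd K j y f) = partial i (partial j (f \<circ> pinv K)) (snd K x)" for i j
  proof -
    have "partial i ((\<lambda>y. dd K j y f) \<circ> pinv K) (snd K x) = partial i (partial j (f \<circ> pinv K)) (snd K x)"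
      by (rule partial_cong[of "S \<inter> S'"]) (use S S' eq in auto)
    then show ?thesis unfolding dd_def[of K i] using hn by simp
  qed
  then show "dd K i x (\<lambda>y. dd K j y f) = dd K j x (\<lambda>y. dd K i y f)"
    using partial_commute[OF S(3,1,2)] by simp
qed

lemma dd_not_hn: "\<not> hn x f \<Longrightarrow> dd K i x f = 0"
  by (simp add: dd_def)

text \<open>Chain rule: near \<open>x\<close> the function \<open>f\<close> is its expression in the
  chart \<open>K\<close> composed with the coordinate functions of \<open>K\<close>.\<close>

lemma dd_change:
  assumes K: "K \<in> A" "x \<in> fst K" and \<mu>: "\<mu> \<in> A" "x \<in> fst \<mu>"
  shows "dd \<mu> i x f = (\<Sum>j\<in>UNIV. dd \<mu> i x (xi K j) * dd K j x f)"
proof (cases "hn x f")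
  case True
  obtain S where S: "open S" "snd K x \<in> S" "holomorphic_fun_on (f \<circ> pinv K) S"
    using hn_iff[OF K] True by blast
  have "dd \<mu> i x f = dd \<mu> i x (\<lambda>y. (f \<circ> pinv K) (\<chi> j. xi K j y))"
    by (rule dd_cong[OF \<mu>]) (use eventually_chart[OF K] K in \<open>auto elim!: eventually_mono\<close>)
  also have "\<dots> = (\<Sum>j\<in>UNIV. partial j (f \<circ> pinv K) (\<chi> j. xi K j x) * dd \<mu> i x (xi K j))"
    by (rule dd_compose[OF \<mu> S(3,1)]) (use S K in \<open>auto intro: hn_coord\<close>)
  also have "\<dots> = (\<Sum>j\<in>UNIV. dd \<mu> i x (xi K j) * dd K j x f)"
    using True unfolding dd_def[of K] by (simp add: mult.commute)
  finally show ?thesis .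
qed (simp add: dd_not_hn)

section \<open>Tangent vectors as combinations of coordinate derivatives\<close>

text \<open>The definition of \<open>tangent_space\<close> allows any chart around \<open>x\<close>;
  \<open>dd_change\<close> moves the coefficients to the given one.\<close>

lemma tangent_iff:
  assumes K: "K \<in> A" "x \<in> fst K"
  shows "v \<in> tangent_space A x \<longleftrightarrow> (\<exists>w. \<forall>f. v f = (\<Sum>i\<in>UNIV. w i * dd K i x f))"
proof -
  have ex: "(\<exists>w. v = (\<lambda>f. if hn x f then frechet_derivative (f \<circ> pinv \<mu>) (at (snd \<mu> x)) w else 0)) \<longleftrightarrow>
      (\<exists>w. \<forall>f. v f = (\<Sum>i\<in>UNIV. w i * dd \<mu> i x f))" if \<mu>: "\<mu> \<in> A" "x \<in> fst \<mu>" for \<mu>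
  proof -
    have "(if hn x f then frechet_derivative (f \<circ> pinv \<mu>) (at (snd \<mu> x)) w else 0) = 
        (\<Sum>i\<in>UNIV. w $ i * dd \<mu> i x f)" for f w
      using has_gradient_frechet[OF dd_gradient[OF \<mu>]] by (simp add: dd_not_hn)
    then have "(\<exists>w. v = (\<lambda>f. if hn x f then frechet_derivative (f \<circ> pinv \<mu>) (at (snd \<mu> x)) w else 0)) \<longleftrightarrow>
      (\<exists>w. \<forall>f. v f = (\<Sum>i\<in>UNIV. w $ i * dd \<mu> i x f))" by (simp add: fun_eq_iff)
    also have "\<dots> \<longleftrightarrow> (\<exists>w. \<forall>f. v f = (\<Sum>i\<in>UNIV. w i * dd \<mu> i x f))"
    proof
      assume "\<exists>w. \<forall>f. v f = (\<Sum>i\<in>UNIV. w i * dd \<mu> i x f)"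
      then obtain w where "\<forall>f. v f = (\<Sum>i\<in>UNIV. w i * dd \<mu> i x f)" by blast
      then show "\<exists>w. \<forall>f. v f = (\<Sum>i\<in>UNIV. w $ i * dd \<mu> i x f)"
        by (intro exI[of _ "\<chi> i. w i"]) simp
    qed blast
    finally show ?thesis .
  qed
  have "v \<in> tangent_space A x \<longleftrightarrow> (\<exists>\<mu>\<in>A. x \<in> fst \<mu> \<and> (\<exists>w. \<forall>f. v f = (\<Sum>i\<in>UNIV. w i * dd \<mu> i x f)))"
    unfolding tangent_space_def mem_Collect_eq case_prod_unfold
    by (intro bex_cong refl conj_cong ex)
  also have "\<dots> \<longleftrightarrow> (\<exists>w. \<forall>f. v f = (\<Sum>i\<in>UNIV. w i * dd K i x f))"
  proof
    assume "\<exists>\<mu>\<in>A. x \<in> fst \<mu> \<and> (\<exists>w. \<forall>f. v f = (\<Sum>i\<in>UNIV. w i * dd \<mu> i x f))"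
    then obtain \<mu> w where \<mu>: "\<mu> \<in> A" "x \<in> fst \<mu>" "\<forall>f. v f = (\<Sum>i\<in>UNIV. w i * dd \<mu> i x f)" by blast
    have "v f = (\<Sum>j\<in>UNIV. (\<Sum>i\<in>UNIV. w i * dd \<mu> i x (xi K j)) * dd K j x f)" for f
    proof -
      have "v f = (\<Sum>i\<in>UNIV. w i * (\<Sum>j\<in>UNIV. dd \<mu> i x (xi K j) * dd K j x f))"
        using \<mu>(3) by (simp only: dd_change[OF K \<mu>(1,2), of _ f, symmetric])
      also have "\<dots> = (\<Sum>i\<in>UNIV. \<Sum>j\<in>UNIV. w i * dd \<mu> i x (xi K j) * dd K j x f)"
        by (simp add: sum_distrib_left mult_ac)
      also have "\<dots> = (\<Sum>j\<in>UNIV. (\<Sum>i\<in>UNIV. w i * dd \<mu> i x (xi K j)) * dd K j x f)"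
        unfolding sum_distrib_right by (rule sum.swap)
      finally show ?thesis .
    qed
    then show "\<exists>w. \<forall>f. v f = (\<Sum>i\<in>UNIV. w i * dd K i x f)"
      by (intro exI[of _ "\<lambda>j. \<Sum>i\<in>UNIV. w i * dd \<mu> i x (xi K j)"] allI)
  qed (use K in blast)
  finally show ?thesis .
qed

lemma tangent_expand:
  assumes K: "K \<in> A" "x \<in> fst K" and v: "v \<in> tangent_space A x"
  shows "v f = (\<Sum>i\<in>UNIV. v (xi K i) * dd K i x f)"
proof -
  obtain w where w: "\<And>f. v f = (\<Sum>i\<in>UNIV. w i * dd K i x f)" using v unfolding tangent_iff[OF K] by blast
  have "v (xi K i) = w i" for i
    unfolding w by (simp add: dd_coord[OF K] if_distrib cong: if_cong)
  then show ?thesis by (simp only: w[of f])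
qed

lemma dd_tangent: "K \<in> A \<Longrightarrow> x \<in> fst K \<Longrightarrow> dd K i x \<in> tangent_space A x"
  unfolding tangent_iff
  by (intro exI[of _ "\<lambda>j. if j = i then 1 else 0"]) (simp add: if_distrib[of "\<lambda>x. x * _"] cong: if_cong)

lemma tangent_pts: "v \<in> tangent_space A x \<Longrightarrow> x \<in> pts"
  unfolding tangent_space_def manifold_points_def by (auto simp: case_prod_unfold)

lemma tangent_chart:
  assumes "v \<in> tangent_space A x"
  obtains K w where "K \<in> A" "x \<in> fst K" "\<And>f. v f = (\<Sum>i\<in>UNIV. w i * dd K i x f)"
proof -
  obtain K where K: "K \<in> A" "x \<in> fst K" using tangent_pts[OF assms] pts_chart by blast
  then obtain w where "\<forall>f. v f = (\<Sum>i\<in>UNIV. w i * dd K i x f)"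
    using assms unfolding tangent_iff[OF K] by blast
  then show thesis using that[OF K] by blast
qed

lemma tangent_cong:
  assumes "v \<in> tangent_space A x" "eventually (\<lambda>y. f y = g y) (NH x)"
  shows "v f = v g"
proof -
  obtain K w where K: "K \<in> A" "x \<in> fst K" "\<And>f. v f = (\<Sum>i\<in>UNIV. w i * dd K i x f)"
    using tangent_chart[OF assms(1)] by blast
  show ?thesis unfolding K(3) dd_cong[OF K(1,2) assms(2)] ..
qed

lemma tangent_const:
  assumes v: "v \<in> tangent_space A x"
  shows "v (\<lambda>_. c) = 0"
proof -
  obtain K w where K: "K \<in> A" "x \<in> fst K" "\<And>f. v f = (\<Sum>i\<in>UNIV. w i * dd K i x f)"
    using tangent_chart[OF v] by blast
  show ?thesis unfolding K(3) by (simp add: dd_const[OF K(1,2)])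
qed

lemma tangent_add:
  assumes "v \<in> tangent_space A x" "hn x f" "hn x g"
  shows "v (\<lambda>y. f y + g y) = v f + v g"
proof -
  obtain K w where K: "K \<in> A" "x \<in> fst K" "\<And>f. v f = (\<Sum>i\<in>UNIV. w i * dd K i x f)"
    using tangent_chart[OF assms(1)] by blast
  show ?thesis unfolding K(3) dd_add[OF K(1,2) assms(2,3)] by (simp add: distrib_left sum.distrib)
qed

lemma tangent_mult:
  assumes "v \<in> tangent_space A x" "hn x f" "hn x g"
  shows "v (\<lambda>y. f y * g y) = v f * g x + f x * v g"
proof -
  obtain K w where K: "K \<in> A" "x \<in> fst K" "\<And>f. v f = (\<Sum>i\<in>UNIV. w i * dd K i x f)"
    using tangent_chart[OF assms(1)] by blast
  show ?thesis unfolding K(3) dd_mult[OF K(1,2) assms(2,3)]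
    by (simp add: sum.distrib distrib_left sum_distrib_left sum_distrib_right mult_ac)
qed

lemma tangent_cmult: "v \<in> tangent_space A x \<Longrightarrow> hn x f \<Longrightarrow> v (\<lambda>y. c * f y) = c * v f"
  using tangent_mult[of v x "\<lambda>_. c" f] by (simp add: hn_const hn_pts tangent_const)

lemma tangent_sum:
  assumes "v \<in> tangent_space A x" "\<And>i. i \<in> I \<Longrightarrow> hn x (f i)"
  shows "v (\<lambda>y. \<Sum>i\<in>I. f i y) = (\<Sum>i\<in>I. v (f i))"
  using assms(2)
  by (induction I rule: infinite_finite_induct)
    (simp_all add: tangent_const[OF assms(1)] tangent_add[OF assms(1)] hn_sum tangent_pts[OF assms(1)])

lemma tangent_compose:
  fixes h :: "complex^'e::finite \<Rightarrow> complex"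
  assumes v: "v \<in> tangent_space A x" and h: "holomorphic_fun_on h T" "open T" "(\<chi> j. g j x) \<in> T"
    and g: "\<And>j. hn x (g j)"
  shows "v (\<lambda>y. h (\<chi> j. g j y)) = (\<Sum>j\<in>UNIV. partial j h (\<chi> j. g j x) * v (g j))"
proof -
  obtain K w where K: "K \<in> A" "x \<in> fst K" "\<And>f. v f = (\<Sum>i\<in>UNIV. w i * dd K i x f)"
    using tangent_chart[OF v] by blast
  show ?thesis unfolding K(3) dd_compose[OF K(1,2) h g] sum_distrib_left
    by (subst sum.swap) (simp add: mult_ac)
qed

lemma tangent_scale: "v \<in> tangent_space A x \<Longrightarrow> c *\<^sub>C v \<in> tangent_space A x"
proof -
  assume v: "v \<in> tangent_space A x"
  obtain K w where K: "K \<in> A" "x \<in> fst K" "\<And>f. v f = (\<Sum>i\<in>UNIV. w i * dd K i x f)"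
    using tangent_chart[OF v] by blast
  then show ?thesis unfolding tangent_iff[OF K(1,2)]
    by (intro exI[of _ "\<lambda>i. c * w i"]) (simp add: sum_distrib_left mult_ac)
qed

lemma tangent_plus:
  assumes "v \<in> tangent_space A x" "v' \<in> tangent_space A x" shows "v + v' \<in> tangent_space A x"
proof -
  obtain K w where K: "K \<in> A" "x \<in> fst K" "\<And>f. v f = (\<Sum>i\<in>UNIV. w i * dd K i x f)"
    using tangent_chart[OF assms(1)] by blast
  obtain w' where "\<And>f. v' f = (\<Sum>i\<in>UNIV. w' i * dd K i x f)"
    using assms(2) unfolding tangent_iff[OF K(1,2)] by blast
  then show ?thesis unfolding tangent_iff[OF K(1,2)] using K(3)
    by (intro exI[of _ "\<lambda>i. w i + w' i"]) (simp add: sum.distrib distrib_right)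
qed

lemma tangent_zero: "x \<in> pts \<Longrightarrow> 0 \<in> tangent_space A x"
proof -
  assume "x \<in> pts"
  then obtain K where K: "K \<in> A" "x \<in> fst K" using pts_chart by blast
  show ?thesis unfolding tangent_iff[OF K] by (intro exI[of _ "\<lambda>_. 0"]) simp
qed

lemma tangent_comb:
  assumes "x \<in> pts" "\<And>i. i \<in> I \<Longrightarrow> v i \<in> tangent_space A x"
  shows "(\<Sum>i\<in>I. c i *\<^sub>C v i) \<in> tangent_space A x"
  using assms by (induction I rule: infinite_finite_induct) (auto intro: tangent_zero tangent_plus tangent_scale)

lemma tangent_eqI:
  assumes "K \<in> A" "x \<in> fst K" "v \<in> tangent_space A x" "v' \<in> tangent_space A x"
    and "\<And>i. v (xi K i) = v' (xi K i)"
  shows "v = v'"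
proof
  fix f
  show "v f = v' f"
    by (simp only: tangent_expand[OF assms(1-3), of f] tangent_expand[OF assms(1,2,4), of f] assms(5))
qed

section \<open>Vector fields and their brackets in coordinates\<close>

lemma hn_field:
  assumes K: "K \<in> A" "x \<in> fst K" and X: "eventually (\<lambda>y. X y \<in> tangent_space A y) (NH x)"
    "\<And>i. hn x (\<lambda>y. X y (xi K i))" and f: "hn x f"
  shows "hn x (\<lambda>y. X y f)"
proof -
  have "eventually (\<lambda>y. X y f = (\<Sum>i\<in>UNIV. X y (xi K i) * dd K i y f)) (NH x)"
    using X(1) eventually_chart[OF K] by eventually_elim (rule tangent_expand[OF K(1)])
  from hn_cong[OF this] show ?thesis
    by (simp only:) (intro hn_sum hn_mult X hn_dd(1)[OF K f] chart_pts[OF K])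
qed

text \<open>The coordinate functions suffice as test functions, because a tangent vector is the
  combination of the coordinate derivatives whose coefficients are its values on the
  coordinates.\<close>

lemma vector_fields_iff:
  assumes V: "mopen V"
  shows "X \<in> vector_fields A V \<longleftrightarrow> (\<forall>p\<in>V. X p \<in> tangent_space A p) \<and>
    (\<forall>K\<in>A. \<forall>i. \<forall>p\<in>V \<inter> fst K. hn p (\<lambda>y. X y (xi K i)))"
proof (intro iffI conjI ballI allI)
  assume X: "X \<in> vector_fields A V"
  then show "X p \<in> tangent_space A p" if "p \<in> V" for p
    using that unfolding vector_fields_def by blast
  fix K i p assume K: "K \<in> A" and p: "p \<in> V \<inter> fst K"
  have o: "mopen (V \<inter> fst K)" using V mopen_chart[OF K] by blast
  have "xi K i \<in> holomorphic_functions A (V \<inter> fst K)"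
    using holfun_iff[OF o] hn_coord[OF K] by blast
  then have "(\<lambda>y. X y (xi K i)) \<in> holomorphic_functions A (V \<inter> fst K)"
    using X o unfolding vector_fields_def by blast
  then show "hn p (\<lambda>y. X y (xi K i))" using holfun_iff[OF o] p by blast
next
  assume X: "(\<forall>p\<in>V. X p \<in> tangent_space A p) \<and> (\<forall>K\<in>A. \<forall>i. \<forall>p\<in>V \<inter> fst K. hn p (\<lambda>y. X y (xi K i)))"
  have "hn p (\<lambda>y. X y f)" if W: "mopen W" "W \<subseteq> V" "f \<in> holomorphic_functions A W" "p \<in> W" for W f p
  proof -
    obtain K where K: "K \<in> A" "p \<in> fst K" using pts_chart mopen_pts W by blast
    have f: "hn p f" using W(4,3) unfolding holfun_iff[OF W(1)] by blast
    have c: "hn p (\<lambda>y. X y (xi K i))" for i using X W(2,4) K by blast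
    have "eventually (\<lambda>y. X y \<in> tangent_space A y) (NH p)"
      using eventually_mopen[OF W(1,4)] by (rule eventually_mono) (use X W in blast)
    from hn_field[OF K this _ f] c show ?thesis by blast
  qed
  then have "(\<lambda>y. X y f) \<in> holomorphic_functions A W"
    if "mopen W" "W \<subseteq> V" "f \<in> holomorphic_functions A W" for W f
    unfolding holfun_iff[OF that(1)] using that by blast
  then show "X \<in> vector_fields A V" unfolding vector_fields_def using X by blast
qed

text \<open>In \<open>X (Y f) - Y (X f)\<close> the terms with second derivatives of
  \<open>f\<close> cancel by the symmetry of mixed derivatives.\<close>

lemma lie_bracket_coords:
  assumes K: "K \<in> A" "x \<in> fst K"
    and X: "eventually (\<lambda>y. X y \<in> tangent_space A y) (NH x)" "\<And>i. hn x (\<lambda>y. X y (xi K i))"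
    and Y: "eventually (\<lambda>y. Y y \<in> tangent_space A y) (NH x)" "\<And>i. hn x (\<lambda>y. Y y (xi K i))"
  shows "lie_bracket A X Y x f = (\<Sum>i\<in>UNIV.
     (X x (\<lambda>y. Y y (xi K i)) - Y x (\<lambda>y. X y (xi K i))) * dd K i x f)"
proof (cases "hn x f")
  case True
  have x: "x \<in> pts" using K chart_pts by blast
  have step: "X x (\<lambda>q. Y q f) = (\<Sum>i\<in>UNIV. X x (\<lambda>y. Y y (xi K i)) * dd K i x f) +
      (\<Sum>i\<in>UNIV. \<Sum>j\<in>UNIV. Y x (xi K i) * X x (xi K j) * dd K j x (\<lambda>y. dd K i y f))"
    if X: "eventually (\<lambda>y. X y \<in> tangent_space A y) (NH x)" 
      and Y: "eventually (\<lambda>y. Y y \<in> tangent_space A y) (NH x)" "\<And>i. hn x (\<lambda>y. Y y (xi K i))" for X Y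
  proof -
    have Xx: "X x \<in> tangent_space A x" using NH_self[OF X x] .
    have "eventually (\<lambda>y. Y y f = (\<Sum>i\<in>UNIV. Y y (xi K i) * dd K i y f)) (NH x)"
      using Y(1) eventually_chart[OF K] by eventually_elim (rule tangent_expand[OF K(1)])
    then have "X x (\<lambda>q. Y q f) = X x (\<lambda>y. \<Sum>i\<in>UNIV. Y y (xi K i) * dd K i y f)"
      by (rule tangent_cong[OF Xx])
    also have "\<dots> = (\<Sum>i\<in>UNIV. X x (\<lambda>y. Y y (xi K i)) * dd K i x f + Y x (xi K i) * X x (\<lambda>y. dd K i y f))"
      using Y(2) hn_dd(1)[OF K True] by (simp add: tangent_sum[OF Xx] hn_mult tangent_mult[OF Xx])
    also have "\<dots> = (\<Sum>i\<in>UNIV. X x (\<lambda>y. Y y (xi K i)) * dd K i x f + Y x (xi K i) * 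
       (\<Sum>j\<in>UNIV. X x (xi K j) * dd K j x (\<lambda>y. dd K i y f)))"
      by (intro sum.cong refl arg_cong2[of _ _ _ _ plus] arg_cong2[of _ _ _ _ times] tangent_expand[OF K Xx])
    finally show ?thesis by (simp add: sum.distrib sum_distrib_left mult_ac)
  qed
  have "(\<Sum>i\<in>UNIV. \<Sum>j\<in>UNIV. Y x (xi K i) * X x (xi K j) * dd K j x (\<lambda>y. dd K i y f)) =
     (\<Sum>i\<in>UNIV. \<Sum>j\<in>UNIV. X x (xi K i) * Y x (xi K j) * dd K j x (\<lambda>y. dd K i y f))"
    by (subst sum.swap) (simp add: hn_dd(2)[OF K True] mult_ac)
  then show ?thesis unfolding lie_bracket_def
    using True step[OF X(1) Y] step[OF Y(1) X] by (simp add: sum_subtractf left_diff_distrib)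
next
  case False then show ?thesis by (simp add: lie_bracket_def dd_not_hn)
qed

end

section \<open>Connections in coordinate frames\<close>

text \<open>Both \<open>TM\<close> and \<open>E\<close> have, over every chart, a frame whose members commute under the bracket. All
  coordinate computations are done once, for an arbitrary anchored bundle with such frames.\<close>

lemma connection_onD:
  assumes "connection_on A L F U D" "openin (manifold_topology A) V" "V \<subseteq> U"
  shows "t \<in> sections F V \<Longrightarrow> D t \<in> sections (hom_bundle A L F) V"
    and "\<lbrakk>t \<in> sections F V; t' \<in> sections F V; \<And>y. y \<in> V \<Longrightarrow> t y = t' y; x \<in> V\<rbrakk> \<Longrightarrow> D t x = D t' x"
    and "\<lbrakk>t \<in> sections F V; t' \<in> sections F V; x \<in> V; e \<in> fibre L x\<rbrakk> \<Longrightarrow>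
      D (\<lambda>y. t y + t' y) x e = D t x e + D t' x e"
    and "\<lbrakk>f \<in> holomorphic_functions A V; t \<in> sections F V; x \<in> V; e \<in> fibre L x\<rbrakk> \<Longrightarrow>
      D (\<lambda>y. f y *\<^sub>C t y) x e = anchor L x e f *\<^sub>C t x + f x *\<^sub>C D t x e"
proof -
  note C = assms(1)[unfolded connection_on_def, THEN conjunct2, THEN spec[of _ V], THEN mp, OF conjI[OF assms(2,3)]]
  show "t \<in> sections F V \<Longrightarrow> D t \<in> sections (hom_bundle A L F) V"
    using C[THEN conjunct1] by (rule bspec)
  show "\<lbrakk>t \<in> sections F V; t' \<in> sections F V; \<And>y. y \<in> V \<Longrightarrow> t y = t' y; x \<in> V\<rbrakk> \<Longrightarrow> D t x = D t' x"
    by (rule C[THEN conjunct2, THEN conjunct1, rule_format])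
  show "\<lbrakk>t \<in> sections F V; t' \<in> sections F V; x \<in> V; e \<in> fibre L x\<rbrakk> \<Longrightarrow>
      D (\<lambda>y. t y + t' y) x e = D t x e + D t' x e"
    by (rule C[THEN conjunct2, THEN conjunct2, THEN conjunct1, rule_format])
  show "\<lbrakk>f \<in> holomorphic_functions A V; t \<in> sections F V; x \<in> V; e \<in> fibre L x\<rbrakk> \<Longrightarrow>
      D (\<lambda>y. f y *\<^sub>C t y) x e = anchor L x e f *\<^sub>C t x + f x *\<^sub>C D t x e"
    by (rule C[THEN conjunct2, THEN conjunct2, THEN conjunct2, rule_format])
qed

text \<open>The index type \<open>'k\<close> of the frame is separate from the index type
  \<open>'d\<close> of the coordinates, since E has one frame member more than the base has
  coordinates. \<open>bracket_coords\<close> has no structure functions, which encodes that the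
  frame members commute; \<open>anchor_commute\<close> is the symmetry of second derivatives along
  the frame.\<close>

locale framed_algebroid = hol_atlas A for A :: "('m, 'd::finite) atlas" +
  fixes L :: "('m, 'v::complex_vector) algebroid"
    and fr :: "'m set \<times> ('m \<Rightarrow> complex^'d) \<Rightarrow> 'k::finite \<Rightarrow> 'm \<Rightarrow> 'v"
    and co :: "'m set \<times> ('m \<Rightarrow> complex^'d) \<Rightarrow> 'k \<Rightarrow> 'm \<Rightarrow> 'v \<Rightarrow> complex"
  assumes fibre_eq: "\<lbrakk>K \<in> A; x \<in> fst K\<rbrakk> \<Longrightarrow> fibre L x = range (\<lambda>c. \<Sum>a\<in>UNIV. c a *\<^sub>C fr K a x)"
    and co_comb: "\<lbrakk>K \<in> A; x \<in> fst K\<rbrakk> \<Longrightarrow> co K a x (\<Sum>b\<in>UNIV. c b *\<^sub>C fr K b x) = c a"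
    and sections_iff: "mopen V \<Longrightarrow> s \<in> sections L V \<longleftrightarrow> (\<forall>x\<in>V. s x \<in> fibre L x) \<and>
      (\<forall>K\<in>A. \<forall>a. \<forall>x\<in>V \<inter> fst K. hn x (\<lambda>y. co K a y (s y)))"
    and fr_section: "K \<in> A \<Longrightarrow> fr K a \<in> sections L (fst K)"
    and anchor_comb: "\<lbrakk>K \<in> A; x \<in> fst K\<rbrakk> \<Longrightarrow> anchor L x (\<Sum>a\<in>UNIV. c a *\<^sub>C fr K a x) f =
      (\<Sum>a\<in>UNIV. c a * anchor L x (fr K a x) f)"
    and anchor_fr: "\<lbrakk>K \<in> A; x \<in> fst K\<rbrakk> \<Longrightarrow> anchor L x (fr K a x) \<in> tangent_space A x"
    and anchor_hn: "\<lbrakk>K \<in> A; x \<in> fst K; hn x f\<rbrakk> \<Longrightarrow> hn x (\<lambda>y. anchor L y (fr K a y) f)"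
    and anchor_commute: "\<lbrakk>K \<in> A; x \<in> fst K; hn x f\<rbrakk> \<Longrightarrow>
      anchor L x (fr K a x) (\<lambda>y. anchor L y (fr K b y) f) =
      anchor L x (fr K b x) (\<lambda>y. anchor L y (fr K a y) f)"
    and bracket_coords: "\<lbrakk>K \<in> A; x \<in> fst K; local_section A L x s; local_section A L x t\<rbrakk> \<Longrightarrow>
      bracket L s t x = (\<Sum>a\<in>UNIV. (anchor L x (s x) (\<lambda>y. co K a y (t y))
        - anchor L x (t x) (\<lambda>y. co K a y (s y))) *\<^sub>C fr K a x)"
begin

abbreviation ls where "ls \<equiv> local_section A L"
abbreviation dA where "dA K a x f \<equiv> anchor L x (fr K a x) f"

section \<open>Linear algebra of the fibres\<close>

lemma fr_fibre: "K \<in> A \<Longrightarrow> x \<in> fst K \<Longrightarrow> fr K a x \<in> fibre L x"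
  using fr_section sections_iff mopen_chart by blast

lemma comb_fibre: "K \<in> A \<Longrightarrow> x \<in> fst K \<Longrightarrow> (\<Sum>a\<in>UNIV. c a *\<^sub>C fr K a x) \<in> fibre L x"
  unfolding fibre_eq by blast

lemma expand:
  assumes "K \<in> A" "x \<in> fst K" "v \<in> fibre L x"
  shows "(\<Sum>a\<in>UNIV. co K a x v *\<^sub>C fr K a x) = v"
proof -
  obtain c where "v = (\<Sum>a\<in>UNIV. c a *\<^sub>C fr K a x)" using assms unfolding fibre_eq[OF assms(1,2)] by blast
  then show ?thesis by (simp add: co_comb[OF assms(1,2)])
qed

lemma fibre_eqI:
  assumes "K \<in> A" "x \<in> fst K" "v \<in> fibre L x" "w \<in> fibre L x" "\<And>a. co K a x v = co K a x w"
  shows "v = w"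
proof -
  have "v = (\<Sum>a\<in>UNIV. co K a x v *\<^sub>C fr K a x)" by (rule expand[OF assms(1-3), symmetric])
  also have "\<dots> = w" unfolding assms(5) by (rule expand[OF assms(1,2,4)])
  finally show ?thesis .
qed

lemma co_fr: "K \<in> A \<Longrightarrow> x \<in> fst K \<Longrightarrow> co K a x (fr K b x) = (if a = b then 1 else 0)"
  using co_comb[of K x a "\<lambda>c. if c = b then 1 else 0"]
  by (simp add: if_distrib[of "\<lambda>x. x *\<^sub>C _"] cong: if_cong)

lemma
  assumes K: "K \<in> A" "x \<in> fst K" and v: "v \<in> fibre L x" "w \<in> fibre L x"
  shows fibre_add: "v + w \<in> fibre L x" and co_add: "co K a x (v + w) = co K a x v + co K a x w"
proof -
  have "v + w = (\<Sum>a\<in>UNIV. (co K a x v + co K a x w) *\<^sub>C fr K a x)"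
    using expand[OF K v(1)] expand[OF K v(2)] by (simp add: scaleC_add_left sum.distrib)
  then show "v + w \<in> fibre L x" "co K a x (v + w) = co K a x v + co K a x w"
    using comb_fibre[OF K] co_comb[OF K] by metis+
qed

lemma
  assumes K: "K \<in> A" "x \<in> fst K" and v: "v \<in> fibre L x"
  shows fibre_scale: "c *\<^sub>C v \<in> fibre L x" and co_scale: "co K a x (c *\<^sub>C v) = c * co K a x v"
proof -
  have "c *\<^sub>C v = (\<Sum>a\<in>UNIV. (c * co K a x v) *\<^sub>C fr K a x)"
    by (subst (1) expand[OF K v, symmetric])
      (simp add: complex_vector.scale_sum_right scaleC_scaleC)
  then show "c *\<^sub>C v \<in> fibre L x" "co K a x (c *\<^sub>C v) = c * co K a x v"
    using comb_fibre[OF K] co_comb[OF K] by metis+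
qed

lemma fibre_zero: "K \<in> A \<Longrightarrow> x \<in> fst K \<Longrightarrow> 0 \<in> fibre L x"
  using comb_fibre[of K x "\<lambda>_. 0"] by simp

lemma fibre_sum: 
  assumes "K \<in> A" "x \<in> fst K" "\<And>i. i \<in> I \<Longrightarrow> v i \<in> fibre L x"
  shows "(\<Sum>i\<in>I. v i) \<in> fibre L x"
  using assms(3) by (induction I rule: infinite_finite_induct) (auto intro: fibre_zero[OF assms(1,2)] fibre_add[OF assms(1,2)])

lemma fibre_diff:
  assumes "K \<in> A" "x \<in> fst K" "v \<in> fibre L x" "w \<in> fibre L x"
  shows "v - w \<in> fibre L x" "co K a x (v - w) = co K a x v - co K a x w"
proof -
  have eq: "v - w = v + (-1) *\<^sub>C w" by simp
  show "v - w \<in> fibre L x" "co K a x (v - w) = co K a x v - co K a x w"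
    unfolding eq by (simp_all add: fibre_add[OF assms(1-3)] co_add[OF assms(1-3)] 
      fibre_scale[OF assms(1,2,4)] co_scale[OF assms(1,2,4)] del: complex_vector.scale_minus_left)
qed

lemma anchor_expand:
  assumes "K \<in> A" "x \<in> fst K" "v \<in> fibre L x"
  shows "anchor L x v f = (\<Sum>a\<in>UNIV. co K a x v * dA K a x f)"
  using anchor_comb[OF assms(1,2), of "\<lambda>a. co K a x v" f] by (simp only: expand[OF assms])

lemma anchor_tangent:
  assumes "K \<in> A" "x \<in> fst K" "v \<in> fibre L x"
  shows "anchor L x v \<in> tangent_space A x"
proof -
  have "anchor L x v = (\<Sum>a\<in>UNIV. co K a x v *\<^sub>C anchor L x (fr K a x))"
    by (rule ext) (simp add: anchor_expand[OF assms] sum_fun_apply)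
  then show ?thesis using tangent_comb[OF chart_pts[OF assms(1,2)] anchor_fr[OF assms(1,2)]] by simp
qed

text \<open>The frame of \<open>K\<close> has holomorphic components in the frame of
  \<open>\<mu>\<close>, and these are the coefficients of the change of components.\<close>

lemma section_change:
  assumes K: "K \<in> A" "x \<in> fst K" and \<mu>: "\<mu> \<in> A" "x \<in> fst \<mu>"
    and s: "eventually (\<lambda>y. s y \<in> fibre L y) (NH x)" "\<And>a. hn x (\<lambda>y. co K a y (s y))"
  shows "hn x (\<lambda>y. co \<mu> b y (s y))"
proof -
  have "eventually (\<lambda>y. co \<mu> b y (s y) = (\<Sum>a\<in>UNIV. co K a y (s y) * co \<mu> b y (fr K a y))) (NH x)"
    using s(1) eventually_chart[OF K] eventually_chart[OF \<mu>]
  proof eventually_elim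
    case (elim y)
    have frs: "\<And>a. fr K a y \<in> fibre L y" using fr_fibre[OF K(1) elim(2)] .
    \<comment> \<open>Linearity of \<open>co\<close> is available on the fibre only, so the partial
      sums have to be kept inside it.\<close>
    have sum: "co \<mu> b y (\<Sum>a\<in>I. c a *\<^sub>C fr K a y) = (\<Sum>a\<in>I. c a * co \<mu> b y (fr K a y))" for I and c :: "'k \<Rightarrow> complex"
    proof (induction I rule: infinite_finite_induct)
      case (insert a I)
      then show ?case
        using co_add[OF \<mu>(1) elim(3), of "c a *\<^sub>C fr K a y" "\<Sum>a\<in>I. c a *\<^sub>C fr K a y" b]
          fibre_sum[OF \<mu>(1) elim(3), of I "\<lambda>a. c a *\<^sub>C fr K a y"]
          fibre_scale[OF \<mu>(1) elim(3) frs] co_scale[OF \<mu>(1) elim(3) frs] by simp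
    qed (use co_comb[OF \<mu>(1) elim(3), of b "\<lambda>_. 0"] in simp_all)
    show ?case using sum[of "\<lambda>a. co K a y (s y)" UNIV] unfolding expand[OF K(1) elim(2,1)] .
  qed
  moreover have "hn x (\<lambda>y. co \<mu> b y (fr K a y))" for a
    using fr_section[OF K(1), of a] sections_iff[OF mopen_chart[OF K(1)]] K \<mu> by blast
  then have "hn x (\<lambda>y. \<Sum>a\<in>UNIV. co K a y (s y) * co \<mu> b y (fr K a y))"
    by (intro hn_sum hn_mult s chart_pts[OF K])
  ultimately show ?thesis using hn_cong by fast
qed

section \<open>Local sections at a point\<close>

lemma ls_iff:
  assumes K: "K \<in> A" "x \<in> fst K"
  shows "ls x s \<longleftrightarrow> eventually (\<lambda>y. s y \<in> fibre L y) (NH x) \<and> (\<forall>a. hn x (\<lambda>y. co K a y (s y)))"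
proof (intro iffI conjI allI)
  assume "ls x s"
  then obtain V where V: "mopen V" "x \<in> V" "s \<in> sections L V" unfolding local_section_def by blast
  then show "eventually (\<lambda>y. s y \<in> fibre L y) (NH x)" "\<And>a. hn x (\<lambda>y. co K a y (s y))"
    using eventually_mopen[OF V(1,2)] K unfolding sections_iff[OF V(1)] by (auto elim!: eventually_mono)
next
  assume s: "eventually (\<lambda>y. s y \<in> fibre L y) (NH x) \<and> (\<forall>a. hn x (\<lambda>y. co K a y (s y)))"
  then have "eventually (\<lambda>y. \<forall>a. hn y (\<lambda>y. co K a y (s y))) (NH x)"
    by (intro eventually_all_finite hn_eventually) auto
  then have "eventually (\<lambda>y. s y \<in> fibre L y \<and> y \<in> fst K \<and> (\<forall>a. hn y (\<lambda>y. co K a y (s y)))) (NH x)"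
    using s eventually_chart[OF K] by (auto intro: eventually_conj)
  then obtain V where V: "mopen V" "x \<in> V"
    "\<And>y. y \<in> V \<Longrightarrow> s y \<in> fibre L y \<and> y \<in> fst K \<and> (\<forall>a. hn y (\<lambda>y. co K a y (s y)))"
    using chart_pts[OF K] unfolding eventually_NH[OF chart_pts[OF K]] by blast
  have "hn y (\<lambda>y. co \<mu> b y (s y))" if "\<mu> \<in> A" "y \<in> V \<inter> fst \<mu>" for \<mu> b y
  proof -
    have "eventually (\<lambda>y. s y \<in> fibre L y) (NH y)"
      using eventually_mopen[OF V(1), of y] that V(3) by (auto elim!: eventually_mono)
    then show ?thesis using section_change[OF K(1) _ that(1), of y s b] V(3) that by blast
  qed
  then have "s \<in> sections L V" unfolding sections_iff[OF V(1)] using V(3) by blast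
  then show "ls x s" unfolding local_section_def using V by blast
qed

lemma ls_sections: "s \<in> sections L V \<Longrightarrow> mopen V \<Longrightarrow> x \<in> V \<Longrightarrow> ls x s"
  unfolding local_section_def by blast

lemma sections_ls: "mopen V \<Longrightarrow> s \<in> sections L V \<longleftrightarrow> (\<forall>x\<in>V. ls x s)"
proof (intro iffI ballI)
  assume V: "mopen V" and s: "\<forall>x\<in>V. ls x s"
  show "s \<in> sections L V" unfolding sections_iff[OF V]
  proof (intro conjI ballI allI)
    fix x assume "x \<in> V"
    moreover obtain K where "K \<in> A" "x \<in> fst K" using pts_chart mopen_pts[OF V \<open>x \<in> V\<close>] by blast
    ultimately show "s x \<in> fibre L x" using s ls_iff[of K x s] NH_self chart_pts by blast
  next
    fix K a x assume "K \<in> A" "x \<in> V \<inter> fst K"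
    then show "hn x (\<lambda>y. co K a y (s y))" using s ls_iff[of K x s] by blast
  qed
qed (rule ls_sections)

lemma ls_pts: "ls x s \<Longrightarrow> x \<in> pts"
  unfolding local_section_def using mopen_pts by blast

lemma ls_fibre: "ls x s \<Longrightarrow> s x \<in> fibre L x"
  unfolding local_section_def using sections_iff by blast

lemma ls_eventually: "ls x s \<Longrightarrow> eventually (\<lambda>y. ls y s) (NH x)"
  unfolding local_section_def[of _ _ x] eventually_nhdsin using ls_sections by blast

lemma ls_hn: "ls x s \<Longrightarrow> K \<in> A \<Longrightarrow> x \<in> fst K \<Longrightarrow> hn x (\<lambda>y. co K a y (s y))"
  using ls_iff by blast

lemma ls_cong:
  assumes "eventually (\<lambda>y. s y = t y) (NH x)" shows "ls x s \<longleftrightarrow> ls x t"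
proof -
  have *: "ls x t" if s: "ls x s" and e: "eventually (\<lambda>y. s y = t y) (NH x)" for s t
  proof -
    obtain K where K: "K \<in> A" "x \<in> fst K" using pts_chart[OF ls_pts[OF s]] by blast
    have "eventually (\<lambda>y. t y \<in> fibre L y) (NH x)"
      using s[unfolded ls_iff[OF K], THEN conjunct1] e by eventually_elim simp
    moreover have "hn x (\<lambda>y. co K a y (t y))" for a
    proof -
      have "eventually (\<lambda>y. co K a y (s y) = co K a y (t y)) (NH x)" using e by eventually_elim simp
      from hn_cong[OF this] show ?thesis using ls_hn[OF s K] by blast
    qed
    ultimately show ?thesis unfolding ls_iff[OF K] by blast
  qed
  have "eventually (\<lambda>y. t y = s y) (NH x)" using assms by (simp add: eq_commute)
  then show ?thesis using *[OF _ assms] *[of t s] by blast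
qed

lemma ls_fr: "K \<in> A \<Longrightarrow> x \<in> fst K \<Longrightarrow> ls x (fr K a)"
  using ls_sections[OF fr_section mopen_chart] .

lemma ls_comb:
  assumes K: "K \<in> A" "x \<in> fst K" and c: "\<And>a. hn x (c a)"
  shows "ls x (\<lambda>y. \<Sum>a\<in>UNIV. c a y *\<^sub>C fr K a y)"
proof -
  have "eventually (\<lambda>y. (\<Sum>a\<in>UNIV. c a y *\<^sub>C fr K a y) \<in> fibre L y) (NH x)"
    using eventually_chart[OF K] by eventually_elim (rule comb_fibre[OF K(1)])
  moreover have "hn x (\<lambda>y. co K b y (\<Sum>a\<in>UNIV. c a y *\<^sub>C fr K a y))" for b
  proof -
    have "eventually (\<lambda>y. c b y = co K b y (\<Sum>a\<in>UNIV. c a y *\<^sub>C fr K a y)) (NH x)"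
      using eventually_chart[OF K] by eventually_elim (simp add: co_comb[OF K(1)])
    from hn_cong[OF this] show ?thesis using c by blast
  qed
  ultimately show ?thesis unfolding ls_iff[OF K] by blast
qed

lemma ls_near: "ls x s \<Longrightarrow> eventually (\<lambda>y. s y \<in> fibre L y) (NH x)"
  by (drule ls_eventually) (auto elim!: eventually_mono intro: ls_fibre)

lemma ls_add: "ls x s \<Longrightarrow> ls x t \<Longrightarrow> ls x (\<lambda>y. s y + t y)"
proof -
  assume st: "ls x s" "ls x t"
  obtain K where K: "K \<in> A" "x \<in> fst K" using pts_chart[OF ls_pts[OF st(1)]] by blast
  have ev: "eventually (\<lambda>y. s y + t y = (\<Sum>a\<in>UNIV. (co K a y (s y) + co K a y (t y)) *\<^sub>C fr K a y)) (NH x)"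
    using ls_near[OF st(1)] ls_near[OF st(2)] eventually_chart[OF K]
    by eventually_elim (simp add: scaleC_add_left sum.distrib expand[OF K(1)])
  show ?thesis unfolding ls_cong[OF ev]
    by (intro ls_comb K hn_add ls_hn st)
qed

lemma ls_scale: "hn x f \<Longrightarrow> ls x s \<Longrightarrow> ls x (\<lambda>y. f y *\<^sub>C s y)"
proof -
  assume f: "hn x f" and s: "ls x s"
  obtain K where K: "K \<in> A" "x \<in> fst K" using pts_chart[OF ls_pts[OF s]] by blast
  have ev: "eventually (\<lambda>y. f y *\<^sub>C s y = (\<Sum>a\<in>UNIV. (f y * co K a y (s y)) *\<^sub>C fr K a y)) (NH x)"
    using ls_near[OF s] eventually_chart[OF K]
  proof eventually_elim
    case (elim y)
    show ?case by (subst expand[OF K(1) elim(2,1), symmetric])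
      (simp add: complex_vector.scale_sum_right scaleC_scaleC)
  qed
  show ?thesis unfolding ls_cong[OF ev]
    by (intro ls_comb K hn_mult ls_hn f s)
qed

text \<open>Constant coefficients in a frame extend any vector, so the choice made in
  \<open>extend_vector\<close> succeeds.\<close>

lemma extend_vector:
  assumes "x \<in> pts" "v \<in> fibre L x"
  shows "ls x (extend_vector A L x v)" "extend_vector A L x v x = v"
proof -
  obtain K where K: "K \<in> A" "x \<in> fst K" using pts_chart[OF assms(1)] by blast
  let ?t = "\<lambda>y. \<Sum>a\<in>UNIV. co K a x v *\<^sub>C fr K a y"
  have "ls x ?t \<and> ?t x = v"
    using ls_comb[OF K, of "\<lambda>a _. co K a x v"] hn_const[OF assms(1)] expand[OF K assms(2)] by simp
  then have "ls x (extend_vector A L x v) \<and> extend_vector A L x v x = v"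
    unfolding extend_vector_def by (rule someI[of "\<lambda>t. ls x t \<and> t x = v"])
  then show "ls x (extend_vector A L x v)" "extend_vector A L x v x = v" by auto
qed

section \<open>Christoffel symbols\<close>

text \<open>\<open>G a b c\<close> is the component \<open>c\<close> of the derivative of frame
  member \<open>b\<close> along frame member \<open>a\<close>. The condition fixes
  \<open>D t x\<close> as a total function, zero off the fibre included, and involves
  \<open>G\<close> only at the point \<open>x\<close>, so that validity near a point can be
  expressed with \<open>eventually\<close>.\<close>

definition christoffel ::
    "'m set \<times> ('m \<Rightarrow> complex^'d) \<Rightarrow> ('m, 'v, 'v) conn \<Rightarrow> ('k \<Rightarrow> 'k \<Rightarrow> 'k \<Rightarrow> 'm \<Rightarrow> complex) \<Rightarrow> 'm \<Rightarrow> bool" where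
  "christoffel K D G x \<longleftrightarrow> (\<forall>t. ls x t \<longrightarrow> D t x = (\<lambda>v. if v \<in> fibre L x then
     \<Sum>c\<in>UNIV. (anchor L x v (\<lambda>y. co K c y (t y)) +
       (\<Sum>a\<in>UNIV. \<Sum>b\<in>UNIV. co K a x v * co K b x (t x) * G a b c x)) *\<^sub>C fr K c x else 0))"

lemma christoffel_co:
  assumes "christoffel K D G x" "K \<in> A" "x \<in> fst K" "ls x t" "v \<in> fibre L x"
  shows "D t x v \<in> fibre L x"
    and "co K c x (D t x v) = anchor L x v (\<lambda>y. co K c y (t y)) +
       (\<Sum>a\<in>UNIV. \<Sum>b\<in>UNIV. co K a x v * co K b x (t x) * G a b c x)"
  using assms unfolding christoffel_def by (simp_all add: comb_fibre co_comb)

lemma christoffel_fr: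
  assumes "christoffel K D G x" "K \<in> A" "x \<in> fst K"
  shows "co K c x (D (fr K b) x (fr K a x)) = G a b c x"
proof -
  have "anchor L x (fr K a x) (\<lambda>y. co K c y (fr K b y)) = anchor L x (fr K a x) (\<lambda>y. if c = b then 1 else 0)"
    by (rule tangent_cong[OF anchor_fr[OF assms(2,3)]])
      (use eventually_chart[OF assms(2,3)] in \<open>auto elim!: eventually_mono simp: co_fr[OF assms(2)]\<close>)
  also have "\<dots> = 0" by (rule tangent_const[OF anchor_fr[OF assms(2,3)]])
  finally show ?thesis
    unfolding christoffel_co(2)[OF assms ls_fr[OF assms(2,3)] fr_fibre[OF assms(2,3)]]
    by (simp add: co_fr[OF assms(2,3)] if_distrib[of "\<lambda>x. x * _"] if_distrib[of "\<lambda>x. _ * x"] 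
        sum.delta sum.delta' cong: if_cong)
qed

lemma christoffel_unique:
  assumes "christoffel K D G x" "christoffel K D' G' x" "\<And>a b c. G a b c x = G' a b c x" "ls x t"
  shows "D t x = D' t x"
  using assms(1,2,4) unfolding christoffel_def assms(3) by simp

lemma linear_maps_sum:
  assumes K: "K \<in> A" "x \<in> fst K" and h: "h \<in> linear_maps (fibre L x) T"
  shows "h (\<Sum>a\<in>I. c a *\<^sub>C fr K a x) = (\<Sum>a\<in>I. c a *\<^sub>C h (fr K a x))"
proof -
  have h0: "h 0 = 0"
    using h fibre_zero[OF K] unfolding linear_maps_def by (auto dest!: spec[of _ 0])
  have fib: "(\<Sum>a\<in>I. c a *\<^sub>C fr K a x) \<in> fibre L x" for I
    using fibre_scale[OF K fr_fibre[OF K]] by (intro fibre_sum[OF K])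
  show ?thesis
  proof (induction I rule: infinite_finite_induct)
    case (insert a I)
    have "h (c a *\<^sub>C fr K a x + (\<Sum>a\<in>I. c a *\<^sub>C fr K a x)) = c a *\<^sub>C h (fr K a x) + h (\<Sum>a\<in>I. c a *\<^sub>C fr K a x)"
      using h fib fibre_scale[OF K fr_fibre[OF K]] fr_fibre[OF K] unfolding linear_maps_def by auto
    then show ?case using insert by simp
  qed (simp_all add: h0)
qed

text \<open>The section is expanded over the frame on an open set where both are defined; additivity
  and the Leibniz rule evaluate \<open>D\<close> on the expansion, and linearity in the direction
  reduces to frame directions.\<close>

lemma connection_christoffel:
  assumes D: "connection_on A L L U D" and U: "mopen U" and K: "K \<in> A" "x \<in> fst K" and x: "x \<in> U"
    and G: "G = (\<lambda>a b c y. co K c y (D (fr K b) y (fr K a y)))"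
  shows "christoffel K D G x" and "hn x (G a b c)"
proof -
  define W where "W = U \<inter> fst K"
  have W: "mopen W" "x \<in> W" "W \<subseteq> U" "W \<subseteq> fst K" unfolding W_def using U mopen_chart[OF K(1)] K x by auto
  have frW: "fr K b \<in> sections L W" for b unfolding sections_ls[OF W(1)] using ls_fr[OF K(1)] W by blast
  have "D (fr K b) \<in> sections (hom_bundle A L L) W" for b
    by (rule connection_onD(1)[OF D W(1,3) frW])
  then have homs: "\<And>b y. y \<in> W \<Longrightarrow> D (fr K b) y \<in> linear_maps (fibre L y) (fibre L y)"
    "\<And>b a. (\<lambda>y. D (fr K b) y (fr K a y)) \<in> sections L W"
    using W frW unfolding hom_bundle_def by auto
  show "hn x (G a b c)" unfolding G using homs(2)[of b a] W K unfolding sections_iff[OF W(1)] by blast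
  show "christoffel K D G x" unfolding christoffel_def
  proof (intro allI impI ext)
    fix t v assume t: "ls x t"
    then obtain V0 where V0: "mopen V0" "x \<in> V0" "t \<in> sections L V0" unfolding local_section_def by blast
    define V where "V = V0 \<inter> W"
    have V: "mopen V" "x \<in> V" "V \<subseteq> W" "V \<subseteq> U" unfolding V_def using V0 W by auto
    have tV: "t \<in> sections L V" unfolding sections_ls[OF V(1)] using ls_sections[OF V0(3,1)] V_def by blast
    have frV: "fr K b \<in> sections L V" for b unfolding sections_ls[OF V(1)] using ls_fr[OF K(1)] V W by blast
    note Dr = connection_onD[OF D V(1,4)]
    have Dlin: "D t x \<in> linear_maps (fibre L x) (fibre L x)"
      using Dr(1)[OF tV] V(2) unfolding hom_bundle_def by auto
    show "D t x v = (if v \<in> fibre L x then \<Sum>c\<in>UNIV. (anchor L x v (\<lambda>y. co K c y (t y)) +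
       (\<Sum>a\<in>UNIV. \<Sum>b\<in>UNIV. co K a x v * co K b x (t x) * G a b c x)) *\<^sub>C fr K c x else 0)"
    proof (cases "v \<in> fibre L x")
      case False then show ?thesis using Dlin unfolding linear_maps_def by simp
    next
      case v: True
      define f where "f b = (\<lambda>y. co K b y (t y))" for b
      have fV: "f b \<in> holomorphic_functions A V" for b
        unfolding holfun_iff[OF V(1)] f_def using ls_hn[OF ls_sections[OF tV V(1)] K(1)] V W by blast
      have scV: "(\<lambda>y. f b y *\<^sub>C fr K b y) \<in> sections L V" for b
        using fV[of b] frV[of b] unfolding sections_ls[OF V(1)] holfun_iff[OF V(1)] by (blast intro: ls_scale)
      have suV: "(\<lambda>y. \<Sum>b\<in>I. f b y *\<^sub>C fr K b y) \<in> sections L V" for I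
      proof (induction I rule: infinite_finite_induct)
        case (insert b I)
        then show ?case using scV[of b] unfolding sections_ls[OF V(1)] by (auto intro: ls_add)
      qed (use ls_scale[OF hn_const[OF mopen_pts[OF V(1)]] ls_sections[OF tV V(1)], of _ 0] sections_ls[OF V(1)] in simp_all)
      have add: "D (\<lambda>y. t y + t' y) x v = D t x v + D t' x v" if "t \<in> sections L V" "t' \<in> sections L V" for t t'
        by (rule Dr(3)[OF that V(2) v])
      have leib: "D (\<lambda>y. f b y *\<^sub>C fr K b y) x v = anchor L x v (f b) *\<^sub>C fr K b x + f b x *\<^sub>C D (fr K b) x v" for b
        by (rule Dr(4)[OF fV frV V(2) v])
      have D0: "D (\<lambda>y. 0) x v = 0"
        using add[OF suV[of "{}"] suV[of "{}"]] by simp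
      have Dsum: "D (\<lambda>y. \<Sum>b\<in>I. f b y *\<^sub>C fr K b y) x v =
          (\<Sum>b\<in>I. anchor L x v (f b) *\<^sub>C fr K b x + f b x *\<^sub>C D (fr K b) x v)" for I
      proof (induction I rule: infinite_finite_induct)
        case (insert b I)
        then show ?case using add[OF scV[of b] suV[of I]] leib[of b] by simp
      qed (simp_all add: D0)
      have "t y = (\<Sum>b\<in>UNIV. f b y *\<^sub>C fr K b y)" if "y \<in> V" for y
        unfolding f_def using expand[OF K(1) _ ls_fibre[OF ls_sections[OF tV V(1) that]]] V W that by auto
      \<comment> \<open>The expansion of \<open>t\<close> is valid on \<open>V\<close> only;
        locality of the connection permits the replacement.\<close>
      from Dr(2)[OF tV suV this V(2)] have "D t x v = D (\<lambda>y. \<Sum>b\<in>UNIV. f b y *\<^sub>C fr K b y) x v"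
        by (rule fun_cong)
      also have "\<dots> = (\<Sum>b\<in>UNIV. anchor L x v (f b) *\<^sub>C fr K b x) + (\<Sum>b\<in>UNIV. f b x *\<^sub>C D (fr K b) x v)"
        unfolding Dsum sum.distrib ..
      also have "(\<Sum>b\<in>UNIV. f b x *\<^sub>C D (fr K b) x v) =
          (\<Sum>b\<in>UNIV. \<Sum>a\<in>UNIV. \<Sum>c\<in>UNIV. (co K a x v * f b x * G a b c x) *\<^sub>C fr K c x)"
      proof (rule sum.cong[OF refl])
        fix b
        have "D (fr K b) x v = (\<Sum>a\<in>UNIV. co K a x v *\<^sub>C D (fr K b) x (fr K a x))"
          using linear_maps_sum[OF K homs(1)[OF W(2), of b], of "\<lambda>a. co K a x v" UNIV] unfolding expand[OF K v] .
        also have "\<dots> = (\<Sum>a\<in>UNIV. co K a x v *\<^sub>C (\<Sum>c\<in>UNIV. G a b c x *\<^sub>C fr K c x))"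
        proof (rule sum.cong[OF refl])
          fix a
          have "D (fr K b) x (fr K a x) \<in> fibre L x"
            using homs(1)[OF W(2)] fr_fibre[OF K] unfolding linear_maps_def by blast
          from expand[OF K this]
          show "co K a x v *\<^sub>C D (fr K b) x (fr K a x) = co K a x v *\<^sub>C (\<Sum>c\<in>UNIV. G a b c x *\<^sub>C fr K c x)"
            unfolding G by simp
        qed
        finally show "f b x *\<^sub>C D (fr K b) x v = (\<Sum>a\<in>UNIV. \<Sum>c\<in>UNIV. (co K a x v * f b x * G a b c x) *\<^sub>C fr K c x)"
          by (simp add: complex_vector.scale_sum_right scaleC_scaleC mult_ac)
      qed
      also have "\<dots> = (\<Sum>a\<in>UNIV. \<Sum>b\<in>UNIV. \<Sum>c\<in>UNIV. (co K a x v * f b x * G a b c x) *\<^sub>C fr K c x)"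
        by (rule sum.swap)
      also have "\<dots> = (\<Sum>a\<in>UNIV. \<Sum>c\<in>UNIV. \<Sum>b\<in>UNIV. (co K a x v * f b x * G a b c x) *\<^sub>C fr K c x)"
        by (intro sum.cong[OF refl] sum.swap)
      also have "\<dots> = (\<Sum>c\<in>UNIV. \<Sum>a\<in>UNIV. \<Sum>b\<in>UNIV. (co K a x v * f b x * G a b c x) *\<^sub>C fr K c x)"
        by (rule sum.swap)
      also have "(\<Sum>b\<in>UNIV. anchor L x v (f b) *\<^sub>C fr K b x) + \<dots> =
         (\<Sum>c\<in>UNIV. (anchor L x v (f c) + (\<Sum>a\<in>UNIV. \<Sum>b\<in>UNIV. co K a x v * f b x * G a b c x)) *\<^sub>C fr K c x)"
        by (simp add: scaleC_add_left complex_vector.scale_sum_left sum.distrib)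
      finally show ?thesis using v unfolding f_def by simp
    qed
  qed
qed

lemma
  assumes K: "K \<in> A" "x \<in> fst K"
    and G: "eventually (\<lambda>y. christoffel K D G y) (NH x)" "\<And>a b c. hn x (G a b c)"
    and t: "ls x t" and s: "ls x s"
  shows covariant_derivative_section: "ls x (\<lambda>y. D t y (s y))"
    and covariant_derivative_coords: "eventually (\<lambda>y. co K c y (D t y (s y)) =
       (\<Sum>a\<in>UNIV. co K a y (s y) * dA K a y (\<lambda>y. co K c y (t y))) +
       (\<Sum>a\<in>UNIV. \<Sum>b\<in>UNIV. co K a y (s y) * co K b y (t y) * G a b c y)) (NH x)"
proof -
  let ?c = "\<lambda>c y. (\<Sum>a\<in>UNIV. co K a y (s y) * dA K a y (\<lambda>y. co K c y (t y))) +
     (\<Sum>a\<in>UNIV. \<Sum>b\<in>UNIV. co K a y (s y) * co K b y (t y) * G a b c y)"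
  have ev: "eventually (\<lambda>y. D t y (s y) = (\<Sum>c\<in>UNIV. ?c c y *\<^sub>C fr K c y)) (NH x)"
    using G(1) eventually_chart[OF K] ls_eventually[OF t] ls_eventually[OF s]
  proof eventually_elim
    case (elim y)
    show ?case using elim(1,3) ls_fibre[OF elim(4)]
      unfolding christoffel_def anchor_expand[OF K(1) elim(2) ls_fibre[OF elim(4)], symmetric] by simp
  qed
  show "ls x (\<lambda>y. D t y (s y))" unfolding ls_cong[OF ev]
    by (intro ls_comb[OF K] hn_add hn_sum hn_mult chart_pts[OF K] anchor_hn[OF K] ls_hn[OF _ K] G(2) s t)
  show "eventually (\<lambda>y. co K c y (D t y (s y)) = ?c c y) (NH x)"
    using ev eventually_chart[OF K] by eventually_elim (simp add: co_comb[OF K(1)])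
qed

text \<open>Converse of \<open>connection_christoffel\<close>, the means by which connections are
  constructed: all axioms of a connection can be verified at a point, each time in one chart whose
  symbols are holomorphic there.\<close>

lemma christoffel_connection:
  assumes D0: "\<And>t x. \<not> (x \<in> U \<and> ls x t) \<Longrightarrow> D t x = 0" and U: "mopen U"
    and ex: "\<And>x. x \<in> U \<Longrightarrow> \<exists>K\<in>A. x \<in> fst K \<and> (\<exists>G. eventually (\<lambda>y. christoffel K D G y) (NH x) \<and> (\<forall>a b c. hn x (G a b c)))"
  shows "connection_on A L L U D"
  unfolding connection_on_def
proof (intro conjI allI impI ballI)
  show "D t x = 0" if "\<not> (x \<in> U \<and> ls x t)" for t x using D0 that .
  fix V assume V: "mopen V \<and> V \<subseteq> U"
  have ptx: "\<exists>K G. K \<in> A \<and> x \<in> fst K \<and> christoffel K D G x" if "x \<in> V" for x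
    using ex[of x] that V NH_self[OF _ mopen_pts, of _ x V] by blast
  {
    fix t assume t: "t \<in> sections L V"
    then have lst: "ls x t" if "x \<in> V" for x using sections_ls V that by blast
    show "D t \<in> sections (hom_bundle A L L) V"
      unfolding hom_bundle_def
    proof (simp, intro conjI ballI allI impI)
      fix x assume x: "x \<in> V"
      then obtain K G where K: "K \<in> A" "x \<in> fst K" and G: "christoffel K D G x" using ptx by blast
      note C = christoffel_co[OF G K lst[OF x]]
      have eq: "D t x v = 0" if "v \<notin> fibre L x" for v
        using G lst[OF x] that unfolding christoffel_def by simp
      show "D t x \<in> linear_maps (fibre L x) (fibre L x)" unfolding linear_maps_def
      proof (intro CollectI conjI ballI allI impI)
        show "D t x v = 0" if "v \<notin> fibre L x" for v using eq that .
        show Cf: "D t x v \<in> fibre L x" if "v \<in> fibre L x" for v using C that by blast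
        have ae: "anchor L x v f = (\<Sum>a\<in>UNIV. co K a x v * dA K a x f)" if "v \<in> fibre L x" for v f
          using anchor_expand[OF K that] .
        show "D t x (v + w) = D t x v + D t x w" if vw: "v \<in> fibre L x" "w \<in> fibre L x" for v w
        proof (rule fibre_eqI[OF K])
          fix c
          show "co K c x (D t x (v + w)) = co K c x (D t x v + D t x w)"
            unfolding C(2)[OF fibre_add[OF K vw]] co_add[OF K Cf[OF vw(1)] Cf[OF vw(2)]]
              C(2)[OF vw(1)] C(2)[OF vw(2)] ae[OF fibre_add[OF K vw]] ae[OF vw(1)] ae[OF vw(2)] co_add[OF K vw]
            by (simp add: distrib_right sum.distrib)
        qed (intro Cf fibre_add[OF K] vw)+
        show "D t x (k *\<^sub>C v) = k *\<^sub>C D t x v" if v: "v \<in> fibre L x" for k v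
        proof (rule fibre_eqI[OF K])
          fix c
          show "co K c x (D t x (k *\<^sub>C v)) = co K c x (k *\<^sub>C D t x v)"
            unfolding C(2)[OF fibre_scale[OF K v]] co_scale[OF K Cf[OF v]]
              C(2)[OF v] ae[OF fibre_scale[OF K v]] ae[OF v] co_scale[OF K v]
            by (simp add: distrib_left sum_distrib_left mult_ac)
        qed (intro Cf fibre_scale[OF K] v)+
      qed
    next
      fix W s assume W: "mopen W \<and> W \<subseteq> V \<and> s \<in> sections L W"
      then have lss: "ls x s" if "x \<in> W" for x using sections_ls that by blast
      have "ls x (\<lambda>y. D t y (s y))" if x: "x \<in> W" for x
      proof -
        from x W V have "x \<in> U" by blast
        then obtain K G where K: "K \<in> A" "x \<in> fst K" and G: "eventually (\<lambda>y. christoffel K D G y) (NH x)"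
          "\<And>a b c. hn x (G a b c)" using ex by blast
        have "ls x t" using lst x W by blast
        from covariant_derivative_section[OF K G this lss[OF x]] show ?thesis by blast
      qed
      then show "(\<lambda>x. D t x (s x)) \<in> sections L W" using sections_ls W by blast
    qed
  }
  {
    fix t t' x assume t: "t \<in> sections L V" "t' \<in> sections L V" "\<forall>y\<in>V. t y = t' y" and x: "x \<in> V"
    obtain K G where K: "K \<in> A" "x \<in> fst K" and G: "christoffel K D G x" using ptx x by blast
    have l: "ls x t" "ls x t'" using t x V sections_ls by blast+
    have "eventually (\<lambda>y. y \<in> V) (NH x)" using eventually_mopen V x by blast
    then have "eventually (\<lambda>y. co K c y (t y) = co K c y (t' y)) (NH x)" for c
      by eventually_elim (simp add: t(3))
    then have "anchor L x v (\<lambda>y. co K c y (t y)) = anchor L x v (\<lambda>y. co K c y (t' y))" if "v \<in> fibre L x" for v c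
      by (rule tangent_cong[OF anchor_tangent[OF K that]])
    then show "D t x = D t' x" using G l t(3) x unfolding christoffel_def by (simp add: fun_eq_iff)
  next
    fix t t' x e assume t: "t \<in> sections L V" "t' \<in> sections L V" and x: "x \<in> V" and e: "e \<in> fibre L x"
    obtain K G where K: "K \<in> A" "x \<in> fst K" and G: "christoffel K D G x" using ptx x by blast
    have l: "ls x t" "ls x t'" using t x V sections_ls by blast+
    note T = anchor_tangent[OF K e]
    have "eventually (\<lambda>y. co K c y (t y + t' y) = co K c y (t y) + co K c y (t' y)) (NH x)" for c
      using eventually_chart[OF K] ls_near[OF l(1)] ls_near[OF l(2)]
      by eventually_elim (rule co_add[OF K(1)])
    note tangent_cong[OF T this]
    then have d: "anchor L x e (\<lambda>y. co K c y (t y + t' y)) = anchor L x e (\<lambda>y. co K c y (t y)) + anchor L x e (\<lambda>y. co K c y (t' y))" for c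
      using tangent_add[OF T ls_hn[OF l(1) K] ls_hn[OF l(2) K]] by simp
    show "D (\<lambda>y. t y + t' y) x e = D t x e + D t' x e"
    proof (rule fibre_eqI[OF K])
      fix c
      note C = christoffel_co[OF G K]
      show "co K c x (D (\<lambda>y. t y + t' y) x e) = co K c x (D t x e + D t' x e)"
        unfolding co_add[OF K C(1)[OF l(1) e] C(1)[OF l(2) e]] C(2)[OF l(1) e] C(2)[OF l(2) e]
          C(2)[OF ls_add[OF l] e] d co_add[OF K ls_fibre[OF l(1)] ls_fibre[OF l(2)]]
        by (simp add: distrib_left distrib_right sum.distrib)
    qed (intro fibre_add[OF K] christoffel_co(1)[OF G K] ls_add l e)+
  next
    fix f t x e assume f: "f \<in> holomorphic_functions A V" and t: "t \<in> sections L V" and x: "x \<in> V" and e: "e \<in> fibre L x"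
    obtain K G where K: "K \<in> A" "x \<in> fst K" and G: "christoffel K D G x" using ptx x by blast
    have l: "ls x t" using t x V sections_ls by blast
    have hf: "hn x f" using f x V holfun_iff by blast
    note T = anchor_tangent[OF K e]
    have "eventually (\<lambda>y. co K c y (f y *\<^sub>C t y) = f y * co K c y (t y)) (NH x)" for c
      using eventually_chart[OF K] ls_near[OF l]
      by eventually_elim (rule co_scale[OF K(1)])
    note tangent_cong[OF T this]
    then have d: "anchor L x e (\<lambda>y. co K c y (f y *\<^sub>C t y)) = anchor L x e f * co K c x (t x) + f x * anchor L x e (\<lambda>y. co K c y (t y))" for c
      using tangent_mult[OF T hf ls_hn[OF l K]] by simp
    show "D (\<lambda>y. f y *\<^sub>C t y) x e = anchor L x e f *\<^sub>C t x + f x *\<^sub>C D t x e"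
    proof (rule fibre_eqI[OF K])
      fix c
      note C = christoffel_co[OF G K]
      show "co K c x (D (\<lambda>y. f y *\<^sub>C t y) x e) = co K c x (anchor L x e f *\<^sub>C t x + f x *\<^sub>C D t x e)"
        unfolding co_add[OF K fibre_scale[OF K ls_fibre[OF l]] fibre_scale[OF K C(1)[OF l e]]]
          co_scale[OF K ls_fibre[OF l]] co_scale[OF K C(1)[OF l e]] C(2)[OF l e]
          C(2)[OF ls_scale[OF hf l] e] d
        by (simp add: distrib_left sum_distrib_left mult_ac)
    qed (intro fibre_add[OF K] fibre_scale[OF K] christoffel_co(1)[OF G K] ls_scale hf l e ls_fibre)+
  }
qed

text \<open>The derivatives of the components cancel against the bracket, because the frame
  commutes. What is left is the antisymmetric part of the symbols, which the frame members
  themselves detect.\<close>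

lemma torsion_christoffel:
  assumes G: "christoffel K D G x" and K: "K \<in> A" "x \<in> fst K"
  shows "(\<forall>s1 s2. ls x s1 \<longrightarrow> ls x s2 \<longrightarrow> D s2 x (s1 x) - D s1 x (s2 x) - bracket L s1 s2 x = 0)
    \<longleftrightarrow> (\<forall>a b c. G a b c x = G b a c x)"
proof -
  have main: "D s2 x (s1 x) - D s1 x (s2 x) - bracket L s1 s2 x = 
     (\<Sum>c\<in>UNIV. (\<Sum>a\<in>UNIV. \<Sum>b\<in>UNIV. co K a x (s1 x) * co K b x (s2 x) * (G a b c x - G b a c x)) *\<^sub>C fr K c x)"
    if s: "ls x s1" "ls x s2" for s1 s2
  proof -
    let ?S = "\<lambda>s1 s2 c. \<Sum>a\<in>UNIV. \<Sum>b\<in>UNIV. co K a x (s1 x) * co K b x (s2 x) * G a b c x"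
    have sw: "?S s2 s1 c = (\<Sum>a\<in>UNIV. \<Sum>b\<in>UNIV. co K a x (s1 x) * co K b x (s2 x) * G b a c x)" for c
      by (subst sum.swap) (simp add: mult_ac)
    have "D s2 x (s1 x) - D s1 x (s2 x) - bracket L s1 s2 x = 
      (\<Sum>c\<in>UNIV. (?S s1 s2 c - ?S s2 s1 c) *\<^sub>C fr K c x)"
      using G s ls_fibre[OF s(1)] ls_fibre[OF s(2)] unfolding bracket_coords[OF K s] christoffel_def
      by (simp add: sum_subtractf[symmetric] complex_vector.scale_left_diff_distrib[symmetric])
    then show ?thesis unfolding sw by (simp add: sum_subtractf right_diff_distrib)
  qed
  show ?thesis
  proof (intro iffI allI impI)
    fix a b c
    assume "\<forall>s1 s2. ls x s1 \<longrightarrow> ls x s2 \<longrightarrow> D s2 x (s1 x) - D s1 x (s2 x) - bracket L s1 s2 x = 0"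
    then have "D (fr K b) x (fr K a x) - D (fr K a) x (fr K b x) - bracket L (fr K a) (fr K b) x = 0"
      using ls_fr[OF K] by blast
    then have "(\<Sum>c\<in>UNIV. (\<Sum>i\<in>UNIV. \<Sum>j\<in>UNIV. co K i x (fr K a x) * co K j x (fr K b x) * (G i j c x - G j i c x)) *\<^sub>C fr K c x) = 0"
      unfolding main[OF ls_fr[OF K] ls_fr[OF K]] .
    then have "(\<Sum>c\<in>UNIV. (G a b c x - G b a c x) *\<^sub>C fr K c x) = 0"
      by (simp add: co_fr[OF K] if_distrib[of "\<lambda>x. x * _"] if_distrib[of "\<lambda>x. _ * x"] cong: if_cong)
    then show "G a b c x = G b a c x"
      using co_comb[OF K, of c "\<lambda>c. G a b c x - G b a c x"] co_comb[OF K, of c "\<lambda>_. 0"] by simp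
  next
    fix s1 s2
    assume "\<forall>a b c. G a b c x = G b a c x" and s: "ls x s1" "ls x s2"
    then have "G a b c x - G b a c x = 0" for a b c by simp
    then show "D s2 x (s1 x) - D s1 x (s2 x) - bracket L s1 s2 x = 0" unfolding main[OF s] by simp
  qed
qed

text \<open>Two germs at \<open>x\<close> may come from sections over different open sets; both
  restrict to the intersection.\<close>

lemma torsion_free_on_iff:
  assumes U: "mopen U"
  shows "torsion_free_on A L U D \<longleftrightarrow>
    (\<forall>x\<in>U. \<forall>s1 s2. ls x s1 \<longrightarrow> ls x s2 \<longrightarrow> D s2 x (s1 x) - D s1 x (s2 x) - bracket L s1 s2 x = 0)"
proof (intro iffI ballI allI impI)
  fix x s1 s2 assume D: "torsion_free_on A L U D" and x: "x \<in> U" and s: "ls x s1" "ls x s2"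
  obtain V1 V2 where V: "mopen V1" "x \<in> V1" "s1 \<in> sections L V1" "mopen V2" "x \<in> V2" "s2 \<in> sections L V2"
    using s unfolding local_section_def by blast
  let ?V = "U \<inter> V1 \<inter> V2"
  have "mopen ?V" using V U by blast
  moreover have "s1 \<in> sections L ?V" "s2 \<in> sections L ?V"
    unfolding sections_ls[OF \<open>mopen ?V\<close>] using ls_sections V by blast+
  ultimately show "D s2 x (s1 x) - D s1 x (s2 x) - bracket L s1 s2 x = 0"
    using D x V unfolding torsion_free_on_def by blast
next
  assume "\<forall>x\<in>U. \<forall>s1 s2. ls x s1 \<longrightarrow> ls x s2 \<longrightarrow> D s2 x (s1 x) - D s1 x (s2 x) - bracket L s1 s2 x = 0"
  then show "torsion_free_on A L U D" unfolding torsion_free_on_def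
    by (intro allI impI ballI) (elim conjE, metis ls_sections subsetD)
qed

end

section \<open>Curvature and traces in coordinate frames\<close>

lemma sum_rotate3:
  "(\<Sum>a\<in>I. \<Sum>b\<in>J. \<Sum>c\<in>K. f a b c) = (\<Sum>c\<in>K. \<Sum>a\<in>I. \<Sum>b\<in>J. f a b c)" for f :: "'a \<Rightarrow> 'b \<Rightarrow> 'c \<Rightarrow> 'e::comm_monoid_add"
proof -
  have "(\<Sum>a\<in>I. \<Sum>b\<in>J. \<Sum>c\<in>K. f a b c) = (\<Sum>a\<in>I. \<Sum>c\<in>K. \<Sum>b\<in>J. f a b c)"
    by (intro sum.cong refl sum.swap)
  also have "\<dots> = (\<Sum>c\<in>K. \<Sum>a\<in>I. \<Sum>b\<in>J. f a b c)" by (rule sum.swap)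
  finally show ?thesis .
qed

lemma sum_delta_mult:
  fixes f :: "'k::finite \<Rightarrow> complex"
  shows "(\<Sum>a\<in>UNIV. (if a = b then 1 else 0) * f a) = f b" "(\<Sum>a\<in>UNIV. (if b = a then 1 else 0) * f a) = f b"
    "(\<Sum>a\<in>UNIV. f a * (if a = b then 1 else 0)) = f b" "(\<Sum>a\<in>UNIV. f a * (if b = a then 1 else 0)) = f b"
  by (simp_all add: if_distrib[of "\<lambda>x. x * _"] if_distrib[of "\<lambda>x. _ * x"] cong: if_cong)

context framed_algebroid
begin

text \<open>The component \<open>d\<close> of the curvature on frame members \<open>a\<close>,
  \<open>b\<close>, \<open>c\<close>. A term with structure functions is absent because the frame
  commutes.\<close>

definition riem :: "'m set \<times> ('m \<Rightarrow> complex^'d) \<Rightarrow> ('k \<Rightarrow> 'k \<Rightarrow> 'k \<Rightarrow> 'm \<Rightarrow> complex) \<Rightarrow> 'k \<Rightarrow> 'k \<Rightarrow> 'k \<Rightarrow> 'k \<Rightarrow> 'm \<Rightarrow> complex" where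
  "riem K G a b c d x = dA K a x (G b c d) - dA K b x (G a c d)
     + (\<Sum>f\<in>UNIV. G b c f x * G a f d x) - (\<Sum>f\<in>UNIV. G a c f x * G b f d x)"

text \<open>The product rule yields seven sums. They are kept apart because each has a different
  fate when the two directions are exchanged in \<open>curvature_coords\<close>.\<close>

lemma second_derivative_coords:
  assumes K: "K \<in> A" "x \<in> fst K"
    and G: "eventually (\<lambda>y. christoffel K D G y) (NH x)" "\<And>a b c. hn x (G a b c)"
    and s: "ls x s1" "ls x s2" "ls x t"
  shows "D (\<lambda>y. D t y (s2 y)) x (s1 x) \<in> fibre L x"
    and "co K d x (D (\<lambda>y. D t y (s2 y)) x (s1 x)) =
      (\<Sum>b\<in>UNIV. anchor L x (s1 x) (\<lambda>y. co K b y (s2 y)) * dA K b x (\<lambda>y. co K d y (t y))) +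
      (\<Sum>b\<in>UNIV. \<Sum>a\<in>UNIV. co K b x (s2 x) * co K a x (s1 x) * dA K a x (\<lambda>y. dA K b y (\<lambda>y. co K d y (t y)))) +
      (\<Sum>b\<in>UNIV. \<Sum>c\<in>UNIV. anchor L x (s1 x) (\<lambda>y. co K b y (s2 y)) * co K c x (t x) * G b c d x) +
      (\<Sum>b\<in>UNIV. \<Sum>c\<in>UNIV. co K b x (s2 x) * anchor L x (s1 x) (\<lambda>y. co K c y (t y)) * G b c d x) +
      (\<Sum>b\<in>UNIV. \<Sum>c\<in>UNIV. \<Sum>a\<in>UNIV. co K b x (s2 x) * co K c x (t x) * co K a x (s1 x) * dA K a x (G b c d)) +
      (\<Sum>a\<in>UNIV. \<Sum>f\<in>UNIV. co K a x (s1 x) * anchor L x (s2 x) (\<lambda>y. co K f y (t y)) * G a f d x) +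
      (\<Sum>a\<in>UNIV. \<Sum>f\<in>UNIV. \<Sum>b\<in>UNIV. \<Sum>c\<in>UNIV. co K a x (s1 x) * co K b x (s2 x) * co K c x (t x) * (G b c f x * G a f d x))"
proof -
  have x: "x \<in> pts" using chart_pts[OF K] .
  let ?u = "\<lambda>y. D t y (s2 y)"
  have Gx: "christoffel K D G x" by (rule NH_self[OF G(1) x])
  have u: "ls x ?u" by (rule covariant_derivative_section[OF K G s(3,2)])
  note f1 = ls_fibre[OF s(1)] and f2 = ls_fibre[OF s(2)]
  show "D ?u x (s1 x) \<in> fibre L x" by (rule christoffel_co(1)[OF Gx K u f1])
  let ?v = "anchor L x (s1 x)"
  note T = anchor_tangent[OF K f1]
  have hU: "hn x (\<lambda>y. co K c y (t y))" and hT: "hn x (\<lambda>y. co K c y (s2 y))" for c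
    using ls_hn[OF s(3) K] ls_hn[OF s(2) K] by auto
  have hdU: "hn x (\<lambda>y. dA K a y (\<lambda>y. co K c y (t y)))" for a c by (rule anchor_hn[OF K hU])
  have ve: "?v f = (\<Sum>a\<in>UNIV. co K a x (s1 x) * dA K a x f)" for f by (rule anchor_expand[OF K f1])
  have "?v (\<lambda>y. co K d y (?u y)) = ?v (\<lambda>y. (\<Sum>b\<in>UNIV. co K b y (s2 y) * dA K b y (\<lambda>y. co K d y (t y))) +
       (\<Sum>b\<in>UNIV. \<Sum>c\<in>UNIV. co K b y (s2 y) * co K c y (t y) * G b c d y))"
    by (rule tangent_cong[OF T covariant_derivative_coords[OF K G s(3,2)]])
  also have "\<dots> = (\<Sum>b\<in>UNIV. ?v (\<lambda>y. co K b y (s2 y)) * dA K b x (\<lambda>y. co K d y (t y)) +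
        co K b x (s2 x) * ?v (\<lambda>y. dA K b y (\<lambda>y. co K d y (t y)))) +
      (\<Sum>b\<in>UNIV. \<Sum>c\<in>UNIV. (?v (\<lambda>y. co K b y (s2 y)) * co K c x (t x) + co K b x (s2 x) * ?v (\<lambda>y. co K c y (t y))) * G b c d x
        + co K b x (s2 x) * co K c x (t x) * ?v (G b c d))"
  proof -
    have "?v (\<lambda>y. \<Sum>b\<in>UNIV. co K b y (s2 y) * dA K b y (\<lambda>y. co K d y (t y))) =
        (\<Sum>b\<in>UNIV. ?v (\<lambda>y. co K b y (s2 y) * dA K b y (\<lambda>y. co K d y (t y))))"
      by (rule tangent_sum[OF T]) (intro hn_mult hT hdU)
    moreover have "?v (\<lambda>y. \<Sum>b\<in>UNIV. \<Sum>c\<in>UNIV. co K b y (s2 y) * co K c y (t y) * G b c d y) =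
        (\<Sum>b\<in>UNIV. ?v (\<lambda>y. \<Sum>c\<in>UNIV. co K b y (s2 y) * co K c y (t y) * G b c d y))"
      by (rule tangent_sum[OF T]) (intro hn_mult hn_sum hT hU G(2) x)
    moreover have "?v (\<lambda>y. \<Sum>c\<in>UNIV. co K b y (s2 y) * co K c y (t y) * G b c d y) =
        (\<Sum>c\<in>UNIV. ?v (\<lambda>y. co K b y (s2 y) * co K c y (t y) * G b c d y))" for b
      by (rule tangent_sum[OF T]) (intro hn_mult hT hU G(2))
    moreover have "?v (\<lambda>y. co K b y (s2 y) * co K c y (t y) * G b c d y) =
       (?v (\<lambda>y. co K b y (s2 y)) * co K c x (t x) + co K b x (s2 x) * ?v (\<lambda>y. co K c y (t y))) * G b c d x
        + co K b x (s2 x) * co K c x (t x) * ?v (G b c d)" for b c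
      unfolding tangent_mult[OF T hn_mult[OF hT hU] G(2)] tangent_mult[OF T hT hU] ..
    ultimately show ?thesis
      by (subst tangent_add[OF T]) (intro hn_sum hn_mult hT hU hdU G(2) x, simp add: tangent_mult[OF T hT hdU])+
  qed
  finally have 1: "?v (\<lambda>y. co K d y (?u y)) = \<dots>" .
  have 2: "co K f x (?u x) = anchor L x (s2 x) (\<lambda>y. co K f y (t y)) +
       (\<Sum>b\<in>UNIV. \<Sum>c\<in>UNIV. co K b x (s2 x) * co K c x (t x) * G b c f x)" for f
    by (rule christoffel_co(2)[OF Gx K s(3) f2])
  have "co K d x (D ?u x (s1 x)) = ?v (\<lambda>y. co K d y (?u y)) +
      (\<Sum>a\<in>UNIV. \<Sum>f\<in>UNIV. co K a x (s1 x) * co K f x (?u x) * G a f d x)"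
    by (rule christoffel_co(2)[OF Gx K u f1])
  moreover have "(\<Sum>b\<in>UNIV. co K b x (s2 x) * ?v (\<lambda>y. dA K b y (\<lambda>y. co K d y (t y)))) =
     (\<Sum>b\<in>UNIV. \<Sum>a\<in>UNIV. co K b x (s2 x) * co K a x (s1 x) * dA K a x (\<lambda>y. dA K b y (\<lambda>y. co K d y (t y))))"
    unfolding ve by (simp add: sum_distrib_left mult.assoc)
  moreover have "(\<Sum>b\<in>UNIV. \<Sum>c\<in>UNIV. co K b x (s2 x) * co K c x (t x) * ?v (G b c d)) =
      (\<Sum>b\<in>UNIV. \<Sum>c\<in>UNIV. \<Sum>a\<in>UNIV. co K b x (s2 x) * co K c x (t x) * co K a x (s1 x) * dA K a x (G b c d))"
    unfolding ve by (simp add: sum_distrib_left mult.assoc)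
  moreover have "(\<Sum>a\<in>UNIV. \<Sum>f\<in>UNIV. co K a x (s1 x) * co K f x (?u x) * G a f d x) =
     (\<Sum>a\<in>UNIV. \<Sum>f\<in>UNIV. co K a x (s1 x) * anchor L x (s2 x) (\<lambda>y. co K f y (t y)) * G a f d x) +
      (\<Sum>a\<in>UNIV. \<Sum>f\<in>UNIV. \<Sum>b\<in>UNIV. \<Sum>c\<in>UNIV. co K a x (s1 x) * co K b x (s2 x) * co K c x (t x) * (G b c f x * G a f d x))"
    unfolding 2 by (simp add: distrib_left distrib_right sum.distrib sum_distrib_left sum_distrib_right mult_ac)
  ultimately show "co K d x (D ?u x (s1 x)) =
      (\<Sum>b\<in>UNIV. ?v (\<lambda>y. co K b y (s2 y)) * dA K b x (\<lambda>y. co K d y (t y))) +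
      (\<Sum>b\<in>UNIV. \<Sum>a\<in>UNIV. co K b x (s2 x) * co K a x (s1 x) * dA K a x (\<lambda>y. dA K b y (\<lambda>y. co K d y (t y)))) +
      (\<Sum>b\<in>UNIV. \<Sum>c\<in>UNIV. ?v (\<lambda>y. co K b y (s2 y)) * co K c x (t x) * G b c d x) +
      (\<Sum>b\<in>UNIV. \<Sum>c\<in>UNIV. co K b x (s2 x) * ?v (\<lambda>y. co K c y (t y)) * G b c d x) +
      (\<Sum>b\<in>UNIV. \<Sum>c\<in>UNIV. \<Sum>a\<in>UNIV. co K b x (s2 x) * co K c x (t x) * co K a x (s1 x) * dA K a x (G b c d)) +
      (\<Sum>a\<in>UNIV. \<Sum>f\<in>UNIV. co K a x (s1 x) * anchor L x (s2 x) (\<lambda>y. co K f y (t y)) * G a f d x) +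
      (\<Sum>a\<in>UNIV. \<Sum>f\<in>UNIV. \<Sum>b\<in>UNIV. \<Sum>c\<in>UNIV. co K a x (s1 x) * co K b x (s2 x) * co K c x (t x) * (G b c f x * G a f d x))"
    unfolding 1 by (simp only: sum.distrib distrib_right add.assoc)
qed

text \<open>Under antisymmetrization the second derivatives of \<open>t\<close> cancel by
  \<open>anchor_commute\<close>, and the mixed terms with one derivative of \<open>t\<close> cancel
  in pairs. The terms that differentiate the directions are the derivative along the bracket. Only
  terms linear in the values at \<open>x\<close> survive: derivatives and products of the
  symbols.\<close>

lemma curvature_coords:
  assumes K: "K \<in> A" "x \<in> fst K"
    and G: "eventually (\<lambda>y. christoffel K D G y) (NH x)" "\<And>a b c. hn x (G a b c)"
    and s: "ls x s1" "ls x s2" "ls x t"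
  shows "curvature L D s1 s2 t x \<in> fibre L x"
    and "co K d x (curvature L D s1 s2 t x) = (\<Sum>a\<in>UNIV. \<Sum>b\<in>UNIV. \<Sum>c\<in>UNIV.
      co K a x (s1 x) * co K b x (s2 x) * co K c x (t x) * riem K G a b c d x)"
proof -
  have x: "x \<in> pts" using chart_pts[OF K] .
  have Gx: "christoffel K D G x" by (rule NH_self[OF G(1) x])
  let ?B = "\<lambda>b. anchor L x (s1 x) (\<lambda>y. co K b y (s2 y)) - anchor L x (s2 x) (\<lambda>y. co K b y (s1 y))"
  have Bf: "bracket L s1 s2 x \<in> fibre L x" and Bc: "co K b x (bracket L s1 s2 x) = ?B b" for b
    unfolding bracket_coords[OF K s(1,2)] by (simp_all only: comb_fibre[OF K] co_comb[OF K])
  note Z1 = second_derivative_coords[OF K G s] and Z2 = second_derivative_coords[OF K G s(2,1,3)]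
  note Df = christoffel_co[OF Gx K s(3) Bf]
  note d1 = fibre_diff[OF K Z1(1) Z2(1)]
  show "curvature L D s1 s2 t x \<in> fibre L x"
    unfolding curvature_def by (rule fibre_diff(1)[OF K d1(1) Df(1)])
  define S T U where "S a = co K a x (s1 x)" and "T a = co K a x (s2 x)" and "U a = co K a x (t x)" for a
  define sT tS sU tU dU where "sT b = anchor L x (s1 x) (\<lambda>y. co K b y (s2 y))"
    and "tS b = anchor L x (s2 x) (\<lambda>y. co K b y (s1 y))"
    and "sU b = anchor L x (s1 x) (\<lambda>y. co K b y (t y))"
    and "tU b = anchor L x (s2 x) (\<lambda>y. co K b y (t y))"
    and "dU b = dA K b x (\<lambda>y. co K d y (t y))" for b
  define ddU where "ddU a b = dA K a x (\<lambda>y. dA K b y (\<lambda>y. co K d y (t y)))" for a b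
  define dG where "dG a b c = dA K a x (G b c d)" for a b c
  define Q where "Q a b c = (\<Sum>f\<in>UNIV. G b c f x * G a f d x)" for a b c
  note defs = S_def[symmetric] T_def[symmetric] U_def[symmetric] sT_def[symmetric] tS_def[symmetric] 
    sU_def[symmetric] tU_def[symmetric] dU_def[symmetric] ddU_def[symmetric] dG_def[symmetric]
  have ddU: "ddU a b = ddU b a" for a b
    unfolding ddU_def by (rule anchor_commute[OF K ls_hn[OF s(3) K]])
  have z1: "co K d x (D (\<lambda>y. D t y (s2 y)) x (s1 x)) =
      (\<Sum>b\<in>UNIV. sT b * dU b) + (\<Sum>b\<in>UNIV. \<Sum>a\<in>UNIV. T b * S a * ddU a b) +
      (\<Sum>b\<in>UNIV. \<Sum>c\<in>UNIV. sT b * U c * G b c d x) + (\<Sum>b\<in>UNIV. \<Sum>c\<in>UNIV. T b * sU c * G b c d x) +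
      (\<Sum>a\<in>UNIV. \<Sum>b\<in>UNIV. \<Sum>c\<in>UNIV. S a * T b * U c * dG a b c) +
      (\<Sum>a\<in>UNIV. \<Sum>f\<in>UNIV. S a * tU f * G a f d x) +
      (\<Sum>a\<in>UNIV. \<Sum>b\<in>UNIV. \<Sum>c\<in>UNIV. S a * T b * U c * Q a b c)"
  proof -
    have "(\<Sum>b\<in>UNIV. \<Sum>c\<in>UNIV. \<Sum>a\<in>UNIV. T b * U c * S a * dG a b c) =
      (\<Sum>a\<in>UNIV. \<Sum>b\<in>UNIV. \<Sum>c\<in>UNIV. S a * T b * U c * dG a b c)"
      by (subst sum_rotate3) (simp add: mult_ac)
    moreover have "(\<Sum>f\<in>UNIV. \<Sum>b\<in>UNIV. \<Sum>c\<in>UNIV. S a * T b * U c * (G b c f x * G a f d x)) =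
      (\<Sum>b\<in>UNIV. \<Sum>c\<in>UNIV. S a * T b * U c * Q a b c)" for a
      unfolding Q_def sum_distrib_left by (rule sum_rotate3[symmetric])
    ultimately show ?thesis unfolding Z1(2) defs by simp
  qed
  \<comment> \<open>The summation indices are renamed so that each sum can be compared with its
    counterpart in \<open>z1\<close>.\<close>
  have z2: "co K d x (D (\<lambda>y. D t y (s1 y)) x (s2 x)) =
      (\<Sum>b\<in>UNIV. tS b * dU b) + (\<Sum>b\<in>UNIV. \<Sum>a\<in>UNIV. T b * S a * ddU a b) +
      (\<Sum>b\<in>UNIV. \<Sum>c\<in>UNIV. tS b * U c * G b c d x) + (\<Sum>b\<in>UNIV. \<Sum>c\<in>UNIV. S b * tU c * G b c d x) +
      (\<Sum>a\<in>UNIV. \<Sum>b\<in>UNIV. \<Sum>c\<in>UNIV. S a * T b * U c * dG b a c) +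
      (\<Sum>a\<in>UNIV. \<Sum>f\<in>UNIV. T a * sU f * G a f d x) +
      (\<Sum>a\<in>UNIV. \<Sum>b\<in>UNIV. \<Sum>c\<in>UNIV. S a * T b * U c * Q b a c)"
  proof -
    have "(\<Sum>b\<in>UNIV. \<Sum>a\<in>UNIV. S b * T a * ddU a b) = (\<Sum>b\<in>UNIV. \<Sum>a\<in>UNIV. T b * S a * ddU a b)"
      by (subst sum.swap) (simp add: mult_ac ddU)
    moreover have "(\<Sum>b\<in>UNIV. \<Sum>c\<in>UNIV. \<Sum>a\<in>UNIV. S b * U c * T a * dG a b c) =
      (\<Sum>a\<in>UNIV. \<Sum>b\<in>UNIV. \<Sum>c\<in>UNIV. S a * T b * U c * dG b a c)"
    proof -
      have "(\<Sum>b\<in>UNIV. \<Sum>c\<in>UNIV. \<Sum>a\<in>UNIV. S b * U c * T a * dG a b c) =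
        (\<Sum>b\<in>UNIV. \<Sum>a\<in>UNIV. \<Sum>c\<in>UNIV. S b * U c * T a * dG a b c)" by (intro sum.cong refl sum.swap)
      then show ?thesis by (simp add: mult_ac)
    qed
    moreover have "(\<Sum>a\<in>UNIV. \<Sum>f\<in>UNIV. \<Sum>b\<in>UNIV. \<Sum>c\<in>UNIV. T a * S b * U c * (G b c f x * G a f d x)) =
      (\<Sum>a\<in>UNIV. \<Sum>b\<in>UNIV. \<Sum>c\<in>UNIV. S a * T b * U c * Q b a c)"
    proof -
      have "(\<Sum>f\<in>UNIV. \<Sum>b\<in>UNIV. \<Sum>c\<in>UNIV. T a * S b * U c * (G b c f x * G a f d x)) =
        (\<Sum>b\<in>UNIV. \<Sum>c\<in>UNIV. T a * S b * U c * Q a b c)" for a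
        unfolding Q_def sum_distrib_left by (rule sum_rotate3[symmetric])
      then have "(\<Sum>a\<in>UNIV. \<Sum>f\<in>UNIV. \<Sum>b\<in>UNIV. \<Sum>c\<in>UNIV. T a * S b * U c * (G b c f x * G a f d x)) =
        (\<Sum>a\<in>UNIV. \<Sum>b\<in>UNIV. \<Sum>c\<in>UNIV. T a * S b * U c * Q a b c)" by simp
      also have "\<dots> = (\<Sum>b\<in>UNIV. \<Sum>a\<in>UNIV. \<Sum>c\<in>UNIV. T a * S b * U c * Q a b c)" by (rule sum.swap)
      finally show ?thesis by (simp add: mult_ac)
    qed
    ultimately show ?thesis unfolding Z2(2) defs by simp
  qed
  have z3: "co K d x (D t x (bracket L s1 s2 x)) =
      (\<Sum>b\<in>UNIV. sT b * dU b) - (\<Sum>b\<in>UNIV. tS b * dU b) +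
      ((\<Sum>b\<in>UNIV. \<Sum>c\<in>UNIV. sT b * U c * G b c d x) - (\<Sum>b\<in>UNIV. \<Sum>c\<in>UNIV. tS b * U c * G b c d x))"
    unfolding Df(2) anchor_expand[OF K Bf] Bc defs by (simp add: left_diff_distrib sum_subtractf)
  have R: "riem K G a b c d x = dG a b c - dG b a c + Q a b c - Q b a c" for a b c
    unfolding riem_def dG_def Q_def ..
  show "co K d x (curvature L D s1 s2 t x) = (\<Sum>a\<in>UNIV. \<Sum>b\<in>UNIV. \<Sum>c\<in>UNIV.
      co K a x (s1 x) * co K b x (s2 x) * co K c x (t x) * riem K G a b c d x)"
    unfolding curvature_def fibre_diff(2)[OF K d1(1) Df(1)] d1(2) z1 z2 z3 defs R
    by (simp add: distrib_left right_diff_distrib sum.distrib sum_subtractf)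
qed

text \<open>\<open>trace_on\<close> takes an unspecified basis \<open>B\<close>. It is finite, since
  the frame spans the fibre, and the trace does not change because passing from the frame to
  \<open>B\<close> and back is the identity.\<close>

lemma trace_on_frame:
  assumes K: "K \<in> A" "x \<in> fst K"
    and h: "\<And>v. v \<in> fibre L x \<Longrightarrow> h v \<in> fibre L x"
      "\<And>v. v \<in> fibre L x \<Longrightarrow> h v = (\<Sum>a\<in>UNIV. co K a x v *\<^sub>C h (fr K a x))"
  shows "trace_on (fibre L x) h = (\<Sum>a\<in>UNIV. co K a x (h (fr K a x)))"
proof -
  let ?S = "fibre L x"
  have sub: "complex_vector.subspace ?S"
    unfolding complex_vector.subspace_def
    using fibre_zero[OF K] fibre_add[OF K] fibre_scale[OF K] by blast
  have "\<exists>B. \<not> complex_vector.dependent B \<and> complex_vector.span B = ?S"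
    using complex_vector.maximal_independent_subset[of ?S] sub
    by (metis complex_vector.span_eq_iff complex_vector.span_mono subset_antisym)
  define B where "B = (SOME B. \<not> complex_vector.dependent B \<and> complex_vector.span B = ?S)"
  have "\<not> complex_vector.dependent B \<and> complex_vector.span B = ?S"
    unfolding B_def by (rule someI_ex) fact
  then have B: "\<not> complex_vector.dependent B" "complex_vector.span B = ?S" by auto
  have "?S \<subseteq> complex_vector.span (range (\<lambda>a. fr K a x))"
  proof
    fix v assume "v \<in> ?S"
    then obtain c where v: "v = (\<Sum>a\<in>UNIV. c a *\<^sub>C fr K a x)" unfolding fibre_eq[OF K] by blast
    show "v \<in> complex_vector.span (range (\<lambda>a. fr K a x))" unfolding v
      by (intro complex_vector.span_sum complex_vector.span_scale complex_vector.span_base rangeI)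
  qed
  moreover have BS: "B \<subseteq> ?S" using complex_vector.span_superset[of B] B(2) by simp
  ultimately have fin: "finite B"
    using complex_vector.independent_span_bound[of "range (\<lambda>a. fr K a x)" B] B(1) by auto
  let ?r = "complex_vector.representation B"
  have r: "?r (\<Sum>a\<in>UNIV. c a *\<^sub>C fr K a x) b = (\<Sum>a\<in>UNIV. c a * ?r (fr K a x) b)" for c b
  proof -
    have "fr K a x \<in> complex_vector.span B" for a using fr_fibre[OF K] B(2) by simp
    then show ?thesis
      by (simp add: complex_vector.representation_sum[OF B(1)] complex_vector.span_scale
          complex_vector.representation_scale[OF B(1)])
  qed
  \<comment> \<open>A frame member is written over \<open>B\<close> and the result over the frame
    again; comparing components gives the unit matrix.\<close>
  have PQ: "(\<Sum>b\<in>B. ?r (fr K c x) b * co K a x b) = (if a = c then 1 else 0)" for a c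
  proof -
    have "fr K c x = (\<Sum>b\<in>B. ?r (fr K c x) b *\<^sub>C b)"
      using complex_vector.sum_representation_eq[OF B(1) _ fin order_refl] fr_fibre[OF K] B(2) by metis
    also have "\<dots> = (\<Sum>b\<in>B. \<Sum>a\<in>UNIV. (?r (fr K c x) b * co K a x b) *\<^sub>C fr K a x)"
    proof (rule sum.cong[OF refl])
      fix b assume "b \<in> B"
      then have "b = (\<Sum>a\<in>UNIV. co K a x b *\<^sub>C fr K a x)" using expand[OF K] BS by auto
      then have "?r (fr K c x) b *\<^sub>C b = ?r (fr K c x) b *\<^sub>C (\<Sum>a\<in>UNIV. co K a x b *\<^sub>C fr K a x)"
        by (rule arg_cong)
      then show "?r (fr K c x) b *\<^sub>C b = (\<Sum>a\<in>UNIV. (?r (fr K c x) b * co K a x b) *\<^sub>C fr K a x)"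
        by (simp add: complex_vector.scale_sum_right scaleC_scaleC)
    qed
    also have "\<dots> = (\<Sum>a\<in>UNIV. (\<Sum>b\<in>B. ?r (fr K c x) b * co K a x b) *\<^sub>C fr K a x)"
      unfolding complex_vector.scale_sum_left by (rule sum.swap)
    finally have "co K a x (fr K c x) = (\<Sum>b\<in>B. ?r (fr K c x) b * co K a x b)"
      using co_comb[OF K, of a "\<lambda>a. \<Sum>b\<in>B. ?r (fr K c x) b * co K a x b"] by simp
    then show ?thesis using co_fr[OF K, of a c] by simp
  qed
  define H where "H a c = co K c x (h (fr K a x))" for a c
  have hb: "?r (h b) b = (\<Sum>a\<in>UNIV. \<Sum>c\<in>UNIV. H a c * (?r (fr K c x) b * co K a x b))" if "b \<in> B" for b
  proof -
    have "h b = (\<Sum>a\<in>UNIV. co K a x b *\<^sub>C h (fr K a x))" using h(2) BS that by blast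
    also have "\<dots> = (\<Sum>a\<in>UNIV. co K a x b *\<^sub>C (\<Sum>c\<in>UNIV. H a c *\<^sub>C fr K c x))"
      unfolding H_def expand[OF K h(1)[OF fr_fibre[OF K]]] ..
    also have "\<dots> = (\<Sum>a\<in>UNIV. \<Sum>c\<in>UNIV. (co K a x b * H a c) *\<^sub>C fr K c x)"
      by (simp add: complex_vector.scale_sum_right scaleC_scaleC)
    also have "\<dots> = (\<Sum>c\<in>UNIV. (\<Sum>a\<in>UNIV. co K a x b * H a c) *\<^sub>C fr K c x)"
      unfolding complex_vector.scale_sum_left by (rule sum.swap)
    finally have "?r (h b) b = (\<Sum>c\<in>UNIV. (\<Sum>a\<in>UNIV. co K a x b * H a c) * ?r (fr K c x) b)"
      by (simp only: r)
    then show ?thesis unfolding sum_distrib_right by (subst sum.swap) (simp add: mult_ac)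
  qed
  have "trace_on ?S h = (\<Sum>b\<in>B. ?r (h b) b)" unfolding trace_on_def B_def Let_def ..
  also have "\<dots> = (\<Sum>b\<in>B. \<Sum>a\<in>UNIV. \<Sum>c\<in>UNIV. H a c * (?r (fr K c x) b * co K a x b))"
    by (rule sum.cong[OF refl hb])
  also have "\<dots> = (\<Sum>a\<in>UNIV. \<Sum>c\<in>UNIV. \<Sum>b\<in>B. H a c * (?r (fr K c x) b * co K a x b))"
    by (rule sum_rotate3[symmetric])
  also have "\<dots> = (\<Sum>a\<in>UNIV. \<Sum>c\<in>UNIV. H a c * (if a = c then 1 else 0))"
    unfolding sum_distrib_left[symmetric] PQ ..
  also have "\<dots> = (\<Sum>a\<in>UNIV. H a a)" unfolding sum_delta_mult ..
  finally show ?thesis unfolding H_def .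
qed

text \<open>By \<open>curvature_coords\<close> the curvature depends only on the values of the three
  sections at \<open>x\<close>, so the extensions chosen by \<open>extend_vector\<close> drop
  out.\<close>

lemma ricci_coords:
  assumes K: "K \<in> A" "x \<in> fst K"
    and G: "eventually (\<lambda>y. christoffel K D G y) (NH x)" "\<And>a b c. hn x (G a b c)"
    and e: "e1 \<in> fibre L x" "e2 \<in> fibre L x"
  shows "ricci A L D x e1 e2 =
    (\<Sum>b\<in>UNIV. \<Sum>c\<in>UNIV. co K b x e2 * co K c x e1 * (\<Sum>a\<in>UNIV. riem K G a b c a x))"
proof -
  have x: "x \<in> pts" using chart_pts[OF K] .
  let ?h = "\<lambda>e. curvature L D (extend_vector A L x e) (extend_vector A L x e2) (extend_vector A L x e1) x"
  note X = extend_vector[OF x]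
  have hf: "?h v \<in> fibre L x" if "v \<in> fibre L x" for v
    by (rule curvature_coords(1)[OF K G X(1)[OF that] X(1)[OF e(2)] X(1)[OF e(1)]])
  have hc: "co K d x (?h v) = (\<Sum>a\<in>UNIV. \<Sum>b\<in>UNIV. \<Sum>c\<in>UNIV.
      co K a x v * co K b x e2 * co K c x e1 * riem K G a b c d x)" if "v \<in> fibre L x" for v d
    unfolding curvature_coords(2)[OF K G X(1)[OF that] X(1)[OF e(2)] X(1)[OF e(1)]]
      X(2)[OF that] X(2)[OF e(1)] X(2)[OF e(2)] ..
  have hfr: "co K d x (?h (fr K a x)) = (\<Sum>b\<in>UNIV. \<Sum>c\<in>UNIV.
      co K b x e2 * co K c x e1 * riem K G a b c d x)" for a d
    unfolding hc[OF fr_fibre[OF K]] co_fr[OF K]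
    by (simp only: mult.assoc sum_distrib_left[symmetric] sum_delta_mult)
  have "ricci A L D x e1 e2 = (\<Sum>a\<in>UNIV. co K a x (?h (fr K a x)))"
    unfolding ricci_def
  proof (rule trace_on_frame[OF K hf])
    fix v assume v: "v \<in> fibre L x"
    \<comment> \<open>\<open>extend_vector\<close> need not be linear in the vector. Linearity of
      the curvature endomorphism is read off from its components instead.\<close>
    have "co K d x (?h v) = co K d x (\<Sum>a\<in>UNIV. co K a x v *\<^sub>C ?h (fr K a x))" for d
    proof -
      have "(\<Sum>a\<in>I. co K a x v *\<^sub>C ?h (fr K a x)) \<in> fibre L x \<and>
        co K d x (\<Sum>a\<in>I. co K a x v *\<^sub>C ?h (fr K a x)) = (\<Sum>a\<in>I. co K a x v * co K d x (?h (fr K a x)))" for I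
      proof (induction I rule: infinite_finite_induct)
        case (insert a I)
        then show ?case
          using fibre_scale[OF K hf[OF fr_fibre[OF K]], of "co K a x v" a] 
            co_scale[OF K hf[OF fr_fibre[OF K]], of d "co K a x v" a]
          by (simp add: fibre_add[OF K] co_add[OF K])
      qed (use fibre_zero[OF K] co_comb[OF K, of d "\<lambda>_. 0"] in simp_all)
      then show ?thesis unfolding hc[OF v] hfr
        by (simp add: sum_distrib_left mult.assoc)
    qed
    moreover have "(\<Sum>a\<in>UNIV. co K a x v *\<^sub>C ?h (fr K a x)) \<in> fibre L x"
      by (intro fibre_sum[OF K] fibre_scale[OF K] hf fr_fibre[OF K])
    ultimately show "?h v = (\<Sum>a\<in>UNIV. co K a x v *\<^sub>C ?h (fr K a x))"
      by (intro fibre_eqI[OF K hf[OF v]])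
  qed
  also have "\<dots> = (\<Sum>a\<in>UNIV. \<Sum>b\<in>UNIV. \<Sum>c\<in>UNIV. co K b x e2 * co K c x e1 * riem K G a b c a x)"
    unfolding hfr ..
  also have "\<dots> = (\<Sum>b\<in>UNIV. \<Sum>c\<in>UNIV. \<Sum>a\<in>UNIV. co K b x e2 * co K c x e1 * riem K G a b c a x)"
    by (rule sum_rotate3[symmetric])
  finally show ?thesis unfolding sum_distrib_left .
qed

end

section \<open>Top degree forms\<close>

lemma alternating_formsD:
  assumes "\<beta> \<in> alternating_forms S"
  shows "\<not> range t \<subseteq> S \<Longrightarrow> \<beta> t = 0"
    and "\<lbrakk>range t \<subseteq> S; u \<in> S; v \<in> S\<rbrakk> \<Longrightarrow> \<beta> (t(i := u + v)) = \<beta> (t(i := u)) + \<beta> (t(i := v))"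
    and "\<lbrakk>range t \<subseteq> S; u \<in> S\<rbrakk> \<Longrightarrow> \<beta> (t(i := c *\<^sub>C u)) = c * \<beta> (t(i := u))"
    and "\<lbrakk>i \<noteq> j; t i = t j\<rbrakk> \<Longrightarrow> \<beta> t = 0"
proof -
  note a = assms[unfolded alternating_forms_def mem_Collect_eq]
  show "\<not> range t \<subseteq> S \<Longrightarrow> \<beta> t = 0" by (rule a[THEN conjunct1, rule_format])
  show "\<lbrakk>range t \<subseteq> S; u \<in> S; v \<in> S\<rbrakk> \<Longrightarrow> \<beta> (t(i := u + v)) = \<beta> (t(i := u)) + \<beta> (t(i := v))"
    by (rule a[THEN conjunct2, THEN conjunct1, rule_format])
  show "\<lbrakk>range t \<subseteq> S; u \<in> S\<rbrakk> \<Longrightarrow> \<beta> (t(i := c *\<^sub>C u)) = c * \<beta> (t(i := u))"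
    by (rule a[THEN conjunct2, THEN conjunct2, THEN conjunct1, rule_format])
  show "\<lbrakk>i \<noteq> j; t i = t j\<rbrakk> \<Longrightarrow> \<beta> t = 0"
    by (rule a[THEN conjunct2, THEN conjunct2, THEN conjunct2, rule_format, OF conjI])
qed

lemma alternating_formsI:
  fixes \<beta> :: "('k::finite \<Rightarrow> 'a::complex_vector) \<Rightarrow> complex"
  assumes "\<And>t. \<not> range t \<subseteq> S \<Longrightarrow> \<beta> t = 0"
    and "\<And>t i u v. \<lbrakk>range t \<subseteq> S; u \<in> S; v \<in> S\<rbrakk> \<Longrightarrow> \<beta> (t(i := u + v)) = \<beta> (t(i := u)) + \<beta> (t(i := v))"
    and "\<And>t i u c. \<lbrakk>range t \<subseteq> S; u \<in> S\<rbrakk> \<Longrightarrow> \<beta> (t(i := c *\<^sub>C u)) = c * \<beta> (t(i := u))"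
    and "\<And>t i j. \<lbrakk>range t \<subseteq> S; i \<noteq> j; t i = t j\<rbrakk> \<Longrightarrow> \<beta> t = 0"
  shows "\<beta> \<in> alternating_forms S"
  unfolding alternating_forms_def
proof (intro CollectI conjI allI impI ballI)
  fix t :: "'k \<Rightarrow> 'a" and i j assume "i \<noteq> j \<and> t i = t j"
  then show "\<beta> t = 0" using assms(1)[of t] assms(4)[of t i j] by argo
qed (simp_all add: assms)

text \<open>Polarization: the sum of the two arguments is put into both places and expanded.\<close>

lemma alternating_swap:
  assumes \<beta>: "\<beta> \<in> alternating_forms S" and S: "\<And>u v. u \<in> S \<Longrightarrow> v \<in> S \<Longrightarrow> u + v \<in> S"
    and t: "range t \<subseteq> S" and ij: "i \<noteq> j"
  shows "\<beta> (t(i := t j, j := t i)) = - \<beta> t"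
proof -
  note d = alternating_formsD[OF \<beta>]
  let ?u = "t i" and ?v = "t j"
  have uv: "?u \<in> S" "?v \<in> S" using t by auto
  have uv3: "?u + ?v \<in> S" by (rule S[OF uv])
  have r: "range (t(k := w)) \<subseteq> S" if "w \<in> S" for k w using t that by auto
  have "0 = \<beta> (t(i := ?u + ?v, j := ?u + ?v))" by (rule d(4)[OF ij, symmetric]) (use ij in simp)
  also have "\<dots> = \<beta> (t(i := ?u + ?v, j := ?u)) + \<beta> (t(i := ?u + ?v, j := ?v))"
    by (rule d(2)[OF r[OF uv3] uv(1,2)])
  also have "t(i := ?u + ?v, j := ?u) = t(j := ?u, i := ?u + ?v)" using ij by (rule fun_upd_twist)
  also have "t(i := ?u + ?v, j := ?v) = t(j := ?v, i := ?u + ?v)" using ij by (rule fun_upd_twist)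
  also have "\<beta> (t(j := ?u, i := ?u + ?v)) = \<beta> (t(j := ?u, i := ?u)) + \<beta> (t(j := ?u, i := ?v))"
    by (rule d(2)[OF r[OF uv(1)] uv(1,2)])
  also have "\<beta> (t(j := ?v, i := ?u + ?v)) = \<beta> (t(j := ?v, i := ?u)) + \<beta> (t(j := ?v, i := ?v))"
    by (rule d(2)[OF r[OF uv(2)] uv(1,2)])
  also have "\<beta> (t(j := ?u, i := ?u)) = 0" by (rule d(4)[OF ij]) (use ij in simp)
  also have "\<beta> (t(j := ?v, i := ?v)) = 0" by (rule d(4)[OF ij]) (use ij in simp)
  also have "t(j := ?v, i := ?u) = t" by auto
  also have "t(j := ?u, i := ?v) = t(i := ?v, j := ?u)" using ij by (rule fun_upd_twist[symmetric])
  finally show ?thesis by (metis add_0 add.right_neutral eq_neg_iff_add_eq_0)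
qed

context hol_atlas
begin

section \<open>Derivatives of products and determinants\<close>

lemma tangent_prod:
  assumes v: "v \<in> tangent_space A x" and "finite I" "\<And>i. i \<in> I \<Longrightarrow> hn x (f i)"
  shows "v (\<lambda>y. \<Prod>i\<in>I. f i y) = (\<Sum>k\<in>I. \<Prod>i\<in>I. if i = k then v (f i) else f i x)"
  using assms(2,3)
proof (induction I rule: finite_induct)
  case empty then show ?case using tangent_const[OF v, of 1] by simp
next
  case (insert a I)
  have h: "hn x (f a)" "hn x (\<lambda>y. \<Prod>i\<in>I. f i y)"
    using insert.prems by (auto intro!: hn_prod[OF tangent_pts[OF v]])
  have 1: "(\<Prod>i\<in>I. if i = a then v (f i) else f i x) = (\<Prod>i\<in>I. f i x)"
    by (rule prod.cong) (use insert.hyps in auto)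
  have 2: "(\<Sum>k\<in>I. (if a = k then v (f a) else f a x) * (\<Prod>i\<in>I. if i = k then v (f i) else f i x)) =
     f a x * (\<Sum>k\<in>I. \<Prod>i\<in>I. if i = k then v (f i) else f i x)"
    unfolding sum_distrib_left by (rule sum.cong) (use insert.hyps in auto)
  have "v (\<lambda>y. \<Prod>i\<in>insert a I. f i y) = v (\<lambda>y. f a y * (\<Prod>i\<in>I. f i y))"
    using insert.hyps by simp
  also have "\<dots> = v (f a) * (\<Prod>i\<in>I. f i x) + f a x * (\<Sum>k\<in>I. \<Prod>i\<in>I. if i = k then v (f i) else f i x)"
    unfolding tangent_mult[OF v h] using insert.IH insert.prems by simp
  finally show ?case using insert.hyps 1 2 by simp
qed

lemma tangent_det:
  fixes f :: "'k::finite \<Rightarrow> 'k \<Rightarrow> 'm \<Rightarrow> complex"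
  assumes v: "v \<in> tangent_space A x" and f: "\<And>i j. hn x (f i j)"
  shows "v (\<lambda>y. det (\<chi> i j. f i j y)) = (\<Sum>k\<in>UNIV. det (\<chi> i j. if i = k then v (f i j) else f i j x))"
proof -
  have x: "x \<in> pts" using tangent_pts[OF v] .
  have "v (\<lambda>y. det (\<chi> i j. f i j y)) =
      (\<Sum>p | p permutes UNIV. v (\<lambda>y. of_int (sign p) * (\<Prod>i\<in>UNIV. f i (p i) y)))"
    unfolding det_def vec_lambda_beta
    by (rule tangent_sum[OF v]) (intro hn_mult hn_const hn_prod f x)
  also have "\<dots> = (\<Sum>p | p permutes UNIV. \<Sum>k\<in>UNIV. of_int (sign p) *
      (\<Prod>i\<in>UNIV. if i = k then v (f i (p i)) else f i (p i) x))"
    unfolding tangent_cmult[OF v hn_prod[OF x f]] sum_distrib_left[symmetric]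
    by (subst tangent_prod[OF v _ f]) simp_all
  also have "\<dots> = (\<Sum>k\<in>UNIV. \<Sum>p | p permutes UNIV. of_int (sign p) *
      (\<Prod>i\<in>UNIV. if i = k then v (f i (p i)) else f i (p i) x))"
    by (rule sum.swap)
  finally show ?thesis unfolding det_def vec_lambda_beta .
qed

end

context framed_algebroid
begin

text \<open>The generator of the line of top degree forms, normalized to 1 on the frame by
  \<open>vol_frv\<close>. For the tangent bundle it is
  \<open>coordinate_volume_form\<close>.\<close>

definition vol :: "'m set \<times> ('m \<Rightarrow> complex^'d) \<Rightarrow> 'm \<Rightarrow> ('k \<Rightarrow> 'v) \<Rightarrow> complex" where
  "vol K x t = (if range t \<subseteq> fibre L x then det (\<chi> i j. co K j x (t i)) else 0)"

abbreviation frv where "frv K x \<equiv> (\<lambda>a. fr K a x)"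

lemma vol_alt:
  assumes K: "K \<in> A" "x \<in> fst K"
  shows "vol K x \<in> alternating_forms (fibre L x)"
proof (rule alternating_formsI)
  fix t :: "'k \<Rightarrow> 'v" and i u v assume t: "range t \<subseteq> fibre L x" and u: "u \<in> fibre L x" and v: "v \<in> fibre L x"
  have r: "range (t(i := w)) \<subseteq> fibre L x" if "w \<in> fibre L x" for w using t that by auto
  have e: "(\<chi> k j. co K j x ((t(i := w)) k)) = (\<chi> k. if k = i then (\<chi> j. co K j x w) else (\<chi> j. co K j x (t k)))" for w
    by (simp add: vec_eq_iff)
  have s: "(\<chi> j. co K j x (u + v)) = (\<chi> j. co K j x u) + (\<chi> j. co K j x v)"
    by (simp add: vec_eq_iff co_add[OF K u v])
  show "vol K x (t(i := u + v)) = vol K x (t(i := u)) + vol K x (t(i := v))"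
    unfolding vol_def e s det_row_add by (simp only: r[OF u] r[OF v] r[OF fibre_add[OF K u v]] if_True)
next
  fix t :: "'k \<Rightarrow> 'v" and i u c assume t: "range t \<subseteq> fibre L x" and u: "u \<in> fibre L x"
  have r: "range (t(i := w)) \<subseteq> fibre L x" if "w \<in> fibre L x" for w using t that by auto
  have e: "(\<chi> k j. co K j x ((t(i := w)) k)) = (\<chi> k. if k = i then (\<chi> j. co K j x w) else (\<chi> j. co K j x (t k)))" for w
    by (simp add: vec_eq_iff)
  have s: "(\<chi> j. co K j x (c *\<^sub>C u)) = c *s (\<chi> j. co K j x u)"
    by (simp add: vec_eq_iff co_scale[OF K u])
  show "vol K x (t(i := c *\<^sub>C u)) = c * vol K x (t(i := u))"
    unfolding vol_def e s det_row_mul by (simp only: r[OF u] r[OF fibre_scale[OF K u]] if_True)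
next
  fix t :: "'k \<Rightarrow> 'v" and i j assume "i \<noteq> j" "t i = t j"
  then show "vol K x t = 0"
    unfolding vol_def by (auto intro!: det_identical_rows[of i j] simp: row_def vec_eq_iff)
qed (auto simp: vol_def)

lemma vol_frv: "K \<in> A \<Longrightarrow> x \<in> fst K \<Longrightarrow> vol K x (frv K x) = 1"
proof -
  assume K: "K \<in> A" "x \<in> fst K"
  have "(\<chi> i j. co K j x (fr K i x)) = mat 1" by (simp add: vec_eq_iff mat_def co_fr[OF K])
  moreover have "range (frv K x) \<subseteq> fibre L x" using fr_fibre[OF K] by auto
  ultimately show ?thesis unfolding vol_def by simp
qed

text \<open>A form of top degree is determined by its value on the frame: permutations of the frame
  reduce to transpositions, repeated frame members give zero, and general arguments are reached by
  multilinearity.\<close>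

lemma alternating_zero:
  fixes \<beta> :: "('k \<Rightarrow> 'v) \<Rightarrow> complex"
  assumes K: "K \<in> A" "x \<in> fst K" and \<beta>: "\<beta> \<in> alternating_forms (fibre L x)" and 0: "\<beta> (frv K x) = 0"
  shows "\<beta> t = 0"
proof -
  note d = alternating_formsD[OF \<beta>]
  \<comment> \<open>The induction composes transpositions on the left. With the inverse of
    \<open>p\<close> in the arguments, such a step becomes an exchange of two arguments.\<close>
  have perm: "\<beta> (\<lambda>i. fr K (inv p i) x) = 0" if "p permutes UNIV" for p :: "'k \<Rightarrow> 'k"
    using that finite[of "UNIV :: 'k set"]
  proof (induction p rule: permutes_induct)
    case id then show ?case using 0 by (simp add: id_def inv_id[unfolded id_def])
  next
    case (swap a b p)
    let ?t = "\<lambda>i. fr K (inv p i) x"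
    have "inv (Transposition.transpose a b \<circ> p) = inv p \<circ> Transposition.transpose a b"
      using swap permutes_bij[of p UNIV] by (simp add: o_inv_distrib)
    then have "(\<lambda>i. fr K (inv (Transposition.transpose a b \<circ> p) i) x) = ?t(a := ?t b, b := ?t a)"
      using \<open>a \<noteq> b\<close> by (auto simp: fun_eq_iff Transposition.transpose_def)
    moreover have "range ?t \<subseteq> fibre L x" using fr_fibre[OF K] by auto
    ultimately have "\<beta> (\<lambda>i. fr K (inv (Transposition.transpose a b \<circ> p) i) x) = - \<beta> ?t"
      using alternating_swap[OF \<beta> fibre_add[OF K] _ \<open>a \<noteq> b\<close>, of ?t] by (simp only:)
    moreover have "\<beta> ?t = 0" using swap by blast
    ultimately show ?case by (simp only: minus_zero)
  qed
  have fr: "\<beta> (\<lambda>i. fr K (\<sigma> i) x) = 0" for \<sigma> :: "'k \<Rightarrow> 'k"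
  proof (cases "inj \<sigma>")
    case True
    then have b: "bij \<sigma>" by (simp add: bij_def finite_UNIV_inj_surj)
    then have "inv \<sigma> permutes UNIV" by (intro bij_imp_permutes) (auto intro: bij_imp_bij_inv)
    from perm[OF this] show ?thesis using b by (simp add: inv_inv_eq)
  next
    case False
    then obtain i j where "i \<noteq> j" "\<sigma> i = \<sigma> j" unfolding inj_def by blast
    then show ?thesis by (intro d(4)[of i j]) auto
  qed
  \<comment> \<open>Induction on the set of places whose argument is not yet known to be a frame
    member; each step expands one of them.\<close>
  have "\<forall>t. range t \<subseteq> fibre L x \<longrightarrow> (\<forall>i. i \<notin> I \<longrightarrow> (\<exists>b. t i = fr K b x)) \<longrightarrow> \<beta> t = 0" if "finite I" for I
    using that
  proof (induction I rule: finite_induct)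
    case empty
    show ?case
    proof (intro allI impI)
      fix t :: "'k \<Rightarrow> 'v" assume "\<forall>i. i \<notin> {} \<longrightarrow> (\<exists>b. t i = fr K b x)"
      then obtain \<sigma> where "\<And>i. t i = fr K (\<sigma> i) x" by (metis empty_iff)
      then have "t = (\<lambda>i. fr K (\<sigma> i) x)" by auto
      then show "\<beta> t = 0" using fr by simp
    qed
  next
    case (insert k I)
    show ?case
    proof (intro allI impI)
      fix t :: "'k \<Rightarrow> 'v" assume t: "range t \<subseteq> fibre L x" and ex: "\<forall>i. i \<notin> insert k I \<longrightarrow> (\<exists>b. t i = fr K b x)"
      have z: "\<beta> (t(k := fr K b x)) = 0" for b
      proof (rule insert.IH[rule_format])
        show "range (t(k := fr K b x)) \<subseteq> fibre L x" using t fr_fibre[OF K] by auto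
      qed (use ex in auto)
      have zero: "\<beta> (t(k := 0)) = 0" using d(3)[OF t fibre_zero[OF K], of k 0] by simp
      have "\<beta> (t(k := (\<Sum>b\<in>J. c b *\<^sub>C fr K b x))) = 0" for J and c :: "'k \<Rightarrow> complex"
      proof (induction J rule: infinite_finite_induct)
        case (insert b J)
        have "(\<Sum>b\<in>J. c b *\<^sub>C fr K b x) \<in> fibre L x" by (intro fibre_sum[OF K] fibre_scale[OF K] fr_fibre[OF K])
        from d(2)[OF t fibre_scale[OF K fr_fibre[OF K]] this, of k "c b" b]
        show ?case by (simp only: sum.insert[OF insert(1,2)] insert.IH d(3)[OF t fr_fibre[OF K]] z mult_zero_right add_0)
      qed (simp_all only: sum.empty sum.infinite zero not_False_eq_True)
      from this[of "\<lambda>b. co K b x (t k)" UNIV] expand[OF K, of "t k"] t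
      show "\<beta> t = 0" by (simp add: range_subsetD)
    qed
  qed
  from this[of UNIV] show ?thesis using d(1)[of t] by auto
qed

text \<open>The difference of the two sides is alternating and vanishes on the frame.\<close>

lemma alternating_eq:
  fixes \<beta> :: "('k \<Rightarrow> 'v) \<Rightarrow> complex"
  assumes K: "K \<in> A" "x \<in> fst K" and \<beta>: "\<beta> \<in> alternating_forms (fibre L x)"
  shows "\<beta> t = \<beta> (frv K x) * vol K x t"
proof -
  let ?\<gamma> = "\<lambda>t. \<beta> t - \<beta> (frv K x) * vol K x t"
  note d = alternating_formsD[OF \<beta>] and e = alternating_formsD[OF vol_alt[OF K]]
  have "?\<gamma> \<in> alternating_forms (fibre L x)"
  proof (rule alternating_formsI)
    show "?\<gamma> t = 0" if "\<not> range t \<subseteq> fibre L x" for t using d(1)[OF that] e(1)[OF that] by simp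
    show "?\<gamma> (t(i := u + v)) = ?\<gamma> (t(i := u)) + ?\<gamma> (t(i := v))" 
      if "range t \<subseteq> fibre L x" "u \<in> fibre L x" "v \<in> fibre L x" for t i u v 
      using d(2)[OF that] e(2)[OF that] by (simp add: algebra_simps)
    show "?\<gamma> (t(i := c *\<^sub>C u)) = c * ?\<gamma> (t(i := u))" 
      if "range t \<subseteq> fibre L x" "u \<in> fibre L x" for t i u c
      using d(3)[OF that] e(3)[OF that] by (simp add: algebra_simps)
    show "?\<gamma> t = 0" if "i \<noteq> j" "t i = t j" for t i j using d(4)[of i j t] e(4)[of i j t] that by simp
  qed
  from alternating_zero[OF K this, of t] show ?thesis by (simp add: vol_frv[OF K])
qed

text \<open>The left-hand side is itself an alternating form of top degree in \<open>t\<close>, so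
  it is enough to compute it on the frame.\<close>

lemma alternating_trace:
  fixes \<beta> :: "('k \<Rightarrow> 'v) \<Rightarrow> complex"
  assumes K: "K \<in> A" "x \<in> fst K" and \<beta>: "\<beta> \<in> alternating_forms (fibre L x)"
    and t: "range t \<subseteq> fibre L x"
    and g: "\<And>v. v \<in> fibre L x \<Longrightarrow> g v \<in> fibre L x"
      "\<And>u v. u \<in> fibre L x \<Longrightarrow> v \<in> fibre L x \<Longrightarrow> g (u + v) = g u + g v"
      "\<And>c v. v \<in> fibre L x \<Longrightarrow> g (c *\<^sub>C v) = c *\<^sub>C g v"
  shows "(\<Sum>i\<in>UNIV. \<beta> (t(i := g (t i)))) = (\<Sum>i\<in>UNIV. co K i x (g (fr K i x))) * \<beta> t"
proof -
  let ?\<gamma> = "\<lambda>t. if range t \<subseteq> fibre L x then \<Sum>i\<in>UNIV. \<beta> (t(i := g (t i))) else 0"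
  note d = alternating_formsD[OF \<beta>]
  have r: "range (t(k := w)) \<subseteq> fibre L x" if "range t \<subseteq> fibre L x" "w \<in> fibre L x" for t :: "'k \<Rightarrow> 'v" and k w 
    using that by auto
  have "?\<gamma> \<in> alternating_forms (fibre L x)"
  proof (rule alternating_formsI)
    fix t :: "'k \<Rightarrow> 'v" and k u v assume t: "range t \<subseteq> fibre L x" and u: "u \<in> fibre L x" and v: "v \<in> fibre L x"
    have "\<beta> ((t(k := u + v))(i := g ((t(k := u + v)) i))) = \<beta> ((t(k := u))(i := g ((t(k := u)) i))) + \<beta> ((t(k := v))(i := g ((t(k := v)) i)))" for i
    proof (cases "i = k")
      case True then show ?thesis using d(2)[OF t g(1)[OF u] g(1)[OF v], of k] g(2)[OF u v] by simp
    next
      case False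
      then have tw: "(t(k := w))(i := g ((t(k := w)) i)) = (t(i := g (t i)))(k := w)" for w by auto
      have "g (t i) \<in> fibre L x" using g(1) t by auto
      from d(2)[OF r[OF t this] u v] show ?thesis unfolding tw .
    qed
    then show "?\<gamma> (t(k := u + v)) = ?\<gamma> (t(k := u)) + ?\<gamma> (t(k := v))"
      using r[OF t u] r[OF t v] r[OF t fibre_add[OF K u v]] by (simp only: if_True sum.distrib)
  next
    fix t :: "'k \<Rightarrow> 'v" and k u c assume t: "range t \<subseteq> fibre L x" and u: "u \<in> fibre L x"
    have "\<beta> ((t(k := c *\<^sub>C u))(i := g ((t(k := c *\<^sub>C u)) i))) = c * \<beta> ((t(k := u))(i := g ((t(k := u)) i)))" for i
    proof (cases "i = k")
      case True then show ?thesis using d(3)[OF t g(1)[OF u], of k c] g(3)[OF u, of c] by simp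
    next
      case False
      then have tw: "(t(k := w))(i := g ((t(k := w)) i)) = (t(i := g (t i)))(k := w)" for w by auto
      have "g (t i) \<in> fibre L x" using g(1) t by auto
      from d(3)[OF r[OF t this] u] show ?thesis unfolding tw .
    qed
    then show "?\<gamma> (t(k := c *\<^sub>C u)) = c * ?\<gamma> (t(k := u))"
      using r[OF t u] r[OF t fibre_scale[OF K u]] by (simp only: if_True sum_distrib_left)
  next
    fix t :: "'k \<Rightarrow> 'v" and i j assume t: "range t \<subseteq> fibre L x" and ij: "i \<noteq> j" "t i = t j"
    \<comment> \<open>For equal arguments at \<open>i\<close> and \<open>j\<close> all other
      summands still contain the repetition, and the two that remain are exchanged by
      \<open>alternating_swap\<close>.\<close>
    have "(\<Sum>k\<in>UNIV. \<beta> (t(k := g (t k)))) = (\<Sum>k\<in>{i, j}. \<beta> (t(k := g (t k))))"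
      by (rule sum.mono_neutral_right) (use ij in \<open>auto intro!: d(4)[of i j]\<close>)
    also have "\<dots> = \<beta> (t(i := g (t i))) + \<beta> (t(j := g (t i)))" using ij by simp
    also have "\<dots> = 0"
    proof -
      let ?s = "t(i := g (t i))"
      have gt: "g (t i) \<in> fibre L x" using g(1) t by auto
      have "?s(i := ?s j, j := ?s i) = t(j := g (t i))" using ij by auto
      then show ?thesis using alternating_swap[OF \<beta> fibre_add[OF K] r[OF t gt, of i] ij(1)] by simp
    qed
    finally show "?\<gamma> t = 0" by simp
  qed simp
  from alternating_eq[OF K this, of t] have 1: "(\<Sum>i\<in>UNIV. \<beta> (t(i := g (t i)))) = ?\<gamma> (frv K x) * vol K x t"
    using t by simp
  have rf: "range (frv K x) \<subseteq> fibre L x" using fr_fibre[OF K] by auto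
  have gf: "g (fr K i x) \<in> fibre L x" for i using g(1) fr_fibre[OF K] by blast
  have "\<beta> ((frv K x)(i := g (fr K i x))) = co K i x (g (fr K i x)) * \<beta> (frv K x)" for i
  proof -
    \<comment> \<open>The matrix is the identity with row \<open>i\<close> replaced, so only the
      diagonal entry of that row contributes to the determinant.\<close>
    have "vol K x ((frv K x)(i := g (fr K i x))) = co K i x (g (fr K i x))"
    proof -
      let ?M = "\<chi> k j. co K j x (((frv K x)(i := g (fr K i x))) k)"
      have nz: "k \<in> {}" if "(k::'k) \<noteq> k" for k using that by simp
      have "det ?M = (\<Prod>k\<in>UNIV. if k = i then co K i x (g (fr K i x)) else 1)"
      proof -
        have e: "?M = (\<chi> k. if k = i then (\<Sum>j\<in>UNIV. co K j x (g (fr K i x)) *s axis j 1) else axis k 1)"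
          by (simp add: vec_eq_iff axis_def co_fr[OF K] sum_delta_mult)
        have 2: "det (\<chi> k. if k = i then axis j 1 else axis k (1::complex)) = (if j = i then 1 else 0)" for j
        proof (cases "j = i")
          case True
          have e4: "(\<chi> k. if k = i then axis i 1 else axis k (1::complex)) = mat 1"
            by (auto simp: vec_eq_iff mat_def axis_def)
          show ?thesis unfolding True e4 by simp
        next
          case False
          then show ?thesis by (simp, intro det_identical_rows[of i j]) (auto simp: row_def vec_eq_iff)
        qed
        show ?thesis unfolding e
          by (subst det_linear_row_sum) (simp_all add: det_row_mul 2 sum_delta_mult prod.delta)
      qed
      then show ?thesis unfolding vol_def using r[OF rf gf] by simp
    qed
    then show ?thesis using alternating_eq[OF K \<beta>, of "(frv K x)(i := g (fr K i x))"] by simp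
  qed
  then have "?\<gamma> (frv K x) = (\<Sum>i\<in>UNIV. co K i x (g (fr K i x))) * \<beta> (frv K x)"
    using rf by (simp add: sum_distrib_right)
  then show ?thesis unfolding 1 using alternating_eq[OF K \<beta>, of t] by simp
qed

text \<open>Over a chart the forms of top degree are a trivial line bundle with generator
  \<open>vol\<close>, so a single coefficient decides about holomorphy.\<close>

lemma form_section_iff:
  fixes \<beta> :: "'m \<Rightarrow> ('k \<Rightarrow> 'v) \<Rightarrow> complex"
  assumes K: "K \<in> A" "x \<in> fst K"
  shows "local_section A (form_bundle A L) x \<beta> \<longleftrightarrow>
    eventually (\<lambda>y. \<beta> y \<in> alternating_forms (fibre L y)) (NH x) \<and> hn x (\<lambda>y. \<beta> y (frv K y))"
proof
  assume "local_section A (form_bundle A L) x \<beta>"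
  then obtain V where V: "mopen V" "x \<in> V" "\<beta> \<in> sections (form_bundle A L) V" unfolding local_section_def by blast
  let ?V = "V \<inter> fst K"
  have o: "mopen ?V" using V mopen_chart[OF K(1)] by blast
  have "fr K i \<in> sections L ?V" for i unfolding sections_ls[OF o] using ls_fr[OF K(1)] by blast
  then have "(\<lambda>y. \<beta> y (frv K y)) \<in> holomorphic_functions A ?V"
    using V(3) o unfolding form_bundle_def by simp
  then have "hn x (\<lambda>y. \<beta> y (frv K y))" using holfun_iff[OF o] V K by blast
  moreover have "eventually (\<lambda>y. \<beta> y \<in> alternating_forms (fibre L y)) (NH x)"
    using eventually_mopen[OF V(1,2)] by (rule eventually_mono) (use V(3) in \<open>simp add: form_bundle_def\<close>)
  ultimately show "eventually (\<lambda>y. \<beta> y \<in> alternating_forms (fibre L y)) (NH x) \<and> hn x (\<lambda>y. \<beta> y (frv K y))" by blast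
next
  assume \<beta>: "eventually (\<lambda>y. \<beta> y \<in> alternating_forms (fibre L y)) (NH x) \<and> hn x (\<lambda>y. \<beta> y (frv K y))"
  from \<beta>[THEN conjunct1] hn_eventually[OF \<beta>[THEN conjunct2]] eventually_chart[OF K]
  have "eventually (\<lambda>y. \<beta> y \<in> alternating_forms (fibre L y) \<and> hn y (\<lambda>y. \<beta> y (frv K y)) \<and> y \<in> fst K) (NH x)"
    by eventually_elim simp
  then obtain V where V: "mopen V" "x \<in> V"
    "\<And>y. y \<in> V \<Longrightarrow> \<beta> y \<in> alternating_forms (fibre L y) \<and> hn y (\<lambda>y. \<beta> y (frv K y)) \<and> y \<in> fst K"
    unfolding eventually_NH[OF chart_pts[OF K]] by blast
  have "(\<lambda>y. \<beta> y (\<lambda>i. t i y)) \<in> holomorphic_functions A W"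
    if W: "mopen W" "W \<subseteq> V" "\<And>i. t i \<in> sections L W" for W t
    unfolding holfun_iff[OF W(1)]
  proof
    fix y assume y: "y \<in> W"
    have yk: "y \<in> fst K" using V(3) W(2) y by blast
    have ls: "ls z (t i)" if "z \<in> W" for z i using ls_sections[OF W(3,1) that] .
    have "eventually (\<lambda>z. \<beta> z (\<lambda>i. t i z) = \<beta> z (frv K z) * det (\<chi> i j. co K j z (t i z))) (NH y)"
      using eventually_mopen[OF W(1) y]
    proof (rule eventually_mono)
      fix z assume z: "z \<in> W"
      have "range (\<lambda>i. t i z) \<subseteq> fibre L z" using ls_fibre[OF ls[OF z]] by blast
      then show "\<beta> z (\<lambda>i. t i z) = \<beta> z (frv K z) * det (\<chi> i j. co K j z (t i z))"
        using alternating_eq[OF K(1), of z "\<beta> z" "\<lambda>i. t i z"] V(3) W(2) z unfolding vol_def by auto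
    qed
    moreover have "hn y (\<lambda>z. \<beta> z (frv K z) * det (\<chi> i j. co K j z (t i z)))"
      using V(3) W(2) y by (intro hn_mult hn_det ls_hn[OF ls[OF y] K(1) yk] chart_pts[OF K(1) yk]) auto
    ultimately show "hn y (\<lambda>y. \<beta> y (\<lambda>i. t i y))" using hn_cong by fast
  qed
  then have "\<beta> \<in> sections (form_bundle A L) V" unfolding form_bundle_def using V(3) by simp
  then show "local_section A (form_bundle A L) x \<beta>" unfolding local_section_def using V by blast
qed

text \<open>The derivatives of the components of the extended arguments occur twice with opposite
  signs, once from the determinant and once from \<open>D\<close>. What remains is the derivative of
  the coefficient and minus the trace of the connection matrix.\<close>

lemma form_connection_coords:
  fixes \<beta> :: "'m \<Rightarrow> ('k \<Rightarrow> 'v) \<Rightarrow> complex"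
  assumes K: "K \<in> A" "x \<in> fst K" and G: "christoffel K D G x"
    and \<beta>: "local_section A (form_bundle A L) x \<beta>" and e: "e \<in> fibre L x"
  shows "form_connection A L L D \<beta> x e w = (anchor L x e (\<lambda>y. \<beta> y (frv K y))
      - (\<Sum>a\<in>UNIV. co K a x e * (\<Sum>b\<in>UNIV. G a b b x)) * \<beta> x (frv K x)) * vol K x w"
proof (cases "range w \<subseteq> fibre L x")
  case False then show ?thesis unfolding form_connection_def vol_def by simp
next
  case w: True
  have x: "x \<in> pts" using chart_pts[OF K] .
  define t where "t i = extend_vector A L x (w i)" for i
  have wf: "w i \<in> fibre L x" for i using w by auto
  have t: "ls x (t i)" "t i x = w i" for i unfolding t_def using extend_vector[OF x wf] by auto
  let ?X = "anchor L x e" and ?g = "\<lambda>y. \<beta> y (frv K y)"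
  note T = anchor_tangent[OF K e]
  from \<beta> have b: "eventually (\<lambda>y. \<beta> y \<in> alternating_forms (fibre L y)) (NH x)" "hn x ?g"
    unfolding form_section_iff[OF K] by auto
  have bx: "\<beta> x \<in> alternating_forms (fibre L x)" by (rule NH_self[OF b(1) x])
  define f where "f i j = (\<lambda>y. co K j y (t i y))" for i j
  have hf: "hn x (f i j)" for i j unfolding f_def by (rule ls_hn[OF t(1) K])
  have "eventually (\<lambda>y. \<forall>i. t i y \<in> fibre L y) (NH x)"
    by (intro eventually_all_finite ls_near t)
  with b(1) eventually_chart[OF K] have "eventually (\<lambda>y. \<beta> y (\<lambda>i. t i y) = ?g y * det (\<chi> i j. f i j y)) (NH x)"
  proof eventually_elim
    case (elim y)
    then show ?case using alternating_eq[OF K(1) elim(2,1), of "\<lambda>i. t i y"] unfolding vol_def f_def by auto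
  qed
  from tangent_cong[OF T this] have 1: "?X (\<lambda>y. \<beta> y (\<lambda>i. t i y)) = ?X ?g * vol K x w +
      ?g x * (\<Sum>k\<in>UNIV. det (\<chi> i j. if i = k then ?X (f i j) else co K j x (w i)))"
    unfolding tangent_mult[OF T b(2) hn_det[OF x hf]] tangent_det[OF T hf] vol_def using w
    by (simp add: f_def t(2) cong: if_cong)
  \<comment> \<open>The part of \<open>D\<close> along \<open>e\<close> that does not differentiate
    components: a linear endomorphism of the fibre, to which \<open>alternating_trace\<close>
    applies.\<close>
  define \<gamma> where "\<gamma> v = (\<Sum>c\<in>UNIV. (\<Sum>a\<in>UNIV. \<Sum>b\<in>UNIV. co K a x e * co K b x v * G a b c x) *\<^sub>C fr K c x)" for v
  have \<gamma>f: "\<gamma> v \<in> fibre L x" and \<gamma>c: "co K c x (\<gamma> v) = (\<Sum>a\<in>UNIV. \<Sum>b\<in>UNIV. co K a x e * co K b x v * G a b c x)" for v c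
    unfolding \<gamma>_def by (rule comb_fibre[OF K], rule co_comb[OF K])
  have 2: "vol K x (w(k := D (t k) x e)) = det (\<chi> i j. if i = k then ?X (f i j) else co K j x (w i)) + vol K x (w(k := \<gamma> (w k)))" for k
  proof -
    note C = christoffel_co[OF G K t(1) e]
    have r: "range (w(k := u)) \<subseteq> fibre L x" if "u \<in> fibre L x" for u using w that by auto
    have e1: "(\<chi> i j. co K j x ((w(k := D (t k) x e)) i)) = (\<chi> i. if i = k then (\<chi> j. ?X (f k j)) + (\<chi> j. co K j x (\<gamma> (w k))) else (\<chi> j. co K j x (w i)))"
      by (simp add: vec_eq_iff C(2) \<gamma>c t(2) f_def)
    have e2: "(\<chi> i j. co K j x ((w(k := \<gamma> (w k))) i)) = (\<chi> i. if i = k then (\<chi> j. co K j x (\<gamma> (w k))) else (\<chi> j. co K j x (w i)))"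
      by (simp add: vec_eq_iff)
    have e3: "(\<chi> i j. if i = k then ?X (f i j) else co K j x (w i)) = (\<chi> i. if i = k then (\<chi> j. ?X (f k j)) else (\<chi> j. co K j x (w i)))"
      by (simp add: vec_eq_iff)
    show ?thesis unfolding vol_def e1 e2 e3 det_row_add by (simp only: r[OF C(1)] r[OF \<gamma>f] if_True)
  qed
  have tr: "(\<Sum>k\<in>UNIV. vol K x (w(k := \<gamma> (w k)))) = (\<Sum>i\<in>UNIV. co K i x (\<gamma> (fr K i x))) * vol K x w"
  proof (rule alternating_trace[OF K vol_alt[OF K] w \<gamma>f])
    fix u v assume uv: "u \<in> fibre L x" "v \<in> fibre L x"
    show "\<gamma> (u + v) = \<gamma> u + \<gamma> v"
      by (rule fibre_eqI[OF K \<gamma>f fibre_add[OF K \<gamma>f \<gamma>f]])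
        (simp add: co_add[OF K \<gamma>f \<gamma>f] \<gamma>c co_add[OF K uv] distrib_left distrib_right sum.distrib)
  next
    fix c v assume v: "v \<in> fibre L x"
    show "\<gamma> (c *\<^sub>C v) = c *\<^sub>C \<gamma> v"
      by (rule fibre_eqI[OF K \<gamma>f fibre_scale[OF K \<gamma>f]])
        (simp add: co_scale[OF K \<gamma>f] \<gamma>c co_scale[OF K v] sum_distrib_left mult_ac)
  qed
  have tr': "(\<Sum>i\<in>UNIV. co K i x (\<gamma> (fr K i x))) = (\<Sum>a\<in>UNIV. co K a x e * (\<Sum>b\<in>UNIV. G a b b x))"
  proof -
    have "co K i x (\<gamma> (fr K i x)) = (\<Sum>a\<in>UNIV. co K a x e * G a i i x)" for i
      unfolding \<gamma>c co_fr[OF K] mult.assoc sum_distrib_left[symmetric] sum_delta_mult ..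
    then have "(\<Sum>i\<in>UNIV. co K i x (\<gamma> (fr K i x))) = (\<Sum>i\<in>UNIV. \<Sum>a\<in>UNIV. co K a x e * G a i i x)"
      by simp
    also have "\<dots> = (\<Sum>a\<in>UNIV. \<Sum>i\<in>UNIV. co K a x e * G a i i x)" by (rule sum.swap)
    finally show ?thesis unfolding sum_distrib_left .
  qed
  have "form_connection A L L D \<beta> x e w = ?X (\<lambda>y. \<beta> y (\<lambda>i. t i y)) - (\<Sum>k\<in>UNIV. \<beta> x (w(k := D (t k) x e)))"
    unfolding form_connection_def Let_def t_def using w by simp
  also have "(\<Sum>k\<in>UNIV. \<beta> x (w(k := D (t k) x e))) = ?g x * (\<Sum>k\<in>UNIV. vol K x (w(k := D (t k) x e)))"
    unfolding sum_distrib_left by (intro sum.cong refl alternating_eq[OF K bx])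
  finally show ?thesis unfolding 1 2 sum.distrib tr tr' by (simp add: algebra_simps)
qed

end

section \<open>The tangent bundle and the total space of \<open>det(TM)\<close>\<close>

context hol_atlas
begin

lemma local_section_tangentD:
  assumes "local_section A (tangent_bundle A) x X"
  shows "eventually (\<lambda>y. X y \<in> tangent_space A y) (NH x)"
    and "K \<in> A \<Longrightarrow> x \<in> fst K \<Longrightarrow> hn x (\<lambda>y. X y (xi K i))"
proof -
  obtain V where V: "mopen V" "x \<in> V" "X \<in> vector_fields A V"
    using assms unfolding local_section_def tangent_bundle_def by auto
  note X = V(3)[unfolded vector_fields_iff[OF V(1)]]
  show "eventually (\<lambda>y. X y \<in> tangent_space A y) (NH x)"
    using eventually_mopen[OF V(1,2)] by (rule eventually_mono) (use X in blast)
  show "K \<in> A \<Longrightarrow> x \<in> fst K \<Longrightarrow> hn x (\<lambda>y. X y (xi K i))" using X V by blast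
qed

lemma dd_vector_field:
  assumes "K \<in> A"
  shows "dd K i \<in> vector_fields A (fst K)"
  unfolding vector_fields_iff[OF mopen_chart[OF assms]]
  using dd_tangent[OF assms] hn_dd(1)[OF assms _ hn_coord] by blast

lemma framed_tangent:
  "framed_algebroid A (tangent_bundle A) dd (\<lambda>K i x v. v (xi K i))"
proof (unfold_locales, unfold tangent_bundle_def vbundle.simps algebroid.simps)
  fix K x assume K: "K \<in> A" "x \<in> fst K"
  show "tangent_space A x = range (\<lambda>c. \<Sum>a\<in>UNIV. c a *\<^sub>C dd K a x)"
  proof (rule set_eqI)
    fix v
    show "v \<in> tangent_space A x \<longleftrightarrow> v \<in> range (\<lambda>c. \<Sum>a\<in>UNIV. c a *\<^sub>C dd K a x)"
      unfolding tangent_iff[OF K] image_iff by (simp add: fun_eq_iff sum_fun_apply)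
  qed
  show "(\<Sum>b\<in>UNIV. c b *\<^sub>C dd K b x) (xi K a) = c a" for a and c :: "'d \<Rightarrow> complex"
    by (simp add: sum_fun_apply dd_coord[OF K] sum_delta_mult)
  show "(\<Sum>a\<in>UNIV. c a *\<^sub>C dd K a x) f = (\<Sum>a\<in>UNIV. c a * dd K a x f)" for f and c :: "'d \<Rightarrow> complex"
    by (simp add: sum_fun_apply)
  show "dd K a x \<in> tangent_space A x" for a by (rule dd_tangent[OF K])
  show "hn x (\<lambda>y. dd K a y f)" if "hn x f" for a f by (rule hn_dd(1)[OF K that])
  show "dd K a x (\<lambda>y. dd K b y f) = dd K b x (\<lambda>y. dd K a y f)" if "hn x f" for a b f
    by (rule hn_dd(2)[OF K that])
  show "lie_bracket A s t x = (\<Sum>a\<in>UNIV. (s x (\<lambda>y. t y (xi K a)) - t x (\<lambda>y. s y (xi K a))) *\<^sub>C dd K a x)"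
    if "local_section A \<lparr>fibre = tangent_space A, sections = vector_fields A, anchor = \<lambda>x v. v, bracket = lie_bracket A\<rparr> x s"
      "local_section A \<lparr>fibre = tangent_space A, sections = vector_fields A, anchor = \<lambda>x v. v, bracket = lie_bracket A\<rparr> x t" for s t
  proof -
    have "local_section A (tangent_bundle A) x s" "local_section A (tangent_bundle A) x t"
      using that by (simp_all add: tangent_bundle_def)
    note s = local_section_tangentD[OF this(1)] and t = local_section_tangentD[OF this(2)]
    show ?thesis
      by (simp add: fun_eq_iff sum_fun_apply lie_bracket_coords[OF K s(1) s(2)[OF K] t(1) t(2)[OF K]])
  qed
next
  show "s \<in> vector_fields A V \<longleftrightarrow> (\<forall>x\<in>V. s x \<in> tangent_space A x) \<and>
      (\<forall>K\<in>A. \<forall>a. \<forall>x\<in>V \<inter> fst K. hn x (\<lambda>y. s y (xi K a)))" if "mopen V" for s V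
    by (rule vector_fields_iff[OF that])
  show "dd K a \<in> vector_fields A (fst K)" if "K \<in> A" for K a by (rule dd_vector_field[OF that])
qed

end

text \<open>Chain rule, with the test function expressed in a chart of the target.\<close>

lemma pushforward_tangent:
  fixes A :: "('p, 'd::finite) atlas" and B :: "('q, 'e::finite) atlas"
  assumes A: "hol_atlas A" and B: "hol_atlas B" and \<mu>: "\<mu> \<in> B" "F p \<in> fst \<mu>"
    and F: "\<And>j. holomorphic_near A p (\<lambda>q. snd \<mu> (F q) $ j)"
      "eventually (\<lambda>q. F q \<in> fst \<mu>) (nhdsin (manifold_topology A) p)"
    and v: "v \<in> tangent_space A p"
  shows "pushforward B F p v \<in> tangent_space B (F p)"
    and "pushforward B F p v f = (\<Sum>j\<in>UNIV. v (\<lambda>q. snd \<mu> (F q) $ j) * hol_atlas.dd B \<mu> j (F p) f)"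
proof -
  interpret A: hol_atlas A by fact
  interpret B: hol_atlas B by fact
  have main: "pushforward B F p v f = (\<Sum>j\<in>UNIV. v (\<lambda>q. snd \<mu> (F q) $ j) * B.dd \<mu> j (F p) f)" for f
  proof (cases "B.hn (F p) f")
    case True
    obtain S where S: "open S" "snd \<mu> (F p) \<in> S" "holomorphic_fun_on (f \<circ> B.pinv \<mu>) S"
      using True unfolding B.hn_iff[OF \<mu>] by blast
    have "eventually (\<lambda>q. (f \<circ> F) q = (f \<circ> B.pinv \<mu>) (\<chi> j. snd \<mu> (F q) $ j)) (A.NH p)"
      using F(2) by eventually_elim (simp add: B.pinv[OF \<mu>(1)])
    then have "v (f \<circ> F) = v (\<lambda>q. (f \<circ> B.pinv \<mu>) (\<chi> j. snd \<mu> (F q) $ j))"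
      by (rule A.tangent_cong[OF v])
    also have "\<dots> = (\<Sum>j\<in>UNIV. partial j (f \<circ> B.pinv \<mu>) (\<chi> j. snd \<mu> (F p) $ j) * v (\<lambda>q. snd \<mu> (F q) $ j))"
      by (rule A.tangent_compose[OF v S(3,1) _ F(1)]) (use S(2) in simp)
    finally show ?thesis unfolding pushforward_def B.dd_def using True by (simp add: mult.commute)
  next
    case False then show ?thesis by (simp add: pushforward_def B.dd_not_hn)
  qed
  then show "pushforward B F p v f = (\<Sum>j\<in>UNIV. v (\<lambda>q. snd \<mu> (F q) $ j) * B.dd \<mu> j (F p) f)" .
  show "pushforward B F p v \<in> tangent_space B (F p)" unfolding B.tangent_iff[OF \<mu>]
    by (intro exI[of _ "\<lambda>j. v (\<lambda>q. snd \<mu> (F q) $ j)"] allI main)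
qed

text \<open>A locale of its own, so that \<open>hol_atlas\<close> can be interpreted for
  \<open>det_atlas A\<close> inside it without that interpretation being repeated for the new
  atlas.\<close>

locale base_atlas = hol_atlas A for A :: "('m, 'n::finite) atlas"

sublocale base_atlas \<subseteq> TM: framed_algebroid A "tangent_bundle A" dd "\<lambda>K i x v. v (\<lambda>y. snd K y $ i)"
  by (rule framed_tangent)

context base_atlas
begin

lemma TM_simps [simp]:
  "fibre (tangent_bundle A) = tangent_space A" "sections (tangent_bundle A) = vector_fields A"
  "anchor (tangent_bundle A) x v = v" "bracket (tangent_bundle A) = lie_bracket A"
  by (simp_all add: tangent_bundle_def)

section \<open>Top degree forms and polyvectors on the base\<close>

abbreviation alt where "alt x \<equiv> alternating_forms (tangent_space A x) :: (('n \<Rightarrow> 'm tangent) \<Rightarrow> complex) set"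

text \<open>The polyvector \<open>\<partial>_1 \<and> ... \<and> \<partial>_n\<close> of the chart,
  which acts on forms by evaluation on the coordinate frame.\<close>

definition ev :: "'m set \<times> ('m \<Rightarrow> complex^'n) \<Rightarrow> 'm \<Rightarrow> ('m, 'n) polyvector" where
  "ev K x = (\<lambda>\<beta>. if \<beta> \<in> alt x then \<beta> (\<lambda>i. dd K i x) else 0)"

definition dchart :: "'m set \<times> ('m \<Rightarrow> complex^'n) \<Rightarrow> ('m, 'n) det_point set \<times> (('m, 'n) det_point \<Rightarrow> complex^'n option)" where
  "dchart K = ({(x, \<xi>) \<in> det_space A. x \<in> fst K},
      \<lambda>(x, \<xi>). \<chi> i. case i of None \<Rightarrow> \<xi> (coordinate_volume_form A (snd K) x) | Some j \<Rightarrow> snd K x $ j)"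

lemma det_atlas_eq: "det_atlas A = dchart ` A"
  unfolding det_atlas_def dchart_def by (auto simp: image_iff case_prod_unfold)

lemma volume_form: "coordinate_volume_form A (snd K) x = TM.vol K x"
  unfolding coordinate_volume_form_def TM.vol_def by (simp add: fun_eq_iff)

lemma fst_dchart: "q \<in> fst (dchart K) \<longleftrightarrow> q \<in> det_space A \<and> fst q \<in> fst K"
  unfolding dchart_def by auto

lemma snd_dchart [simp]:
  "snd (dchart K) q $ Some j = snd K (fst q) $ j" "snd (dchart K) q $ None = snd q (TM.vol K (fst q))"
  unfolding dchart_def volume_form by (simp_all add: case_prod_unfold)

lemma polyvector_fibre: "fibre (top_polyvectors A) x = linear_maps (alt x) UNIV"
  unfolding exterior_power_def dual_bundle_def hom_bundle_def form_bundle_def trivial_bundle_def by simp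

lemma vol_alt [simp]: "K \<in> A \<Longrightarrow> x \<in> fst K \<Longrightarrow> TM.vol K x \<in> alt x"
  using TM.vol_alt by simp

lemma alt_eq:
  assumes K: "K \<in> A" "x \<in> fst K" and \<beta>: "\<beta> \<in> alt x"
  shows "\<beta> = \<beta> (\<lambda>i. dd K i x) *\<^sub>C TM.vol K x"
  by (rule ext, unfold scaleC_fun_apply scaleC_complex, rule TM.alternating_eq[OF K]) (simp add: \<beta>)

lemma alt_add:
  assumes \<beta>: "\<beta> \<in> alternating_forms S" and \<gamma>: "\<gamma> \<in> alternating_forms S"
  shows "\<beta> + \<gamma> \<in> alternating_forms S"
proof (rule alternating_formsI)
  note d = alternating_formsD[OF \<beta>] and e = alternating_formsD[OF \<gamma>]
  show "(\<beta> + \<gamma>) t = 0" if "\<not> range t \<subseteq> S" for t using d(1)[OF that] e(1)[OF that] by simp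
  show "(\<beta> + \<gamma>) (t(i := u + v)) = (\<beta> + \<gamma>) (t(i := u)) + (\<beta> + \<gamma>) (t(i := v))"
    if "range t \<subseteq> S" "u \<in> S" "v \<in> S" for t i u v using d(2)[OF that] e(2)[OF that] by simp
  show "(\<beta> + \<gamma>) (t(i := c *\<^sub>C u)) = c * (\<beta> + \<gamma>) (t(i := u))" if "range t \<subseteq> S" "u \<in> S" for t i u c
    using d(3)[OF that] e(3)[OF that] by (simp add: distrib_left)
  show "(\<beta> + \<gamma>) t = 0" if "i \<noteq> j" "t i = t j" for t i j using d(4)[OF that] e(4)[OF that] by simp
qed

lemma alt_scale:
  assumes \<beta>: "\<beta> \<in> alternating_forms S"
  shows "c *\<^sub>C \<beta> \<in> alternating_forms S"
proof (rule alternating_formsI)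
  note d = alternating_formsD[OF \<beta>]
  show "(c *\<^sub>C \<beta>) t = 0" if "\<not> range t \<subseteq> S" for t using d(1)[OF that] by simp
  show "(c *\<^sub>C \<beta>) (t(i := u + v)) = (c *\<^sub>C \<beta>) (t(i := u)) + (c *\<^sub>C \<beta>) (t(i := v))"
    if "range t \<subseteq> S" "u \<in> S" "v \<in> S" for t i u v using d(2)[OF that] by (simp add: distrib_left)
  show "(c *\<^sub>C \<beta>) (t(i := b *\<^sub>C u)) = b * (c *\<^sub>C \<beta>) (t(i := u))" if "range t \<subseteq> S" "u \<in> S" for t i u b
    using d(3)[OF that] by simp
  show "(c *\<^sub>C \<beta>) t = 0" if "i \<noteq> j" "t i = t j" for t i j using d(4)[OF that] by simp
qed

lemma polyvector_eq:
  assumes K: "K \<in> A" "x \<in> fst K" and \<xi>: "\<xi> \<in> linear_maps (alt x) UNIV"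
  shows "\<xi> = \<xi> (TM.vol K x) *\<^sub>C ev K x"
proof
  fix \<beta>
  show "\<xi> \<beta> = (\<xi> (TM.vol K x) *\<^sub>C ev K x) \<beta>"
  proof (cases "\<beta> \<in> alt x")
    case True
    have "\<xi> (c *\<^sub>C TM.vol K x) = c * \<xi> (TM.vol K x)" for c
      using \<xi> vol_alt[OF K] unfolding linear_maps_def by simp
    then have "\<xi> \<beta> = \<beta> (\<lambda>i. dd K i x) * \<xi> (TM.vol K x)"
      by (subst (1) alt_eq[OF K True])
    then show ?thesis using True by (simp add: ev_def)
  next
    case False then show ?thesis using \<xi> by (simp add: ev_def linear_maps_def)
  qed
qed

lemma ev_linear: "c *\<^sub>C ev K x \<in> linear_maps (alt x) UNIV"
  unfolding linear_maps_def ev_def by (simp add: alt_add alt_scale algebra_simps)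

lemma ev_vol [simp]: "K \<in> A \<Longrightarrow> x \<in> fst K \<Longrightarrow> ev K x (TM.vol K x) = 1"
  unfolding ev_def by (simp add: TM.vol_frv)

text \<open>Forms of top degree are multiples of \<open>vol\<close>, so over a chart the fibre of
  \<open>det(TM)\<close> is a punctured line with generator \<open>ev K x\<close>. The value of
  \<open>\<xi>\<close> on \<open>vol\<close> is the fibre coordinate \<open>\<tau>\<close>.\<close>

lemma det_space_iff:
  assumes K: "K \<in> A" "x \<in> fst K"
  shows "(x, \<xi>) \<in> det_space A \<longleftrightarrow> \<xi> (TM.vol K x) \<noteq> 0 \<and> \<xi> = \<xi> (TM.vol K x) *\<^sub>C ev K x"
proof
  assume "(x, \<xi>) \<in> det_space A"
  then have l: "\<xi> \<in> linear_maps (alt x) UNIV" and nz: "\<xi> \<noteq> 0" unfolding det_space_def polyvector_fibre by auto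
  note e = polyvector_eq[OF K l]
  have "\<xi> (TM.vol K x) \<noteq> 0"
  proof
    assume "\<xi> (TM.vol K x) = 0"
    then have "\<xi> (TM.vol K x) *\<^sub>C ev K x = 0" by simp
    from notE[OF nz trans[OF e this]] show False .
  qed
  then show "\<xi> (TM.vol K x) \<noteq> 0 \<and> \<xi> = \<xi> (TM.vol K x) *\<^sub>C ev K x" by (rule conjI[OF _ e])
next
  assume a: "\<xi> (TM.vol K x) \<noteq> 0 \<and> \<xi> = \<xi> (TM.vol K x) *\<^sub>C ev K x"
  have l: "\<xi> \<in> linear_maps (alt x) UNIV"
    using ev_linear[of "\<xi> (TM.vol K x)" K x] by (simp only: a[THEN conjunct2, symmetric])
  have "\<xi> \<noteq> 0" using a[THEN conjunct1] by (rule contrapos_nn) simp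
  then show "(x, \<xi>) \<in> det_space A"
    unfolding det_space_def polyvector_fibre using l chart_pts[OF K] by simp
qed

lemmas det_space_nz = det_space_iff[THEN iffD1, THEN conjunct1]
lemmas det_space_eq = det_space_iff[THEN iffD1, THEN conjunct2]

lemma det_space_ev: "K \<in> A \<Longrightarrow> x \<in> fst K \<Longrightarrow> c \<noteq> 0 \<Longrightarrow> (x, c *\<^sub>C ev K x) \<in> det_space A"
  by (simp add: det_space_iff)

lemma det_space_pts: "q \<in> det_space A \<Longrightarrow> fst q \<in> pts"
  unfolding det_space_def by auto

lemma det_space_scale: "(x, \<xi>) \<in> det_space A \<Longrightarrow> c \<noteq> 0 \<Longrightarrow> (x, c *\<^sub>C \<xi>) \<in> det_space A"
proof -
  assume a: "(x, \<xi>) \<in> det_space A" "c \<noteq> 0"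
  have "x \<in> pts" using det_space_pts[OF a(1)] by simp
  then obtain K where K: "K \<in> A" "x \<in> fst K" using pts_chart by blast
  have "\<xi> (TM.vol K x) \<noteq> 0" "c *\<^sub>C \<xi> = c *\<^sub>C \<xi> (TM.vol K x) *\<^sub>C ev K x"
    using det_space_nz[OF K a(1)] arg_cong[OF det_space_eq[OF K a(1)], of "scaleC c"] by blast+
  then show ?thesis unfolding det_space_iff[OF K] using a(2) by (simp add: scaleC_scaleC ev_vol[OF K])
qed

lemma ex_det_point: "x \<in> pts \<Longrightarrow> \<exists>\<xi>. (x, \<xi>) \<in> det_space A"
  using pts_chart det_space_ev[of _ x 1] by (metis zero_neq_one)

section \<open>The atlas of det(TM)\<close>

abbreviation Spart :: "complex^'n option \<Rightarrow> complex^'n" where "Spart z \<equiv> \<chi> j. z $ Some j"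

lemma vec_option_eqI: "z $ None = w $ None \<Longrightarrow> (\<And>j. z $ Some j = w $ Some j) \<Longrightarrow> z = w"
  for z w :: "'a^'k::finite option"
  unfolding vec_eq_iff by (metis option.exhaust)

lemma dchart_image:
  assumes K: "K \<in> A"
  shows "snd (dchart K) ` ({q \<in> det_space A. fst q \<in> V} \<inter> fst (dchart K)) =
    {z. z $ None \<noteq> 0 \<and> Spart z \<in> snd K ` (fst K \<inter> V)}" (is "?L = ?R")
proof
  show "?L \<subseteq> ?R"
  proof
    fix z assume "z \<in> ?L"
    then obtain q where q: "z = snd (dchart K) q" "q \<in> det_space A" "fst q \<in> V" "fst q \<in> fst K"
      unfolding image_iff Bex_def Int_iff mem_Collect_eq fst_dchart by blast
    moreover have "Spart z = snd K (fst q)" by (simp add: q(1) vec_eq_iff)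
    ultimately show "z \<in> ?R" using det_space_nz[OF K q(4), of "snd q"] by auto
  qed
  show "?R \<subseteq> ?L"
  proof
    fix z assume "z \<in> ?R"
    then obtain x where x: "z $ None \<noteq> 0" "Spart z = snd K x" "x \<in> fst K" "x \<in> V" by auto
    have "snd (dchart K) (x, z $ None *\<^sub>C ev K x) = z"
      using x(2) ev_vol[OF K x(3)] by (intro vec_option_eqI) (simp_all add: vec_eq_iff)
    then show "z \<in> ?L" using det_space_ev[OF K x(3,1)] x fst_dchart[of _ K]
      by (intro image_eqI[of _ _ "(x, z $ None *\<^sub>C ev K x)"]) auto
  qed
qed

lemma dchart_inj: "K \<in> A \<Longrightarrow> inj_on (snd (dchart K)) (fst (dchart K))"
proof (rule inj_onI)
  fix p q assume K: "K \<in> A" and p: "p \<in> fst (dchart K)" and q: "q \<in> fst (dchart K)"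
    and eq: "snd (dchart K) p = snd (dchart K) q"
  have pk: "fst p \<in> fst K" "fst q \<in> fst K" "p \<in> det_space A" "q \<in> det_space A" using p q fst_dchart by auto
  have "snd K (fst p) $ j = snd K (fst q) $ j" for j
    using arg_cong[OF eq, of "\<lambda>z. z $ Some j"] by simp
  then have x: "fst p = fst q" using chart_inj[OF K] pk by (simp add: inj_on_def vec_eq_iff)
  have "snd p (TM.vol K (fst p)) = snd q (TM.vol K (fst q))"
    using arg_cong[OF eq, of "\<lambda>z. z $ None"] by simp
  then have "snd p (TM.vol K (fst p)) *\<^sub>C ev K (fst p) = snd q (TM.vol K (fst q)) *\<^sub>C ev K (fst q)"
    using x by simp
  moreover note det_space_eq[OF K pk(1), of "snd p"] det_space_eq[OF K pk(2), of "snd q"]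
  ultimately have "snd p = snd q" using pk(3,4) unfolding prod.collapse by metis
  then show "p = q" using x by (simp add: prod_eq_iff)
qed

lemma dchart_inv:
  assumes K: "K \<in> A" and z: "z $ None \<noteq> 0" "Spart z \<in> snd K ` fst K"
  shows "inv_into (fst (dchart K)) (snd (dchart K)) z = (pinv K (Spart z), z $ None *\<^sub>C ev K (pinv K (Spart z)))"
proof -
  obtain x where x: "Spart z = snd K x" "x \<in> fst K" using z by auto
  let ?q = "(x, z $ None *\<^sub>C ev K x)"
  have "snd (dchart K) ?q = z"
    using x ev_vol[OF K x(2)] by (intro vec_option_eqI) (simp_all add: vec_eq_iff)
  moreover have "?q \<in> fst (dchart K)" using fst_dchart det_space_ev[OF K x(2) z(1)] x by simp
  ultimately have "inv_into (fst (dchart K)) (snd (dchart K)) z = ?q"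
    using dchart_inj[OF K] inv_into_f_eq by metis
  then show ?thesis using x K by simp
qed

lemma continuous_Spart: "continuous_on S Spart"
  by (intro continuous_on_vec_lambda continuous_intros)

lemma open_dchart_image:
  assumes K: "K \<in> A" and V: "mopen V"
  shows "open (snd (dchart K) ` ({q \<in> det_space A. fst q \<in> V} \<inter> fst (dchart K)))"
proof -
  have "open (Spart -` (snd K ` (fst K \<inter> V)))"
    using open_vimage[OF open_chart_image[OF V K] continuous_Spart] .
  moreover have "open {z :: complex^'n option. z $ None \<noteq> 0}"
    using open_vimage_vec_nth[OF open_Compl[OF closed_singleton[of "0::complex"]], of "None :: 'n option"]
    by (simp add: vimage_def)
  ultimately have "open ({z :: complex^'n option. z $ None \<noteq> 0} \<inter> Spart -` (snd K ` (fst K \<inter> V)))"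
    by (rule open_Int[rotated])
  then show ?thesis unfolding dchart_image[OF K] by (simp add: vimage_def Collect_conj_eq)
qed

text \<open>This function is the Jacobian determinant of the change of coordinates.\<close>

lemma vol_change_hn:
  assumes K: "K \<in> A" "x \<in> fst K" and \<mu>: "\<mu> \<in> A" "x \<in> fst \<mu>"
  shows "hn x (\<lambda>y. TM.vol \<mu> y (\<lambda>i. dd K i y))"
proof -
  have "eventually (\<lambda>y. TM.vol \<mu> y (\<lambda>i. dd K i y) = det (\<chi> i j. dd K i y (xi \<mu> j))) (NH x)"
    using eventually_chart[OF K] dd_tangent[OF K(1)]
    by (auto elim!: eventually_mono simp: TM.vol_def)
  moreover have "hn x (\<lambda>y. det (\<chi> i j. dd K i y (xi \<mu> j)))"
    by (intro hn_det chart_pts[OF K] hn_dd(1)[OF K] hn_coord \<mu>)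
  ultimately show ?thesis using hn_cong by fast
qed

text \<open>A change of chart acts on the base coordinates as on \<open>M\<close> and multiplies the
  fibre coordinate by the Jacobian determinant, which depends holomorphically on the base
  point.\<close>

lemma holomorphic_det_atlas: "holomorphic_atlas (det_atlas A)"
proof -
  have 1: "open (snd (dchart K) ` (fst (dchart K)))" if "K \<in> A" for K
  proof -
    have "{q \<in> det_space A. fst q \<in> fst K} \<inter> fst (dchart K) = fst (dchart K)" by (auto simp: fst_dchart)
    with open_dchart_image[OF that mopen_chart[OF that]] show ?thesis by simp
  qed
  have int: "fst (dchart K) \<inter> fst (dchart \<mu>) = {q \<in> det_space A. fst q \<in> fst \<mu>} \<inter> fst (dchart K)" for K \<mu>
    by (auto simp: fst_dchart)
  have 2: "open (snd (dchart K) ` (fst (dchart K) \<inter> fst (dchart \<mu>)))" if "K \<in> A" "\<mu> \<in> A" for K \<mu>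
    unfolding int by (rule open_dchart_image[OF that(1) mopen_chart[OF that(2)]])
  have 3: "holomorphic_fun_on (\<lambda>z. snd (dchart \<mu>) (inv_into (fst (dchart K)) (snd (dchart K)) z) $ i)
      (snd (dchart K) ` (fst (dchart K) \<inter> fst (dchart \<mu>)))" if K: "K \<in> A" and \<mu>: "\<mu> \<in> A" for K \<mu> i
  proof -
    let ?R = "{z :: complex^'n option. z $ None \<noteq> 0 \<and> Spart z \<in> snd K ` (fst K \<inter> fst \<mu>)}"
    have R: "snd (dchart K) ` (fst (dchart K) \<inter> fst (dchart \<mu>)) = ?R"
      unfolding int by (rule dchart_image[OF K])
    have oR: "open ?R" using 2[OF K \<mu>] unfolding R .
    have inv: "inv_into (fst (dchart K)) (snd (dchart K)) z = (pinv K (Spart z), z $ None *\<^sub>C ev K (pinv K (Spart z)))"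
      if "z \<in> ?R" for z by (rule dchart_inv[OF K]) (use that in auto)
    have sp: "holomorphic_fun_on (\<lambda>z. h (Spart z)) ?R"
      if "holomorphic_fun_on h (snd K ` (fst K \<inter> fst \<mu>))" for h
      by (rule holomorphic_fun_on_compose[OF that holomorphic_fun_on_nth]) auto
    show ?thesis unfolding R
    proof (cases i)
      case (Some j)
      show "holomorphic_fun_on (\<lambda>z. snd (dchart \<mu>) (inv_into (fst (dchart K)) (snd (dchart K)) z) $ i) ?R"
        by (rule holomorphic_fun_on_cong[OF sp[OF transition[OF K \<mu>, of j]] oR]) (simp add: Some inv)
    next
      case None
      \<comment> \<open>The Jacobian determinant, the factor by which the fibre coordinate
        changes.\<close>
      let ?J = "\<lambda>y. TM.vol \<mu> y (\<lambda>i. dd K i y)"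
      have "mopen (fst K \<inter> fst \<mu>)" using mopen_chart K \<mu> by blast
      from holfun_iff[OF this, of ?J] vol_change_hn[OF K _ \<mu>]
      have "?J \<in> holomorphic_functions A (fst K \<inter> fst \<mu>)" by blast
      then have J: "holomorphic_fun_on (?J \<circ> pinv K) (snd K ` (fst K \<inter> fst \<mu>))"
        unfolding holomorphic_functions_def using K by (auto simp: case_prod_unfold)
      show "holomorphic_fun_on (\<lambda>z. snd (dchart \<mu>) (inv_into (fst (dchart K)) (snd (dchart K)) z) $ i) ?R"
      proof (rule holomorphic_fun_on_cong[OF holomorphic_fun_on_mult[OF holomorphic_fun_on_nth[of None] sp[OF J]] oR])
        fix z assume z: "z \<in> ?R"
        then obtain x where x: "x \<in> fst K" "x \<in> fst \<mu>" "Spart z = snd K x" by auto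
        have "pinv K (Spart z) = x" using x pinv[OF K] by simp
        then show "z $ None * (?J \<circ> pinv K) (Spart z) = snd (dchart \<mu>) (inv_into (fst (dchart K)) (snd (dchart K)) z) $ i"
          unfolding inv[OF z] None using vol_alt[OF \<mu> x(2)] by (simp add: ev_def)
      qed
    qed
  qed
  show ?thesis unfolding holomorphic_atlas_def det_atlas_eq
    unfolding case_prod_unfold ball_simps using dchart_inj 1 2 3 by blast
qed

end

sublocale base_atlas \<subseteq> dt: hol_atlas "det_atlas A"
  by unfold_locales (rule holomorphic_det_atlas)

context base_atlas
begin

section \<open>Functions and vectors on det(TM) over the base\<close>

lemma dchart_mem: "K \<in> A \<Longrightarrow> dchart K \<in> det_atlas A"
  unfolding det_atlas_eq by blast

lemma in_dchart: "(x, \<xi>) \<in> det_space A \<Longrightarrow> x \<in> fst K \<Longrightarrow> (x, \<xi>) \<in> fst (dchart K)"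
  using fst_dchart by simp

lemma dt_pts: "dt.pts = det_space A"
proof
  show "dt.pts \<subseteq> det_space A"
  proof
    fix q assume "q \<in> dt.pts"
    then obtain \<mu> where "\<mu> \<in> dchart ` A" "q \<in> fst \<mu>" using dt.pts_chart unfolding det_atlas_eq[symmetric] by blast
    then show "q \<in> det_space A" by (auto simp: fst_dchart)
  qed
  show "det_space A \<subseteq> dt.pts"
  proof
    fix q assume q: "q \<in> det_space A"
    obtain K where "K \<in> A" "fst q \<in> fst K" using pts_chart[OF det_space_pts[OF q]] by blast
    then show "q \<in> dt.pts" using dt.chart_pts[OF dchart_mem, of K q] fst_dchart[of q K] q by blast
  qed
qed

lemma dt_mopen: "mopen V \<Longrightarrow> dt.mopen {q \<in> det_space A. fst q \<in> V}"
  unfolding dt.mopen_iff dt_pts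
proof (intro conjI ballI)
  fix \<mu> assume V: "mopen V" and "\<mu> \<in> det_atlas A"
  then obtain K where "K \<in> A" "\<mu> = dchart K" unfolding det_atlas_eq by blast
  with open_dchart_image[OF _ V] show "open (snd \<mu> ` ({q \<in> det_space A. fst q \<in> V} \<inter> fst \<mu>))" by simp
qed auto

lemma eventually_dt:
  assumes q: "(x, \<xi>) \<in> det_space A" and P: "eventually P (NH x)"
  shows "eventually (\<lambda>q. q \<in> det_space A \<and> P (fst q)) (dt.NH (x, \<xi>))"
proof -
  obtain V where V: "mopen V" "x \<in> V" "\<forall>y\<in>V. P y"
    using P eventually_NH det_space_pts[OF q] by auto
  show ?thesis
    using dt.eventually_mopen[OF dt_mopen[OF V(1)], of "(x, \<xi>)"] q V by (auto elim!: eventually_mono)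
qed

text \<open>A function on the base is recovered from its pullback along a local section of
  \<open>det(TM)\<close>, so holomorphy passes in both directions.\<close>

lemma
  assumes K: "K \<in> A" "x \<in> fst K" and q: "(x, \<xi>) \<in> det_space A"
  shows hn_fst: "dt.hn (x, \<xi>) (\<lambda>q. f (fst q)) \<longleftrightarrow> hn x f"
    and tangent_fst: "\<And>v. v \<in> tangent_space (det_atlas A) (x, \<xi>) \<Longrightarrow> hn x f \<Longrightarrow>
      v (\<lambda>q. f (fst q)) = (\<Sum>j\<in>UNIV. v (dt.xi (dchart K) (Some j)) * dd K j x f)"
proof -
  note dk = dchart_mem[OF K(1)] in_dchart[OF q K(2)]
  have main: "dt.hn (x, \<xi>) (\<lambda>q. f (fst q)) \<and> (\<forall>v\<in>tangent_space (det_atlas A) (x, \<xi>).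
      v (\<lambda>q. f (fst q)) = (\<Sum>j\<in>UNIV. v (dt.xi (dchart K) (Some j)) * dd K j x f))" if f: "hn x f"
  proof -
    obtain S where S: "open S" "snd K x \<in> S" "holomorphic_fun_on (f \<circ> pinv K) S"
      using f unfolding hn_iff[OF K] by blast
    let ?h = "\<lambda>q. (f \<circ> pinv K) (\<chi> j. snd K (fst q) $ j)"
    have e: "eventually (\<lambda>q. f (fst q) = ?h q) (dt.NH (x, \<xi>))"
      using eventually_dt[OF q eventually_chart[OF K]] by eventually_elim (simp add: pinv[OF K(1)])
    have x: "(x, \<xi>) \<in> dt.pts" unfolding dt_pts by (rule q)
    have c: "dt.hn (x, \<xi>) (\<lambda>q. snd K (fst q) $ j)" for j
      using dt.hn_coord[OF dk, of "Some j"] by simp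
    have "dt.hn (x, \<xi>) ?h" by (rule dt.hn_compose[OF x S(3,1) _ c]) (use S(2) in simp)
    moreover have "v (\<lambda>q. f (fst q)) = (\<Sum>j\<in>UNIV. v (dt.xi (dchart K) (Some j)) * dd K j x f)"
      if v: "v \<in> tangent_space (det_atlas A) (x, \<xi>)" for v
    proof -
      have "v ?h = (\<Sum>j\<in>UNIV. partial j (f \<circ> pinv K) (\<chi> j. snd K (fst (x, \<xi>)) $ j) * v (\<lambda>q. snd K (fst q) $ j))"
        by (rule dt.tangent_compose[OF v S(3,1) _ c]) (use S(2) in simp)
      then show ?thesis unfolding dt.tangent_cong[OF v e] using f by (simp add: dd_def mult.commute)
    qed
    ultimately show ?thesis unfolding dt.hn_cong[OF e] by blast
  qed
  have "hn x f" if "dt.hn (x, \<xi>) (\<lambda>q. f (fst q))"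
  proof -
    from that obtain S where S: "open S" "snd (dchart K) (x, \<xi>) \<in> S"
      "holomorphic_fun_on ((\<lambda>q. f (fst q)) \<circ> dt.pinv (dchart K)) S"
      unfolding dt.hn_iff[OF dk] by blast
    let ?F = "(\<lambda>q. f (fst q)) \<circ> dt.pinv (dchart K)"
    let ?c = "\<xi> (TM.vol K x)"
    have c: "?c \<noteq> 0" by (rule det_space_nz[OF K q])
    \<comment> \<open>The coordinates of the section whose fibre coordinate is frozen at that of
      \<open>\<xi>\<close>.\<close>
    let ?g = "\<lambda>i y. case i of None \<Rightarrow> ?c | Some j \<Rightarrow> snd K y $ j"
    have g: "hn x (?g i)" for i
      by (cases i) (simp_all add: hn_const[OF chart_pts[OF K]] hn_coord[OF K])
    have "(\<chi> i. ?g i x) = snd (dchart K) (x, \<xi>)" by (rule vec_option_eqI) simp_all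
    then have "hn x (\<lambda>y. ?F (\<chi> i. ?g i y))"
      using hn_compose[OF chart_pts[OF K] S(3,1) _ g] S(2) by simp
    moreover have "eventually (\<lambda>y. ?F (\<chi> i. ?g i y) = f y) (NH x)"
      using eventually_chart[OF K]
    proof eventually_elim
      case (elim y)
      have "dt.pinv (dchart K) (\<chi> i. ?g i y) = (pinv K (snd K y), ?c *\<^sub>C ev K (pinv K (snd K y)))"
        using dchart_inv[OF K(1), of "\<chi> i. ?g i y"] c elim by simp
      then show ?case using pinv[OF K(1) elim] by simp
    qed
    ultimately show ?thesis using hn_cong by fast
  qed
  then show "dt.hn (x, \<xi>) (\<lambda>q. f (fst q)) \<longleftrightarrow> hn x f" using main by blast
  show "v (\<lambda>q. f (fst q)) = (\<Sum>j\<in>UNIV. v (dt.xi (dchart K) (Some j)) * dd K j x f)"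
    if "v \<in> tangent_space (det_atlas A) (x, \<xi>)" "hn x f" for v using main that by blast
qed

section \<open>The bundle \<open>E\<close>\<close>

text \<open>In the chart of \<open>det(TM)\<close> induced by \<open>K\<close>, with fibre coordinate \<open>\<tau>\<close>, the invariant fields are spanned
  by \<open>\<tau> \<partial>/\<partial>\<tau>\<close> (index \<^term>\<open>None\<close>) and the coordinate fields of the base.\<close>

definition fE :: "'m set \<times> ('m \<Rightarrow> complex^'n) \<Rightarrow> 'n option \<Rightarrow> 'm \<Rightarrow> ('m, 'n) atiyah" where
  "fE K a x = (\<lambda>\<xi>. if (x, \<xi>) \<in> det_space A
     then (case a of None \<Rightarrow> \<xi> (TM.vol K x) | Some j \<Rightarrow> 1) *\<^sub>C dt.dd (dchart K) a (x, \<xi>) else 0)"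

text \<open>Components are read at \<open>ev K x\<close>, where the fibre coordinate is 1, so that
  the Euler component carries no factor \<open>\<tau>\<close>.\<close>

definition cE :: "'m set \<times> ('m \<Rightarrow> complex^'n) \<Rightarrow> 'n option \<Rightarrow> 'm \<Rightarrow> ('m, 'n) atiyah \<Rightarrow> complex" where
  "cE K a x e = e (ev K x) (dt.xi (dchart K) a)"

lemma sum_option: "(\<Sum>a\<in>UNIV. f a) = f None + (\<Sum>j\<in>UNIV. f (Some j))"
  for f :: "'k::finite option \<Rightarrow> 'a::comm_monoid_add"
  unfolding UNIV_option_conv by (subst sum.insert) (auto simp: sum.reindex)

lemma ev_det_space: "K \<in> A \<Longrightarrow> x \<in> fst K \<Longrightarrow> (x, ev K x) \<in> det_space A"
  using det_space_ev[of K x 1] by simp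

lemma comb_fE:
  assumes "(x, \<xi>) \<in> det_space A"
  shows "(\<Sum>a\<in>UNIV. c a *\<^sub>C fE K a x) \<xi> f = c None * \<xi> (TM.vol K x) * dt.dd (dchart K) None (x, \<xi>) f
    + (\<Sum>j\<in>UNIV. c (Some j) * dt.dd (dchart K) (Some j) (x, \<xi>) f)"
  using assms by (simp add: sum_fun_apply fE_def sum_option mult.assoc)

lemma comb_fE_tangent:
  assumes K: "K \<in> A" "x \<in> fst K" and q: "(x, \<xi>) \<in> det_space A"
  shows "(\<Sum>a\<in>UNIV. c a *\<^sub>C fE K a x) \<xi> \<in> tangent_space (det_atlas A) (x, \<xi>)"
    and "(\<Sum>a\<in>UNIV. c a *\<^sub>C fE K a x) \<xi> (dt.xi (dchart K) a) =
      (case a of None \<Rightarrow> c None * \<xi> (TM.vol K x) | Some j \<Rightarrow> c (Some j))"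
proof -
  note dk = dchart_mem[OF K(1)] in_dchart[OF q K(2)]
  show "(\<Sum>a\<in>UNIV. c a *\<^sub>C fE K a x) \<xi> \<in> tangent_space (det_atlas A) (x, \<xi>)"
    unfolding dt.tangent_iff[OF dk]
    by (intro exI[of _ "\<lambda>a. case a of None \<Rightarrow> c None * \<xi> (TM.vol K x) | Some j \<Rightarrow> c (Some j)"])
      (unfold comb_fE[OF q], simp add: sum_option)
  show "(\<Sum>a\<in>UNIV. c a *\<^sub>C fE K a x) \<xi> (dt.xi (dchart K) a) =
      (case a of None \<Rightarrow> c None * \<xi> (TM.vol K x) | Some j \<Rightarrow> c (Some j))"
    unfolding comb_fE[OF q] dt.dd_coord[OF dk] by (cases a) (simp_all add: sum_delta_mult)
qed

text \<open>In a chart the scaling multiplies the fibre coordinate by \<open>c\<close> and leaves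
  the base coordinates unchanged.\<close>

lemma scale_map:
  assumes K: "K \<in> A" "x \<in> fst K" and q: "(x, \<xi>) \<in> det_space A" and c: "c \<noteq> 0"
    and v: "v \<in> tangent_space (det_atlas A) (x, \<xi>)"
  shows "pushforward (det_atlas A) (\<lambda>(y, \<zeta>). (y, c *\<^sub>C \<zeta>)) (x, \<xi>) v \<in> tangent_space (det_atlas A) (x, c *\<^sub>C \<xi>)"
    and "pushforward (det_atlas A) (\<lambda>(y, \<zeta>). (y, c *\<^sub>C \<zeta>)) (x, \<xi>) v (dt.xi (dchart K) a) =
      (case a of None \<Rightarrow> c | Some j \<Rightarrow> 1) * v (dt.xi (dchart K) a)"
proof -
  note dk = dchart_mem[OF K(1)] in_dchart[OF q K(2)]
  note q' = det_space_scale[OF q c]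
  note dk' = dchart_mem[OF K(1)] in_dchart[OF q' K(2)]
  let ?F = "\<lambda>(y, \<zeta>). (y, c *\<^sub>C \<zeta>)"
  have F: "(\<lambda>q. snd (dchart K) (?F q) $ a) = (\<lambda>q. (case a of None \<Rightarrow> c | Some j \<Rightarrow> 1) * snd (dchart K) q $ a)" for a
    by (cases a) (auto simp: case_prod_unfold)
  have h: "dt.hn (x, \<xi>) (\<lambda>q. snd (dchart K) (?F q) $ a)" for a
    unfolding F by (intro dt.hn_mult dt.hn_const dt.hn_coord[OF dk]) (simp add: dt_pts q)
  have "eventually (\<lambda>q. ?F q \<in> fst (dchart K)) (dt.NH (x, \<xi>))"
    using eventually_dt[OF q eventually_chart[OF K]]
  proof eventually_elim
    case (elim p) then show ?case using det_space_scale[of "fst p" "snd p" c] c by (simp add: fst_dchart case_prod_unfold)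
  qed
  show "pushforward (det_atlas A) ?F (x, \<xi>) v \<in> tangent_space (det_atlas A) (x, c *\<^sub>C \<xi>)"
    using pushforward_tangent(1)[OF dt.hol_atlas_axioms dt.hol_atlas_axioms dchart_mem[OF K(1)] _ h _ v] dk'(2) 
      \<open>eventually (\<lambda>q. ?F q \<in> fst (dchart K)) (dt.NH (x, \<xi>))\<close> by simp
  have "pushforward (det_atlas A) ?F (x, \<xi>) v (dt.xi (dchart K) a) =
      (\<Sum>j\<in>UNIV. v (\<lambda>q. snd (dchart K) (?F q) $ j) * dt.dd (dchart K) j (x, c *\<^sub>C \<xi>) (dt.xi (dchart K) a))"
    using pushforward_tangent(2)[OF dt.hol_atlas_axioms dt.hol_atlas_axioms dchart_mem[OF K(1)] _ h _ v] dk'(2) 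
      \<open>eventually (\<lambda>q. ?F q \<in> fst (dchart K)) (dt.NH (x, \<xi>))\<close> by simp
  also have "\<dots> = v (\<lambda>q. snd (dchart K) (?F q) $ a)"
    unfolding dt.dd_coord[OF dk'] sum_delta_mult ..
  also have "\<dots> = (case a of None \<Rightarrow> c | Some j \<Rightarrow> 1) * v (dt.xi (dchart K) a)"
    unfolding F by (rule dt.tangent_cmult[OF v dt.hn_coord[OF dk]])
  finally show "pushforward (det_atlas A) ?F (x, \<xi>) v (dt.xi (dchart K) a) =
      (case a of None \<Rightarrow> c | Some j \<Rightarrow> 1) * v (dt.xi (dchart K) a)" .
qed

text \<open>Scaling acts transitively on the fibre of \<open>det(TM)\<close>, so an invariant field
  along the fibre is determined by its value at \<open>ev K x\<close>, where all n + 1 components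
  are free.\<close>

lemma atiyah_fibre_eq:
  assumes K: "K \<in> A" "x \<in> fst K"
  shows "atiyah_fibre A x = range (\<lambda>c. \<Sum>a\<in>UNIV. c a *\<^sub>C fE K a x)"
proof
  show "range (\<lambda>c. \<Sum>a\<in>UNIV. c a *\<^sub>C fE K a x) \<subseteq> atiyah_fibre A x"
  proof (rule image_subsetI)
    fix c :: "'n option \<Rightarrow> complex"
    let ?e = "\<Sum>a\<in>UNIV. c a *\<^sub>C fE K a x"
    have "?e (b *\<^sub>C \<xi>) = pushforward (det_atlas A) (\<lambda>(y, \<zeta>). (y, b *\<^sub>C \<zeta>)) (x, \<xi>) (?e \<xi>)"
      if q: "(x, \<xi>) \<in> det_space A" and b: "b \<noteq> 0" for \<xi> b
    proof (rule dt.tangent_eqI)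
      note q' = det_space_scale[OF q b]
      show "dchart K \<in> det_atlas A" "(x, b *\<^sub>C \<xi>) \<in> fst (dchart K)"
        by (rule dchart_mem[OF K(1)] in_dchart[OF q' K(2)])+
      note T = comb_fE_tangent[OF K q] comb_fE_tangent[OF K q']
      show "?e (b *\<^sub>C \<xi>) \<in> tangent_space (det_atlas A) (x, b *\<^sub>C \<xi>)" by (rule T)
      show "pushforward (det_atlas A) (\<lambda>(y, \<zeta>). (y, b *\<^sub>C \<zeta>)) (x, \<xi>) (?e \<xi>) \<in> tangent_space (det_atlas A) (x, b *\<^sub>C \<xi>)"
        by (rule scale_map(1)[OF K q b T(1)])
      show "?e (b *\<^sub>C \<xi>) (dt.xi (dchart K) i) =
          pushforward (det_atlas A) (\<lambda>(y, \<zeta>). (y, b *\<^sub>C \<zeta>)) (x, \<xi>) (?e \<xi>) (dt.xi (dchart K) i)" for i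
        unfolding scale_map(2)[OF K q b T(1)] T(2) T(4) by (cases i) simp_all
    qed
    moreover have "?e \<xi> = 0" if "(x, \<xi>) \<notin> det_space A" for \<xi>
      using that by (simp add: sum_fun_apply fE_def fun_eq_iff)
    ultimately show "?e \<in> atiyah_fibre A x"
      unfolding atiyah_fibre_def using comb_fE_tangent(1)[OF K] by blast
  qed
  show "atiyah_fibre A x \<subseteq> range (\<lambda>c. \<Sum>a\<in>UNIV. c a *\<^sub>C fE K a x)"
  proof
    fix e assume e: "e \<in> atiyah_fibre A x"
    then have e0: "e \<xi> = 0" if "(x, \<xi>) \<notin> det_space A" for \<xi> using that unfolding atiyah_fibre_def by blast
    have et: "e \<xi> \<in> tangent_space (det_atlas A) (x, \<xi>)" 
      and es: "b \<noteq> 0 \<Longrightarrow> e (b *\<^sub>C \<xi>) = pushforward (det_atlas A) (\<lambda>(y, \<zeta>). (y, b *\<^sub>C \<zeta>)) (x, \<xi>) (e \<xi>)"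
      if "(x, \<xi>) \<in> det_space A" for \<xi> b using that e unfolding atiyah_fibre_def by blast+
    have "e = (\<Sum>a\<in>UNIV. cE K a x e *\<^sub>C fE K a x)"
    proof
      fix \<xi>
      show "e \<xi> = (\<Sum>a\<in>UNIV. cE K a x e *\<^sub>C fE K a x) \<xi>"
      proof (cases "(x, \<xi>) \<in> det_space A")
        case True
        note q0 = ev_det_space[OF K]
        let ?t = "\<xi> (TM.vol K x)"
        have nz: "?t \<noteq> 0" by (rule det_space_nz[OF K True])
        have \<xi>: "\<xi> = ?t *\<^sub>C ev K x" by (rule det_space_eq[OF K True])
        show ?thesis
        proof (rule dt.tangent_eqI)
          show "dchart K \<in> det_atlas A" "(x, \<xi>) \<in> fst (dchart K)"
            by (rule dchart_mem[OF K(1)] in_dchart[OF True K(2)])+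
          show "e \<xi> \<in> tangent_space (det_atlas A) (x, \<xi>)" by (rule et[OF True])
          show "(\<Sum>a\<in>UNIV. cE K a x e *\<^sub>C fE K a x) \<xi> \<in> tangent_space (det_atlas A) (x, \<xi>)"
            by (rule comb_fE_tangent(1)[OF K True])
          fix i
          have "e \<xi> (dt.xi (dchart K) i) = e (?t *\<^sub>C ev K x) (dt.xi (dchart K) i)" using \<xi> by simp
          also have "\<dots> = (case i of None \<Rightarrow> ?t | Some j \<Rightarrow> 1) * cE K i x e"
            unfolding es[OF q0 nz] cE_def by (rule scale_map(2)[OF K q0 nz et[OF q0]])
          also have "\<dots> = (\<Sum>a\<in>UNIV. cE K a x e *\<^sub>C fE K a x) \<xi> (dt.xi (dchart K) i)"
            unfolding comb_fE_tangent(2)[OF K True] by (cases i) simp_all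
          finally show "e \<xi> (dt.xi (dchart K) i) = (\<Sum>a\<in>UNIV. cE K a x e *\<^sub>C fE K a x) \<xi> (dt.xi (dchart K) i)" .
        qed
      next
        case False then show ?thesis using e0[OF False] by (simp add: sum_fun_apply fE_def fun_eq_iff)
      qed
    qed
    show "e \<in> range (\<lambda>c. \<Sum>a\<in>UNIV. c a *\<^sub>C fE K a x)" by (rule range_eqI) fact
  qed
qed

lemma cE_comb:
  assumes K: "K \<in> A" "x \<in> fst K"
  shows "cE K a x (\<Sum>b\<in>UNIV. c b *\<^sub>C fE K b x) = c a"
  unfolding cE_def comb_fE_tangent(2)[OF K ev_det_space[OF K]] ev_vol[OF K] by (cases a) simp_all

lemma atiyah_at:
  assumes K: "K \<in> A" "x \<in> fst K" and q: "(x, \<xi>) \<in> det_space A" and e: "e \<in> atiyah_fibre A x"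
  shows "e \<xi> \<in> tangent_space (det_atlas A) (x, \<xi>)"
    and "e \<xi> (dt.xi (dchart K) a) = (case a of None \<Rightarrow> \<xi> (TM.vol K x) | Some j \<Rightarrow> 1) * cE K a x e"
proof -
  obtain c where c: "e = (\<Sum>a\<in>UNIV. c a *\<^sub>C fE K a x)" using e unfolding atiyah_fibre_eq[OF K] by blast
  show "e \<xi> \<in> tangent_space (det_atlas A) (x, \<xi>)" unfolding c by (rule comb_fE_tangent(1)[OF K q])
  show "e \<xi> (dt.xi (dchart K) a) = (case a of None \<Rightarrow> \<xi> (TM.vol K x) | Some j \<Rightarrow> 1) * cE K a x e"
    unfolding c cE_comb[OF K] comb_fE_tangent(2)[OF K q] by (cases a) simp_all
qed

lemma atiyah_anchor_coords:
  assumes K: "K \<in> A" "x \<in> fst K" and e: "e \<in> atiyah_fibre A x"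
  shows "atiyah_anchor A x e f = (\<Sum>j\<in>UNIV. cE K (Some j) x e * dd K j x f)"
proof -
  define \<xi> where "\<xi> = (SOME \<xi>. (x, \<xi>) \<in> det_space A)"
  have q: "(x, \<xi>) \<in> det_space A" unfolding \<xi>_def by (rule someI_ex[OF ex_det_point[OF chart_pts[OF K]]])
  note dk = dchart_mem[OF K(1)] in_dchart[OF q K(2)]
  have h: "dt.hn (x, \<xi>) (\<lambda>q. snd K (fst q) $ j)" for j using dt.hn_coord[OF dk, of "Some j"] by simp
  have "eventually (\<lambda>q. fst q \<in> fst K) (dt.NH (x, \<xi>))"
    using eventually_dt[OF q eventually_chart[OF K]] by eventually_elim simp
  with pushforward_tangent(2)[OF dt.hol_atlas_axioms hol_atlas_axioms K(1) _ h _ atiyah_at(1)[OF K q e]]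
  have "pushforward A fst (x, \<xi>) (e \<xi>) f = (\<Sum>j\<in>UNIV. e \<xi> (\<lambda>q. snd K (fst q) $ j) * dd K j x f)"
    using K(2) by simp
  then show ?thesis unfolding atiyah_anchor_def Let_def \<xi>_def[symmetric]
    using atiyah_at(2)[OF K q e, of "Some _"] by simp
qed

lemma atiyah_base:
  assumes K: "K \<in> A" "x \<in> fst K" and q: "(x, \<xi>) \<in> det_space A" and e: "e \<in> atiyah_fibre A x" and f: "hn x f"
  shows "e \<xi> (\<lambda>q. f (fst q)) = atiyah_anchor A x e f"
  unfolding tangent_fst[OF K q atiyah_at(1)[OF K q e] f] atiyah_anchor_coords[OF K e]
  by (simp add: atiyah_at(2)[OF K q e, of "Some _", simplified])

text \<open>The fibre coordinate is holomorphic without zeros, so it can be multiplied in and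
  divided out. It occurs as a factor in the Euler component of an invariant field.\<close>

lemma hn_tau:
  assumes K: "K \<in> A" "x \<in> fst K" and q: "(x, \<xi>) \<in> det_space A"
  shows "dt.hn (x, \<xi>) (\<lambda>q. snd q (TM.vol K (fst q)) * f (fst q)) \<longleftrightarrow> hn x f"
proof
  note dk = dchart_mem[OF K(1)] in_dchart[OF q K(2)]
  have \<tau>: "dt.hn (x, \<xi>) (\<lambda>q. snd q (TM.vol K (fst q)))" using dt.hn_coord[OF dk, of None] by simp
  show "dt.hn (x, \<xi>) (\<lambda>q. snd q (TM.vol K (fst q)) * f (fst q))" if "hn x f"
    using dt.hn_mult[OF \<tau>] hn_fst[OF K q] that by blast
  assume h: "dt.hn (x, \<xi>) (\<lambda>q. snd q (TM.vol K (fst q)) * f (fst q))"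
  have "dt.hn (x, \<xi>) (\<lambda>q. inverse (snd q (TM.vol K (fst q))))"
    by (rule dt.hn_compose1[of inverse "- {0}", OF _ _ _ \<tau>])
      (use det_space_nz[OF K q] in \<open>auto intro!: holomorphic_intros\<close>)
  from dt.hn_mult[OF this h] have "dt.hn (x, \<xi>) (\<lambda>q. inverse (snd q (TM.vol K (fst q))) * (snd q (TM.vol K (fst q)) * f (fst q)))" .
  moreover have "eventually (\<lambda>q. inverse (snd q (TM.vol K (fst q))) * (snd q (TM.vol K (fst q)) * f (fst q)) = f (fst q)) (dt.NH (x, \<xi>))"
    using eventually_dt[OF q eventually_chart[OF K]]
  proof eventually_elim
    case (elim p)
    then have "snd p (TM.vol K (fst p)) \<noteq> 0" using det_space_nz[OF K(1), of "fst p" "snd p"] by simp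
    then show ?case by simp
  qed
  ultimately have "dt.hn (x, \<xi>) (\<lambda>q. f (fst q))" using dt.hn_cong by fast
  then show "hn x f" using hn_fst[OF K q] by blast
qed

lemma invariant_coords:
  assumes V: "mopen V" "\<And>y. y \<in> V \<Longrightarrow> s y \<in> atiyah_fibre A y" and x: "x \<in> V" and K: "K \<in> A" "x \<in> fst K"
    and q: "(x, \<xi>) \<in> det_space A"
  shows "eventually (\<lambda>p. p \<in> det_space A \<and> fst p \<in> V \<and> invariant_field s p (dt.xi (dchart K) a) =
      (case a of None \<Rightarrow> snd p (TM.vol K (fst p)) | Some j \<Rightarrow> 1) * cE K a (fst p) (s (fst p))) (dt.NH (x, \<xi>))"
  using eventually_dt[OF q eventually_chart[OF K]] eventually_dt[OF q eventually_mopen[OF V(1) x]]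
proof eventually_elim
  case (elim p)
  then have "(fst p, snd p) \<in> det_space A" by simp
  from atiyah_at(2)[OF K(1) _ this V(2)] elim show ?case by (simp add: invariant_field_def case_prod_unfold)
qed

text \<open>In the chart of \<open>det(TM)\<close> the components of an invariant field are
  functions of the base point, except that the one along the fibre carries the factor
  \<open>\<tau>\<close>; \<open>hn_fst\<close> and \<open>hn_tau\<close> handle the two
  kinds.\<close>

lemma atiyah_sections_iff:
  assumes V: "mopen V"
  shows "s \<in> atiyah_sections A V \<longleftrightarrow> (\<forall>x\<in>V. s x \<in> atiyah_fibre A x) \<and>
    (\<forall>K\<in>A. \<forall>a. \<forall>x\<in>V \<inter> fst K. hn x (\<lambda>y. cE K a y (s y)))"
proof (cases "\<forall>x\<in>V. s x \<in> atiyah_fibre A x")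
  case True
  let ?V = "{(x, \<xi>) \<in> det_space A. x \<in> V}"
  have V': "?V = {q \<in> det_space A. fst q \<in> V}" by auto
  have o: "dt.mopen ?V" unfolding V' by (rule dt_mopen[OF V])
  have eq: "dt.hn (x, \<xi>) (\<lambda>p. invariant_field s p (dt.xi (dchart K) a)) \<longleftrightarrow> hn x (\<lambda>y. cE K a y (s y))"
    if q: "(x, \<xi>) \<in> det_space A" and x: "x \<in> V" and K: "K \<in> A" "x \<in> fst K" for x \<xi> K a
  proof -
    have "dt.hn (x, \<xi>) (\<lambda>p. invariant_field s p (dt.xi (dchart K) a)) \<longleftrightarrow>
      dt.hn (x, \<xi>) (\<lambda>p. (case a of None \<Rightarrow> snd p (TM.vol K (fst p)) | Some j \<Rightarrow> 1) * cE K a (fst p) (s (fst p)))"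
      by (rule dt.hn_cong, rule eventually_mono[OF invariant_coords[OF V _ x K q]]) (use True in auto)
    then show ?thesis
      using hn_tau[OF K q, of "\<lambda>y. cE K a y (s y)"] hn_fst[OF K q, of "\<lambda>y. cE K a y (s y)"] by (cases a) simp_all
  qed
  have tan: "invariant_field s p \<in> tangent_space (det_atlas A) p" if p: "p \<in> ?V" for p
  proof -
    obtain x \<xi> where p': "p = (x, \<xi>)" by (cases p)
    then have "x \<in> pts" using p det_space_pts[of p] by simp
    then obtain K where "K \<in> A" "x \<in> fst K" using pts_chart by blast
    from atiyah_at(1)[OF this, of \<xi> "s x"] True p show ?thesis unfolding p' invariant_field_def by auto
  qed
  have "invariant_field s \<in> vector_fields (det_atlas A) ?V \<longleftrightarrow>
      (\<forall>\<mu>\<in>det_atlas A. \<forall>i. \<forall>p\<in>?V \<inter> fst \<mu>. dt.hn p (\<lambda>y. invariant_field s y (dt.xi \<mu> i)))"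
    unfolding dt.vector_fields_iff[OF o] using tan by simp
  also have "\<dots> \<longleftrightarrow> (\<forall>K\<in>A. \<forall>a. \<forall>x\<in>V \<inter> fst K. hn x (\<lambda>y. cE K a y (s y)))"
    unfolding det_atlas_eq ball_simps
  proof (intro ball_cong refl iff_allI iffI ballI)
    fix K a x assume K: "K \<in> A" and h: "\<forall>p\<in>?V \<inter> fst (dchart K). holomorphic_near (dchart ` A) p (\<lambda>y. invariant_field s y (dt.xi (dchart K) a))"
      and x: "x \<in> V \<inter> fst K"
    have q: "(x, ev K x) \<in> det_space A" using ev_det_space[OF K] x by blast
    then show "hn x (\<lambda>y. cE K a y (s y))"
      using h[unfolded det_atlas_eq[symmetric], rule_format, of "(x, ev K x)"] eq[OF q _ K] x in_dchart[OF q] by auto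
  next
    fix K a p assume K: "K \<in> A" and h: "\<forall>x\<in>V \<inter> fst K. hn x (\<lambda>y. cE K a y (s y))" and p: "p \<in> ?V \<inter> fst (dchart K)"
    obtain x \<xi> where p': "p = (x, \<xi>)" by (cases p)
    then have "(x, \<xi>) \<in> det_space A" "x \<in> V" "x \<in> fst K" using p fst_dchart[of p] by auto
    then show "holomorphic_near (dchart ` A) p (\<lambda>y. invariant_field s y (dt.xi (dchart K) a))"
      unfolding p' det_atlas_eq[symmetric] using h eq[OF _ _ K] by blast
  qed
  finally show ?thesis unfolding atiyah_sections_def using True by simp
qed (auto simp: atiyah_sections_def)

section \<open>Frame, anchor and bracket of E\<close>

lemma fE_fibre: "K \<in> A \<Longrightarrow> x \<in> fst K \<Longrightarrow> fE K a x \<in> atiyah_fibre A x"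
proof -
  assume K: "K \<in> A" "x \<in> fst K"
  have "fE K a x = (\<Sum>b\<in>UNIV. (if b = a then 1 else 0) *\<^sub>C fE K b x)"
    by (simp add: if_distrib[of "\<lambda>x. x *\<^sub>C _"] cong: if_cong)
  show ?thesis unfolding atiyah_fibre_eq[OF K] by (rule range_eqI) fact
qed

lemma fE_section:
  assumes K: "K \<in> A"
  shows "fE K a \<in> atiyah_sections A (fst K)"
proof -
  let ?V = "{(x, \<xi>) \<in> det_space A. x \<in> fst K}"
  have V': "?V = {q \<in> det_space A. fst q \<in> fst K}" by auto
  have o: "dt.mopen ?V" unfolding V' by (rule dt_mopen[OF mopen_chart[OF K]])
  have tan: "invariant_field (fE K a) p \<in> tangent_space (det_atlas A) p" if p: "p \<in> ?V" for p
    using p atiyah_at(1)[OF K _ _ fE_fibre[OF K]] unfolding invariant_field_def by auto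
  have h: "dt.hn p (\<lambda>y. invariant_field (fE K a) y (dt.xi \<mu> i))" if \<mu>: "\<mu> \<in> det_atlas A" and p: "p \<in> ?V \<inter> fst \<mu>" for \<mu> p i
  proof -
    obtain x \<xi> where p': "p = (x, \<xi>)" by (cases p)
    then have q: "(x, \<xi>) \<in> det_space A" and x: "x \<in> fst K" using p by auto
    note dk = dchart_mem[OF K] in_dchart[OF q x]
    have "eventually (\<lambda>q. invariant_field (fE K a) q (dt.xi \<mu> i) =
        (case a of None \<Rightarrow> snd q (TM.vol K (fst q)) | Some j \<Rightarrow> 1) * dt.dd (dchart K) a q (dt.xi \<mu> i)) (dt.NH (x, \<xi>))"
      using eventually_dt[OF q eventually_chart[OF K x]]
      by eventually_elim (auto simp: invariant_field_def fE_def case_prod_unfold split: option.split)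
    moreover have "dt.hn (x, \<xi>) (\<lambda>q. (case a of None \<Rightarrow> snd q (TM.vol K (fst q)) | Some j \<Rightarrow> 1) * dt.dd (dchart K) a q (dt.xi \<mu> i))"
    proof (rule dt.hn_mult)
      show "dt.hn (x, \<xi>) (\<lambda>q. dt.dd (dchart K) a q (dt.xi \<mu> i))"
        using p by (intro dt.hn_dd(1)[OF dk] dt.hn_coord[OF \<mu>]) (simp add: p')
      show "dt.hn (x, \<xi>) (\<lambda>q. case a of None \<Rightarrow> snd q (TM.vol K (fst q)) | Some j \<Rightarrow> 1)"
        using dt.hn_coord[OF dk, of None] dt.hn_const[of "(x, \<xi>)" 1] q by (cases a) (simp_all add: dt_pts)
    qed
    ultimately show ?thesis unfolding p' using dt.hn_cong by fast
  qed
  show ?thesis unfolding atiyah_sections_def dt.vector_fields_iff[OF o]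
    using tan h fE_fibre[OF K] by blast
qed

lemma anchor_fE:
  assumes K: "K \<in> A" "x \<in> fst K"
  shows "atiyah_anchor A x (fE K a x) f = (case a of None \<Rightarrow> 0 | Some j \<Rightarrow> dd K j x f)"
proof -
  have e: "fE K a x = (\<Sum>b\<in>UNIV. (if b = a then 1 else 0) *\<^sub>C fE K b x)"
    by (simp add: if_distrib[of "\<lambda>x. x *\<^sub>C _"] cong: if_cong)
  have "cE K (Some j) x (fE K a x) = (if Some j = a then 1 else 0)" for j
    by (subst e) (rule cE_comb[OF K])
  then show ?thesis unfolding atiyah_anchor_coords[OF K fE_fibre[OF K]]
    by (cases a) (simp_all add: sum_delta_mult)
qed

text \<open>The fibre component of an invariant field is \<open>\<tau>\<close> times a function of
  the base. Differentiating \<open>\<tau>\<close> adds the product of the two Euler coordinates,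
  which is symmetric in the two sections and cancels in the bracket.\<close>

lemma bracket_E:
  assumes K: "K \<in> A" "x \<in> fst K" and s: "mopen V" "x \<in> V" "s \<in> atiyah_sections A V" "t \<in> atiyah_sections A V"
  shows "atiyah_bracket A s t x = (\<Sum>a\<in>UNIV. (atiyah_anchor A x (s x) (\<lambda>y. cE K a y (t y))
        - atiyah_anchor A x (t x) (\<lambda>y. cE K a y (s y))) *\<^sub>C fE K a x)"
proof (intro ext)
  fix \<xi> f
  show "atiyah_bracket A s t x \<xi> f = (\<Sum>a\<in>UNIV. (atiyah_anchor A x (s x) (\<lambda>y. cE K a y (t y))
        - atiyah_anchor A x (t x) (\<lambda>y. cE K a y (s y))) *\<^sub>C fE K a x) \<xi> f"
  proof (cases "(x, \<xi>) \<in> det_space A")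
    case False
    then have "\<not> dt.hn (x, \<xi>) f" using dt.hn_pts dt_pts by blast
    then show ?thesis using False by (simp add: atiyah_bracket_def lie_bracket_def sum_fun_apply fE_def)
  next
    case q: True
    note dk = dchart_mem[OF K(1)] in_dchart[OF q K(2)]
    have \<tau>: "dt.hn (x, \<xi>) (\<lambda>q. snd q (TM.vol K (fst q)))" using dt.hn_coord[OF dk, of None] by simp
    let ?V = "{(x, \<xi>) \<in> det_space A. x \<in> V}"
    have V': "?V = {q \<in> det_space A. fst q \<in> V}" by auto
    have o: "dt.mopen ?V" unfolding V' by (rule dt_mopen[OF s(1)])
    have pV: "(x, \<xi>) \<in> ?V" using q s by simp
    have X: "eventually (\<lambda>p. invariant_field u p \<in> tangent_space (det_atlas A) p) (dt.NH (x, \<xi>))"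
      "dt.hn (x, \<xi>) (\<lambda>p. invariant_field u p (dt.xi (dchart K) i))" 
      "u x \<in> atiyah_fibre A x" "hn x (\<lambda>y. cE K i y (u y))"
      if u: "u \<in> atiyah_sections A V" for u i
    proof -
      have "invariant_field u \<in> vector_fields (det_atlas A) ?V" using u unfolding atiyah_sections_def by blast
      note X = this[unfolded dt.vector_fields_iff[OF o]]
      show "eventually (\<lambda>p. invariant_field u p \<in> tangent_space (det_atlas A) p) (dt.NH (x, \<xi>))"
        using dt.eventually_mopen[OF o pV] by (rule eventually_mono) (use X in blast)
      show "dt.hn (x, \<xi>) (\<lambda>p. invariant_field u p (dt.xi (dchart K) i))"
        using X dk pV by blast
      show "u x \<in> atiyah_fibre A x" "hn x (\<lambda>y. cE K i y (u y))"
        using u s(2) K unfolding atiyah_sections_iff[OF s(1)] by blast+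
    qed
    have step: "invariant_field u (x, \<xi>) (\<lambda>p. invariant_field w p (dt.xi (dchart K) a)) =
      (case a of None \<Rightarrow> \<xi> (TM.vol K x) | Some j \<Rightarrow> 1) * atiyah_anchor A x (u x) (\<lambda>y. cE K a y (w y)) +
      (case a of None \<Rightarrow> \<xi> (TM.vol K x) * cE K None x (u x) * cE K None x (w x) | Some j \<Rightarrow> 0)"
      if u: "u \<in> atiyah_sections A V" and w: "w \<in> atiyah_sections A V" for u w a
    proof -
      note T = atiyah_at[OF K q X(3)[OF u]]
      have wf: "w y \<in> atiyah_fibre A y" if "y \<in> V" for y using w that unfolding atiyah_sections_def by blast
      have "eventually (\<lambda>p. invariant_field w p (dt.xi (dchart K) a) =
         (case a of None \<Rightarrow> snd p (TM.vol K (fst p)) | Some j \<Rightarrow> 1) * cE K a (fst p) (w (fst p))) (dt.NH (x, \<xi>))"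
        by (rule eventually_mono[OF invariant_coords[where a = a, OF s(1) wf s(2) K q]]) simp_all
      from dt.tangent_cong[OF T(1) this]
      have 1: "u x \<xi> (\<lambda>p. invariant_field w p (dt.xi (dchart K) a)) =
        u x \<xi> (\<lambda>p. (case a of None \<Rightarrow> snd p (TM.vol K (fst p)) | Some j \<Rightarrow> 1) * cE K a (fst p) (w (fst p)))" .
      note B = atiyah_base[OF K q X(3)[OF u] X(4)[OF w]]
      have hw: "dt.hn (x, \<xi>) (\<lambda>p. cE K a (fst p) (w (fst p)))" for a
        using hn_fst[OF K q, of "\<lambda>y. cE K a y (w y)"] X(4)[OF w] by blast
      show ?thesis
      proof (cases a)
        case (Some j) then show ?thesis using 1 B by (simp add: invariant_field_def)
      next
        case None
        have "u x \<xi> (\<lambda>p. snd p (TM.vol K (fst p)) * cE K None (fst p) (w (fst p))) =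
          \<xi> (TM.vol K x) * cE K None x (u x) * cE K None x (w x) + \<xi> (TM.vol K x) * atiyah_anchor A x (u x) (\<lambda>y. cE K None y (w y))"
          unfolding dt.tangent_mult[OF T(1) \<tau> hw] B using T(2)[of None] by simp
        then show ?thesis using 1 None by (simp add: invariant_field_def)
      qed
    qed
    have "atiyah_bracket A s t x \<xi> f = (\<Sum>a\<in>UNIV. (case a of None \<Rightarrow> \<xi> (TM.vol K x) | Some j \<Rightarrow> 1) *
       (atiyah_anchor A x (s x) (\<lambda>y. cE K a y (t y)) - atiyah_anchor A x (t x) (\<lambda>y. cE K a y (s y))) * dt.dd (dchart K) a (x, \<xi>) f)"
      unfolding atiyah_bracket_def dt.lie_bracket_coords[OF dk X(1)[OF s(3)] X(2)[OF s(3)] X(1)[OF s(4)] X(2)[OF s(4)]]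
        step[OF s(3,4)] step[OF s(4,3)]
      by (intro sum.cong refl) (auto simp: algebra_simps split: option.split)
    then show ?thesis unfolding comb_fE[OF q] by (simp add: sum_option mult_ac)
  qed
qed

lemma framed_atiyah: "framed_algebroid A (atiyah_bundle A) fE cE"
proof (unfold_locales, unfold atiyah_bundle_def vbundle.simps algebroid.simps)
  fix K x assume K: "K \<in> A" "x \<in> fst K"
  show "atiyah_fibre A x = range (\<lambda>c. \<Sum>a\<in>UNIV. c a *\<^sub>C fE K a x)" by (rule atiyah_fibre_eq[OF K])
  show "cE K a x (\<Sum>b\<in>UNIV. c b *\<^sub>C fE K b x) = c a" for a c by (rule cE_comb[OF K])
  show "atiyah_anchor A x (\<Sum>a\<in>UNIV. c a *\<^sub>C fE K a x) f = (\<Sum>a\<in>UNIV. c a * atiyah_anchor A x (fE K a x) f)" for c f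
  proof -
    have m: "(\<Sum>a\<in>UNIV. c a *\<^sub>C fE K a x) \<in> atiyah_fibre A x" unfolding atiyah_fibre_eq[OF K] by blast
    show ?thesis
      unfolding atiyah_anchor_coords[OF K m] cE_comb[OF K] anchor_fE[OF K] by (simp add: sum_option)
  qed
  show "atiyah_anchor A x (fE K a x) \<in> tangent_space A x" for a
  proof (cases a)
    case None
    then have "atiyah_anchor A x (fE K a x) = 0" by (simp add: anchor_fE[OF K] fun_eq_iff)
    then show ?thesis using tangent_zero[OF chart_pts[OF K]] by simp
  next
    case (Some j)
    then have "atiyah_anchor A x (fE K a x) = dd K j x" by (simp add: anchor_fE[OF K] fun_eq_iff)
    then show ?thesis using dd_tangent[OF K] by simp
  qed
  have ev: "eventually (\<lambda>y. atiyah_anchor A y (fE K a y) f = (case a of None \<Rightarrow> 0 | Some j \<Rightarrow> dd K j y f)) (NH x)" for a f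
    using eventually_chart[OF K] by eventually_elim (rule anchor_fE[OF K(1)])
  show "hn x (\<lambda>y. atiyah_anchor A y (fE K a y) f)" if "hn x f" for a f
    unfolding hn_cong[OF ev] using hn_const[OF chart_pts[OF K]] hn_dd(1)[OF K that] by (cases a) simp_all
  show "atiyah_anchor A x (fE K a x) (\<lambda>y. atiyah_anchor A y (fE K b y) f) =
      atiyah_anchor A x (fE K b x) (\<lambda>y. atiyah_anchor A y (fE K a y) f)" if f: "hn x f" for a b f
    unfolding anchor_fE[OF K] dd_cong[OF K ev]
    by (cases a; cases b) (simp_all add: dd_const[OF K] hn_dd(2)[OF K f])
  fix s t
  assume "local_section A \<lparr>fibre = atiyah_fibre A, sections = atiyah_sections A, anchor = atiyah_anchor A, bracket = atiyah_bracket A\<rparr> x s"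
    "local_section A \<lparr>fibre = atiyah_fibre A, sections = atiyah_sections A, anchor = atiyah_anchor A, bracket = atiyah_bracket A\<rparr> x t"
  then obtain V W where V: "mopen V" "x \<in> V" "s \<in> atiyah_sections A V" and W: "mopen W" "x \<in> W" "t \<in> atiyah_sections A W"
    unfolding local_section_def by auto
  have o: "mopen (V \<inter> W)" using V W by blast
  have "s \<in> atiyah_sections A (V \<inter> W)" using V(3) unfolding atiyah_sections_iff[OF V(1)] atiyah_sections_iff[OF o] by blast
  moreover have "t \<in> atiyah_sections A (V \<inter> W)" using W(3) unfolding atiyah_sections_iff[OF W(1)] atiyah_sections_iff[OF o] by blast
  ultimately show "atiyah_bracket A s t x = (\<Sum>a\<in>UNIV. (atiyah_anchor A x (s x) (\<lambda>y. cE K a y (t y))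
        - atiyah_anchor A x (t x) (\<lambda>y. cE K a y (s y))) *\<^sub>C fE K a x)"
    using bracket_E[OF K o] V W by blast
qed (fact atiyah_sections_iff fE_section)+

text \<open>The curve \<open>c \<mapsto> (x, c *\<^sub>C \<xi>)\<close> has constant base
  coordinates and a fibre coordinate linear in \<open>c\<close>.\<close>

lemma euler_fE:
  assumes K: "K \<in> A" "x \<in> fst K"
  shows "euler_section A x = fE K None x"
proof (intro ext)
  fix \<xi> f
  show "euler_section A x \<xi> f = fE K None x \<xi> f"
  proof (cases "dt.hn (x, \<xi>) f")
    case False then show ?thesis by (simp add: euler_section_def fE_def dt.dd_not_hn)
  next
    case True
    then have q: "(x, \<xi>) \<in> det_space A" using dt.hn_pts dt_pts by blast
    note dk = dchart_mem[OF K(1)] in_dchart[OF q K(2)]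
    let ?t = "\<xi> (TM.vol K x)"
    define g where "g i c = (case i of None \<Rightarrow> c * ?t | Some j \<Rightarrow> snd K x $ j)" for i c
    have gc: "(\<chi> i. g i c) = snd (dchart K) (x, c *\<^sub>C \<xi>)" for c
      by (rule vec_option_eqI) (simp_all add: g_def)
    have d: "(g i has_field_derivative (case i of None \<Rightarrow> ?t | Some j \<Rightarrow> 0)) (at 1)" for i
      unfolding g_def by (cases i) (auto intro!: derivative_eq_intros)
    have grad: "has_gradient (f \<circ> dt.pinv (dchart K)) (\<lambda>i. dt.dd (dchart K) i (x, \<xi>) f) (\<chi> i. g i 1)"
      unfolding gc using dt.dd_gradient[OF dk True] by simp
    have "((\<lambda>c. (f \<circ> dt.pinv (dchart K)) (\<chi> i. g i c)) has_field_derivative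
        (\<Sum>i\<in>UNIV. dt.dd (dchart K) i (x, \<xi>) f * (case i of None \<Rightarrow> ?t | Some j \<Rightarrow> 0))) (at 1)"
      by (rule has_gradient_curve[OF grad d])
    then have "((\<lambda>c. f (x, c *\<^sub>C \<xi>)) has_field_derivative
        (\<Sum>i\<in>UNIV. dt.dd (dchart K) i (x, \<xi>) f * (case i of None \<Rightarrow> ?t | Some j \<Rightarrow> 0))) (at 1)"
    proof (rule has_field_derivative_transform_within_open[of _ _ _ "- {0}"])
      fix c :: complex assume "c \<in> - {0}"
      then have "(x, c *\<^sub>C \<xi>) \<in> fst (dchart K)" using in_dchart[OF det_space_scale[OF q] K(2)] by simp
      then show "(f \<circ> dt.pinv (dchart K)) (\<chi> i. g i c) = f (x, c *\<^sub>C \<xi>)"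
        unfolding gc using dt.pinv[OF dk(1)] by simp
    qed auto
    then show ?thesis unfolding euler_section_def fE_def using True q
      by (simp add: DERIV_imp_deriv sum_option mult.commute)
  qed
qed

end

section \<open>The conditions on \<open>\<nabla>\<close> in coordinates\<close>

text \<open>If the argument \<open>None\<close> is repeated, its term cancels the only summand that
  survives. If two later arguments agree, two summands survive and cancel by
  \<open>alternating_swap\<close>.\<close>

lemma wedge1_alternating:
  fixes \<alpha> :: "'a::complex_vector \<Rightarrow> complex" and \<beta> :: "('k::finite \<Rightarrow> 'a) \<Rightarrow> complex"
  assumes \<alpha>: "\<And>u v. u \<in> S \<Longrightarrow> v \<in> S \<Longrightarrow> \<alpha> (u + v) = \<alpha> u + \<alpha> v" "\<And>c u. u \<in> S \<Longrightarrow> \<alpha> (c *\<^sub>C u) = c * \<alpha> u"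
    and \<beta>: "\<beta> \<in> alternating_forms S"
    and S: "\<And>u v. u \<in> S \<Longrightarrow> v \<in> S \<Longrightarrow> u + v \<in> S" "\<And>c u. u \<in> S \<Longrightarrow> c *\<^sub>C u \<in> S"
  shows "wedge1 S \<alpha> \<beta> \<in> alternating_forms S"
proof -
  note d = alternating_formsD[OF \<beta>]
  have N: "wedge1 S \<alpha> \<beta> (t(None := w)) = \<alpha> w * \<beta> (\<lambda>j. t (Some j)) - (\<Sum>j\<in>UNIV. \<alpha> (t (Some j)) * \<beta> ((\<lambda>i. t (Some i))(j := w)))"
    if "range t \<subseteq> S" "w \<in> S" for t w
  proof -
    have "range (t(None := w)) \<subseteq> S" using that by auto
    then show ?thesis unfolding wedge1_def by simp
  qed
  \<comment> \<open>The summand \<open>j = k\<close> is split off: in it the new argument is taken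
    by \<open>\<alpha>\<close>, in all others by \<open>\<beta>\<close>.\<close>
  have KK: "wedge1 S \<alpha> \<beta> (t(Some k := w)) = \<alpha> (t None) * \<beta> ((\<lambda>i. t (Some i))(k := w)) -
      (\<alpha> w * \<beta> ((\<lambda>i. t (Some i))(k := t None)) + 
       (\<Sum>j\<in>UNIV - {k}. \<alpha> (t (Some j)) * \<beta> ((\<lambda>i. t (Some i))(j := t None, k := w))))"
    if t: "range t \<subseteq> S" and w: "w \<in> S" for t k w
  proof -
    have r: "range (t(Some k := w)) \<subseteq> S" using t w by auto
    have e: "(t(Some k := w)) None = t None" "(t(Some k := w)) (Some j) = ((\<lambda>i. t (Some i))(k := w)) j" for j
      by auto
    have "(\<Sum>j\<in>UNIV. \<alpha> (((\<lambda>i. t (Some i))(k := w)) j) * \<beta> ((\<lambda>i. t (Some i))(k := w, j := t None))) =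
      \<alpha> w * \<beta> ((\<lambda>i. t (Some i))(k := t None)) + 
       (\<Sum>j\<in>UNIV - {k}. \<alpha> (t (Some j)) * \<beta> ((\<lambda>i. t (Some i))(j := t None, k := w)))"
      by (subst sum.remove[of UNIV k], simp, simp, simp, intro sum.cong refl) (simp add: fun_upd_twist)
    then show ?thesis unfolding wedge1_def using r by (simp only: if_True e)
  qed
  show ?thesis
  proof (rule alternating_formsI)
    show "wedge1 S \<alpha> \<beta> t = 0" if "\<not> range t \<subseteq> S" for t using that by (simp add: wedge1_def)
  next
    fix t :: "'k option \<Rightarrow> 'a" and i u v assume t: "range t \<subseteq> S" and u: "u \<in> S" and v: "v \<in> S"
    have T: "range (\<lambda>i. t (Some i)) \<subseteq> S" "t None \<in> S" using t by auto
    have T': "range ((\<lambda>i. t (Some i))(j := t None)) \<subseteq> S" for j using t by auto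
    show "wedge1 S \<alpha> \<beta> (t(i := u + v)) = wedge1 S \<alpha> \<beta> (t(i := u)) + wedge1 S \<alpha> \<beta> (t(i := v))"
    proof (cases i)
      case None then show ?thesis
        by (simp only: N[OF t u] N[OF t v] N[OF t S(1)[OF u v]] d(2)[OF T(1) u v] \<alpha>(1)[OF u v])
          (simp add: algebra_simps sum.distrib)
    next
      case (Some k) then show ?thesis
        by (simp only: KK[OF t u] KK[OF t v] KK[OF t S(1)[OF u v]] d(2)[OF T(1) u v] d(2)[OF T' u v] \<alpha>(1)[OF u v])
          (simp add: algebra_simps sum.distrib)
    qed
  next
    fix t :: "'k option \<Rightarrow> 'a" and i u c assume t: "range t \<subseteq> S" and u: "u \<in> S"
    have T: "range (\<lambda>i. t (Some i)) \<subseteq> S" "t None \<in> S" using t by auto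
    have T': "range ((\<lambda>i. t (Some i))(j := t None)) \<subseteq> S" for j using t by auto
    show "wedge1 S \<alpha> \<beta> (t(i := c *\<^sub>C u)) = c * wedge1 S \<alpha> \<beta> (t(i := u))"
    proof (cases i)
      case None then show ?thesis
        by (simp only: N[OF t u] N[OF t S(2)[OF u]] d(3)[OF T(1) u] \<alpha>(2)[OF u])
          (simp add: algebra_simps sum_distrib_left)
    next
      case (Some k) then show ?thesis
        by (simp only: KK[OF t u] KK[OF t S(2)[OF u]] d(3)[OF T(1) u] d(3)[OF T' u] \<alpha>(2)[OF u])
          (simp add: algebra_simps sum_distrib_left)
    qed
  next
    fix t :: "'k option \<Rightarrow> 'a" and p q assume t: "range t \<subseteq> S" and pq: "p \<noteq> q" "t p = t q"
    let ?T = "\<lambda>i. t (Some i)"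
    have T: "range ?T \<subseteq> S" "t None \<in> S" using t by auto
    have w: "wedge1 S \<alpha> \<beta> t = \<alpha> (t None) * \<beta> ?T - (\<Sum>j\<in>UNIV. \<alpha> (?T j) * \<beta> (?T(j := t None)))"
      using t by (simp add: wedge1_def)
    have None: "wedge1 S \<alpha> \<beta> t = 0" if k: "t (Some k) = t None" for k
    proof -
      have "(\<Sum>j\<in>UNIV. \<alpha> (?T j) * \<beta> (?T(j := t None))) = (\<Sum>j\<in>{k}. \<alpha> (?T j) * \<beta> (?T(j := t None)))"
        by (rule sum.mono_neutral_right) (use k in \<open>auto intro!: d(4)[of _ k]\<close>)
      moreover have "?T(k := t None) = ?T" using k by auto
      ultimately show ?thesis unfolding w using k by simp
    qed
    show "wedge1 S \<alpha> \<beta> t = 0"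
    proof (cases p)
      case pN: None
      then obtain k where "q = Some k" using pq by (cases q) auto
      then show ?thesis using None[of k] pq pN by simp
    next
      case p: (Some k)
      show ?thesis
      proof (cases q)
        case None' : None
        then show ?thesis using None[of k] pq p by simp
      next
        case q: (Some l)
        have kl: "k \<noteq> l" "?T k = ?T l" using pq p q by auto
        have "(\<Sum>j\<in>UNIV. \<alpha> (?T j) * \<beta> (?T(j := t None))) = (\<Sum>j\<in>{k, l}. \<alpha> (?T j) * \<beta> (?T(j := t None)))"
          by (rule sum.mono_neutral_right) (use kl in \<open>auto intro!: d(4)[of k l]\<close>)
        also have "\<dots> = \<alpha> (?T k) * (\<beta> (?T(k := t None)) + \<beta> (?T(l := t None)))"
          using kl by (simp add: distrib_left)
        also have "\<beta> (?T(l := t None)) = - \<beta> (?T(k := t None))"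
        proof -
          let ?s = "?T(k := t None)"
          have "?s(k := ?s l, l := ?s k) = ?T(l := t None)" using kl by auto
          moreover have "range ?s \<subseteq> S" using t by auto
          ultimately show ?thesis using alternating_swap[OF \<beta> S(1) _ kl(1), of ?s] by simp
        qed
        also have "\<alpha> (?T k) * (\<beta> (?T(k := t None)) + - \<beta> (?T(k := t None))) = 0"
          by (simp only: add.right_inverse mult_zero_right)
        finally show ?thesis unfolding w d(4)[of k l ?T, OF kl] by (simp only: mult_zero_right diff_self)
      qed
    qed
  qed
qed

sublocale base_atlas \<subseteq> E: framed_algebroid A "atiyah_bundle A" fE cE
  by (rule framed_atiyah)

context base_atlas
begin

lemma E_simps [simp]:
  "fibre (atiyah_bundle A) = atiyah_fibre A" "sections (atiyah_bundle A) = atiyah_sections A"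
  "anchor (atiyah_bundle A) = atiyah_anchor A" "bracket (atiyah_bundle A) = atiyah_bracket A"
  by (simp_all add: atiyah_bundle_def)

section \<open>The isomorphism with polyvectors and condition (ii2)\<close>

abbreviation altE where "altE x \<equiv> alternating_forms (atiyah_fibre A x) :: (('n option \<Rightarrow> ('m, 'n) atiyah) \<Rightarrow> complex) set"

lemma form_fibre [simp]: "fibre (form_bundle A F) x = alternating_forms (fibre F x)"
  by (simp add: form_bundle_def)

text \<open>Only the value on the frame matters. The anchor kills the Euler member, so the terms of
  the sum vanish and the value of \<open>\<alpha>\<close> on the Euler section times
  \<open>\<omega>\<close> is left. The result does not depend on \<open>\<alpha>\<close>.\<close>

lemma wedge_vol:
  assumes K: "K \<in> A" "x \<in> fst K" and \<omega>: "\<omega> \<in> alt x"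
    and \<alpha>: "\<alpha> \<in> linear_maps (atiyah_fibre A x) UNIV" "\<alpha> (euler_section A x) = 1"
  shows "wedge1 (atiyah_fibre A x) \<alpha> (pullback_form (atiyah_fibre A x) (atiyah_anchor A x) \<omega>) =
    \<omega> (\<lambda>i. dd K i x) *\<^sub>C E.vol K x"
proof -
  let ?S = "atiyah_fibre A x" and ?\<rho> = "atiyah_anchor A x"
  let ?p = "pullback_form ?S ?\<rho> \<omega>"
  note d = alternating_formsD[OF \<omega>]
  note fa = E.fibre_add[OF K, simplified] and fs = E.fibre_scale[OF K, simplified]
  have ra: "?\<rho> (u + v) = ?\<rho> u + ?\<rho> v" if "u \<in> ?S" "v \<in> ?S" for u v
    using E.anchor_expand[OF K] E.co_add[OF K] fa that by (simp add: fun_eq_iff distrib_right sum.distrib)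
  have rs: "?\<rho> (c *\<^sub>C u) = c *\<^sub>C ?\<rho> u" if "u \<in> ?S" for c u
    using E.anchor_expand[OF K] E.co_scale[OF K] fs that by (simp add: fun_eq_iff sum_distrib_left mult.assoc)
  have rt: "?\<rho> u \<in> tangent_space A x" if "u \<in> ?S" for u using E.anchor_tangent[OF K] that by simp
  have p: "?p \<in> alternating_forms ?S"
  proof (rule alternating_formsI)
    show "?p t = 0" if "\<not> range t \<subseteq> ?S" for t using that by (simp add: pullback_form_def)
  next
    fix t :: "'n \<Rightarrow> ('m, 'n) atiyah" and i u v assume t: "range t \<subseteq> ?S" and u: "u \<in> ?S" and v: "v \<in> ?S"
    have r: "range (t(i := w)) \<subseteq> ?S" if "w \<in> ?S" for w using t that by auto
    have e: "(\<lambda>j. ?\<rho> ((t(i := w)) j)) = (\<lambda>j. ?\<rho> (t j))(i := ?\<rho> w)" for w by auto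
    have "range (\<lambda>j. ?\<rho> (t j)) \<subseteq> tangent_space A x" using rt t by auto
    from d(2)[OF this rt[OF u] rt[OF v]]
    show "?p (t(i := u + v)) = ?p (t(i := u)) + ?p (t(i := v))"
      unfolding pullback_form_def e ra[OF u v] using r[OF u] r[OF v] r[OF fa[OF u v]] by (simp only: if_True)
  next
    fix t :: "'n \<Rightarrow> ('m, 'n) atiyah" and i u c assume t: "range t \<subseteq> ?S" and u: "u \<in> ?S"
    have r: "range (t(i := w)) \<subseteq> ?S" if "w \<in> ?S" for w using t that by auto
    have e: "(\<lambda>j. ?\<rho> ((t(i := w)) j)) = (\<lambda>j. ?\<rho> (t j))(i := ?\<rho> w)" for w by auto
    have "range (\<lambda>j. ?\<rho> (t j)) \<subseteq> tangent_space A x" using rt t by auto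
    from d(3)[OF this rt[OF u]]
    show "?p (t(i := c *\<^sub>C u)) = c * ?p (t(i := u))"
      unfolding pullback_form_def e rs[OF u] using r[OF u] r[OF fs[OF u]] by (simp only: if_True)
  next
    fix t :: "'n \<Rightarrow> ('m, 'n) atiyah" and i j assume "i \<noteq> j" "t i = t j"
    then show "?p t = 0" using d(4)[of i j "\<lambda>j. ?\<rho> (t j)"] by (simp add: pullback_form_def)
  qed
  have "wedge1 ?S \<alpha> ?p \<in> alternating_forms ?S"
    by (rule wedge1_alternating[OF _ _ p fa fs]) (use \<alpha>(1) in \<open>auto simp: linear_maps_def\<close>)
  then have 1: "wedge1 ?S \<alpha> ?p = wedge1 ?S \<alpha> ?p (E.frv K x) *\<^sub>C E.vol K x"
    by (intro ext, unfold scaleC_fun_apply scaleC_complex, intro E.alternating_eq[OF K]) simp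
  have fr: "range (E.frv K x) \<subseteq> ?S" "range (\<lambda>j. fE K (Some j) x) \<subseteq> ?S" using fE_fibre[OF K] by auto
  have \<rho>N: "?\<rho> (fE K None x) = 0" and \<rho>S: "?\<rho> (fE K (Some j) x) = dd K j x" for j
    by (simp_all add: fun_eq_iff anchor_fE[OF K])
  have z: "\<omega> ((\<lambda>i. dd K i x)(j := 0)) = 0" for j
    using d(3)[of "\<lambda>i. dd K i x" 0 j 0] dd_tangent[OF K] tangent_zero[OF chart_pts[OF K]] by auto
  have "?p ((\<lambda>i. fE K (Some i) x)(j := fE K None x)) = 0" for j
  proof -
    have "(\<lambda>i. ?\<rho> (((\<lambda>i. fE K (Some i) x)(j := fE K None x)) i)) = (\<lambda>i. dd K i x)(j := 0)"
      by (auto simp: \<rho>N \<rho>S)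
    then show ?thesis unfolding pullback_form_def using z by simp
  qed
  then have "wedge1 ?S \<alpha> ?p (E.frv K x) = \<omega> (\<lambda>i. dd K i x)"
    unfolding wedge1_def using fr \<alpha>(2)[unfolded euler_fE[OF K]] by (simp add: pullback_form_def \<rho>S)
  with 1 show ?thesis by simp
qed

text \<open>The form chosen in \<open>det_isomorphism\<close> drops out by \<open>wedge_vol\<close>;
  the Euler coordinate, extended by zero, shows that the choice is possible.\<close>

lemma det_isomorphism_eq:
  assumes K: "K \<in> A" "x \<in> fst K" and \<theta>: "\<theta> \<in> linear_maps (altE x) UNIV"
  shows "det_isomorphism A x \<theta> \<omega> = (if \<omega> \<in> alt x then \<omega> (\<lambda>i. dd K i x) * \<theta> (E.vol K x) else 0)"
proof -
  let ?S = "atiyah_fibre A x"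
  have Df: "fibre (dual_bundle A (atiyah_bundle A)) x = linear_maps ?S UNIV"
    by (simp add: dual_bundle_def hom_bundle_def trivial_bundle_def)
  let ?a = "\<lambda>v. if v \<in> ?S then cE K None x v else 0"
  have "?a \<in> linear_maps ?S UNIV"
    unfolding linear_maps_def using E.fibre_add[OF K] E.fibre_scale[OF K] E.co_add[OF K] E.co_scale[OF K] by simp
  moreover have "?a (euler_section A x) = 1"
    unfolding euler_fE[OF K] using fE_fibre[OF K] E.co_fr[OF K] by simp
  ultimately have ex: "\<exists>\<alpha> :: ('m, 'n) atiyah \<Rightarrow> complex. \<alpha> \<in> linear_maps ?S UNIV \<and> \<alpha> (euler_section A x) = 1" by (rule exI[where x = ?a, OF conjI])
  define \<alpha> :: "('m, 'n) atiyah \<Rightarrow> complex" where "\<alpha> = (SOME \<alpha>. \<alpha> \<in> linear_maps ?S UNIV \<and> \<alpha> (euler_section A x) = 1)"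
  have \<alpha>: "\<alpha> \<in> linear_maps ?S UNIV" "\<alpha> (euler_section A x) = 1"
    using someI_ex[OF ex] unfolding \<alpha>_def by auto
  have "\<theta> (c *\<^sub>C E.vol K x) = c * \<theta> (E.vol K x)" for c
    using \<theta> E.vol_alt[OF K] unfolding linear_maps_def by simp
  then show ?thesis unfolding det_isomorphism_def Let_def Df \<alpha>_def[symmetric]
    by (simp add: wedge_vol[OF K _ \<alpha>])
qed

text \<open>Condition (ii2) at one point, for germs of sections, so that it can be tested on
  connections defined near that point only.\<close>

definition canonical_at :: "('m, ('m, 'n) atiyah, ('m, 'n) atiyah) conn \<Rightarrow> 'm \<Rightarrow> bool" where
  "canonical_at D x \<longleftrightarrow> (\<forall>\<theta>. local_section A (exterior_power A (atiyah_bundle A)) x \<theta> \<longrightarrow>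
     (\<forall>e\<in>atiyah_fibre A x. det_isomorphism A x
        (exterior_power_connection A (atiyah_bundle A) (atiyah_bundle A) D \<theta> x e) =
       canonical_connection A (\<lambda>y. det_isomorphism A y (\<theta> y)) x e))"

lemma exterior_section_eval:
  assumes \<theta>: "local_section A (exterior_power A (atiyah_bundle A)) x (\<theta> :: 'm \<Rightarrow> (('n option \<Rightarrow> ('m, 'n) atiyah) \<Rightarrow> complex) \<Rightarrow> complex)"
  shows "eventually (\<lambda>y. \<theta> y \<in> linear_maps (altE y) UNIV) (NH x)"
    and "local_section A (form_bundle A (atiyah_bundle A)) x \<beta> \<Longrightarrow> hn x (\<lambda>y. \<theta> y (\<beta> y))"
proof -
  obtain V where V: "mopen V" "x \<in> V" "\<theta> \<in> sections (exterior_power A (atiyah_bundle A)) V"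
    using \<theta> unfolding local_section_def by blast
  note T = V(3)[unfolded exterior_power_def dual_bundle_def hom_bundle_def trivial_bundle_def, simplified]
  show "eventually (\<lambda>y. \<theta> y \<in> linear_maps (altE y) UNIV) (NH x)"
    using eventually_mopen[OF V(1,2)] by (rule eventually_mono) (use T in blast)
  assume "local_section A (form_bundle A (atiyah_bundle A)) x \<beta>"
  then obtain W where W: "mopen W" "x \<in> W" "\<beta> \<in> sections (form_bundle A (atiyah_bundle A)) W"
    unfolding local_section_def by blast
  have o: "mopen (V \<inter> W)" using V W by blast
  have "\<beta> \<in> sections (form_bundle A (atiyah_bundle A)) (V \<inter> W)" using W(3) unfolding form_bundle_def by simp
  then have "(\<lambda>y. \<theta> y (\<beta> y)) \<in> holomorphic_functions A (V \<inter> W)" using T o by blast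
  then show "hn x (\<lambda>y. \<theta> y (\<beta> y))" using holfun_iff[OF o] V W by blast
qed

lemma extend_form:
  fixes w :: "('k::finite \<Rightarrow> 'v::complex_vector) \<Rightarrow> complex"
    and fr :: "'m set \<times> ('m \<Rightarrow> complex^'n) \<Rightarrow> 'k \<Rightarrow> 'm \<Rightarrow> 'v"
  assumes F: "framed_algebroid A F fr co" and K: "K \<in> A" "x \<in> fst K"
    and w: "w \<in> alternating_forms (fibre F x)"
  shows "local_section A (form_bundle A F) x (extend_vector A (form_bundle A F) x w)"
    and "extend_vector A (form_bundle A F) x w x = w"
proof -
  interpret F: framed_algebroid A F fr co by fact
  let ?t = "\<lambda>y. w (F.frv K x) *\<^sub>C F.vol K y"
  have "eventually (\<lambda>y. ?t y \<in> alternating_forms (fibre F y)) (NH x)"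
    using eventually_chart[OF K] by eventually_elim (intro alt_scale F.vol_alt[OF K(1)])
  moreover have "hn x (\<lambda>y. ?t y (F.frv K y))"
  proof -
    have "eventually (\<lambda>y. w (F.frv K x) = ?t y (F.frv K y)) (NH x)"
      using eventually_chart[OF K] by eventually_elim (simp add: F.vol_frv[OF K(1)])
    from hn_cong[OF this] show ?thesis using hn_const[OF chart_pts[OF K]] by blast
  qed
  ultimately have 1: "local_section A (form_bundle A F) x ?t" unfolding F.form_section_iff[OF K] by blast
  have 2: "?t x = w" by (rule ext) (simp add: F.alternating_eq[OF K w, symmetric])
  have "local_section A (form_bundle A F) x (extend_vector A (form_bundle A F) x w) \<and> extend_vector A (form_bundle A F) x w x = w"
    unfolding extend_vector_def
    by (rule someI[of "\<lambda>t. local_section A (form_bundle A F) x t \<and> t x = w" ?t]) (use 1 2 in blast)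
  then show "local_section A (form_bundle A F) x (extend_vector A (form_bundle A F) x w)"
    "extend_vector A (form_bundle A F) x w x = w" by auto
qed

text \<open>In a chart the function of a form is the fibre coordinate times the coefficient of the
  form. A vector of E differentiates the fibre coordinate into its Euler component times that
  coordinate, which is the origin of the zero order term.\<close>

lemma canonical_form:
  assumes K: "K \<in> A" "x \<in> fst K" and t: "local_section A (form_bundle A (tangent_bundle A)) x t"
    and e: "e \<in> atiyah_fibre A x"
  shows "canonical_form_connection A t x e = (atiyah_anchor A x e (\<lambda>y. t y (\<lambda>i. dd K i y))
     + cE K None x e * t x (\<lambda>i. dd K i x)) *\<^sub>C TM.vol K x"
proof -
  let ?k = "\<lambda>y. t y (\<lambda>i. dd K i y)"
  let ?c = "atiyah_anchor A x e ?k + cE K None x e * ?k x"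
  from t have t': "eventually (\<lambda>y. t y \<in> alt y) (NH x)" "hn x ?k"
    unfolding TM.form_section_iff[OF K] by auto
  have val: "e \<xi> (\<lambda>(y, \<zeta>). \<zeta> (t y)) = ?c * \<xi> (TM.vol K x)" if q: "(x, \<xi>) \<in> det_space A" for \<xi>
  proof -
    note dk = dchart_mem[OF K(1)] in_dchart[OF q K(2)]
    have \<tau>: "dt.hn (x, \<xi>) (\<lambda>q. snd q (TM.vol K (fst q)))" using dt.hn_coord[OF dk, of None] by simp
    have hk: "dt.hn (x, \<xi>) (\<lambda>q. ?k (fst q))" using hn_fst[OF K q, of ?k] t'(2) by simp
    note T = atiyah_at[OF K q e]
    have "eventually (\<lambda>q. (case q of (y, \<zeta>) \<Rightarrow> \<zeta> (t y)) = snd q (TM.vol K (fst q)) * ?k (fst q)) (dt.NH (x, \<xi>))"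
      using eventually_dt[OF q t'(1)] eventually_dt[OF q eventually_chart[OF K]]
    proof eventually_elim
      case (elim p)
      obtain y \<zeta> where p: "p = (y, \<zeta>)" by (cases p)
      have y: "y \<in> fst K" "(y, \<zeta>) \<in> det_space A" "t y \<in> alt y" using elim p by auto
      have "\<zeta> (t y) = (\<zeta> (TM.vol K y) *\<^sub>C ev K y) (t y)"
        by (rule fun_cong[OF det_space_eq[OF K(1) y(1,2)]])
      then show ?case using y by (simp add: p ev_def)
    qed
    from dt.tangent_cong[OF T(1) this]
    have "e \<xi> (\<lambda>(y, \<zeta>). \<zeta> (t y)) = e \<xi> (\<lambda>q. snd q (TM.vol K (fst q)) * ?k (fst q))" by simp
    then show ?thesis
      unfolding dt.tangent_mult[OF T(1) \<tau> hk] atiyah_base[OF K q e t'(2)] using T(2)[of None]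
      by (simp add: algebra_simps)
  qed
  have pair: "\<xi> (c *\<^sub>C TM.vol K x) = c * \<xi> (TM.vol K x)" if "(x, \<xi>) \<in> det_space A" for \<xi> c
    using that vol_alt[OF K] unfolding det_space_def polyvector_fibre linear_maps_def by simp
  show ?thesis unfolding canonical_form_connection_def
  proof (rule the_equality)
    show "?c *\<^sub>C TM.vol K x \<in> alt x \<and> (\<forall>\<xi>. (x, \<xi>) \<in> det_space A \<longrightarrow> \<xi> (?c *\<^sub>C TM.vol K x) = e \<xi> (\<lambda>(y, \<zeta>). \<zeta> (t y)))"
      using alt_scale[OF vol_alt[OF K]] pair val by simp
  next
    fix \<eta> assume \<eta>: "\<eta> \<in> alt x \<and> (\<forall>\<xi>. (x, \<xi>) \<in> det_space A \<longrightarrow> \<xi> \<eta> = e \<xi> (\<lambda>(y, \<zeta>). \<zeta> (t y)))"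
    \<comment> \<open>Evaluation at the point \<open>ev K x\<close> recovers the coefficient of a
      form, hence uniqueness.\<close>
    have "ev K x \<eta> = ?c" using \<eta> val[OF ev_det_space[OF K]] ev_det_space[OF K] ev_vol[OF K] by simp
    then have "\<eta> (\<lambda>i. dd K i x) = ?c" using \<eta> by (simp add: ev_def)
    then show "\<eta> = ?c *\<^sub>C TM.vol K x" using alt_eq[OF K \<eta>[THEN conjunct1]] by (simp only:)
  qed
qed

text \<open>\<open>h\<close> is the coefficient of \<open>\<theta>\<close> over the chart. Both
  connections differentiate it through the anchor and differ only in their zero order terms: the
  trace of the connection matrix on one side, minus the Euler coordinate on the other. Dualizing
  twice restores the sign of the trace.\<close>

lemma canonical_sides:
  assumes K: "K \<in> A" "x \<in> fst K" and G: "E.christoffel K D G x"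
    and \<theta>: "local_section A (exterior_power A (atiyah_bundle A)) x \<theta>" and e: "e \<in> atiyah_fibre A x"
    and \<omega>: "\<omega> \<in> alt x"
  defines "h \<equiv> \<lambda>y. \<theta> y (E.vol K y)"
  shows "det_isomorphism A x (exterior_power_connection A (atiyah_bundle A) (atiyah_bundle A) D \<theta> x e) \<omega> =
      \<omega> (\<lambda>i. dd K i x) * (atiyah_anchor A x e h + (\<Sum>a\<in>UNIV. cE K a x e * (\<Sum>b\<in>UNIV. G a b b x)) * h x)"
    and "canonical_connection A (\<lambda>y. det_isomorphism A y (\<theta> y)) x e \<omega> =
      \<omega> (\<lambda>i. dd K i x) * (atiyah_anchor A x e h - cE K None x e * h x)"
proof -
  let ?X = "atiyah_anchor A x e"
  have x: "x \<in> pts" using chart_pts[OF K] .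
  have T: "?X \<in> tangent_space A x" using E.anchor_tangent[OF K] e by simp
  note ev = exterior_section_eval[OF \<theta>]
  have volE: "local_section A (form_bundle A (atiyah_bundle A)) x (E.vol K)"
    unfolding E.form_section_iff[OF K]
  proof
    show "eventually (\<lambda>y. E.vol K y \<in> alternating_forms (fibre (atiyah_bundle A) y)) (NH x)"
      using eventually_chart[OF K] by eventually_elim (rule E.vol_alt[OF K(1)])
    have "eventually (\<lambda>y. 1 = E.vol K y (E.frv K y)) (NH x)"
      using eventually_chart[OF K] by eventually_elim (simp add: E.vol_frv[OF K(1)])
    from hn_cong[OF this] show "hn x (\<lambda>y. E.vol K y (E.frv K y))" using hn_const[OF x] by blast
  qed
  have h: "hn x h" unfolding h_def by (rule ev(2)[OF volE])
  have \<theta>x: "\<theta> x \<in> linear_maps (altE x) UNIV" by (rule NH_self[OF ev(1) x])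
  have \<theta>s: "\<theta> y (c *\<^sub>C E.vol K y) = c * h y" if "\<theta> y \<in> linear_maps (altE y) UNIV" "y \<in> fst K" for y c
    using that E.vol_alt[OF K(1) that(2)] unfolding linear_maps_def h_def by simp
  let ?ep = "exterior_power_connection A (atiyah_bundle A) (atiyah_bundle A) D \<theta> x e"
  have ep: "?ep w = w (E.frv K x) * (?X h + (\<Sum>a\<in>UNIV. cE K a x e * (\<Sum>b\<in>UNIV. G a b b x)) * h x)" if w: "w \<in> altE x" for w
  proof -
    define t where "t = extend_vector A (form_bundle A (atiyah_bundle A)) x w"
    have t: "local_section A (form_bundle A (atiyah_bundle A)) x t" "t x = w"
      unfolding t_def using extend_form[OF framed_atiyah K] w by simp_all
    let ?g = "\<lambda>y. t y (E.frv K y)"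
    from t(1) have g: "eventually (\<lambda>y. t y \<in> altE y) (NH x)" "hn x ?g"
      unfolding E.form_section_iff[OF K] by auto
    have "eventually (\<lambda>y. \<theta> y (t y) = ?g y * h y) (NH x)"
      using g(1) ev(1) eventually_chart[OF K]
    proof eventually_elim
      case (elim y)
      have "t y = ?g y *\<^sub>C E.vol K y"
        by (intro ext, unfold scaleC_fun_apply scaleC_complex, rule E.alternating_eq[OF K(1) elim(3)]) (use elim in simp)
      then show ?case using \<theta>s[OF elim(2,3), of "?g y"] by (simp only:)
    qed
    from tangent_cong[OF T this]
    have 1: "?X (\<lambda>y. \<theta> y (t y)) = ?X ?g * h x + ?g x * ?X h" unfolding tangent_mult[OF T g(2) h] .
    have "form_connection A (atiyah_bundle A) (atiyah_bundle A) D t x e =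
      (?X ?g - (\<Sum>a\<in>UNIV. cE K a x e * (\<Sum>b\<in>UNIV. G a b b x)) * ?g x) *\<^sub>C E.vol K x"
      using E.form_connection_coords[OF K G t(1), of e] e by (simp add: fun_eq_iff)
    then have 2: "\<theta> x (form_connection A (atiyah_bundle A) (atiyah_bundle A) D t x e) =
      (?X ?g - (\<Sum>a\<in>UNIV. cE K a x e * (\<Sum>b\<in>UNIV. G a b b x)) * ?g x) * h x"
      by (simp only: \<theta>s[OF \<theta>x K(2)])
    have "?ep w = ?X (\<lambda>y. \<theta> y (t y)) - \<theta> x (form_connection A (atiyah_bundle A) (atiyah_bundle A) D t x e)"
      unfolding exterior_power_connection_def dual_connection_def Let_def t_def[symmetric] using w by simp
    then show ?thesis unfolding 1 2 t(2) by (simp add: algebra_simps)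
  qed
  have eplin: "?ep \<in> linear_maps (altE x) UNIV"
    unfolding linear_maps_def
  proof (intro CollectI conjI allI impI ballI)
    show "?ep v = 0" if "v \<notin> altE x" for v
      unfolding exterior_power_connection_def dual_connection_def using that by simp
    show "?ep (v + w) = ?ep v + ?ep w" if "v \<in> altE x" "w \<in> altE x" for v w
      using ep[OF alt_add[OF that]] ep[OF that(1)] ep[OF that(2)] by (simp add: distrib_right)
    show "?ep (c *\<^sub>C v) = c *\<^sub>C ?ep v" if "v \<in> altE x" for c v
      using ep[OF alt_scale[OF that]] ep[OF that] by simp
  qed simp
  show "det_isomorphism A x ?ep \<omega> =
      \<omega> (\<lambda>i. dd K i x) * (?X h + (\<Sum>a\<in>UNIV. cE K a x e * (\<Sum>b\<in>UNIV. G a b b x)) * h x)"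
    unfolding det_isomorphism_eq[OF K eplin] using \<omega> ep[OF E.vol_alt[OF K, simplified]] E.vol_frv[OF K] by simp
  define t where "t = extend_vector A (form_bundle A (tangent_bundle A)) x \<omega>"
  have t: "local_section A (form_bundle A (tangent_bundle A)) x t" "t x = \<omega>"
    unfolding t_def using extend_form[OF framed_tangent K] \<omega> by simp_all
  let ?k = "\<lambda>y. t y (\<lambda>i. dd K i y)"
  from t(1) have k: "eventually (\<lambda>y. t y \<in> alt y) (NH x)" "hn x ?k"
    unfolding TM.form_section_iff[OF K] by auto
  have "eventually (\<lambda>y. det_isomorphism A y (\<theta> y) (t y) = ?k y * h y) (NH x)"
    using k(1) ev(1) eventually_chart[OF K]
    by eventually_elim (simp add: det_isomorphism_eq[OF K(1)] h_def)
  from tangent_cong[OF T this]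
  have 1: "?X (\<lambda>y. det_isomorphism A y (\<theta> y) (t y)) = ?X ?k * h x + ?k x * ?X h"
    unfolding tangent_mult[OF T k(2) h] .
  have 2: "det_isomorphism A x (\<theta> x) (canonical_form_connection A t x e) = (?X ?k + cE K None x e * ?k x) * h x"
    unfolding canonical_form[OF K t(1) e] det_isomorphism_eq[OF K \<theta>x]
    using alt_scale[OF vol_alt[OF K]] TM.vol_frv[OF K] by (simp add: h_def)
  have "canonical_connection A (\<lambda>y. det_isomorphism A y (\<theta> y)) x e \<omega> =
      ?X (\<lambda>y. det_isomorphism A y (\<theta> y) (t y)) - det_isomorphism A x (\<theta> x) (canonical_form_connection A t x e)"
    unfolding canonical_connection_def dual_connection_def Let_def t_def[symmetric] using \<omega> by simp
  then show "canonical_connection A (\<lambda>y. det_isomorphism A y (\<theta> y)) x e \<omega> =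
      \<omega> (\<lambda>i. dd K i x) * (?X h - cE K None x e * h x)"
    unfolding 1 2 t(2) by (simp add: algebra_simps)
qed

text \<open>The derivative parts in \<open>canonical_sides\<close> agree, so the condition compares
  the zero order terms, frame direction by frame direction.\<close>

lemma canonical_at_iff:
  assumes K: "K \<in> A" "x \<in> fst K" and G: "E.christoffel K D G x"
  shows "canonical_at D x \<longleftrightarrow> (\<forall>a. (\<Sum>b\<in>UNIV. G a b b x) = (if a = None then -1 else 0))"
proof
  assume R: "\<forall>a. (\<Sum>b\<in>UNIV. G a b b x) = (if a = None then -1 else 0)"
  have s: "(\<Sum>a\<in>UNIV. cE K a x e * (\<Sum>b\<in>UNIV. G a b b x)) = - cE K None x e" for e
    by (simp only: R[rule_format]) (simp add: sum_option)
  show "canonical_at D x" unfolding canonical_at_def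
  proof (intro allI impI ballI ext)
    fix \<theta> :: "'m \<Rightarrow> (('n option \<Rightarrow> ('m, 'n) atiyah) \<Rightarrow> complex) \<Rightarrow> complex" and e \<omega>
    assume \<theta>: "local_section A (exterior_power A (atiyah_bundle A)) x \<theta>" and e: "e \<in> atiyah_fibre A x"
    show "det_isomorphism A x (exterior_power_connection A (atiyah_bundle A) (atiyah_bundle A) D \<theta> x e) \<omega> =
       canonical_connection A (\<lambda>y. det_isomorphism A y (\<theta> y)) x e \<omega>"
    proof (cases "\<omega> \<in> alt x")
      case True show ?thesis unfolding canonical_sides[OF K G \<theta> e True] s by simp
    next
      case False then show ?thesis
        by (simp add: det_isomorphism_def canonical_connection_def dual_connection_def Let_def)
    qed
  qed
next
  assume L: "canonical_at D x"
  \<comment> \<open>A section with constant coefficient 1, which isolates the zero order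
    terms.\<close>
  define \<theta> where "\<theta> y = (\<lambda>\<beta>. if \<beta> \<in> altE y then \<beta> (E.frv K y) else 0)" for y
  have \<theta>: "local_section A (exterior_power A (atiyah_bundle A)) x \<theta>"
    unfolding local_section_def
  proof (intro exI conjI)
    show "mopen (fst K)" "x \<in> fst K" using mopen_chart K by auto
    have "\<theta> y \<in> linear_maps (altE y) UNIV" for y
      unfolding linear_maps_def \<theta>_def by (simp add: alt_add alt_scale)
    moreover have "(\<lambda>y. \<theta> y (\<beta> y)) \<in> holomorphic_functions A V"
      if V: "mopen V" "V \<subseteq> fst K" "\<beta> \<in> sections (form_bundle A (atiyah_bundle A)) V" for V \<beta>
      unfolding holfun_iff[OF V(1)]
    proof
      fix y assume y: "y \<in> V"
      then have yk: "y \<in> fst K" using V by blast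
      have "local_section A (form_bundle A (atiyah_bundle A)) y \<beta>" unfolding local_section_def using V y by blast
      then have b: "eventually (\<lambda>z. \<beta> z \<in> altE z) (NH y)" "hn y (\<lambda>z. \<beta> z (E.frv K z))"
        unfolding E.form_section_iff[OF K(1) yk] by auto
      have "eventually (\<lambda>z. \<theta> z (\<beta> z) = \<beta> z (E.frv K z)) (NH y)"
        using b(1) by eventually_elim (simp add: \<theta>_def)
      from hn_cong[OF this] b(2) show "hn y (\<lambda>y. \<theta> y (\<beta> y))" by blast
    qed
    ultimately show "\<theta> \<in> sections (exterior_power A (atiyah_bundle A)) (fst K)"
      unfolding exterior_power_def dual_bundle_def hom_bundle_def trivial_bundle_def by simp
  qed
  have h: "\<theta> x (E.vol K x) = 1" unfolding \<theta>_def using E.vol_alt[OF K] E.vol_frv[OF K] by simp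
  show "\<forall>a. (\<Sum>b\<in>UNIV. G a b b x) = (if a = None then -1 else 0)"
  proof
    fix a
    have e: "fE K a x \<in> atiyah_fibre A x" by (rule fE_fibre[OF K])
    have "det_isomorphism A x (exterior_power_connection A (atiyah_bundle A) (atiyah_bundle A) D \<theta> x (fE K a x)) =
       canonical_connection A (\<lambda>y. det_isomorphism A y (\<theta> y)) x (fE K a x)"
      using L \<theta> e unfolding canonical_at_def by blast
    from fun_cong[OF this, of "TM.vol K x"]
    have "(\<Sum>c\<in>UNIV. cE K c x (fE K a x) * (\<Sum>b\<in>UNIV. G c b b x)) = - cE K None x (fE K a x)"
      unfolding canonical_sides[OF K G \<theta> e vol_alt[OF K]] TM.vol_frv[OF K] h by simp
    then show "(\<Sum>b\<in>UNIV. G a b b x) = (if a = None then -1 else 0)"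
      unfolding E.co_fr[OF K] sum_delta_mult by auto
  qed
qed

section \<open>Normalized symbols and the Ricci equation\<close>

lemma dimc_nz: "(of_nat CARD('n) :: complex) + 1 \<noteq> 0" "CARD('n) \<ge> 2 \<Longrightarrow> (of_nat CARD('n) :: complex) - 1 \<noteq> 0"
proof -
  have "(of_nat CARD('n) :: complex) + 1 = of_nat (Suc CARD('n))" by simp
  then show "(of_nat CARD('n) :: complex) + 1 \<noteq> 0" by (metis of_nat_eq_0_iff nat.distinct(1))
  show "CARD('n) \<ge> 2 \<Longrightarrow> (of_nat CARD('n) :: complex) - 1 \<noteq> 0" by (auto simp: of_nat_eq_1_iff)
qed

text \<open>All conditions on the connection at a single point, expressed by germs; a local solution
  can be checked on its own domain before it is glued to others.\<close>

definition good_at :: "('m, ('m, 'n) atiyah, ('m, 'n) atiyah) conn \<Rightarrow> 'm \<Rightarrow> bool" where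
  "good_at D x \<longleftrightarrow>
    (\<forall>s1 s2. E.ls x s1 \<longrightarrow> E.ls x s2 \<longrightarrow> D s2 x (s1 x) - D s1 x (s2 x) - bracket (atiyah_bundle A) s1 s2 x = 0) \<and>
    (\<forall>s. E.ls x s \<longrightarrow> D s x (euler_section A x) = (- 1 / ((of_nat CARD('n) :: complex) + 1)) *\<^sub>C s x) \<and> canonical_at D x \<and>
    (\<forall>e1\<in>atiyah_fibre A x. \<forall>e2\<in>atiyah_fibre A x. ricci A (atiyah_bundle A) D x e1 e2 = 0)"

text \<open>The coordinate form of vanishing torsion, (ii1) and (ii2). These are algebraic in the
  symbols; (ii3) is kept apart because it involves their derivatives.\<close>

definition normal :: "('n option \<Rightarrow> 'n option \<Rightarrow> 'n option \<Rightarrow> 'm \<Rightarrow> complex) \<Rightarrow> 'm \<Rightarrow> bool" where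
  "normal G x \<longleftrightarrow> (\<forall>a b c. G a b c x = G b a c x) \<and>
    (\<forall>b c. G None b c x = (if b = c then (- 1 / ((of_nat CARD('n) :: complex) + 1)) else 0)) \<and>
    (\<forall>a. (\<Sum>b\<in>UNIV. G a b b x) = (if a = None then -1 else 0))"

lemma normalD:
  assumes "normal G y"
  shows "G None b c y = (if b = c then (- 1 / ((of_nat CARD('n) :: complex) + 1)) else 0)"
    and "G b None c y = (if b = c then (- 1 / ((of_nat CARD('n) :: complex) + 1)) else 0)"
proof -
  have "\<And>b c. G None b c y = (if b = c then (- 1 / ((of_nat CARD('n) :: complex) + 1)) else 0)"
    "G b None c y = G None b c y" using assms unfolding normal_def by blast+
  then show "G None b c y = (if b = c then (- 1 / ((of_nat CARD('n) :: complex) + 1)) else 0)"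
    "G b None c y = (if b = c then (- 1 / ((of_nat CARD('n) :: complex) + 1)) else 0)" by simp_all
qed

lemma euler_at_iff:
  assumes K: "K \<in> A" "x \<in> fst K" and G: "E.christoffel K D G x"
  shows "(\<forall>s. E.ls x s \<longrightarrow> D s x (euler_section A x) = (- 1 / ((of_nat CARD('n) :: complex) + 1)) *\<^sub>C s x) \<longleftrightarrow>
    (\<forall>b c. G None b c x = (if b = c then (- 1 / ((of_nat CARD('n) :: complex) + 1)) else 0))"
proof
  assume L: "\<forall>s. E.ls x s \<longrightarrow> D s x (euler_section A x) = (- 1 / ((of_nat CARD('n) :: complex) + 1)) *\<^sub>C s x"
  show "\<forall>b c. G None b c x = (if b = c then (- 1 / ((of_nat CARD('n) :: complex) + 1)) else 0)"
  proof (intro allI)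
    fix b c
    have "G None b c x = cE K c x (D (fE K b) x (fE K None x))" by (rule E.christoffel_fr[OF G K, symmetric])
    also have "\<dots> = cE K c x ((- 1 / ((of_nat CARD('n) :: complex) + 1)) *\<^sub>C fE K b x)"
      using L[rule_format, OF E.ls_fr[OF K]] unfolding euler_fE[OF K] by simp
    also have "\<dots> = (- 1 / ((of_nat CARD('n) :: complex) + 1)) * (if c = b then 1 else 0)"
      unfolding E.co_scale[OF K E.fr_fibre[OF K]] E.co_fr[OF K] ..
    finally show "G None b c x = (if b = c then (- 1 / ((of_nat CARD('n) :: complex) + 1)) else 0)" by auto
  qed
next
  assume R: "\<forall>b c. G None b c x = (if b = c then (- 1 / ((of_nat CARD('n) :: complex) + 1)) else 0)"
  show "\<forall>s. E.ls x s \<longrightarrow> D s x (euler_section A x) = (- 1 / ((of_nat CARD('n) :: complex) + 1)) *\<^sub>C s x"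
  proof (intro allI impI)
    fix s assume s: "E.ls x s"
    have fN: "fE K None x \<in> fibre (atiyah_bundle A) x" by (rule E.fr_fibre[OF K])
    note C = E.christoffel_co[OF G K s fN]
    show "D s x (euler_section A x) = (- 1 / ((of_nat CARD('n) :: complex) + 1)) *\<^sub>C s x" unfolding euler_fE[OF K]
    proof (rule E.fibre_eqI[OF K C(1) E.fibre_scale[OF K E.ls_fibre[OF s]]])
      fix c
      have "(\<Sum>b\<in>UNIV. cE K b x (s x) * G None b c x) = cE K c x (s x) * (- 1 / ((of_nat CARD('n) :: complex) + 1))"
        using R by (simp add: if_distrib[of "\<lambda>x. _ * x"] cong: if_cong)
      then show "cE K c x (D s x (fE K None x)) = cE K c x ((- 1 / ((of_nat CARD('n) :: complex) + 1)) *\<^sub>C s x)"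
        unfolding C(2) E.co_scale[OF K E.ls_fibre[OF s]] E.co_fr[OF K] mult.assoc sum_distrib_left[symmetric] sum_delta_mult
        by (simp add: anchor_fE[OF K])
    qed
  qed
qed

lemma good_at_iff:
  assumes K: "K \<in> A" "x \<in> fst K"
    and G: "eventually (\<lambda>y. E.christoffel K D G y) (NH x)" "\<And>a b c. hn x (G a b c)"
  shows "good_at D x \<longleftrightarrow> normal G x \<and> (\<forall>b c. (\<Sum>a\<in>UNIV. E.riem K G a b c a x) = 0)"
proof -
  have Gx: "E.christoffel K D G x" by (rule NH_self[OF G(1) chart_pts[OF K]])
  have "(\<forall>e1\<in>atiyah_fibre A x. \<forall>e2\<in>atiyah_fibre A x. ricci A (atiyah_bundle A) D x e1 e2 = 0) \<longleftrightarrow>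
      (\<forall>b c. (\<Sum>a\<in>UNIV. E.riem K G a b c a x) = 0)" (is "?L \<longleftrightarrow> ?R")
  proof
    assume ?L
    show ?R
    proof (intro allI)
      fix b c
      have "ricci A (atiyah_bundle A) D x (fE K c x) (fE K b x) = 0"
        using \<open>?L\<close> fE_fibre[OF K] by blast
      then show "(\<Sum>a\<in>UNIV. E.riem K G a b c a x) = 0"
        unfolding E.ricci_coords[OF K G E.fr_fibre[OF K] E.fr_fibre[OF K]] E.co_fr[OF K]
          mult.assoc sum_distrib_left[symmetric] sum_delta_mult .
    qed
  next
    assume ?R
    then show ?L using E.ricci_coords[OF K G] by simp
  qed
  then show ?thesis unfolding good_at_def normal_def E.torsion_christoffel[OF Gx K] euler_at_iff[OF K Gx]
      canonical_at_iff[OF K Gx] by blast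
qed

text \<open>The contracted symbols are constant by (ii2), so one derivative term of the curvature
  drops out and one quadratic term reduces to a single symbol. If \<open>b\<close> or
  \<open>c\<close> is the Euler index, the remaining terms are fixed by (ii1) and (ii2) and
  cancel.\<close>

lemma ricci_normal:
  assumes K: "K \<in> A" "x \<in> fst K"
    and n: "eventually (\<lambda>y. normal G y) (NH x)" and G: "\<And>a b c. hn x (G a b c)"
  shows "(\<Sum>a\<in>UNIV. E.riem K G a (Some i) (Some j) a x) =
      (\<Sum>k\<in>UNIV. dd K k x (G (Some i) (Some j) (Some k)))
      - (\<Sum>k\<in>UNIV. \<Sum>l\<in>UNIV. G (Some k) (Some j) (Some l) x * G (Some i) (Some l) (Some k) x)
      - ((of_nat CARD('n) :: complex) - 1) / ((of_nat CARD('n) :: complex) + 1) * G (Some i) (Some j) None x"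
    and "b = None \<or> c = None \<Longrightarrow> (\<Sum>a\<in>UNIV. E.riem K G a b c a x) = 0"
proof -
  have x: "x \<in> pts" using chart_pts[OF K] .
  have nx: "G a b c x = G b a c x" "G None b c x = (if b = c then (- 1 / ((of_nat CARD('n) :: complex) + 1)) else 0)" "(\<Sum>b\<in>UNIV. G a b b x) = (if a = None then -1 else 0)" for a b c
    using NH_self[OF n x] unfolding normal_def by blast+
  have nN: "G b None c x = (if b = c then (- 1 / ((of_nat CARD('n) :: complex) + 1)) else 0)" for b c using nx(1)[of b None c] nx(2) by simp
  have tr: "(\<Sum>a\<in>UNIV. G a c a x) = (if c = None then -1 else 0)" for c
    using nx(3)[of c] nx(1)[of _ c] by simp
  have 2: "(\<Sum>a\<in>UNIV. E.dA K b x (G a c a)) = 0" for b c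
  proof -
    note T = E.anchor_fr[OF K, of b]
    have "(\<Sum>a\<in>UNIV. E.dA K b x (G a c a)) = E.dA K b x (\<lambda>y. \<Sum>a\<in>UNIV. G a c a y)"
      by (rule tangent_sum[OF T G, symmetric])
    also have "\<dots> = E.dA K b x (\<lambda>y. if c = None then -1 else 0)"
    proof (rule tangent_cong[OF T], rule eventually_mono[OF n])
      fix y assume "normal G y"
      then have "G a c a y = G c a a y" "(\<Sum>b\<in>UNIV. G c b b y) = (if c = None then -1 else 0)" for a
        unfolding normal_def by blast+
      then show "(\<Sum>a\<in>UNIV. G a c a y) = (if c = None then -1 else 0)" by simp
    qed
    also have "\<dots> = 0" by (rule tangent_const[OF T])
    finally show ?thesis .
  qed
  have main: "(\<Sum>a\<in>UNIV. E.riem K G a b c a x) = (\<Sum>k\<in>UNIV. dd K k x (G b c (Some k))) - G b c None x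
      - (\<Sum>a\<in>UNIV. \<Sum>f\<in>UNIV. G a c f x * G b f a x)" for b c
  proof -
    have 1: "(\<Sum>a\<in>UNIV. E.dA K a x (G b c a)) = (\<Sum>k\<in>UNIV. dd K k x (G b c (Some k)))"
      by (simp add: sum_option anchor_fE[OF K])
    have 3: "(\<Sum>a\<in>UNIV. \<Sum>f\<in>UNIV. G b c f x * G a f a x) = - G b c None x"
      by (subst sum.swap) (simp add: sum_distrib_left[symmetric] tr sum_option)
    show ?thesis unfolding E.riem_def sum_subtractf sum.distrib 1 2 3 by simp
  qed
  have const0: "dd K k x (G b c d) = 0" if "b = None \<or> c = None" for b c d k
  proof -
    have "dd K k x (G b c d) = dd K k x (\<lambda>y. if (if b = None then c else b) = d then (- 1 / ((of_nat CARD('n) :: complex) + 1)) else 0)"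
      by (rule dd_cong[OF K], rule eventually_mono[OF n]) (use that in \<open>auto simp: normalD\<close>)
    then show ?thesis by (simp add: dd_const[OF K])
  qed
  show "(\<Sum>a\<in>UNIV. E.riem K G a b c a x) = 0" if bc: "b = None \<or> c = None"
  proof (cases "c = None")
    case True
    have "(\<Sum>a\<in>UNIV. \<Sum>f\<in>UNIV. G a c f x * G b f a x) = (\<Sum>a\<in>UNIV. (- 1 / ((of_nat CARD('n) :: complex) + 1)) * G b a a x)"
      unfolding True nN by (simp add: if_distrib[of "\<lambda>x. x * _"] cong: if_cong)
    also have "\<dots> = (- 1 / ((of_nat CARD('n) :: complex) + 1)) * (if b = None then -1 else 0)" unfolding sum_distrib_left[symmetric] nx(3) ..
    finally show ?thesis unfolding main const0[OF bc] unfolding True nN by simp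
  next
    case False
    then have b: "b = None" using bc by blast
    have "(\<Sum>a\<in>UNIV. \<Sum>f\<in>UNIV. G a c f x * G b f a x) = (\<Sum>a\<in>UNIV. G a c a x * (- 1 / ((of_nat CARD('n) :: complex) + 1)))"
      unfolding b nx(2) by (simp add: if_distrib[of "\<lambda>x. _ * x"] cong: if_cong)
    also have "\<dots> = (if c = None then -1 else 0) * (- 1 / ((of_nat CARD('n) :: complex) + 1))" unfolding sum_distrib_right[symmetric] tr ..
    finally show ?thesis unfolding main const0[OF bc] unfolding b nx(2) by auto
  qed
  show "(\<Sum>a\<in>UNIV. E.riem K G a (Some i) (Some j) a x) =
      (\<Sum>k\<in>UNIV. dd K k x (G (Some i) (Some j) (Some k)))
      - (\<Sum>k\<in>UNIV. \<Sum>l\<in>UNIV. G (Some k) (Some j) (Some l) x * G (Some i) (Some l) (Some k) x)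
      - ((of_nat CARD('n) :: complex) - 1) / ((of_nat CARD('n) :: complex) + 1) * G (Some i) (Some j) None x"
  proof -
    let ?Q = "\<Sum>k\<in>UNIV. \<Sum>l\<in>UNIV. G (Some k) (Some j) (Some l) x * G (Some i) (Some l) (Some k) x"
    \<comment> \<open>The contractions of the quadratic term through the Euler index, one for each
      place. Together with the linear term they give the coefficient 1 - 2/(n + 1).\<close>
    have a: "(\<Sum>l\<in>UNIV. G None (Some j) (Some l) x * G (Some i) (Some l) None x) = (- 1 / ((of_nat CARD('n) :: complex) + 1)) * G (Some i) (Some j) None x"
      unfolding nx(2) by (simp add: if_distrib[of "\<lambda>x. x * _"] cong: if_cong)
    have b: "(\<Sum>k\<in>UNIV. G (Some k) (Some j) None x * G (Some i) None (Some k) x) = (- 1 / ((of_nat CARD('n) :: complex) + 1)) * G (Some i) (Some j) None x"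
      unfolding nN by (simp add: if_distrib[of "\<lambda>x. _ * x"] cong: if_cong)
    have "(\<Sum>a\<in>UNIV. \<Sum>f\<in>UNIV. G a (Some j) f x * G (Some i) f a x) = 2 * (- 1 / ((of_nat CARD('n) :: complex) + 1)) * G (Some i) (Some j) None x + ?Q"
      unfolding sum_option sum.distrib a b unfolding nx(2) by simp
    moreover have "1 + 2 * (- 1 / ((of_nat CARD('n) :: complex) + 1)) = ((of_nat CARD('n) :: complex) - 1) / ((of_nat CARD('n) :: complex) + 1)" using dimc_nz(1) by (simp add: field_simps)
    then have "((of_nat CARD('n) :: complex) - 1) / ((of_nat CARD('n) :: complex) + 1) * G (Some i) (Some j) None x = G (Some i) (Some j) None x + 2 * (- 1 / ((of_nat CARD('n) :: complex) + 1)) * G (Some i) (Some j) None x"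
      by (metis distrib_right mult_1)
    ultimately show ?thesis unfolding main by (simp only: algebra_simps)
  qed
qed

text \<open>For n \<ge> 2 the Ricci equation can be solved for the \<open>None\<close> components.
  It contains derivatives of the spatial symbols, so these have to agree near
  \<open>x\<close>.\<close>

lemma normal_unique:
  assumes n2: "CARD('n) \<ge> 2" and K: "K \<in> A" "x \<in> fst K"
    and n: "eventually (\<lambda>y. normal G y) (NH x)" "eventually (\<lambda>y. normal G' y) (NH x)"
    and G: "\<And>a b c. hn x (G a b c)" "\<And>a b c. hn x (G' a b c)"
    and R: "\<And>b c. (\<Sum>a\<in>UNIV. E.riem K G a b c a x) = 0" "\<And>b c. (\<Sum>a\<in>UNIV. E.riem K G' a b c a x) = 0"
    and eq: "\<And>i j k. eventually (\<lambda>y. G (Some i) (Some j) (Some k) y = G' (Some i) (Some j) (Some k) y) (NH x)"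
  shows "G a b c x = G' a b c x"
proof -
  have x: "x \<in> pts" using chart_pts[OF K] .
  have nx: "G a b c x = G b a c x" "G None b c x = (if b = c then (- 1 / ((of_nat CARD('n) :: complex) + 1)) else 0)" 
    "G' a b c x = G' b a c x" "G' None b c x = (if b = c then (- 1 / ((of_nat CARD('n) :: complex) + 1)) else 0)" for a b c
    using NH_self[OF n(1) x] NH_self[OF n(2) x] unfolding normal_def by blast+
  have e: "G (Some i) (Some j) (Some k) x = G' (Some i) (Some j) (Some k) x" for i j k by (rule NH_self[OF eq x])
  have d: "dd K k x (G (Some i) (Some j) (Some k)) = dd K k x (G' (Some i) (Some j) (Some k))" for i j k
    by (rule dd_cong[OF K eq])
  have 0: "G (Some i) (Some j) None x = G' (Some i) (Some j) None x" for i j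
  proof -
    have "((of_nat CARD('n) :: complex) - 1) / ((of_nat CARD('n) :: complex) + 1) * G (Some i) (Some j) None x = ((of_nat CARD('n) :: complex) - 1) / ((of_nat CARD('n) :: complex) + 1) * G' (Some i) (Some j) None x"
    proof -
      have "p = q" if "0 = S - Q - p" "0 = S - Q - q" for p q S Q :: complex using that by (metis diff_left_imp_eq)
      note l = this
      show ?thesis by (rule l[OF ricci_normal(1)[OF K n(1) G(1), of i j, unfolded R d e] ricci_normal(1)[OF K n(2) G(2), of i j, unfolded R]])
    qed
    moreover have "((of_nat CARD('n) :: complex) - 1) / ((of_nat CARD('n) :: complex) + 1) \<noteq> 0" using dimc_nz n2 by simp
    ultimately show ?thesis by (simp only: mult_cancel_left) blast
  qed
  show ?thesis
  proof (cases a)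
    case None then show ?thesis using nx(2,4) by simp
  next
    case (Some i)
    show ?thesis
    proof (cases b)
      case None then show ?thesis using nx(1)[of a b c] nx(3)[of a b c] nx(2,4) by simp
    next
      case (Some j) then show ?thesis using \<open>a = Some i\<close> e 0 by (cases c) simp_all
    qed
  qed
qed

text \<open>The symbols on E with Thomas's parameters \<open>P\<close> as spatial part. Entries with
  a lower Euler index are those of (ii1); the remaining \<open>None\<close> component is the Ricci
  equation of \<open>ricci_normal\<close> solved for it.\<close>

definition thomas :: "'m set \<times> ('m \<Rightarrow> complex^'n) \<Rightarrow> ('n \<Rightarrow> 'n \<Rightarrow> 'n \<Rightarrow> 'm \<Rightarrow> complex) \<Rightarrow>
    'n option \<Rightarrow> 'n option \<Rightarrow> 'n option \<Rightarrow> 'm \<Rightarrow> complex" where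
  "thomas K P a b c y = (case a of None \<Rightarrow> if b = c then (- 1 / ((of_nat CARD('n) :: complex) + 1)) else 0 | Some i \<Rightarrow>
     (case b of None \<Rightarrow> if a = c then (- 1 / ((of_nat CARD('n) :: complex) + 1)) else 0 | Some j \<Rightarrow>
       (case c of Some k \<Rightarrow> P i j k y | None \<Rightarrow> ((of_nat CARD('n) :: complex) + 1) / ((of_nat CARD('n) :: complex) - 1) *
         ((\<Sum>k\<in>UNIV. dd K k y (P i j k)) - (\<Sum>k\<in>UNIV. \<Sum>l\<in>UNIV. P k j l y * P i l k y)))))"

lemma thomas_normal:
  assumes n2: "CARD('n) \<ge> 2" and K: "K \<in> A" "x \<in> fst K"
    and P: "\<And>i j k. hn x (P i j k)"
    and sym: "eventually (\<lambda>y. \<forall>i j k. P i j k y = P j i k y) (NH x)"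
    and tr: "eventually (\<lambda>y. \<forall>i. (\<Sum>j\<in>UNIV. P i j j y) = 0) (NH x)"
  shows "hn x (thomas K P a b c)"
    and "eventually (\<lambda>y. normal (thomas K P) y) (NH x)"
    and "(\<Sum>a\<in>UNIV. E.riem K (thomas K P) a b c a x) = 0"
proof -
  have x: "x \<in> pts" using chart_pts[OF K] .
  have hn: "hn x (thomas K P a b c)" for a b c
  proof -
    have e: "thomas K P a b c = (case a of None \<Rightarrow> (\<lambda>y. if b = c then (- 1 / ((of_nat CARD('n) :: complex) + 1)) else 0) | Some i \<Rightarrow>
     (case b of None \<Rightarrow> (\<lambda>y. if a = c then (- 1 / ((of_nat CARD('n) :: complex) + 1)) else 0) | Some j \<Rightarrow>
       (case c of Some k \<Rightarrow> P i j k | None \<Rightarrow> (\<lambda>y. ((of_nat CARD('n) :: complex) + 1) / ((of_nat CARD('n) :: complex) - 1) *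
         ((\<Sum>k\<in>UNIV. dd K k y (P i j k)) - (\<Sum>k\<in>UNIV. \<Sum>l\<in>UNIV. P k j l y * P i l k y))))))"
      unfolding thomas_def by (auto split: option.split)
    have h: "hn x (\<lambda>y. ((of_nat CARD('n) :: complex) + 1) / ((of_nat CARD('n) :: complex) - 1) * ((\<Sum>k\<in>UNIV. dd K k y (P i j k)) - (\<Sum>k\<in>UNIV. \<Sum>l\<in>UNIV. P k j l y * P i l k y)))" for i j
      by (intro hn_mult hn_const hn_diff hn_sum hn_dd(1)[OF K] P x)
    show ?thesis unfolding e using h P hn_const[OF x] by (auto split: option.split)
  qed
  then show "hn x (thomas K P a b c)" .
  show nrm: "eventually (\<lambda>y. normal (thomas K P) y) (NH x)"
    using eventually_chart[OF K] NH_NH[OF sym x] sym tr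
  proof eventually_elim
    case (elim y)
    note Ky = K(1) elim(1)
    have s: "P i j k y = P j i k y" for i j k using elim(3) by blast
    have ds: "dd K k y (P i j k) = dd K k y (P j i k)" for i j k
      by (rule dd_cong[OF Ky]) (use elim(2) in \<open>auto elim!: eventually_mono\<close>)
    \<comment> \<open>The solved Ricci equation has to be symmetric in \<open>i\<close> and
      \<open>j\<close> for the torsion to vanish. In its quadratic term this is an exchange of the
      summation indices followed by the symmetry of \<open>P\<close>.\<close>
    have Q: "(\<Sum>k\<in>UNIV. \<Sum>l\<in>UNIV. P k j l y * P i l k y) = (\<Sum>k\<in>UNIV. \<Sum>l\<in>UNIV. P k i l y * P j l k y)" for i j
    proof -
      have "(\<Sum>k\<in>UNIV. \<Sum>l\<in>UNIV. P k j l y * P i l k y) = (\<Sum>k\<in>UNIV. \<Sum>l\<in>UNIV. P l j k y * P i k l y)"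
        by (rule sum.swap)
      also have "\<dots> = (\<Sum>k\<in>UNIV. \<Sum>l\<in>UNIV. P k i l y * P j l k y)"
        by (intro sum.cong refl) (metis s mult.commute)
      finally show ?thesis .
    qed
    have "thomas K P a b c y = thomas K P b a c y" for a b c
    proof (cases "\<exists>i j. a = Some i \<and> b = Some j")
      case True
      then obtain i j where "a = Some i" "b = Some j" by blast
      then show ?thesis unfolding thomas_def
        by (cases c) (simp_all only: option.case ds[of _ i j] Q[of i j] s[of i j])
    next
      case False then show ?thesis by (cases a; cases b) (auto simp: thomas_def)
    qed
    moreover have "thomas K P None b c y = (if b = c then (- 1 / ((of_nat CARD('n) :: complex) + 1)) else 0)" for b c by (simp add: thomas_def)
    moreover have "(\<Sum>b\<in>UNIV. thomas K P a b b y) = (if a = None then -1 else 0)" for a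
    proof (cases a)
      case None
      have "(\<Sum>b\<in>UNIV. thomas K P a b b y) = ((of_nat CARD('n) :: complex) + 1) * (- 1 / ((of_nat CARD('n) :: complex) + 1))"
        by (simp add: None thomas_def sum_option algebra_simps)
      then show ?thesis using None dimc_nz(1) by simp
    next
      case (Some i) then show ?thesis using elim(4) by (simp add: thomas_def sum_option)
    qed
    ultimately show ?case unfolding normal_def by blast
  qed
  show "(\<Sum>a\<in>UNIV. E.riem K (thomas K P) a b c a x) = 0"
  proof (cases "b = None \<or> c = None")
    case True then show ?thesis by (rule ricci_normal(2)[OF K nrm hn])
  next
    case False
    then obtain i j where bc: "b = Some i" "c = Some j" by auto
    have e: "thomas K P (Some i) (Some j) (Some k) = P i j k" for i j k by (simp add: thomas_def fun_eq_iff)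
    have n: "thomas K P (Some i) (Some j) None x = ((of_nat CARD('n) :: complex) + 1) / ((of_nat CARD('n) :: complex) - 1) *
         ((\<Sum>k\<in>UNIV. dd K k x (P i j k)) - (\<Sum>k\<in>UNIV. \<Sum>l\<in>UNIV. P k j l x * P i l k x))"
      by (simp add: thomas_def)
    show ?thesis unfolding bc ricci_normal(1)[OF K nrm hn] e n using dimc_nz(1) dimc_nz(2)[OF n2] by simp
  qed
qed

end

section \<open>Holomorphic ordinary differential equations\<close>

lemma vec_norm_le_card:
  fixes z :: "complex^'k::finite"
  assumes "\<And>k. norm (z $ k) \<le> e"
  shows "norm z \<le> real CARD('k) * e"
proof -
  have "norm z \<le> (\<Sum>k\<in>UNIV. norm (z $ k))" unfolding norm_vec_def by (rule L2_set_le_sum) simp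
  also have "\<dots> \<le> (\<Sum>k\<in>(UNIV::'k set). e)" by (rule sum_mono) (rule assms)
  finally show ?thesis by simp
qed

text \<open>The partial derivatives are bounded on the compact set, and convexity gives the mean
  value inequality.\<close>

lemma holomorphic_lipschitz:
  fixes f :: "complex^'k::finite \<Rightarrow> complex"
  assumes f: "holomorphic_fun_on f S" and S: "open S" and C: "compact C" "convex C" "C \<subseteq> S"
  shows "\<exists>L\<ge>0. \<forall>z\<in>C. \<forall>w\<in>C. norm (f z - f w) \<le> L * norm (z - w)"
proof -
  have "\<exists>b. \<forall>z\<in>C. norm (partial i f z) \<le> b" for i
  proof -
    have "continuous_on C (partial i f)"
      using holomorphic_fun_on_continuous[OF holomorphic_partial[OF f S]] C(3) continuous_on_subset by blast
    then have "bounded (partial i f ` C)" using C(1) compact_continuous_image compact_imp_bounded by blast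
    then show ?thesis unfolding bounded_iff by auto
  qed
  then obtain b where b: "\<And>i z. z \<in> C \<Longrightarrow> norm (partial i f z) \<le> b i" by metis
  let ?L = "\<Sum>i\<in>UNIV. \<bar>b i\<bar>"
  have "norm (f z - f w) \<le> ?L * norm (z - w)" if zw: "z \<in> C" "w \<in> C" for z w
  proof (rule differentiable_bound[OF C(2) _ _ zw])
    fix u assume u: "u \<in> C"
    have "has_gradient f (\<lambda>i. partial i f u) u" using holomorphic_has_gradient[OF f] C(3) u by blast
    then show "(f has_derivative (\<lambda>w. \<Sum>i\<in>UNIV. w $ i * partial i f u)) (at u within C)"
      unfolding has_gradient_def by (rule has_derivative_at_withinI)
    show "onorm (\<lambda>w. \<Sum>i\<in>UNIV. w $ i * partial i f u) \<le> ?L"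
    proof (rule onorm_bound)
      fix w :: "complex^'k"
      have "norm (\<Sum>i\<in>UNIV. w $ i * partial i f u) \<le> (\<Sum>i\<in>UNIV. norm (w $ i * partial i f u))" by (rule norm_sum)
      also have "\<dots> \<le> (\<Sum>i\<in>UNIV. norm w * \<bar>b i\<bar>)"
      proof (rule sum_mono)
        fix i
        have "norm (partial i f u) \<le> \<bar>b i\<bar>" using b[OF u, of i] by linarith
        then show "norm (w $ i * partial i f u) \<le> norm w * \<bar>b i\<bar>"
          unfolding norm_mult using Finite_Cartesian_Product.norm_nth_le[of w i] by (intro mult_mono) auto
      qed
      finally show "norm (\<Sum>i\<in>UNIV. w $ i * partial i f u) \<le> ?L * norm w"
        by (simp add: sum_distrib_left mult.commute)
    qed (simp add: sum_nonneg)
  qed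
  then show ?thesis by (intro exI[of _ ?L]) (simp add: sum_nonneg)
qed

text \<open>Picard iteration.\<close>

lemma holomorphic_ode:
  fixes f :: "'k::finite \<Rightarrow> complex^'k \<Rightarrow> complex" and y0 :: "complex^'k"
  assumes f: "\<And>k. holomorphic_fun_on (f k) S" and S: "open S" "y0 \<in> S"
  obtains r y where "r > 0" "\<And>k. y k 0 = y0 $ k" "\<And>t. t \<in> ball 0 r \<Longrightarrow> (\<chi> k. y k t) \<in> S"
    "\<And>k t. t \<in> ball 0 r \<Longrightarrow> (y k has_field_derivative f k (\<chi> j. y j t)) (at t)"
proof -
  obtain R where R: "R > 0" "cball y0 R \<subseteq> S" using S open_contains_cball by blast
  let ?C = "cball y0 R"
  have "\<exists>B. \<forall>z\<in>?C. norm (f k z) \<le> B" for k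
  proof -
    have "continuous_on ?C (f k)" using holomorphic_fun_on_continuous[OF f] R continuous_on_subset by blast
    then have "bounded (f k ` ?C)" using compact_continuous_image compact_imp_bounded compact_cball by blast
    then show ?thesis unfolding bounded_iff by auto
  qed
  then obtain B0 where B0: "\<And>k z. z \<in> ?C \<Longrightarrow> norm (f k z) \<le> B0 k" by metis
  have "\<exists>L\<ge>0. \<forall>z\<in>?C. \<forall>w\<in>?C. norm (f k z - f k w) \<le> L * norm (z - w)" for k
    by (rule holomorphic_lipschitz[OF f S(1) compact_cball convex_cball R(2)])
  then obtain L0 where L0: "\<And>k. L0 k \<ge> 0" "\<And>k z w. z \<in> ?C \<Longrightarrow> w \<in> ?C \<Longrightarrow> norm (f k z - f k w) \<le> L0 k * norm (z - w)" by metis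
  define B where "B = (\<Sum>k\<in>UNIV. \<bar>B0 k\<bar>) + 1"
  define L where "L = (\<Sum>k\<in>UNIV. L0 k) + 1"
  have B: "norm (f k z) \<le> B" if "z \<in> ?C" for k z
  proof -
    have "\<bar>B0 k\<bar> \<le> (\<Sum>k\<in>UNIV. \<bar>B0 k\<bar>)" by (rule member_le_sum) auto
    then show ?thesis using B0[OF that, of k] unfolding B_def by linarith
  qed
  have L: "norm (f k z - f k w) \<le> L * norm (z - w)" if "z \<in> ?C" "w \<in> ?C" for k z w
  proof -
    have "L0 k \<le> L" unfolding L_def using member_le_sum[of k UNIV L0] L0(1) by fastforce
    then show ?thesis using L0(2)[OF that, of k] mult_right_mono[of "L0 k" L "norm (z - w)"] by fastforce
  qed
  have pos: "B > 0" "L > 0" unfolding B_def L_def using L0(1) by (simp_all add: add_nonneg_pos sum_nonneg)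
  \<comment> \<open>The iterates are controlled component by component: the box of half-width
    \<open>e = R / KK\<close> around \<open>y0\<close> lies in the ball of radius
    \<open>R\<close>.\<close>
  define KK where "KK = real CARD('k)"
  have KK: "KK > 0" unfolding KK_def by simp
  define e where "e = R / KK"
  have e: "e > 0" "KK * e = R" unfolding e_def using R KK by auto
  \<comment> \<open>The first bound keeps the iterates in the box, the second makes successive
    differences shrink by the factor 1/2.\<close>
  define r where "r = min (e / B) (1 / (2 * L * KK))"
  have r: "r > 0" "B * r \<le> e" "L * KK * r \<le> 1/2"
  proof -
    show "r > 0" unfolding r_def using e pos KK by simp
    have "r \<le> e / B" "r \<le> 1 / (2 * L * KK)" unfolding r_def by auto
    then show "B * r \<le> e" "L * KK * r \<le> 1/2" using pos KK by (auto simp: field_simps)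
  qed
  have inC: "(\<chi> k. a k) \<in> ?C" if "\<And>k. norm (a k - y0 $ k) \<le> e" for a
  proof -
    have "norm ((\<chi> k. a k) - y0) \<le> real CARD('k) * e" by (rule vec_norm_le_card) (simp add: that)
    then show ?thesis using e(2) by (simp add: dist_norm norm_minus_commute KK_def)
  qed
  \<comment> \<open>The primitive on the disc that vanishes at 0 takes the place of the integral
    from 0 to \<open>t\<close>.\<close>
  define prim where "prim g = (SOME G. G 0 = 0 \<and> (\<forall>t\<in>ball (0::complex) r. (G has_field_derivative g t) (at t)))"
    for g :: "complex \<Rightarrow> complex"
  have prim: "prim g 0 = 0 \<and> (\<forall>t\<in>ball 0 r. (prim g has_field_derivative g t) (at t))"
    if g: "g holomorphic_on ball 0 r" for g
  proof -
    obtain G where G: "\<And>t. t \<in> ball 0 r \<Longrightarrow> (G has_field_derivative g t) (at t within ball 0 r)"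
      using holomorphic_convex_primitive'[OF convex_ball open_ball g] by blast
    have "((\<lambda>t. G t - G 0) has_field_derivative g t) (at t)" if "t \<in> ball 0 r" for t
      using G[OF that] at_within_open[OF that open_ball] by (auto intro!: derivative_eq_intros)
    then have "\<exists>G. G 0 = 0 \<and> (\<forall>t\<in>ball 0 r. (G has_field_derivative g t) (at t))"
      by (intro exI[of _ "\<lambda>t. G t - G 0"]) simp
    then show ?thesis unfolding prim_def by (rule someI_ex)
  qed
  define Y where "Y = rec_nat (\<lambda>k t. y0 $ k) (\<lambda>m Ym k t. y0 $ k + prim (\<lambda>s. f k (\<chi> j. Ym j s)) t)"
  have Y0: "Y 0 k t = y0 $ k" and YS: "Y (Suc m) k = (\<lambda>t. y0 $ k + prim (\<lambda>s. f k (\<chi> j. Y m j s)) t)" for m k t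
    unfolding Y_def by simp_all
  define good where "good m \<longleftrightarrow> (\<forall>k. Y m k holomorphic_on ball 0 r \<and> (\<forall>t\<in>ball 0 r. norm (Y m k t - y0 $ k) \<le> e))" for m
  have step: "(\<lambda>s. f k (\<chi> j. Y m j s)) holomorphic_on ball 0 r" if m: "good m" for m k
    unfolding holomorphic_on_open[OF open_ball]
  proof
    fix t assume t: "t \<in> ball (0::complex) r"
    have "(\<chi> j. Y m j t) \<in> S" using inC[of "\<lambda>j. Y m j t"] m t R(2) unfolding good_def by blast
    then have "has_gradient (f k) (\<lambda>i. partial i (f k) (\<chi> j. Y m j t)) (\<chi> j. Y m j t)"
      by (rule holomorphic_has_gradient[OF f])
    moreover have "(Y m j has_field_derivative deriv (Y m j) t) (at t)" for j
      using m t unfolding good_def by (intro holomorphic_derivI[of _ "ball 0 r"]) auto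
    ultimately have "((\<lambda>s. f k (\<chi> j. Y m j s)) has_field_derivative
        (\<Sum>j\<in>UNIV. partial j (f k) (\<chi> j. Y m j t) * deriv (Y m j) t)) (at t)"
      by (rule has_gradient_curve[of "f k"])
    then show "\<exists>f'. ((\<lambda>s. f k (\<chi> j. Y m j s)) has_field_derivative f') (at t)" ..
  qed
  have derY: "(Y (Suc m) k has_field_derivative f k (\<chi> j. Y m j t)) (at t)" if "good m" "t \<in> ball 0 r" for m k t
    unfolding YS using prim[OF step[OF that(1), of k]] that(2) by (auto intro!: derivative_eq_intros)
  have good: "good m" for m
  proof (induction m)
    case 0 then show ?case unfolding good_def Y0 using e by (simp add: Y0[abs_def] holomorphic_on_const cong: holomorphic_cong)
  next
    case (Suc m)
    show ?case unfolding good_def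
    proof (intro allI conjI ballI)
      fix k
      show "Y (Suc m) k holomorphic_on ball 0 r"
        unfolding holomorphic_on_open[OF open_ball] using derY[OF Suc] by blast
      fix t assume t: "t \<in> ball (0::complex) r"
      have "norm (Y (Suc m) k t - Y (Suc m) k 0) \<le> B * norm (t - 0)"
      proof (rule field_differentiable_bound[OF convex_ball[of 0 r]])
        show "(Y (Suc m) k has_field_derivative f k (\<chi> j. Y m j z)) (at z within ball 0 r)" if "z \<in> ball 0 r" for z
          using derY[OF Suc that] by (rule has_field_derivative_at_within)
        show "norm (f k (\<chi> j. Y m j z)) \<le> B" if "z \<in> ball 0 r" for z
          by (rule B, rule inC) (use Suc that in \<open>auto simp: good_def\<close>)
      qed (use t r in auto)
      also have "\<dots> \<le> B * r" using t pos by (intro mult_left_mono) (auto simp: dist_norm)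
      finally show "norm (Y (Suc m) k t - y0 $ k) \<le> e"
        using r(2) prim[OF step[OF Suc, of k]] by (simp add: YS)
    qed
  qed
  have zero: "Y m k 0 = y0 $ k" for m k
    by (cases m) (use prim[OF step[OF good]] in \<open>simp_all add: Y0 YS\<close>)
  have dist: "norm (Y (Suc m) k t - Y m k t) \<le> e * (1/2)^m" if "t \<in> ball 0 r" for m k t
    using that
  proof (induction m arbitrary: k t)
    case 0 then show ?case using good[of 1] unfolding good_def by (simp add: Y0)
  next
    case (Suc m)
    let ?D = "\<lambda>t. Y (Suc (Suc m)) k t - Y (Suc m) k t"
    have "norm (?D t - ?D 0) \<le> (L * (KK * (e * (1/2)^m))) * norm (t - 0)"
    proof (rule field_differentiable_bound[OF convex_ball[of 0 r]])
      fix z :: complex assume z: "z \<in> ball 0 r"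
      show "(?D has_field_derivative f k (\<chi> j. Y (Suc m) j z) - f k (\<chi> j. Y m j z)) (at z within ball 0 r)"
        by (rule DERIV_diff[OF has_field_derivative_at_within[OF derY[OF good z]] has_field_derivative_at_within[OF derY[OF good z]]])
      have "norm (f k (\<chi> j. Y (Suc m) j z) - f k (\<chi> j. Y m j z)) \<le> L * norm ((\<chi> j. Y (Suc m) j z) - (\<chi> j. Y m j z))"
        using good[of m] good[of "Suc m"] z unfolding good_def by (intro L inC) auto
      also have "norm ((\<chi> j. Y (Suc m) j z) - (\<chi> j. Y m j z)) \<le> KK * (e * (1/2)^m)"
        unfolding KK_def by (rule vec_norm_le_card) (use Suc.IH[OF z] in simp)
      finally show "norm (f k (\<chi> j. Y (Suc m) j z) - f k (\<chi> j. Y m j z)) \<le> L * (KK * (e * (1/2)^m))"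
        using pos by simp
    qed (use Suc.prems r in auto)
    also have "\<dots> \<le> (L * (KK * (e * (1/2)^m))) * r"
      using Suc.prems pos KK e by (intro mult_left_mono) (auto simp: dist_norm)
    also have "\<dots> = (L * KK * r) * (e * (1/2)^m)" by simp
    also have "\<dots> \<le> 1/2 * (e * (1/2)^m)" using r(3) e by (intro mult_right_mono) auto
    finally show ?case by (simp add: zero)
  qed
  \<comment> \<open>The limit is written as a telescoping series, so that the geometric bound
    \<open>dist\<close> gives uniform convergence.\<close>
  define y where "y k t = y0 $ k + (\<Sum>i. Y (Suc i) k t - Y i k t)" for k t
  have ul: "uniform_limit (ball 0 r) (\<lambda>m. Y m k) (y k) sequentially" for k
  proof -
    have "uniform_limit (ball 0 r) (\<lambda>n t. \<Sum>i<n. Y (Suc i) k t - Y i k t) (\<lambda>t. \<Sum>i. Y (Suc i) k t - Y i k t) sequentially"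
      by (rule Weierstrass_m_test[OF dist]) (auto intro!: summable_mult summable_geometric)
    then have "uniform_limit (ball 0 r) (\<lambda>n t. y0 $ k + (\<Sum>i<n. Y (Suc i) k t - Y i k t)) (y k) sequentially"
      unfolding y_def by (intro uniform_limit_intros)
    moreover have "y0 $ k + (\<Sum>i<n. Y (Suc i) k t - Y i k t) = Y n k t" for n t
      by (subst sum_lessThan_telescope) (simp add: Y0)
    ultimately show ?thesis by simp
  qed
  have lim: "(\<lambda>m. Y m k t) \<longlonglongrightarrow> y k t" if "t \<in> ball 0 r" for k t
    by (rule tendsto_uniform_limitI[OF ul that])
  have yC: "(\<chi> k. y k t) \<in> ?C" if t: "t \<in> ball 0 r" for t
  proof (rule inC)
    fix k
    have "(\<lambda>m. norm (Y m k t - y0 $ k)) \<longlonglongrightarrow> norm (y k t - y0 $ k)" by (intro tendsto_intros lim t)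
    then show "norm (y k t - y0 $ k) \<le> e"
      by (rule LIMSEQ_le_const2) (use good t in \<open>auto simp: good_def\<close>)
  qed
  have "(y k has_field_derivative f k (\<chi> j. y j t)) (at t)" if t: "t \<in> ball 0 r" for k t
  proof -
    \<comment> \<open>Derivatives of locally uniformly convergent holomorphic functions converge to
      the derivative of the limit, which continuity of \<open>f k\<close> then identifies.\<close>
    have "\<exists>g'. \<forall>x\<in>ball 0 r. (y k has_field_derivative g' x) (at x) \<and> (\<lambda>n. f k (\<chi> j. Y n j x)) \<longlonglongrightarrow> g' x"
    proof (rule has_complex_derivative_uniform_sequence[OF open_ball derY[OF good]])
      fix x :: complex assume "x \<in> ball 0 r"
      then obtain d where "d > 0" "cball x d \<subseteq> ball 0 r" using open_ball open_contains_cball by blast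
      moreover have "uniform_limit (ball 0 r) (\<lambda>n. Y (Suc n) k) (y k) sequentially"
        by (rule filterlim_compose[OF ul filterlim_Suc])
      ultimately show "\<exists>d>0. cball x d \<subseteq> ball 0 r \<and> uniform_limit (cball x d) (\<lambda>n. Y (Suc n) k) (y k) sequentially"
        using uniform_limit_on_subset by blast
    qed
    then obtain g' where g': "(\<lambda>n. f k (\<chi> j. Y n j t)) \<longlonglongrightarrow> g' t" "(y k has_field_derivative g' t) (at t)" using t by blast
    have "(\<chi> j. y j t) \<in> S" using yC[OF t] R by blast
    then have "isCont (f k) (\<chi> j. y j t)"
      using holomorphic_fun_on_continuous[OF f] S(1) continuous_on_eq_continuous_at by blast
    moreover have "(\<lambda>n. \<chi> j. Y n j t) \<longlonglongrightarrow> (\<chi> j. y j t)" by (intro tendsto_vec_lambda lim t)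
    ultimately have "(\<lambda>n. f k (\<chi> j. Y n j t)) \<longlonglongrightarrow> f k (\<chi> j. y j t)" by (rule isCont_tendsto_compose)
    then show ?thesis using LIMSEQ_unique[OF g'(1)] g'(2) by simp
  qed
  moreover have "y k 0 = y0 $ k" for k using lim[of 0 k] r LIMSEQ_unique[of "\<lambda>m. y0 $ k"] by (simp add: zero)
  moreover have "(\<chi> k. y k t) \<in> S" if "t \<in> ball 0 r" for t using yC[OF that] R by blast
  ultimately show ?thesis using that r(1) by blast
qed

section \<open>Geodesics in coordinates\<close>

context hol_atlas
begin

lemma immersedD:
  assumes c: "immersed_curve A W c" and t: "t \<in> W"
  shows "hn (c t) f \<Longrightarrow> \<exists>S. open S \<and> t \<in> S \<and> S \<subseteq> W \<and> (\<lambda>s. f (c s)) holomorphic_on S"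
    and "eventually P (NH (c t)) \<Longrightarrow> \<exists>S. open S \<and> t \<in> S \<and> S \<subseteq> W \<and> (\<forall>s\<in>S. P (c s))"
    and "c t \<in> pts"
proof -
  have c': "open W" "c ` W \<subseteq> pts"
    "\<And>V. mopen V \<Longrightarrow> open {t\<in>W. c t \<in> V} \<and> (\<forall>f\<in>holomorphic_functions A V. (f \<circ> c) holomorphic_on {t\<in>W. c t \<in> V})"
    using c unfolding immersed_curve_def by blast+
  show pt: "c t \<in> pts" using c' t by blast
  show "\<exists>S. open S \<and> t \<in> S \<and> S \<subseteq> W \<and> (\<lambda>s. f (c s)) holomorphic_on S" if f: "hn (c t) f"
  proof -
    obtain V where "mopen V" "c t \<in> V" "f \<in> holomorphic_functions A V" using f unfolding holomorphic_near_def by blast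
    then show ?thesis using c'(3)[of V] t by (intro exI[of _ "{t\<in>W. c t \<in> V}"]) (auto simp: comp_def)
  qed
  show "\<exists>S. open S \<and> t \<in> S \<and> S \<subseteq> W \<and> (\<forall>s\<in>S. P (c s))" if P: "eventually P (NH (c t))"
  proof -
    obtain V where "mopen V" "c t \<in> V" "\<forall>y\<in>V. P y" using P unfolding eventually_NH[OF pt] by blast
    then show ?thesis using c'(3)[of V] t by (intro exI[of _ "{t\<in>W. c t \<in> V}"]) auto
  qed
qed

lemma velocity_coord: "K \<in> A \<Longrightarrow> c t \<in> fst K \<Longrightarrow> velocity A c t (xi K k) = deriv (\<lambda>s. snd K (c s) $ k) t"
  unfolding velocity_def using hn_coord by (simp add: comp_def)

lemma velocity_expand:
  assumes K: "K \<in> A" "c t \<in> fst K" and S: "open S" "t \<in> S" "\<And>s. s \<in> S \<Longrightarrow> c s \<in> fst K"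
    and d: "\<And>k. (\<lambda>s. snd K (c s) $ k) holomorphic_on S"
  shows "velocity A c t f = (\<Sum>k\<in>UNIV. deriv (\<lambda>s. snd K (c s) $ k) t * dd K k (c t) f)"
    and "velocity A c t \<in> tangent_space A (c t)"
    and "hn (c t) f \<Longrightarrow> (\<lambda>s. f (c s)) field_differentiable (at t)"
proof -
  have main: "((\<lambda>s. f (c s)) has_field_derivative (\<Sum>k\<in>UNIV. deriv (\<lambda>s. snd K (c s) $ k) t * dd K k (c t) f)) (at t)"
    if f: "hn (c t) f" for f
  proof -
    have "((\<lambda>s. (f \<circ> pinv K) (\<chi> k. snd K (c s) $ k)) has_field_derivative
        (\<Sum>k\<in>UNIV. dd K k (c t) f * deriv (\<lambda>s. snd K (c s) $ k) t)) (at t)"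
      by (rule has_gradient_curve)
        (use dd_gradient[OF K f] holomorphic_derivI[OF d S(1,2)] in \<open>simp_all add: comp_def\<close>)
    then have "((\<lambda>s. f (c s)) has_field_derivative (\<Sum>k\<in>UNIV. dd K k (c t) f * deriv (\<lambda>s. snd K (c s) $ k) t)) (at t)"
      by (rule has_field_derivative_transform_within_open[OF _ S(1,2)]) (use pinv[OF K(1) S(3)] in simp)
    then show ?thesis by (simp add: mult.commute)
  qed
  then show "hn (c t) f \<Longrightarrow> (\<lambda>s. f (c s)) field_differentiable (at t)" unfolding field_differentiable_def by blast
  have v: "velocity A c t f = (\<Sum>k\<in>UNIV. deriv (\<lambda>s. snd K (c s) $ k) t * dd K k (c t) f)" for f
  proof (cases "hn (c t) f")
    case True then show ?thesis unfolding velocity_def using DERIV_imp_deriv[OF main[OF True]] by (simp add: comp_def)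
  next
    case False then show ?thesis by (simp add: velocity_def dd_not_hn)
  qed
  show "velocity A c t f = (\<Sum>k\<in>UNIV. deriv (\<lambda>s. snd K (c s) $ k) t * dd K k (c t) f)" by (rule v)
  show "velocity A c t \<in> tangent_space A (c t)" unfolding tangent_iff[OF K]
    by (intro exI[of _ "\<lambda>k. deriv (\<lambda>s. snd K (c s) $ k) t"] allI v)
qed

lemma immersed_chart:
  assumes c: "immersed_curve A W c" and t: "t \<in> W" and K: "K \<in> A" "c t \<in> fst K" and P: "eventually P (NH (c t))"
  obtains r where "r > 0" "ball t r \<subseteq> W" "\<And>s. s \<in> ball t r \<Longrightarrow> c s \<in> fst K \<and> P (c s)"
    "\<And>k. (\<lambda>s. snd K (c s) $ k) holomorphic_on ball t r"
proof -
  have "\<forall>k. \<exists>S. open S \<and> t \<in> S \<and> S \<subseteq> W \<and> (\<lambda>s. snd K (c s) $ k) holomorphic_on S"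
    using immersedD(1)[OF c t hn_coord[OF K]] by blast
  then obtain S where S: "\<And>k. open (S k)" "\<And>k. t \<in> S k" "\<And>k. (\<lambda>s. snd K (c s) $ k) holomorphic_on S k" by metis
  have "eventually (\<lambda>y. y \<in> fst K \<and> P y) (NH (c t))" using eventually_chart[OF K] P by (rule eventually_conj)
  then obtain S0 where S0: "open S0" "t \<in> S0" "S0 \<subseteq> W" "\<forall>s\<in>S0. c s \<in> fst K \<and> P (c s)"
    using immersedD(2)[OF c t, of "\<lambda>y. y \<in> fst K \<and> P y"] by blast
  have "open (\<Inter>k. S k)" by (rule open_INT) (use S in auto)
  then have "open (S0 \<inter> (\<Inter>k. S k))" "t \<in> S0 \<inter> (\<Inter>k. S k)" using S S0 by auto
  then obtain r where r: "r > 0" "ball t r \<subseteq> S0 \<inter> (\<Inter>k. S k)" by (rule openE)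
  show ?thesis
  proof (rule that[OF r(1)])
    show "ball t r \<subseteq> W" using r(2) S0(3) by blast
    show "c s \<in> fst K \<and> P (c s)" if "s \<in> ball t r" for s using S0(4) r(2) that by blast
    have "ball t r \<subseteq> S k" for k using r(2) by blast
    then show "(\<lambda>s. snd K (c s) $ k) holomorphic_on ball t r" for k by (rule holomorphic_on_subset[OF S(3)])
  qed
qed

lemma velocity_immersed:
  assumes c: "immersed_curve A W c" and t: "t \<in> W" and K: "K \<in> A" "c t \<in> fst K"
  shows "velocity A c t f = (\<Sum>k\<in>UNIV. deriv (\<lambda>s. snd K (c s) $ k) t * dd K k (c t) f)"
    and "velocity A c t \<in> tangent_space A (c t)"
    and "\<exists>k. deriv (\<lambda>s. snd K (c s) $ k) t \<noteq> 0"
proof -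
  obtain r where r: "r > 0" "ball t r \<subseteq> W" "\<And>s. s \<in> ball t r \<Longrightarrow> c s \<in> fst K \<and> True"
    "\<And>k. (\<lambda>s. snd K (c s) $ k) holomorphic_on ball t r"
    using immersed_chart[OF c t K, of "\<lambda>_. True"] by auto
  note v = velocity_expand[where c = c and t = t and S = "ball t r", OF K open_ball _ _ r(4)]
  show 1: "velocity A c t f = (\<Sum>k\<in>UNIV. deriv (\<lambda>s. snd K (c s) $ k) t * dd K k (c t) f)" for f using v(1) r by simp
  show "velocity A c t \<in> tangent_space A (c t)" using v(2) r by simp
  have "velocity A c t \<noteq> 0" using c t unfolding immersed_curve_def by blast
  then show "\<exists>k. deriv (\<lambda>s. snd K (c s) $ k) t \<noteq> 0" using 1 by (intro ccontr[of "\<exists>k. deriv (\<lambda>s. snd K (c s) $ k) t \<noteq> 0"]) (auto simp: fun_eq_iff)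
qed

end

context base_atlas
begin

definition geo :: "'m set \<times> ('m \<Rightarrow> complex^'n) \<Rightarrow> ('n \<Rightarrow> 'n \<Rightarrow> 'n \<Rightarrow> 'm \<Rightarrow> complex) \<Rightarrow> (complex \<Rightarrow> 'm) \<Rightarrow> complex \<Rightarrow> bool" where
  "geo K G c t \<longleftrightarrow> (\<forall>k. deriv (deriv (\<lambda>s. snd K (c s) $ k)) t +
     (\<Sum>i\<in>UNIV. \<Sum>j\<in>UNIV. deriv (\<lambda>s. snd K (c s) $ i) t * deriv (\<lambda>s. snd K (c s) $ j) t * G i j k (c t)) = 0)"

text \<open>Along the curve the components of \<open>X\<close> are the first derivatives of the
  coordinates of \<open>c\<close>. Their derivatives in the direction of the velocity are the second
  derivatives, whatever the extension \<open>X\<close>.\<close>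

lemma derivative_along_curve:
  assumes c: "immersed_curve A W c" and N: "open N" "N \<subseteq> W" and V: "mopen V" "c ` N \<subseteq> V"
    and X: "X \<in> vector_fields A V" "\<And>s. s \<in> N \<Longrightarrow> X (c s) = velocity A c s" and t: "t \<in> N"
    and K: "K \<in> A" "c t \<in> fst K" and G: "TM.christoffel K D G (c t)"
  shows "D X (c t) (velocity A c t) = 0 \<longleftrightarrow> geo K G c t"
proof -
  have tW: "t \<in> W" using t N by blast
  note v = velocity_immersed[OF c tW K]
  have lsX: "TM.ls (c t) X" unfolding local_section_def using V X t by auto
  obtain r where r: "r > 0" "ball t r \<subseteq> W" "\<And>s. s \<in> ball t r \<Longrightarrow> c s \<in> fst K \<and> True"
    "\<And>k. (\<lambda>s. snd K (c s) $ k) holomorphic_on ball t r"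
    using immersed_chart[OF c tW K, of "\<lambda>_. True"] by auto
  let ?g = "\<lambda>k s. snd K (c s) $ k"
  have vX: "velocity A c t (\<lambda>y. X y (xi K k)) = deriv (deriv (?g k)) t" for k
  proof -
    have h: "hn (c t) (\<lambda>y. X y (xi K k))" using TM.ls_hn[OF lsX K] .
    have "eventually (\<lambda>s. s \<in> ball t r \<inter> N) (nhds t)" using r N t by (intro eventually_nhds_in_open) auto
    then have "eventually (\<lambda>s. X (c s) (xi K k) = deriv (?g k) s) (nhds t)"
    proof eventually_elim
      case (elim s) then show ?case using X(2)[of s] velocity_coord[of K c s k, OF K(1)] r(3)[of s] by simp
    qed
    then have "deriv (\<lambda>s. X (c s) (xi K k)) t = deriv (deriv (?g k)) t" by (rule deriv_cong_ev) simp
    then show ?thesis unfolding velocity_def using h by (simp add: comp_def)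
  qed
  have Xt: "X (c t) = velocity A c t" by (rule X(2)[OF t])
  have vt: "velocity A c t \<in> fibre (tangent_bundle A) (c t)" using v(2) by simp
  have co: "D X (c t) (velocity A c t) (xi K k) = deriv (deriv (?g k)) t +
     (\<Sum>i\<in>UNIV. \<Sum>j\<in>UNIV. deriv (?g i) t * deriv (?g j) t * G i j k (c t))" for k
    using TM.christoffel_co(2)[OF G K lsX vt, of k] by (simp add: vX Xt velocity_coord[where c = c and t = t, OF K])
  have fib: "D X (c t) (velocity A c t) \<in> fibre (tangent_bundle A) (c t)" by (rule TM.christoffel_co(1)[OF G K lsX vt])
  have "D X (c t) (velocity A c t) = 0 \<longleftrightarrow> (\<forall>k. D X (c t) (velocity A c t) (xi K k) = 0)"
    using TM.fibre_eqI[OF K fib TM.fibre_zero[OF K]] by auto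
  then show ?thesis unfolding geo_def co .
qed

text \<open>Some coordinate \<open>k0\<close> has nonzero derivative along the curve and serves as a
  local parameter. At \<open>y\<close> the field takes the velocity components that belong to the
  parameter value read off from the coordinate \<open>k0\<close> of \<open>y\<close>.\<close>

lemma extend_velocity:
  assumes c: "immersed_curve A W c" and t: "t \<in> W"
  shows "\<exists>N V X. open N \<and> t \<in> N \<and> N \<subseteq> W \<and> mopen V \<and> c ` N \<subseteq> V \<and> X \<in> vector_fields A V \<and>
    (\<forall>s\<in>N. X (c s) = velocity A c s)"
proof -
  obtain K where K: "K \<in> A" "c t \<in> fst K" using pts_chart[OF immersedD(3)[OF c t]] by blast
  obtain r where r: "r > 0" "ball t r \<subseteq> W" "\<And>s. s \<in> ball t r \<Longrightarrow> c s \<in> fst K \<and> True"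
    "\<And>k. (\<lambda>s. snd K (c s) $ k) holomorphic_on ball t r"
    using immersed_chart[OF c t K, of "\<lambda>_. True"] by auto
  let ?g = "\<lambda>k s. snd K (c s) $ k"
  obtain k0 where k0: "deriv (?g k0) t \<noteq> 0" using velocity_immersed(3)[OF c t K] by blast
  obtain r' where r': "r' > 0" "ball t r' \<subseteq> ball t r" "inj_on (?g k0) (ball t r')"
    using has_complex_derivative_locally_injective[OF r(4)[of k0] _ open_ball k0] r(1) by auto
  have hol: "?g k holomorphic_on ball t r'" for k using r(4) r'(2) holomorphic_on_subset by blast
  obtain \<tau> where \<tau>: "\<tau> holomorphic_on (?g k0 ` ball t r')" "\<And>z. z \<in> ball t r' \<Longrightarrow> \<tau> (?g k0 z) = z"
    using holomorphic_has_inverse[OF hol open_ball r'(3)] by metis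
  let ?T = "?g k0 ` ball t r'"
  have oT: "open ?T" by (rule open_mapping_thm3[OF hol open_ball r'(3)])
  have o1: "open {z :: complex^'n. z $ k0 \<in> ?T}" using open_vimage_vec_nth[OF oT, of k0] by (simp add: vimage_def)
  let ?V = "{y \<in> fst K. snd K y \<in> {z. z $ k0 \<in> ?T}}"
  have V: "mopen ?V" by (rule mopen_preimage[OF K(1) o1])
  let ?X = "\<lambda>y. \<Sum>k\<in>UNIV. deriv (?g k) (\<tau> (snd K y $ k0)) *\<^sub>C dd K k y"
  have "TM.ls y ?X" if y: "y \<in> ?V" for y
  proof (rule TM.ls_comb[OF K(1)])
    show "y \<in> fst K" using y by blast
    have "(\<lambda>w. deriv (?g k) (\<tau> w)) holomorphic_on ?T" for k
    proof -
      have "(deriv (?g k) \<circ> \<tau>) holomorphic_on ?T"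
        by (rule holomorphic_on_compose_gen[OF \<tau>(1) holomorphic_deriv[OF hol open_ball]]) (use \<tau>(2) in auto)
      then show ?thesis by (simp add: comp_def)
    qed
    then show "hn y (\<lambda>y. deriv (?g k) (\<tau> (snd K y $ k0)))" for k
      by (rule hn_compose1[OF _ oT]) (use y hn_coord[OF K(1)] in auto)
  qed
  then have X: "?X \<in> vector_fields A ?V" using TM.sections_ls[OF V] by simp
  show ?thesis
  proof (intro exI conjI ballI)
    show "open (ball t r')" "t \<in> ball t r'" "ball t r' \<subseteq> W" "mopen ?V" "?X \<in> vector_fields A ?V"
      using r' r V X by auto
    show "c ` ball t r' \<subseteq> ?V" using r' r(3) by auto
    fix s assume s: "s \<in> ball t r'"
    then have s': "c s \<in> fst K" "s \<in> W" using r r' by auto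
    show "?X (c s) = velocity A c s"
      by (rule ext) (simp add: \<tau>(2)[OF s] velocity_immersed(1)[OF c s'(2) K(1) s'(1)] sum_fun_apply)
  qed
qed

lemma geodesicD:
  assumes g: "geodesic A D W c" and t: "t \<in> W" and K: "K \<in> A" "c t \<in> fst K" and G: "TM.christoffel K D G (c t)"
  shows "geo K G c t"
proof -
  have c: "immersed_curve A W c" using g unfolding geodesic_def by blast
  obtain N V X where N: "open N" "t \<in> N" "N \<subseteq> W" "mopen V" "c ` N \<subseteq> V" "X \<in> vector_fields A V"
    "\<forall>s\<in>N. X (c s) = velocity A c s \<and> D X (c s) (velocity A c s) = 0"
    using g t unfolding geodesic_def by blast
  note N = this
  have "D X (c t) (velocity A c t) = 0 \<longleftrightarrow> geo K G c t"
    by (rule derivative_along_curve[OF c N(1,3,4,5,6) _ N(2) K G]) (use N(7) in blast)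
  then show ?thesis using N(2,7) by simp
qed

lemma geodesicI:
  assumes c: "immersed_curve A W c"
    and g: "\<And>t. t \<in> W \<Longrightarrow> \<exists>K\<in>A. \<exists>G. c t \<in> fst K \<and> TM.christoffel K D G (c t) \<and> geo K G c t"
  shows "geodesic A D W c"
  unfolding geodesic_def
proof (intro conjI c ballI)
  fix t assume t: "t \<in> W"
  obtain N V X where N: "open N" "t \<in> N" "N \<subseteq> W" "mopen V" "c ` N \<subseteq> V" "X \<in> vector_fields A V"
    "\<forall>s\<in>N. X (c s) = velocity A c s" 
    using extend_velocity[OF c t] by blast
  have "D X (c s) (velocity A c s) = 0" if s: "s \<in> N" for s
  proof -
    obtain K G where "K \<in> A" "c s \<in> fst K" "TM.christoffel K D G (c s)" "geo K G c s"
      using g[OF subsetD[OF N(3) s]] by blast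
    note k = this
    have "D X (c s) (velocity A c s) = 0 \<longleftrightarrow> geo K G c s"
      by (rule derivative_along_curve[OF c N(1,3,4,5,6) _ s k(1,2,3)]) (use N(7) in blast)
    then show ?thesis using k(4) by simp
  qed
  then have "\<forall>s\<in>N. X (c s) = velocity A c s \<and> D X (c s) (velocity A c s) = 0" using N(7) by simp
  then show "\<exists>N V X. open N \<and> t \<in> N \<and> N \<subseteq> W \<and> mopen V \<and> c ` N \<subseteq> V \<and> X \<in> vector_fields A V \<and>
      (\<forall>t\<in>N. X (c t) = velocity A c t \<and> D X (c t) (velocity A c t) = 0)"
    by (intro exI[of _ N] exI[of _ V] exI[of _ X] conjI N(1-6))
qed

end

section \<open>Weyl's theorem on projectively equivalent connections\<close>

text \<open>Test vectors with at most two nonzero entries suffice: an axis vector yields the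
  diagonal terms, the sum and the difference of two axis vectors the mixed ones.\<close>

lemma quadratic_pure_trace:
  fixes S :: "'n::finite \<Rightarrow> 'n \<Rightarrow> 'n \<Rightarrow> complex"
  assumes sym: "\<And>i j k. S i j k = S j i k"
    and par: "\<And>w. (\<exists>k. w k \<noteq> 0) \<Longrightarrow> \<exists>l. \<forall>k. (\<Sum>i\<in>UNIV. \<Sum>j\<in>UNIV. w i * w j * S i j k) = l * w k"
  shows "\<exists>\<psi>. \<forall>i j k. S i j k = (if j = k then \<psi> i else 0) + (if i = k then \<psi> j else 0)"
proof -
  have two: "(\<Sum>i\<in>UNIV. \<Sum>j\<in>UNIV. w i * w j * S i j k) =
      a * a * S p p k + 2 * a * b * S p q k + b * b * S q q k"
    if "p \<noteq> q" "w = (\<lambda>i. if i = p then a else if i = q then b else 0)" for w a b p q k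
  proof -
    have h: "(\<Sum>i\<in>UNIV. w i * F i) = a * F p + b * F q" for F
    proof -
      have "(\<Sum>i\<in>UNIV. w i * F i) = (\<Sum>i\<in>UNIV. (if i = p then a * F i else 0) + (if i = q then b * F i else 0))"
        using that by (intro sum.cong) auto
      then show ?thesis by (simp add: sum.distrib)
    qed
    have "(\<Sum>i\<in>UNIV. \<Sum>j\<in>UNIV. w i * w j * S i j k) = (\<Sum>i\<in>UNIV. w i * (\<Sum>j\<in>UNIV. w j * S i j k))"
      by (simp add: sum_distrib_left mult.assoc)
    also have "\<dots> = (\<Sum>i\<in>UNIV. w i * (a * S i p k + b * S i q k))" by (simp only: h)
    also have "\<dots> = a * (a * S p p k + b * S p q k) + b * (a * S q p k + b * S q q k)" by (rule h)
    finally show ?thesis by (simp add: sym[of q p] algebra_simps)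
  qed
  have diag: "S i i k = 0" if "k \<noteq> i" for i k
  proof -
    let ?w = "\<lambda>j. if j = i then 1 else if j = k then 0 else (0::complex)"
    obtain l where l: "\<And>m. (\<Sum>i\<in>UNIV. \<Sum>j\<in>UNIV. ?w i * ?w j * S i j m) = l * ?w m" using par[of ?w] by force
    show ?thesis using l[of k] two[of i k ?w 1 0 k] that by simp
  qed
  have off: "S i j k = (if j = k then S i i i / 2 else 0) + (if i = k then S j j j / 2 else 0)" if ij: "i \<noteq> j" for i j k
  proof -
    let ?w = "\<lambda>b m. if m = i then 1 else if m = j then b else (0::complex)"
    have "\<exists>l. \<forall>k. (\<Sum>i'\<in>UNIV. \<Sum>j'\<in>UNIV. ?w b i' * ?w b j' * S i' j' k) = l * ?w b k" for b
      by (rule par) (auto intro: exI[of _ i])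
    then have "\<exists>l. \<forall>b k. (\<Sum>i'\<in>UNIV. \<Sum>j'\<in>UNIV. ?w b i' * ?w b j' * S i' j' k) = l b * ?w b k"
      by (intro choice allI)
    then obtain l where l: "\<forall>b k. (\<Sum>i'\<in>UNIV. \<Sum>j'\<in>UNIV. ?w b i' * ?w b j' * S i' j' k) = l b * ?w b k" ..
    have e: "S i i k + 2 * b * S i j k + b * b * S j j k = l b * ?w b k" for b k
      using l[THEN spec[where x=b], THEN spec[where x=k]] two[OF ij, of "?w b" 1 b k] by simp
    show ?thesis
    proof (cases "k = i \<or> k = j")
      case False
      then show ?thesis using e[where b=1 and k=k] diag[of k i] diag[of k j] by auto
    next
      case True
      have i1: "S i i i + 2 * S i j i = l 1" "S i i i - 2 * S i j i = l (-1)"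
        using e[where b=1 and k=i] e[where b="-1" and k=i] diag[of i j] ij by auto
      have j1: "2 * S i j j + S j j j = l 1" "- 2 * S i j j + S j j j = - l (-1)"
        using e[where b=1 and k=j] e[where b="-1" and k=j] diag[of j i] ij by auto
      \<comment> \<open>Elimination of the unknown multipliers: \<open>u\<close> belongs to the sum
        of the two axis vectors, \<open>v\<close> to their difference.\<close>
      have lin: "x = q / 2 \<and> y = p / 2" if "p + 2 * x = u" "p - 2 * x = v" "2 * y + q = u" "- 2 * y + q = - v"
        for p q x y u v :: complex
      proof -
        have "4 * x = (p + 2 * x) - (p - 2 * x)" by simp
        also have "\<dots> = (2 * y + q) + (- 2 * y + q)" unfolding that by simp
        finally have x: "4 * x = 2 * q" by simp
        have "4 * y = (2 * y + q) - (- 2 * y + q)" by simp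
        also have "\<dots> = (p + 2 * x) + (p - 2 * x)" unfolding that by simp
        finally have "4 * y = 2 * p" by simp
        with x show ?thesis by (simp add: field_simps)
      qed
      have "S i j i = S j j j / 2" "S i j j = S i i i / 2" using lin[OF i1 j1] by blast+
      then show ?thesis using True ij by auto
    qed
  qed
  show ?thesis
  \<comment> \<open>The witness is read off at \<open>i = j = k\<close>, where the right-hand side
    is \<open>2 * \<psi> i\<close>.\<close>
  proof (intro exI[of _ "\<lambda>i. S i i i / 2"] allI)
    fix i j k
    show "S i j k = (if j = k then S i i i / 2 else 0) + (if i = k then S j j j / 2 else 0)"
      by (cases "i = j") (use off diag in auto)
  qed
qed

lemma sum_pure_trace:
  fixes \<psi> v w :: "'n::finite \<Rightarrow> complex"
  shows "(\<Sum>a\<in>UNIV. \<Sum>b\<in>UNIV. v a * w b * ((if b = k then \<psi> a else 0) + (if a = k then \<psi> b else 0))) =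
    (\<Sum>a\<in>UNIV. v a * \<psi> a) * w k + (\<Sum>b\<in>UNIV. w b * \<psi> b) * v k"
proof -
  have sw: "(\<Sum>a\<in>UNIV. \<Sum>b\<in>UNIV. if a = k then F b else 0) = (\<Sum>b\<in>UNIV. F b)" for F :: "'n \<Rightarrow> complex"
    by (subst sum.swap) simp
  have "(\<Sum>b\<in>UNIV. v a * w b * ((if b = k then \<psi> a else 0) + (if a = k then \<psi> b else 0))) =
      v a * \<psi> a * w k + (\<Sum>b\<in>UNIV. if a = k then w b * \<psi> b * v k else 0)" for a
  proof -
    have "(\<Sum>b\<in>UNIV. v a * w b * ((if b = k then \<psi> a else 0) + (if a = k then \<psi> b else 0))) =
      (\<Sum>b\<in>UNIV. (if b = k then v a * w b * \<psi> a else 0) + (if a = k then w b * \<psi> b * v k else 0))"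
      by (intro sum.cong refl) (simp add: algebra_simps)
    then show ?thesis by (simp add: sum.distrib)
  qed
  then show ?thesis unfolding sum_distrib_right by (simp add: sum.distrib sw)
qed

context base_atlas
begin

text \<open>Weyl's condition at a single point and without charts, so that it can be chained between
  connections given on different open sets.\<close>

definition pure_trace :: "('m, 'm tangent, 'm tangent) conn \<Rightarrow> ('m, 'm tangent, 'm tangent) conn \<Rightarrow> 'm \<Rightarrow> bool" where
  "pure_trace D D' x \<longleftrightarrow> (\<exists>\<psi>. \<forall>Y v. TM.ls x Y \<longrightarrow> v \<in> tangent_space A x \<longrightarrow>
     D Y x v - D' Y x v = \<psi> v *\<^sub>C Y x + \<psi> (Y x) *\<^sub>C v)"

lemma pure_trace_sym: "pure_trace D D' x \<Longrightarrow> pure_trace D' D x"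
  unfolding pure_trace_def
proof (elim exE)
  fix \<psi> assume a: "\<forall>Y v. TM.ls x Y \<longrightarrow> v \<in> tangent_space A x \<longrightarrow> D Y x v - D' Y x v = \<psi> v *\<^sub>C Y x + \<psi> (Y x) *\<^sub>C v"
  show "\<exists>\<psi>. \<forall>Y v. TM.ls x Y \<longrightarrow> v \<in> tangent_space A x \<longrightarrow> D' Y x v - D Y x v = \<psi> v *\<^sub>C Y x + \<psi> (Y x) *\<^sub>C v"
  proof (intro exI[of _ "\<lambda>v. - \<psi> v"] allI impI)
    fix Y v assume "TM.ls x Y" "v \<in> tangent_space A x"
    then have "D Y x v - D' Y x v = \<psi> v *\<^sub>C Y x + \<psi> (Y x) *\<^sub>C v" using a by blast
    moreover have "D' Y x v - D Y x v = - (D Y x v - D' Y x v)" by simp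
    ultimately show "D' Y x v - D Y x v = (- \<psi> v) *\<^sub>C Y x + (- \<psi> (Y x)) *\<^sub>C v"
      by (simp only: complex_vector.scale_minus_left minus_add_distrib)
  qed
qed

lemma pure_trace_trans: "pure_trace D D' x \<Longrightarrow> pure_trace D' D'' x \<Longrightarrow> pure_trace D D'' x"
  unfolding pure_trace_def
proof (elim exE)
  fix \<psi> \<theta>
  assume a: "\<forall>Y v. TM.ls x Y \<longrightarrow> v \<in> tangent_space A x \<longrightarrow> D Y x v - D' Y x v = \<psi> v *\<^sub>C Y x + \<psi> (Y x) *\<^sub>C v"
    "\<forall>Y v. TM.ls x Y \<longrightarrow> v \<in> tangent_space A x \<longrightarrow> D' Y x v - D'' Y x v = \<theta> v *\<^sub>C Y x + \<theta> (Y x) *\<^sub>C v"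
  show "\<exists>\<psi>. \<forall>Y v. TM.ls x Y \<longrightarrow> v \<in> tangent_space A x \<longrightarrow> D Y x v - D'' Y x v = \<psi> v *\<^sub>C Y x + \<psi> (Y x) *\<^sub>C v"
  proof (intro exI[of _ "\<lambda>v. \<psi> v + \<theta> v"] allI impI)
    fix Y v assume "TM.ls x Y" "v \<in> tangent_space A x"
    then have "D Y x v - D' Y x v = \<psi> v *\<^sub>C Y x + \<psi> (Y x) *\<^sub>C v" "D' Y x v - D'' Y x v = \<theta> v *\<^sub>C Y x + \<theta> (Y x) *\<^sub>C v"
      using a by blast+
    moreover have "D Y x v - D'' Y x v = (D Y x v - D' Y x v) + (D' Y x v - D'' Y x v)" by simp
    ultimately show "D Y x v - D'' Y x v = (\<psi> v + \<theta> v) *\<^sub>C Y x + (\<psi> (Y x) + \<theta> (Y x)) *\<^sub>C v"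
      by (simp add: scaleC_add_left)
  qed
qed

lemma pure_trace_iff:
  assumes K: "K \<in> A" "x \<in> fst K" and G: "TM.christoffel K D G x" and G': "TM.christoffel K D' G' x"
  shows "pure_trace D D' x \<longleftrightarrow> (\<exists>\<psi>. \<forall>i j k. G i j k x - G' i j k x = (if j = k then \<psi> i else 0) + (if i = k then \<psi> j else 0))"
proof
  assume "pure_trace D D' x"
  then obtain \<psi> where p: "\<And>Y v. TM.ls x Y \<Longrightarrow> v \<in> tangent_space A x \<Longrightarrow> D Y x v - D' Y x v = \<psi> v *\<^sub>C Y x + \<psi> (Y x) *\<^sub>C v"
    unfolding pure_trace_def by blast
  show "\<exists>\<psi>. \<forall>i j k. G i j k x - G' i j k x = (if j = k then \<psi> i else 0) + (if i = k then \<psi> j else 0)"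
  proof (intro exI[of _ "\<lambda>i. \<psi> (dd K i x)"] allI)
    fix i j k
    have "(D (dd K j) x (dd K i x) - D' (dd K j) x (dd K i x)) (xi K k) =
        (\<psi> (dd K i x) *\<^sub>C dd K j x + \<psi> (dd K j x) *\<^sub>C dd K i x) (xi K k)"
      unfolding p[OF TM.ls_fr[OF K] dd_tangent[OF K]] ..
    then show "G i j k x - G' i j k x = (if j = k then \<psi> (dd K i x) else 0) + (if i = k then \<psi> (dd K j x) else 0)"
      using TM.christoffel_fr[OF G K, of j i k] TM.christoffel_fr[OF G' K, of j i k] by (simp add: dd_coord[OF K])
  qed
next
  assume "\<exists>\<psi>. \<forall>i j k. G i j k x - G' i j k x = (if j = k then \<psi> i else 0) + (if i = k then \<psi> j else 0)"
  then obtain \<psi> where p: "\<And>i j k. G i j k x - G' i j k x = (if j = k then \<psi> i else 0) + (if i = k then \<psi> j else 0)" by blast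
  show "pure_trace D D' x" unfolding pure_trace_def
  proof (intro exI[of _ "\<lambda>v. \<Sum>i\<in>UNIV. v (xi K i) * \<psi> i"] allI impI)
    fix Y v assume Y: "TM.ls x Y" and v: "v \<in> tangent_space A x"
    have vf: "v \<in> fibre (tangent_bundle A) x" using v by simp
    have Yf: "Y x \<in> tangent_space A x" using TM.ls_fibre[OF Y] by simp
    note C = TM.christoffel_co[OF G K Y vf] TM.christoffel_co[OF G' K Y vf]
    let ?p = "\<lambda>v. \<Sum>i\<in>UNIV. v (xi K i) * \<psi> i"
    show "D Y x v - D' Y x v = ?p v *\<^sub>C Y x + ?p (Y x) *\<^sub>C v"
    proof (rule TM.fibre_eqI[OF K TM.fibre_diff(1)[OF K C(1,3)]])
      show "?p v *\<^sub>C Y x + ?p (Y x) *\<^sub>C v \<in> fibre (tangent_bundle A) x"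
        by (intro TM.fibre_add[OF K] TM.fibre_scale[OF K] TM.ls_fibre[OF Y] vf)
      fix k
      have "(D Y x v - D' Y x v) (xi K k) = (\<Sum>a\<in>UNIV. \<Sum>b\<in>UNIV. v (xi K a) * Y x (xi K b) * (G a b k x - G' a b k x))"
        using C(2)[of k] C(4)[of k] by (simp add: right_diff_distrib sum_subtractf)
      also have "\<dots> = ?p v * Y x (xi K k) + ?p (Y x) * v (xi K k)" unfolding p by (rule sum_pure_trace)
      finally show "(D Y x v - D' Y x v) (xi K k) = (?p v *\<^sub>C Y x + ?p (Y x) *\<^sub>C v) (xi K k)" by simp
    qed
  qed
qed

definition gam :: "'m set \<times> ('m \<Rightarrow> complex^'n) \<Rightarrow> ('m, 'm tangent, 'm tangent) conn \<Rightarrow> 'n \<Rightarrow> 'n \<Rightarrow> 'n \<Rightarrow> 'm \<Rightarrow> complex" where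
  "gam K D i j k y = D (dd K j) y (dd K i y) (xi K k)"

text \<open>What the arguments on geodesics use of a torsion free connection near \<open>x\<close>,
  with no reference to the open set on which it is given.\<close>

definition affine_at :: "('m, 'm tangent, 'm tangent) conn \<Rightarrow> 'm \<Rightarrow> bool" where
  "affine_at D x \<longleftrightarrow> x \<in> pts \<and> (\<forall>K\<in>A. x \<in> fst K \<longrightarrow> eventually (\<lambda>y. TM.christoffel K D (gam K D) y) (NH x) \<and>
     (\<forall>i j k. hn x (gam K D i j k)) \<and> eventually (\<lambda>y. \<forall>i j k. gam K D i j k y = gam K D j i k y) (NH x))"

lemma affine_atD:
  assumes "affine_at D x" "K \<in> A" "x \<in> fst K"
  shows "eventually (\<lambda>y. TM.christoffel K D (gam K D) y) (NH x)" "hn x (gam K D i j k)"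
    "eventually (\<lambda>y. \<forall>i j k. gam K D i j k y = gam K D j i k y) (NH x)"
    "TM.christoffel K D (gam K D) x" "gam K D i j k x = gam K D j i k x"
proof -
  have a: "x \<in> pts" "eventually (\<lambda>y. TM.christoffel K D (gam K D) y) (NH x) \<and>
     (\<forall>i j k. hn x (gam K D i j k)) \<and> eventually (\<lambda>y. \<forall>i j k. gam K D i j k y = gam K D j i k y) (NH x)"
    using assms unfolding affine_at_def by blast+
  show 1: "eventually (\<lambda>y. TM.christoffel K D (gam K D) y) (NH x)" "hn x (gam K D i j k)"
    and 3: "eventually (\<lambda>y. \<forall>i j k. gam K D i j k y = gam K D j i k y) (NH x)" using a(2) by blast+
  show "TM.christoffel K D (gam K D) x" by (rule NH_self[OF 1(1) a(1)])
  show "gam K D i j k x = gam K D j i k x" using NH_self[OF 3 a(1)] by blast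
qed

lemma connection_affine_at:
  assumes D: "connection_on A (tangent_bundle A) (tangent_bundle A) U D" "torsion_free_on A (tangent_bundle A) U D"
    and U: "mopen U" and x: "x \<in> U"
  shows "affine_at D x"
  unfolding affine_at_def
proof (intro conjI ballI impI)
  show "x \<in> pts" by (rule mopen_pts[OF U x])
  fix K assume K: "K \<in> A" "x \<in> fst K"
  have g: "gam K D = (\<lambda>a b c y. (D (dd K b) y (dd K a y)) (\<lambda>z. snd K z $ c))" by (simp add: gam_def fun_eq_iff)
  have c: "TM.christoffel K D (gam K D) y \<and> hn y (gam K D i j k)" if y: "y \<in> fst K" "y \<in> U" for y i j k
    using TM.connection_christoffel[OF D(1) U K(1) y g] by blast
  have ev: "eventually (\<lambda>y. y \<in> fst K \<and> y \<in> U) (NH x)"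
    using eventually_chart[OF K] eventually_mopen[OF U x] by (rule eventually_conj)
  show "eventually (\<lambda>y. TM.christoffel K D (gam K D) y) (NH x)"
    using ev by (rule eventually_mono) (use c in blast)
  show "\<forall>i j k. hn x (gam K D i j k)" using c[OF K(2) x] by blast
  show "eventually (\<lambda>y. \<forall>i j k. gam K D i j k y = gam K D j i k y) (NH x)"
  proof (rule eventually_mono[OF ev])
    fix y assume y: "y \<in> fst K \<and> y \<in> U"
    then have C: "TM.christoffel K D (gam K D) y" using c by blast
    have "\<forall>s1 s2. TM.ls y s1 \<longrightarrow> TM.ls y s2 \<longrightarrow> D s2 y (s1 y) - D s1 y (s2 y) - bracket (tangent_bundle A) s1 s2 y = 0"
      using D(2) y unfolding TM.torsion_free_on_iff[OF U] by blast
    then show "\<forall>i j k. gam K D i j k y = gam K D j i k y"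
      using TM.torsion_christoffel[OF C K(1)] y by blast
  qed
qed

section \<open>Construction and reparametrization of curves\<close>

lemma immersed_curveI:
  assumes K: "K \<in> A" and W: "open W" "\<And>t. t \<in> W \<Longrightarrow> c t \<in> fst K"
    and h: "\<And>k. (\<lambda>s. snd K (c s) $ k) holomorphic_on W"
    and nz: "\<And>t. t \<in> W \<Longrightarrow> \<exists>k. deriv (\<lambda>s. snd K (c s) $ k) t \<noteq> 0"
  shows "immersed_curve A W c"
  unfolding immersed_curve_def
proof (intro conjI allI impI ballI)
  show "open W" by fact
  show "c ` W \<subseteq> pts" using W(2) chart_pts[OF K] by blast
  fix V assume V: "mopen V"
  have "continuous_on W (\<lambda>t. \<chi> k. snd K (c t) $ k)"
    by (intro continuous_on_vec_lambda holomorphic_on_imp_continuous_on h)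
  then have cont: "continuous_on W (\<lambda>t. snd K (c t))" by simp
  have "{t \<in> W. c t \<in> V} = W \<inter> (\<lambda>t. snd K (c t)) -` (snd K ` (fst K \<inter> V))"
  proof (rule set_eqI)
    fix t
    have "c t \<in> V" if "c t \<in> fst K" "snd K (c t) = snd K y" "y \<in> fst K" "y \<in> V" for y
      using inj_onD[OF chart_inj[OF K] that(2,1,3)] that(4) by simp
    then show "t \<in> {t \<in> W. c t \<in> V} \<longleftrightarrow> t \<in> W \<inter> (\<lambda>t. snd K (c t)) -` (snd K ` (fst K \<inter> V))"
      using W(2)[of t] by auto
  qed
  then show o: "open {t \<in> W. c t \<in> V}"
    using continuous_open_preimage[OF cont W(1) open_chart_image[OF V K]] by simp
  fix f assume f: "f \<in> holomorphic_functions A V"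
  show "(f \<circ> c) holomorphic_on {t \<in> W. c t \<in> V}" unfolding holomorphic_on_def
  proof
    fix t assume t: "t \<in> {t \<in> W. c t \<in> V}"
    then have "hn (c t) f" using f holfun_iff[OF V] by blast
    then have "(\<lambda>s. f (c s)) field_differentiable (at t)"
      using velocity_expand(3)[where c = c and t = t and S = W, OF K _ W(1) _ W(2) h] t W(2) by blast
    then show "(f \<circ> c) field_differentiable at t within {t \<in> W. c t \<in> V}"
      by (simp add: comp_def field_differentiable_at_within)
  qed
next
  fix t assume t: "t \<in> W"
  obtain k where "deriv (\<lambda>s. snd K (c s) $ k) t \<noteq> 0" using nz[OF t] by blast
  then have "velocity A c t (xi K k) \<noteq> 0" using velocity_coord[of K c t k, OF K W(2)[OF t]] by simp
  then show "velocity A c t \<noteq> 0" by auto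
qed

lemma immersed_reparametrize:
  assumes c: "immersed_curve A W c" and N: "open N" "h holomorphic_on N" "h ` N \<subseteq> W" "\<forall>t\<in>N. deriv h t \<noteq> 0"
  shows "immersed_curve A N (c \<circ> h)"
    and "t \<in> N \<Longrightarrow> K \<in> A \<Longrightarrow> c (h t) \<in> fst K \<Longrightarrow>
      deriv (\<lambda>s. snd K ((c \<circ> h) s) $ k) t = deriv (\<lambda>s. snd K (c s) $ k) (h t) * deriv h t"
    and "t \<in> N \<Longrightarrow> K \<in> A \<Longrightarrow> c (h t) \<in> fst K \<Longrightarrow>
      deriv (deriv (\<lambda>s. snd K ((c \<circ> h) s) $ k)) t =
      deriv (deriv (\<lambda>s. snd K (c s) $ k)) (h t) * (deriv h t)\<^sup>2 + deriv (\<lambda>s. snd K (c s) $ k) (h t) * deriv (deriv h) t"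
proof -
  have main: "deriv (\<lambda>s. snd K ((c \<circ> h) s) $ k) t = deriv (\<lambda>s. snd K (c s) $ k) (h t) * deriv h t \<and>
      deriv (deriv (\<lambda>s. snd K ((c \<circ> h) s) $ k)) t =
      deriv (deriv (\<lambda>s. snd K (c s) $ k)) (h t) * (deriv h t)\<^sup>2 + deriv (\<lambda>s. snd K (c s) $ k) (h t) * deriv (deriv h) t"
    if t: "t \<in> N" and K: "K \<in> A" "c (h t) \<in> fst K" for t K k
  proof -
    let ?g = "\<lambda>s. snd K (c s) $ k"
    have ht: "h t \<in> W" using N(3) t by blast
    obtain r where r: "r > 0" "ball (h t) r \<subseteq> W" "\<And>s. s \<in> ball (h t) r \<Longrightarrow> c s \<in> fst K \<and> True"
      "\<And>k. (\<lambda>s. snd K (c s) $ k) holomorphic_on ball (h t) r"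
      using immersed_chart[OF c ht K, of "\<lambda>_. True"] by auto
    let ?N = "N \<inter> h -` ball (h t) r"
    have oN: "open ?N" using continuous_open_preimage[OF holomorphic_on_imp_continuous_on[OF N(2)] N(1) open_ball] .
    have tN: "t \<in> ?N" using t r(1) by simp
    have dh: "(h has_field_derivative deriv h s) (at s)" if "s \<in> N" for s using holomorphic_derivI[OF N(2,1) that] .
    have dg: "(?g has_field_derivative deriv ?g u) (at u)" if "u \<in> ball (h t) r" for u using holomorphic_derivI[OF r(4) open_ball that] .
    have d1: "((\<lambda>s. ?g (h s)) has_field_derivative deriv ?g (h s) * deriv h s) (at s)" if "s \<in> ?N" for s
      by (rule DERIV_chain2[OF dg dh]) (use that in auto)
    have e1: "deriv (\<lambda>s. ?g (h s)) s = deriv ?g (h s) * deriv h s" if "s \<in> ?N" for s by (rule DERIV_imp_deriv[OF d1[OF that]])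
    have ddg: "(deriv ?g has_field_derivative deriv (deriv ?g) (h t)) (at (h t))"
      by (rule holomorphic_derivI[OF holomorphic_deriv[OF r(4) open_ball] open_ball]) (use r(1) in simp)
    have ddh: "(deriv h has_field_derivative deriv (deriv h) t) (at t)"
      by (rule holomorphic_derivI[OF holomorphic_deriv[OF N(2,1)] N(1) t])
    have "((\<lambda>s. deriv ?g (h s) * deriv h s) has_field_derivative
        deriv (deriv ?g) (h t) * deriv h t * deriv h t + deriv (deriv h) t * deriv ?g (h t)) (at t)"
      by (rule DERIV_mult[OF DERIV_chain2[OF ddg dh[OF t]] ddh])
    then have "((deriv (\<lambda>s. ?g (h s))) has_field_derivative
        deriv (deriv ?g) (h t) * deriv h t * deriv h t + deriv (deriv h) t * deriv ?g (h t)) (at t)"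
      by (rule has_field_derivative_transform_within_open[OF _ oN tN]) (simp add: e1)
    from DERIV_imp_deriv[OF this] e1[OF tN] show ?thesis by (simp add: comp_def power2_eq_square algebra_simps)
  qed
  show "t \<in> N \<Longrightarrow> K \<in> A \<Longrightarrow> c (h t) \<in> fst K \<Longrightarrow>
      deriv (\<lambda>s. snd K ((c \<circ> h) s) $ k) t = deriv (\<lambda>s. snd K (c s) $ k) (h t) * deriv h t"
    "t \<in> N \<Longrightarrow> K \<in> A \<Longrightarrow> c (h t) \<in> fst K \<Longrightarrow>
      deriv (deriv (\<lambda>s. snd K ((c \<circ> h) s) $ k)) t =
      deriv (deriv (\<lambda>s. snd K (c s) $ k)) (h t) * (deriv h t)\<^sup>2 + deriv (\<lambda>s. snd K (c s) $ k) (h t) * deriv (deriv h) t"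
    using main by blast+
  have c': "open W" "c ` W \<subseteq> pts"
    "\<And>V. mopen V \<Longrightarrow> open {t\<in>W. c t \<in> V} \<and> (\<forall>f\<in>holomorphic_functions A V. (f \<circ> c) holomorphic_on {t\<in>W. c t \<in> V})"
    using c unfolding immersed_curve_def by blast+
  show "immersed_curve A N (c \<circ> h)" unfolding immersed_curve_def
  proof (intro conjI allI impI ballI)
    show "open N" by fact
    show "(c \<circ> h) ` N \<subseteq> pts" using c'(2) N(3) by auto
    fix V assume V: "mopen V"
    have e: "{t \<in> N. (c \<circ> h) t \<in> V} = N \<inter> h -` {t \<in> W. c t \<in> V}" using N(3) by auto
    show "open {t \<in> N. (c \<circ> h) t \<in> V}" unfolding e
      using continuous_open_preimage[OF holomorphic_on_imp_continuous_on[OF N(2)] N(1)] c'(3)[OF V] by blast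
    fix f assume "f \<in> holomorphic_functions A V"
    then have "(f \<circ> c) holomorphic_on {t\<in>W. c t \<in> V}" using c'(3)[OF V] by blast
    then have "((f \<circ> c) \<circ> h) holomorphic_on {t \<in> N. (c \<circ> h) t \<in> V}"
      by (rule holomorphic_on_compose_gen[rotated]) (use N(3) in \<open>auto intro: holomorphic_on_subset[OF N(2)]\<close>)
    then show "(f \<circ> (c \<circ> h)) holomorphic_on {t \<in> N. (c \<circ> h) t \<in> V}" by (simp add: comp_assoc)
  next
    fix t assume t: "t \<in> N"
    then have ht: "h t \<in> W" using N(3) by blast
    obtain K where K: "K \<in> A" "c (h t) \<in> fst K" using pts_chart[OF immersedD(3)[OF c ht]] by blast
    obtain k where "deriv (\<lambda>s. snd K (c s) $ k) (h t) \<noteq> 0" using velocity_immersed(3)[OF c ht K] by blast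
    then have "velocity A (c \<circ> h) t (xi K k) \<noteq> 0"
      using velocity_coord[of K "c \<circ> h" t k] K main[OF t K, of k] bspec[OF N(4) t] by simp
    then show "velocity A (c \<circ> h) t \<noteq> 0" by auto
  qed
qed

text \<open>The geodesic equation becomes a first order system for position and velocity, indexed by
  \<open>'n + 'n\<close>, to which \<open>holomorphic_ode\<close> applies.\<close>

lemma geodesic_exists:
  assumes aff: "affine_at D x" and U: "mopen U" "x \<in> U" and K: "K \<in> A" "x \<in> fst K" and w: "w k0 \<noteq> 0"
  obtains W c where "open W" "0 \<in> W" "c 0 = x" "c ` W \<subseteq> U" "geodesic A D W c"
    "\<And>k. deriv (\<lambda>s. snd K (c s) $ k) 0 = w k"
proof -
  have x: "x \<in> pts" by (rule chart_pts[OF K])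
  let ?G = "gam K D"
  have "eventually (\<lambda>y. (\<forall>i j k. hn y (?G i j k)) \<and> TM.christoffel K D ?G y \<and> y \<in> fst K \<and> y \<in> U) (NH x)"
    by (intro eventually_conj eventually_all_finite hn_eventually affine_atD[OF aff K] eventually_chart[OF K] eventually_mopen[OF U])
  then obtain V where V: "mopen V" "x \<in> V"
    "\<And>y. y \<in> V \<Longrightarrow> (\<forall>i j k. hn y (?G i j k)) \<and> TM.christoffel K D ?G y \<and> y \<in> fst K \<and> y \<in> U"
    unfolding eventually_NH[OF x] by blast
  have Vk: "V \<subseteq> fst K" using V(3) by blast
  let ?O = "snd K ` V"
  have oO: "open ?O" using open_chart_image[OF V(1) K(1)] Vk by (simp add: Int_absorb1)
  have hG: "holomorphic_fun_on (?G i j k \<circ> pinv K) ?O" for i j k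
    unfolding holomorphic_fun_on_iff
  proof
    fix z assume "z \<in> ?O"
    then obtain y where y: "z = snd K y" "y \<in> V" by blast
    have "has_gradient (?G i j k \<circ> pinv K) (\<lambda>l. dd K l y (?G i j k)) (snd K y)"
      by (rule dd_gradient[OF K(1)]) (use V(3)[OF y(2)] in blast)+
    then show "\<exists>a. has_gradient (?G i j k \<circ> pinv K) a z" using y by blast
  qed
  let ?pos = "\<lambda>z :: complex^('n + 'n). \<chi> i. z $ Inl i"
  \<comment> \<open>The component \<open>k0\<close> of the velocity is kept nonzero, so that the
    solution is immersed on the whole disc.\<close>
  let ?S = "{z :: complex^('n + 'n). ?pos z \<in> ?O \<and> z $ Inr k0 \<noteq> 0}"
  define f :: "'n + 'n \<Rightarrow> complex^('n + 'n) \<Rightarrow> complex" where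
    "f = (\<lambda>a z. case a of Inl k \<Rightarrow> z $ Inr k
      | Inr k \<Rightarrow> (\<Sum>i\<in>UNIV. \<Sum>j\<in>UNIV. (- 1) * (z $ Inr i * z $ Inr j * (?G i j k \<circ> pinv K) (?pos z))))"
  have oS: "open ?S"
  proof -
    have "continuous_on UNIV ?pos" by (intro continuous_intros)
    then have 1: "open (?pos -` ?O)" using open_vimage[OF oO] by blast
    have "open (- {0 :: complex})" by (rule open_Compl[OF closed_singleton])
    then have "open ((\<lambda>z :: complex^('n + 'n). z $ Inr k0) -` (- {0}))" by (rule open_vimage_vec_nth)
    then have "open (?pos -` ?O \<inter> (\<lambda>z. z $ Inr k0) -` (- {0}))" using 1 by (rule open_Int[rotated])
    moreover have "?pos -` ?O \<inter> (\<lambda>z. z $ Inr k0) -` (- {0}) = ?S" by blast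
    ultimately show ?thesis by simp
  qed
  have sumh: "holomorphic_fun_on (\<lambda>z. \<Sum>i\<in>I. F i z) ?S" if "\<And>i. holomorphic_fun_on (F i) ?S" for I and F :: "'n \<Rightarrow> _"
    by (induction I rule: infinite_finite_induct) (simp_all add: holomorphic_fun_on_const holomorphic_fun_on_add that)
  have hf: "holomorphic_fun_on (f a) ?S" for a
  proof (cases a)
    case (Inl k) then show ?thesis unfolding f_def by (simp add: holomorphic_fun_on_nth)
  next
    case (Inr k)
    have "holomorphic_fun_on (\<lambda>z. (?G i j k \<circ> pinv K) (?pos z)) ?S" for i j
      by (rule holomorphic_fun_on_compose[OF hG holomorphic_fun_on_nth]) blast
    then show ?thesis unfolding f_def Inr sum.case
      by (intro sumh holomorphic_fun_on_mult holomorphic_fun_on_const holomorphic_fun_on_nth)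
  qed
  define z0 :: "complex^('n + 'n)" where "z0 = (\<chi> a. case a of Inl k \<Rightarrow> snd K x $ k | Inr k \<Rightarrow> w k)"
  have z0: "z0 \<in> ?S" using V(2) w by (simp add: z0_def)
  obtain r y where y: "r > 0" "\<And>k. y k 0 = z0 $ k" "\<And>t. t \<in> ball 0 r \<Longrightarrow> (\<chi> k. y k t) \<in> ?S"
    "\<And>k t. t \<in> ball 0 r \<Longrightarrow> (y k has_field_derivative f k (\<chi> j. y j t)) (at t)"
    using holomorphic_ode[of f, OF hf oS z0] by blast
  define c where "c t = pinv K (\<chi> i. y (Inl i) t)" for t
  have cV: "c t \<in> V \<and> snd K (c t) = (\<chi> i. y (Inl i) t)" if t: "t \<in> ball 0 r" for t
  proof -
    have "(\<chi> i. y (Inl i) t) \<in> ?O" using y(3)[OF t] by simp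
    then obtain v where v: "(\<chi> i. y (Inl i) t) = snd K v" "v \<in> V" by blast
    then show ?thesis unfolding c_def using pinv[OF K(1), of v] Vk by auto
  qed
  have g: "snd K (c t) $ k = y (Inl k) t" if "t \<in> ball 0 r" for t k using cV[OF that] by simp
  have dg: "((\<lambda>s. snd K (c s) $ k) has_field_derivative y (Inr k) t) (at t)" if t: "t \<in> ball 0 r" for t k
  proof (rule has_field_derivative_transform_within_open[OF _ open_ball t])
    show "(y (Inl k) has_field_derivative y (Inr k) t) (at t)" using y(4)[OF t, of "Inl k"] by (simp add: f_def)
  qed (simp add: g)
  have e1: "deriv (\<lambda>s. snd K (c s) $ k) t = y (Inr k) t" if "t \<in> ball 0 r" for t k by (rule DERIV_imp_deriv[OF dg[OF that]])
  have e2: "deriv (deriv (\<lambda>s. snd K (c s) $ k)) t = f (Inr k) (\<chi> j. y j t)" if t: "t \<in> ball 0 r" for t k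
    by (rule DERIV_imp_deriv, rule has_field_derivative_transform_within_open[OF y(4)[OF t] open_ball t]) (simp add: e1)
  have imm: "immersed_curve A (ball 0 r) c"
  proof (rule immersed_curveI[OF K(1) open_ball])
    show "c t \<in> fst K" if "t \<in> ball 0 r" for t using cV[OF that] Vk by blast
    show "(\<lambda>s. snd K (c s) $ k) holomorphic_on ball 0 r" for k unfolding holomorphic_on_open[OF open_ball] using dg by blast
    show "\<exists>k. deriv (\<lambda>s. snd K (c s) $ k) t \<noteq> 0" if "t \<in> ball 0 r" for t
      using y(3)[OF that] e1[OF that, of k0] by (intro exI[of _ k0]) simp
  qed
  have "geodesic A D (ball 0 r) c"
  proof (rule geodesicI[OF imm])
    fix t assume t: "t \<in> ball (0::complex) r"
    have ct: "TM.christoffel K D ?G (c t)" "c t \<in> fst K" using V(3) cV[OF t] by blast+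
    have "geo K ?G c t" unfolding geo_def e2[OF t] e1[OF t] f_def using cV[OF t]
      by (simp add: c_def[symmetric] sum_negf)
    then show "\<exists>K\<in>A. \<exists>G. c t \<in> fst K \<and> TM.christoffel K D G (c t) \<and> geo K G c t" using K(1) ct by blast
  qed
  moreover have "c 0 = x" unfolding c_def y(2) z0_def using pinv[OF K] by simp
  moreover have "deriv (\<lambda>s. snd K (c s) $ k) 0 = w k" for k using e1[of 0 k] y(1) by (simp add: y(2) z0_def)
  moreover have "c ` ball 0 r \<subseteq> U" using cV V(3) by blast
  ultimately show ?thesis using that[of "ball 0 r" c] y(1) by simp
qed

text \<open>In every direction \<open>w\<close> at \<open>x\<close> there is a geodesic of
  \<open>D\<close>, some reparametrization of which is a geodesic of \<open>D'\<close>. Comparison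
  of the two equations at \<open>x\<close> shows that the difference of the symbols sends
  \<open>(w, w)\<close> to a multiple of \<open>w\<close>.\<close>

lemma projectively_equivalent_pure_trace:
  assumes U: "mopen U" and aff: "affine_at D x" "affine_at D' x" and x: "x \<in> U"
    and P: "projectively_equivalent_on A U D D'"
  shows "pure_trace D D' x"
proof -
  have "x \<in> pts" by (rule mopen_pts[OF U x])
  then obtain K where K: "K \<in> A" "x \<in> fst K" using pts_chart by blast
  note G = affine_atD(4)[OF aff(1) K] and G' = affine_atD(4)[OF aff(2) K]
  let ?S = "\<lambda>i j k. gam K D i j k x - gam K D' i j k x"
  have "\<exists>l. \<forall>k. (\<Sum>i\<in>UNIV. \<Sum>j\<in>UNIV. w i * w j * ?S i j k) = l * w k" if nz: "\<exists>k. w k \<noteq> 0" for w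
  proof -
    obtain k0 where "w k0 \<noteq> 0" using nz by blast
    then obtain W c where c: "open W" "0 \<in> W" "c 0 = x" "c ` W \<subseteq> U" "geodesic A D W c"
      "\<And>k. deriv (\<lambda>s. snd K (c s) $ k) 0 = w k" using geodesic_exists[OF aff(1) U x K] by blast
    have "geodesic_up_to_parametrization A D' W c" using P c(4,5) unfolding projectively_equivalent_on_def by blast
    then have "\<exists>N h. open N \<and> h holomorphic_on N \<and> inj_on h N \<and> h ` N \<subseteq> W \<and> 0 \<in> h ` N \<and> geodesic A D' N (c \<circ> h)"
      unfolding geodesic_up_to_parametrization_def by (rule bspec[OF _ c(2)])
    then obtain N h where h: "open N" "h holomorphic_on N" "inj_on h N" "h ` N \<subseteq> W" "0 \<in> h ` N" "geodesic A D' N (c \<circ> h)"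
      by (elim exE conjE) (rule that)
    obtain t where t: "t \<in> N" "h t = 0" using h(5) by (elim imageE) simp
    have nz: "\<forall>s\<in>N. deriv h s \<noteq> 0" using holomorphic_injective_imp_regular[OF h(2,1,3)] by blast
    have im: "immersed_curve A W c" using c(5) unfolding geodesic_def by blast
    have Kc: "c (h t) \<in> fst K" using t c(3) K by simp
    note d = immersed_reparametrize(2,3)[OF im h(1,2,4) nz t(1) K(1) Kc]
    have g1: "geo K (gam K D) c 0" by (rule geodesicD[OF c(5,2) K(1)]) (use c(3) K G in simp_all)
    have g2: "geo K (gam K D') (c \<circ> h) t" by (rule geodesicD[OF h(6) t(1) K(1)]) (use c(3) K G' t in simp_all)
    let ?h = "deriv h t"
    \<comment> \<open>The multiplier comes from the second derivative of the reparametrization; the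
      first derivative is nonzero because \<open>h\<close> is injective.\<close>
    have "(\<Sum>i\<in>UNIV. \<Sum>j\<in>UNIV. w i * w j * ?S i j k) = (deriv (deriv h) t / ?h\<^sup>2) * w k" for k
    proof -
      let ?A = "\<Sum>i\<in>UNIV. \<Sum>j\<in>UNIV. w i * w j * gam K D i j k x"
      let ?B = "\<Sum>i\<in>UNIV. \<Sum>j\<in>UNIV. w i * w j * gam K D' i j k x"
      let ?c = "deriv (deriv (\<lambda>s. snd K (c s) $ k)) 0"
      have 1: "?c + ?A = 0" using g1 unfolding geo_def c(3,6) by blast
      have "?c * ?h\<^sup>2 + w k * deriv (deriv h) t + (\<Sum>i\<in>UNIV. \<Sum>j\<in>UNIV. (w i * ?h) * (w j * ?h) * gam K D' i j k x) = 0"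
        using g2 unfolding geo_def d t(2) c(6) comp_apply[of c h t] c(3) by blast
      moreover have "(\<Sum>i\<in>UNIV. \<Sum>j\<in>UNIV. (w i * ?h) * (w j * ?h) * gam K D' i j k x) = ?B * ?h\<^sup>2"
        unfolding sum_distrib_right by (simp add: power2_eq_square mult_ac)
      ultimately have 2: "?c * ?h\<^sup>2 + w k * deriv (deriv h) t + ?B * ?h\<^sup>2 = 0" by simp
      have "(?A - ?B) * ?h\<^sup>2 = deriv (deriv h) t * w k"
      proof -
        have "?c = - ?A" using 1 by (simp add: eq_neg_iff_add_eq_0)
        then show ?thesis using 2 by (simp add: algebra_simps)
      qed
      moreover have "?h\<^sup>2 \<noteq> 0" using bspec[OF nz t(1)] by simp
      ultimately have "?A - ?B = deriv (deriv h) t / ?h\<^sup>2 * w k" by (simp add: field_simps)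
      then show ?thesis by (simp add: right_diff_distrib sum_subtractf)
    qed
    then show ?thesis by (intro exI allI)
  qed
  then have "\<exists>\<psi>. \<forall>i j k. ?S i j k = (if j = k then \<psi> i else 0) + (if i = k then \<psi> j else 0)"
    by (intro quadratic_pure_trace) (simp_all add: affine_atD(5)[OF aff(1) K] affine_atD(5)[OF aff(2) K])
  then show ?thesis unfolding pure_trace_iff[OF K G G'] .
qed

text \<open>The pure trace term along a curve is a multiple \<open>q\<close> of the velocity. A
  reparametrization \<open>h\<close> absorbs it if its second derivative is \<open>q\<close> at
  \<open>h\<close> times the square of the first. The inverse \<open>Q\<close> of such an
  \<open>h\<close> satisfies the linear equation \<open>Q'' = - q Q'\<close>, which two primitives
  on a disc solve.\<close>

lemma pure_trace_geodesic:
  assumes U: "mopen U" and aff: "\<And>x. x \<in> U \<Longrightarrow> affine_at D x" "\<And>x. x \<in> U \<Longrightarrow> affine_at D' x"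
    and pt: "\<And>x. x \<in> U \<Longrightarrow> pure_trace D D' x" and g: "geodesic A D W c" "c ` W \<subseteq> U"
  shows "geodesic_up_to_parametrization A D' W c"
  unfolding geodesic_up_to_parametrization_def
proof
  fix t0 assume t0: "t0 \<in> W"
  have im: "immersed_curve A W c" using g(1) unfolding geodesic_def by blast
  have x: "c t0 \<in> U" using g(2) t0 by blast
  obtain K where K: "K \<in> A" "c t0 \<in> fst K" using pts_chart[OF immersedD(3)[OF im t0]] by blast
  let ?G = "gam K D" and ?G' = "gam K D'"
  define P where "P y \<longleftrightarrow> TM.christoffel K D ?G y \<and> TM.christoffel K D' ?G' y \<and> pure_trace D D' y \<and>
    (\<forall>i j k. hn y (?G i j k)) \<and> (\<forall>i j k. hn y (?G' i j k))" for y
  have "eventually (\<lambda>y. y \<in> fst K \<and> y \<in> U) (NH (c t0))"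
    using eventually_chart[OF K] eventually_mopen[OF U x] by (rule eventually_conj)
  then have "eventually P (NH (c t0))"
  proof (rule eventually_mono)
    fix y assume y: "y \<in> fst K \<and> y \<in> U"
    then have yU: "y \<in> U" and yk: "y \<in> fst K" by blast+
    show "P y" unfolding P_def
      using affine_atD(2,4)[OF aff(1)[OF yU] K(1) yk] affine_atD(2,4)[OF aff(2)[OF yU] K(1) yk] pt[OF yU] by blast
  qed
  then obtain r where r: "r > 0" "ball t0 r \<subseteq> W" "\<And>s. s \<in> ball t0 r \<Longrightarrow> c s \<in> fst K \<and> P (c s)"
    "\<And>k. (\<lambda>s. snd K (c s) $ k) holomorphic_on ball t0 r"
    using immersed_chart[OF im t0 K] by blast
  let ?g = "\<lambda>k s. snd K (c s) $ k"
  \<comment> \<open>\<open>pure_trace\<close> provides some covector at each point separately. The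
    contraction of the pure trace term is (n + 1) times this covector, so it is expressed by the
    symbols and is holomorphic.\<close>
  define \<psi> where "\<psi> i y = (1 / ((of_nat CARD('n) :: complex) + 1)) * (\<Sum>k\<in>UNIV. ?G i k k y - ?G' i k k y)" for i y
  have pf: "?G i j k y - ?G' i j k y = (if j = k then \<psi> i y else 0) + (if i = k then \<psi> j y else 0)"
    if y: "P y" "y \<in> fst K" for i j k y
  proof -
    have C: "TM.christoffel K D ?G y" "TM.christoffel K D' ?G' y" "pure_trace D D' y" using y(1) unfolding P_def by blast+
    obtain \<phi> where \<phi>: "\<And>i j k. ?G i j k y - ?G' i j k y = (if j = k then \<phi> i else 0) + (if i = k then \<phi> j else 0)"
      using C(3) unfolding pure_trace_iff[OF K(1) y(2) C(1,2)] by blast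
    have "(\<Sum>k\<in>UNIV. ?G i k k y - ?G' i k k y) = ((of_nat CARD('n) :: complex) + 1) * \<phi> i" for i
      unfolding \<phi> by (simp add: sum.distrib algebra_simps)
    then have "\<psi> i y = \<phi> i" for i unfolding \<psi>_def using dimc_nz(1) by simp
    then show ?thesis using \<phi> by simp
  qed
  \<comment> \<open>The factor 2 arises because both summands of the pure trace term contribute
    equally when the two arguments are the velocity.\<close>
  define q where "q s = 2 * (\<Sum>i\<in>UNIV. deriv (?g i) s * \<psi> i (c s))" for s
  have "(\<lambda>s. \<psi> i (c s)) holomorphic_on ball t0 r" for i unfolding holomorphic_on_def
  proof
    fix s assume s: "s \<in> ball t0 r"
    have Ps: "P (c s)" "c s \<in> fst K" using r(3)[OF s] by blast+
    have "hn (c s) (\<psi> i)" unfolding \<psi>_def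
      by (intro hn_mult hn_const hn_sum hn_diff chart_pts[OF K(1) Ps(2)]) (use Ps(1) in \<open>auto simp: P_def\<close>)
    then have "(\<lambda>s. \<psi> i (c s)) field_differentiable (at s)"
      using velocity_expand(3)[where c = c and t = s and S = "ball t0 r", OF K(1) Ps(2) open_ball s _ r(4)] r(3) by blast
    then show "(\<lambda>s. \<psi> i (c s)) field_differentiable at s within ball t0 r" by (rule field_differentiable_at_within)
  qed
  then have "(\<lambda>s. - q s) holomorphic_on ball t0 r" unfolding q_def
    by (intro holomorphic_intros holomorphic_deriv r(4) open_ball)
  then obtain F where "\<And>s. s \<in> ball t0 r \<Longrightarrow> (F has_field_derivative - q s) (at s within ball t0 r)"
    using holomorphic_convex_primitive'[OF convex_ball open_ball] by blast
  then have F: "(F has_field_derivative - q s) (at s)" if "s \<in> ball t0 r" for s using at_within_open[OF that open_ball] that by metis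
  have "F holomorphic_on ball t0 r" unfolding holomorphic_on_open[OF open_ball] using F by blast
  then have "(\<lambda>s. exp (F s)) holomorphic_on ball t0 r" by (intro holomorphic_intros)
  then obtain Q where "\<And>s. s \<in> ball t0 r \<Longrightarrow> (Q has_field_derivative exp (F s)) (at s within ball t0 r)"
    using holomorphic_convex_primitive'[OF convex_ball open_ball] by blast
  then have Q: "(Q has_field_derivative exp (F s)) (at s)" if "s \<in> ball t0 r" for s using at_within_open[OF that open_ball] that by metis
  have dQ: "deriv Q s = exp (F s)" if "s \<in> ball t0 r" for s by (rule DERIV_imp_deriv[OF Q[OF that]])
  have hQ: "Q holomorphic_on ball t0 r" unfolding holomorphic_on_open[OF open_ball] using Q by blast
  have t0r: "t0 \<in> ball t0 r" using r(1) by simp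
  have nzQ: "deriv Q t0 \<noteq> 0" using dQ[OF t0r] by simp
  obtain r' where r': "r' > 0" "ball t0 r' \<subseteq> ball t0 r" "inj_on Q (ball t0 r')"
    using has_complex_derivative_locally_injective[OF hQ t0r open_ball nzQ] by blast
  have hQ': "Q holomorphic_on ball t0 r'" by (rule holomorphic_on_subset[OF hQ r'(2)])
  obtain h where h: "h holomorphic_on (Q ` ball t0 r')" "\<And>z. z \<in> ball t0 r' \<Longrightarrow> deriv Q z * deriv h (Q z) = 1"
    "\<And>z. z \<in> ball t0 r' \<Longrightarrow> h (Q z) = z"
    using holomorphic_has_inverse[OF hQ' open_ball r'(3)] by blast
  let ?N = "Q ` ball t0 r'"
  have N: "open ?N" by (rule open_mapping_thm3[OF hQ' open_ball r'(3)])
  have hN: "h u \<in> ball t0 r'" if "u \<in> ?N" for u using that h(3) by auto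
  have dh: "deriv h u = exp (- F (h u))" if u: "u \<in> ?N" for u
  proof -
    obtain z where z: "u = Q z" "z \<in> ball t0 r'" using u by blast
    then have "exp (F z) * deriv h u = 1" using h(2)[OF z(2)] dQ r'(2) by auto
    then show ?thesis using z h(3) by (simp add: exp_minus inverse_eq_divide field_simps)
  qed
  have nz: "\<forall>u\<in>?N. deriv h u \<noteq> 0" using dh by simp
  have ddh: "deriv (deriv h) u = q (h u) * (deriv h u)\<^sup>2" if u: "u \<in> ?N" for u
  proof -
    have hu: "h u \<in> ball t0 r" using hN[OF u] r'(2) by blast
    have "((\<lambda>u. F (h u)) has_field_derivative - q (h u) * deriv h u) (at u)"
      by (rule DERIV_chain2[OF F[OF hu] holomorphic_derivI[OF h(1) N u]])
    then have "((\<lambda>u. exp (- F (h u))) has_field_derivative exp (- F (h u)) * (q (h u) * deriv h u)) (at u)"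
      by (auto intro!: derivative_eq_intros)
    then have "((deriv h) has_field_derivative exp (- F (h u)) * (q (h u) * deriv h u)) (at u)"
      by (rule has_field_derivative_transform_within_open[OF _ N u]) (simp add: dh)
    from DERIV_imp_deriv[OF this] show ?thesis using dh[OF u] by (simp add: power2_eq_square)
  qed
  have hW: "h ` ?N \<subseteq> W" using hN r'(2) r(2) by blast
  have "geodesic A D' ?N (c \<circ> h)"
  proof (rule geodesicI[OF immersed_reparametrize(1)[OF im N h(1) hW nz]])
    fix u assume u: "u \<in> ?N"
    have s: "h u \<in> ball t0 r" using hN[OF u] r'(2) by blast
    let ?s = "h u" and ?d = "deriv h u"
    have cs: "c ?s \<in> fst K" "P (c ?s)" using r(3)[OF s] by blast+
    have C: "TM.christoffel K D ?G (c ?s)" "TM.christoffel K D' ?G' (c ?s)" using cs(2) unfolding P_def by blast+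
    have ge: "geo K ?G c ?s" by (rule geodesicD[OF g(1) _ K(1) cs(1) C(1)]) (use s r(2) in blast)
    have "geo K ?G' (c \<circ> h) u" unfolding geo_def
    proof
      fix k
      let ?v = "\<lambda>i. deriv (?g i) ?s"
      let ?A = "\<Sum>i\<in>UNIV. \<Sum>j\<in>UNIV. ?v i * ?v j * ?G i j k (c ?s)"
      let ?B = "\<Sum>i\<in>UNIV. \<Sum>j\<in>UNIV. ?v i * ?v j * ?G' i j k (c ?s)"
      have 1: "deriv (deriv (?g k)) ?s + ?A = 0" using ge unfolding geo_def by blast
      have "?A - ?B = (\<Sum>i\<in>UNIV. \<Sum>j\<in>UNIV. ?v i * ?v j * (?G i j k (c ?s) - ?G' i j k (c ?s)))"
        by (simp add: right_diff_distrib sum_subtractf)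
      also have "\<dots> = q ?s * ?v k" unfolding pf[OF cs(2,1)] sum_pure_trace q_def by (simp add: algebra_simps)
      finally have 2: "?A - ?B = q ?s * ?v k" .
      have 3: "(\<Sum>i\<in>UNIV. \<Sum>j\<in>UNIV. (?v i * ?d) * (?v j * ?d) * ?G' i j k (c ?s)) = ?B * ?d\<^sup>2"
        unfolding sum_distrib_right by (simp add: power2_eq_square mult_ac)
      have "deriv (deriv (?g k)) ?s * ?d\<^sup>2 + ?v k * (q ?s * ?d\<^sup>2) + ?B * ?d\<^sup>2 = (deriv (deriv (?g k)) ?s + q ?s * ?v k + ?B) * ?d\<^sup>2"
        by (simp add: algebra_simps)
      also have "\<dots> = 0" unfolding 2[symmetric] using 1 by simp
      finally show "deriv (deriv (\<lambda>s. snd K ((c \<circ> h) s) $ k)) u + (\<Sum>i\<in>UNIV. \<Sum>j\<in>UNIV.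
          deriv (\<lambda>s. snd K ((c \<circ> h) s) $ i) u * deriv (\<lambda>s. snd K ((c \<circ> h) s) $ j) u * ?G' i j k ((c \<circ> h) u)) = 0"
        unfolding immersed_reparametrize(2,3)[OF im N h(1) hW nz u K(1) cs(1)] ddh[OF u] comp_apply[of c h u] 3 .
    qed
    then show "\<exists>K\<in>A. \<exists>G. (c \<circ> h) u \<in> fst K \<and> TM.christoffel K D' G ((c \<circ> h) u) \<and> geo K G (c \<circ> h) u"
      using K(1) cs(1) C(2) by (intro bexI[of _ K] exI[of _ ?G']) simp_all
  qed
  moreover have "inj_on h ?N" by (rule inj_onI) (use h(3) in auto)
  moreover have "t0 \<in> h ` ?N"
  proof (rule image_eqI)
    show "t0 = h (Q t0)" using h(3)[of t0] r'(1) by simp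
  qed (use r'(1) in simp)
  ultimately show "\<exists>N h. open N \<and> h holomorphic_on N \<and> inj_on h N \<and> h ` N \<subseteq> W \<and> t0 \<in> h ` N \<and> geodesic A D' N (c \<circ> h)"
    using N h(1) hW by blast
qed

lemma projectively_equivalent_iff:
  assumes U: "mopen U" and aff: "\<And>x. x \<in> U \<Longrightarrow> affine_at D x" "\<And>x. x \<in> U \<Longrightarrow> affine_at D' x"
  shows "projectively_equivalent_on A U D D' \<longleftrightarrow> (\<forall>x\<in>U. pure_trace D D' x)"
proof
  assume "projectively_equivalent_on A U D D'"
  then show "\<forall>x\<in>U. pure_trace D D' x" using projectively_equivalent_pure_trace[OF U aff] by blast
next
  assume pt: "\<forall>x\<in>U. pure_trace D D' x"
  have pt1: "pure_trace D D' x" "pure_trace D' D x" if "x \<in> U" for x using pt that pure_trace_sym by blast+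
  show "projectively_equivalent_on A U D D'" unfolding projectively_equivalent_on_def
  proof (intro allI impI conjI)
    fix W :: "complex set" and c assume c: "c ` W \<subseteq> U"
    show "geodesic_up_to_parametrization A D' W c" if g: "geodesic A D W c"
      by (rule pure_trace_geodesic[OF U aff pt1(1) g c])
    show "geodesic_up_to_parametrization A D W c" if g: "geodesic A D' W c"
      by (rule pure_trace_geodesic[OF U aff(2,1) pt1(2) g c])
  qed
qed

section \<open>Induced projective structures\<close>

lemma mopen_pts_all: "mopen pts"
  using openin_topspace[of "manifold_topology A"] by simp

lemma splittingD:
  assumes c: "c \<in> anchor_splittings A U" and U: "mopen U" "x \<in> U"
  shows "c x \<in> linear_maps (tangent_space A x) (atiyah_fibre A x)"
    and "v \<in> tangent_space A x \<Longrightarrow> c x v \<in> atiyah_fibre A x"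
    and "v \<in> tangent_space A x \<Longrightarrow> atiyah_anchor A x (c x v) = v"
    and "TM.ls x Y \<Longrightarrow> E.ls x (\<lambda>y. c y (Y y))"
proof -
  have c1: "\<And>x. x \<in> U \<Longrightarrow> c x \<in> linear_maps (tangent_space A x) (atiyah_fibre A x)"
    "\<And>V s. mopen V \<Longrightarrow> V \<subseteq> U \<Longrightarrow> s \<in> vector_fields A V \<Longrightarrow> (\<lambda>x. c x (s x)) \<in> atiyah_sections A V"
    "\<And>x v. x \<in> U \<Longrightarrow> v \<in> tangent_space A x \<Longrightarrow> atiyah_anchor A x (c x v) = v"
    using c unfolding anchor_splittings_def hom_bundle_def by auto
  show l: "c x \<in> linear_maps (tangent_space A x) (atiyah_fibre A x)" by (rule c1(1)[OF U(2)])
  show "v \<in> tangent_space A x \<Longrightarrow> c x v \<in> atiyah_fibre A x" using l unfolding linear_maps_def by blast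
  show "v \<in> tangent_space A x \<Longrightarrow> atiyah_anchor A x (c x v) = v" by (rule c1(3)[OF U(2)])
  show "E.ls x (\<lambda>y. c y (Y y))" if Y: "TM.ls x Y"
  proof -
    obtain V where V: "mopen V" "x \<in> V" "Y \<in> sections (tangent_bundle A) V" using Y unfolding local_section_def by blast
    have o: "mopen (U \<inter> V)" using U(1) V(1) by (rule openin_Int)
    have "Y \<in> vector_fields A (U \<inter> V)"
      using V(3) TM.sections_ls[OF V(1), of Y] TM.sections_ls[OF o, of Y] by auto
    then have "(\<lambda>x. c x (Y x)) \<in> atiyah_sections A (U \<inter> V)" by (rule c1(2)[OF o Int_lower1])
    then show ?thesis using E.ls_sections[OF _ o] U(2) V(2) by simp
  qed
qed

lemma splitting_coords:
  assumes c: "c \<in> anchor_splittings A U" and U: "mopen U" "x \<in> U" and K: "K \<in> A" "x \<in> fst K" and v: "v \<in> tangent_space A x"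
  shows "cE K (Some k) x (c x v) = v (xi K k)"
    and "cE K None x (c x v) = (\<Sum>i\<in>UNIV. v (xi K i) * cE K None x (c x (dd K i x)))"
proof -
  note s = splittingD[OF c U]
  have "v (xi K k) = atiyah_anchor A x (c x v) (xi K k)" unfolding s(3)[OF v] ..
  also have "\<dots> = (\<Sum>j\<in>UNIV. cE K (Some j) x (c x v) * (if j = k then 1 else 0))"
    unfolding atiyah_anchor_coords[OF K s(2)[OF v]] dd_coord[OF K] ..
  also have "\<dots> = cE K (Some k) x (c x v)" by (rule sum_delta_mult)
  finally show "cE K (Some k) x (c x v) = v (xi K k)" ..
  have zero: "cE K a x 0 = 0 \<and> 0 \<in> atiyah_fibre A x" for a
    using E.co_scale[OF K E.fibre_zero[OF K], of a 0] E.fibre_zero[OF K] by (simp add: complex_vector.scale_zero_left)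
  have sum: "cE K a x (\<Sum>i\<in>I. r i *\<^sub>C e i) = (\<Sum>i\<in>I. r i * cE K a x (e i)) \<and> (\<Sum>i\<in>I. r i *\<^sub>C e i) \<in> atiyah_fibre A x"
    if e: "\<And>i. e i \<in> atiyah_fibre A x" for a r e and I :: "'n set"
  proof (induction I rule: infinite_finite_induct)
    case (insert i I)
    have f1: "e i \<in> fibre (atiyah_bundle A) x" using e[of i] by simp
    have f2: "r i *\<^sub>C e i \<in> fibre (atiyah_bundle A) x" by (rule E.fibre_scale[OF K f1])
    have f3: "(\<Sum>i\<in>I. r i *\<^sub>C e i) \<in> fibre (atiyah_bundle A) x" using insert.IH unfolding E_simps by blast
    have IH: "cE K a x (\<Sum>i\<in>I. r i *\<^sub>C e i) = (\<Sum>i\<in>I. r i * cE K a x (e i))" using insert.IH by blast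
    have "r i *\<^sub>C e i + (\<Sum>i\<in>I. r i *\<^sub>C e i) \<in> atiyah_fibre A x" using E.fibre_add[OF K f2 f3] unfolding E_simps .
    then show ?case unfolding sum.insert[OF insert.hyps(1,2)] E.co_add[OF K f2 f3] E.co_scale[OF K f1] IH
      by (rule conjI[OF refl])
  next
    case empty show ?case unfolding sum.empty by (rule zero)
  next
    case (infinite I) then show ?case unfolding sum.infinite[OF infinite] using zero by blast
  qed
  have l: "c x \<in> linear_maps (fibre (tangent_bundle A) x) (atiyah_fibre A x)" using s(1) by simp
  have ev: "v = (\<Sum>i\<in>UNIV. v (xi K i) *\<^sub>C dd K i x)" using TM.expand[OF K, of v] v by simp
  have "c x v = c x (\<Sum>i\<in>UNIV. v (xi K i) *\<^sub>C dd K i x)" using ev by (rule arg_cong)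
  also have "\<dots> = (\<Sum>i\<in>UNIV. v (xi K i) *\<^sub>C c x (dd K i x))" by (rule TM.linear_maps_sum[OF K l])
  finally have "cE K None x (c x v) = cE K None x (\<Sum>i\<in>UNIV. v (xi K i) *\<^sub>C c x (dd K i x))" by (rule arg_cong)
  also have "\<dots> = (\<Sum>i\<in>UNIV. v (xi K i) * cE K None x (c x (dd K i x)))"
    by (rule sum[THEN conjunct1]) (rule s(2)[OF dd_tangent[OF K]])
  finally show "cE K None x (c x v) = (\<Sum>i\<in>UNIV. v (xi K i) * cE K None x (c x (dd K i x)))" .
qed

text \<open>A splitting adds Euler components to the lifted vectors. By (ii1) and the symmetry of
  the symbols an Euler argument in either place acts as -1/(n + 1), which produces the pure trace
  terms; two Euler arguments give no spatial component.\<close>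

lemma induced_christoffel:
  assumes c: "c \<in> anchor_splittings A U" and U: "mopen U" "x \<in> U" and K: "K \<in> A" "x \<in> fst K"
    and G: "E.christoffel K D G x" and n: "normal G x"
  shows "TM.christoffel K (induced_connection A U c D)
    (\<lambda>i j k y. G (Some i) (Some j) (Some k) y + (- 1 / ((of_nat CARD('n) :: complex) + 1)) *
      ((if j = k then cE K None y (c y (dd K i y)) else 0) + (if i = k then cE K None y (c y (dd K j y)) else 0))) x"
  unfolding TM.christoffel_def
proof (intro allI impI, rule ext)
  fix Y v assume Y: "TM.ls x Y"
  let ?nu = "- 1 / ((of_nat CARD('n) :: complex) + 1)"
  let ?a = "\<lambda>i. cE K None x (c x (dd K i x))"
  let ?H = "\<lambda>i j k. G (Some i) (Some j) (Some k) x + ?nu * ((if j = k then ?a i else 0) + (if i = k then ?a j else 0))"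
  show "induced_connection A U c D Y x v = (if v \<in> fibre (tangent_bundle A) x
      then \<Sum>k\<in>UNIV. (anchor (tangent_bundle A) x v (\<lambda>y. Y y (xi K k)) +
        (\<Sum>i\<in>UNIV. \<Sum>j\<in>UNIV. v (xi K i) * Y x (xi K j) * ?H i j k)) *\<^sub>C dd K k x
      else 0)" (is "_ = ?R")
  proof (cases "v \<in> tangent_space A x")
    case False then show ?thesis by (simp add: induced_connection_def)
  next
    case v: True
    note s = splittingD[OF c U]
    have Yx: "Y x \<in> tangent_space A x" using TM.ls_fibre[OF Y] by simp
    let ?s = "\<lambda>y. c y (Y y)"
    have ls: "E.ls x ?s" by (rule s(4)[OF Y])
    have e: "c x v \<in> fibre (atiyah_bundle A) x" using s(2)[OF v] by simp
    have C1: "D ?s x (c x v) \<in> atiyah_fibre A x" using E.christoffel_co(1)[OF G K ls e] by simp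
    have near: "eventually (\<lambda>y. cE K (Some k) y (?s y) = Y y (xi K k)) (NH x)" for k
      using eventually_mopen[OF U] eventually_chart[OF K] TM.ls_near[OF Y]
    proof eventually_elim
      case (elim y) then show ?case using splitting_coords(1)[OF c U(1) elim(1) K(1) elim(2)] by simp
    qed
    have dv: "v (\<lambda>y. cE K (Some k) y (?s y)) = v (\<lambda>y. Y y (xi K k))" for k by (rule tangent_cong[OF v near])
    note v0 = splitting_coords[OF c U K v] and Y0 = splitting_coords[OF c U K Yx]
    note nN = normalD[OF n]
    have quad: "(\<Sum>a\<in>UNIV. \<Sum>b\<in>UNIV. cE K a x (c x v) * cE K b x (?s x) * G a b (Some k) x) =
        (\<Sum>i\<in>UNIV. \<Sum>j\<in>UNIV. v (xi K i) * Y x (xi K j) * ?H i j k)" for k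
    proof -
      let ?e = "cE K None x (c x v)" and ?f = "cE K None x (c x (Y x))"
      have 1: "(\<Sum>j\<in>UNIV. cE K (Some j) x (?s x) * G None (Some j) (Some k) x) = ?nu * Y x (xi K k)"
        unfolding nN Y0(1) by (simp add: if_distrib[of "\<lambda>x. _ * x"] cong: if_cong)
      have 2: "(\<Sum>i\<in>UNIV. cE K (Some i) x (c x v) * G (Some i) None (Some k) x) = ?nu * v (xi K k)"
        unfolding nN v0(1) by (simp add: if_distrib[of "\<lambda>x. _ * x"] cong: if_cong)
      have "(\<Sum>a\<in>UNIV. \<Sum>b\<in>UNIV. cE K a x (c x v) * cE K b x (?s x) * G a b (Some k) x) =
         ?e * (\<Sum>j\<in>UNIV. cE K (Some j) x (?s x) * G None (Some j) (Some k) x) +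
         (\<Sum>i\<in>UNIV. cE K (Some i) x (c x v) * G (Some i) None (Some k) x) * ?f +
         (\<Sum>i\<in>UNIV. \<Sum>j\<in>UNIV. v (xi K i) * Y x (xi K j) * G (Some i) (Some j) (Some k) x)"
      proof -
        have o: "(\<Sum>a\<in>UNIV. \<Sum>b\<in>UNIV. F a b) = F None None + (\<Sum>j\<in>UNIV. F None (Some j)) +
            ((\<Sum>i\<in>UNIV. F (Some i) None) + (\<Sum>i\<in>UNIV. \<Sum>j\<in>UNIV. F (Some i) (Some j)))" for F :: "'n option \<Rightarrow> 'n option \<Rightarrow> complex"
          by (simp add: sum_option sum.distrib)
        have e: "(\<Sum>i\<in>UNIV. cE K (Some i) x (c x v) * ?f * G (Some i) None (Some k) x) =
            (\<Sum>i\<in>UNIV. cE K (Some i) x (c x v) * G (Some i) None (Some k) x) * ?f"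
          unfolding sum_distrib_right by (intro sum.cong refl) (simp only: mult_ac)
        have z: "G None None (Some k) x = 0" by (simp add: nN)
        show ?thesis unfolding o e unfolding z v0(1) Y0(1) mult.assoc sum_distrib_left[symmetric] by simp
      qed
      also have "\<dots> = (\<Sum>i\<in>UNIV. \<Sum>j\<in>UNIV. v (xi K i) * Y x (xi K j) * G (Some i) (Some j) (Some k) x) +
         ?nu * ((\<Sum>i\<in>UNIV. v (xi K i) * ?a i) * Y x (xi K k) + (\<Sum>i\<in>UNIV. Y x (xi K i) * ?a i) * v (xi K k))"
        unfolding 1 2 v0(2) Y0(2) by (simp only: algebra_simps)
      also have "\<dots> = (\<Sum>i\<in>UNIV. \<Sum>j\<in>UNIV. v (xi K i) * Y x (xi K j) * ?H i j k)"
        unfolding sum_pure_trace[where v = "\<lambda>i. v (xi K i)" and w = "\<lambda>i. Y x (xi K i)" and k = k and \<psi> = ?a, symmetric]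
        unfolding sum_distrib_left sum.distrib[symmetric]
        by (intro sum.cong refl) (simp only: algebra_simps)
      finally show ?thesis .
    qed
    have R: "?R = (\<Sum>k\<in>UNIV. (v (\<lambda>y. Y y (xi K k)) +
        (\<Sum>i\<in>UNIV. \<Sum>j\<in>UNIV. v (xi K i) * Y x (xi K j) * ?H i j k)) *\<^sub>C dd K k x)" using v by simp
    have L: "induced_connection A U c D Y x v = atiyah_anchor A x (D ?s x (c x v))"
      using U(2) Y v by (simp add: induced_connection_def)
    show ?thesis unfolding R L
    proof
      fix f
      have "cE K (Some k) x (D ?s x (c x v)) = v (\<lambda>y. Y y (xi K k)) +
        (\<Sum>i\<in>UNIV. \<Sum>j\<in>UNIV. v (xi K i) * Y x (xi K j) * ?H i j k)" for k
        unfolding E.christoffel_co(2)[OF G K ls e] quad using dv s(3)[OF v] by simp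
      then show "atiyah_anchor A x (D ?s x (c x v)) f = (\<Sum>k\<in>UNIV. (v (\<lambda>y. Y y (xi K k)) +
        (\<Sum>i\<in>UNIV. \<Sum>j\<in>UNIV. v (xi K i) * Y x (xi K j) * ?H i j k)) *\<^sub>C dd K k x) f"
        unfolding atiyah_anchor_coords[OF K C1] by (simp add: sum_fun_apply)
    qed
  qed
qed

text \<open>The two splittings differ by a one-form with values in the Euler direction, and -1/(n +
  1) times this one-form is the witness.\<close>

lemma induced_pure_trace:
  assumes c: "c \<in> anchor_splittings A U" "mopen U" "x \<in> U" and c': "c' \<in> anchor_splittings A U'" "mopen U'" "x \<in> U'"
    and K: "K \<in> A" "x \<in> fst K" and G: "E.christoffel K D G x" and n: "normal G x"
  shows "pure_trace (induced_connection A U c D) (induced_connection A U' c' D) x"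
  unfolding pure_trace_iff[OF K induced_christoffel[OF c K G n] induced_christoffel[OF c' K G n]]
  by (intro exI[of _ "\<lambda>i. (- 1 / ((of_nat CARD('n) :: complex) + 1)) * (cE K None x (c x (dd K i x)) - cE K None x (c' x (dd K i x)))"])
    (simp only: right_diff_distrib distrib_left, simp)

text \<open>The splitting along the coordinate frame of a chart. Its Euler components vanish, so the
  induced connection has exactly the spatial symbols of the connection on E. The zero off the
  tangent space is the convention of \<open>linear_maps\<close>.\<close>

definition csplit :: "'m set \<times> ('m \<Rightarrow> complex^'n) \<Rightarrow> 'm \<Rightarrow> 'm tangent \<Rightarrow> ('m, 'n) atiyah" where
  "csplit K y v = (if v \<in> tangent_space A y
     then \<Sum>a\<in>UNIV. (case a of None \<Rightarrow> 0 | Some i \<Rightarrow> v (xi K i)) *\<^sub>C fE K a y else 0)"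

lemma csplit:
  assumes K: "K \<in> A"
  shows "csplit K \<in> anchor_splittings A (fst K)"
    and "x \<in> fst K \<Longrightarrow> v \<in> tangent_space A x \<Longrightarrow> cE K None x (csplit K x v) = 0"
proof -
  have co: "cE K a x (csplit K x v) = (case a of None \<Rightarrow> 0 | Some i \<Rightarrow> v (xi K i))"
    if "x \<in> fst K" "v \<in> tangent_space A x" for a x v
    unfolding csplit_def using that by (simp add: E.co_comb[OF K])
  then show "x \<in> fst K \<Longrightarrow> v \<in> tangent_space A x \<Longrightarrow> cE K None x (csplit K x v) = 0" by simp
  have fib: "csplit K x v \<in> atiyah_fibre A x" if "x \<in> fst K" "v \<in> tangent_space A x" for x v
    unfolding csplit_def using that E.comb_fibre[OF K that(1)] by simp
  have lin: "csplit K x \<in> linear_maps (tangent_space A x) (atiyah_fibre A x)" if x: "x \<in> fst K" for x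
    unfolding linear_maps_def mem_Collect_eq
  proof (intro conjI allI impI ballI)
    show "csplit K x v = 0" if "v \<notin> tangent_space A x" for v using that by (simp add: csplit_def)
    show "csplit K x v \<in> atiyah_fibre A x" if "v \<in> tangent_space A x" for v by (rule fib[OF x that])
    show "csplit K x (v + w) = csplit K x v + csplit K x w" if "v \<in> tangent_space A x" "w \<in> tangent_space A x" for v w
      using that tangent_plus[OF that] unfolding csplit_def
      by (simp add: sum.distrib[symmetric] scaleC_add_left[symmetric]) (intro sum.cong refl arg_cong2[of _ _ _ _ scaleC], simp split: option.split)
    show "csplit K x (c *\<^sub>C v) = c *\<^sub>C csplit K x v" if "v \<in> tangent_space A x" for c v
      using that tangent_scale[OF that] unfolding csplit_def
      by (simp add: complex_vector.scale_sum_right scaleC_scaleC) (intro sum.cong refl arg_cong2[of _ _ _ _ scaleC], simp split: option.split)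
  qed
  have anch: "atiyah_anchor A x (csplit K x v) = v" if "x \<in> fst K" "v \<in> tangent_space A x" for x v
  proof
    fix f
    show "atiyah_anchor A x (csplit K x v) f = v f"
      unfolding atiyah_anchor_coords[OF K that(1) fib[OF that]] co[OF that] tangent_expand[OF K that, of f] by simp
  qed
  have sec: "(\<lambda>y. csplit K y (s y)) \<in> atiyah_sections A V" if V: "mopen V" "V \<subseteq> fst K" and s: "s \<in> vector_fields A V" for V s
  proof -
    have "E.ls x (\<lambda>y. csplit K y (s y))" if x: "x \<in> V" for x
    proof -
      have xk: "x \<in> fst K" using x V by blast
      have Y: "TM.ls x s" by (rule TM.ls_sections[OF _ V(1) x]) (use s in simp)
      have "eventually (\<lambda>y. csplit K y (s y) = (\<Sum>a\<in>UNIV. (case a of None \<Rightarrow> \<lambda>y. 0 | Some i \<Rightarrow> \<lambda>y. s y (xi K i)) y *\<^sub>C fE K a y)) (NH x)"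
        using TM.ls_near[OF Y]
      proof eventually_elim
        case (elim y) then show ?case by (simp add: csplit_def) (intro sum.cong refl arg_cong2[of _ _ _ _ scaleC], simp split: option.split)
      qed
      note e = this
      show ?thesis unfolding E.ls_cong[OF e]
      proof (rule E.ls_comb[OF K xk])
        show "hn x (case a of None \<Rightarrow> \<lambda>y. 0 | Some i \<Rightarrow> \<lambda>y. s y (xi K i))" for a
          using hn_const[OF chart_pts[OF K xk]] TM.ls_hn[OF Y K xk] by (cases a) simp_all
      qed
    qed
    then show ?thesis using E.sections_ls[OF V(1)] by simp
  qed
  show "csplit K \<in> anchor_splittings A (fst K)"
    unfolding anchor_splittings_def hom_bundle_def using lin anch sec by simp
qed

abbreviation bconn where "bconn K D \<equiv> induced_connection A (fst K) (csplit K) D"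

lemma bconn_christoffel:
  assumes K: "K \<in> A" "x \<in> fst K" and G: "E.christoffel K D G x" and n: "normal G x"
  shows "TM.christoffel K (bconn K D) (\<lambda>i j k. G (Some i) (Some j) (Some k)) x"
proof -
  have "TM.christoffel K (bconn K D) (\<lambda>i j k y. G (Some i) (Some j) (Some k) y + (- 1 / ((of_nat CARD('n) :: complex) + 1)) *
      ((if j = k then cE K None y (csplit K y (dd K i y)) else 0) + (if i = k then cE K None y (csplit K y (dd K j y)) else 0))) x"
    by (rule induced_christoffel[OF csplit(1)[OF K(1)] mopen_chart[OF K(1)] K(2) K G n])
  then show ?thesis unfolding TM.christoffel_def csplit(2)[OF K dd_tangent[OF K]] if_cancel add_0_right mult_zero_right .
qed

section \<open>Connections that satisfy the conditions near a point\<close>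

definition gamE :: "'m set \<times> ('m \<Rightarrow> complex^'n) \<Rightarrow> ('m, ('m, 'n) atiyah, ('m, 'n) atiyah) conn \<Rightarrow>
    'n option \<Rightarrow> 'n option \<Rightarrow> 'n option \<Rightarrow> 'm \<Rightarrow> complex" where
  "gamE K D a b c y = cE K c y (D (fE K b) y (fE K a y))"

text \<open>Together with the conditions at \<open>x\<close> this retains holomorphic symbols near
  \<open>x\<close> in every chart. The domain of the connection is not mentioned, so local and
  global connections can be compared directly.\<close>

definition regular :: "('m, ('m, 'n) atiyah, ('m, 'n) atiyah) conn \<Rightarrow> 'm \<Rightarrow> bool" where
  "regular D x \<longleftrightarrow> good_at D x \<and> (\<forall>K\<in>A. x \<in> fst K \<longrightarrow>
     eventually (E.christoffel K D (gamE K D)) (NH x) \<and> (\<forall>a b c. hn x (gamE K D a b c)))"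

lemma connection_regular:
  assumes D: "connection_on A (atiyah_bundle A) (atiyah_bundle A) U D" and U: "mopen U" and x: "x \<in> U" and g: "good_at D x"
  shows "regular D x"
  unfolding regular_def
proof (intro conjI g ballI impI)
  fix K assume K: "K \<in> A" "x \<in> fst K"
  have e: "gamE K D = (\<lambda>a b c y. cE K c y (D (fE K b) y (fE K a y)))" by (simp add: gamE_def fun_eq_iff)
  have c: "E.christoffel K D (gamE K D) y \<and> hn y (gamE K D a b c)" if y: "y \<in> fst K" "y \<in> U" for y a b c
    using E.connection_christoffel[OF D U K(1) y e] by blast
  have ev: "eventually (\<lambda>y. y \<in> fst K \<and> y \<in> U) (NH x)"
    using eventually_chart[OF K] eventually_mopen[OF U x] by (rule eventually_conj)
  show "eventually (E.christoffel K D (gamE K D)) (NH x)" using ev by (rule eventually_mono) (use c in blast)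
  show "\<forall>a b c. hn x (gamE K D a b c)" using c[OF K(2) x] by blast
qed

lemma regularD:
  assumes r: "regular D x" and K: "K \<in> A" "x \<in> fst K"
  shows "E.christoffel K D (gamE K D) x" "hn x (gamE K D a b c)" "normal (gamE K D) x"
    "(\<Sum>a\<in>UNIV. E.riem K (gamE K D) a b c a x) = 0"
proof -
  have h: "good_at D x" "eventually (E.christoffel K D (gamE K D)) (NH x)" "\<And>a b c. hn x (gamE K D a b c)"
    using r K unfolding regular_def by blast+
  show "E.christoffel K D (gamE K D) x" by (rule NH_self[OF h(2) chart_pts[OF K]])
  show "hn x (gamE K D a b c)" by (rule h(3))
  have "normal (gamE K D) x \<and> (\<forall>b c. (\<Sum>a\<in>UNIV. E.riem K (gamE K D) a b c a x) = 0)"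
    using h(1) unfolding good_at_iff[OF K h(2,3)] .
  then show "normal (gamE K D) x" "(\<Sum>a\<in>UNIV. E.riem K (gamE K D) a b c a x) = 0" by blast+
qed

lemma regular_pure_trace:
  assumes r: "regular D x" and c: "c \<in> anchor_splittings A U" "mopen U" "x \<in> U" and c': "c' \<in> anchor_splittings A U'" "mopen U'" "x \<in> U'"
  shows "pure_trace (induced_connection A U c D) (induced_connection A U' c' D) x"
proof -
  obtain K where K: "K \<in> A" "x \<in> fst K" using pts_chart[OF mopen_pts[OF c(2,3)]] by blast
  show ?thesis by (rule induced_pure_trace[OF c c' K regularD(1,3)[OF r K]])
qed

text \<open>By (ii2) both families of spatial symbols are trace free, so a pure trace difference
  between them contracts to (n + 1) \<psi> = 0. They agree near \<open>x\<close>, and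
  \<open>normal_unique\<close> gives the other components.\<close>

lemma regular_unique:
  assumes n2: "CARD('n) \<ge> 2" and W: "mopen W" "x \<in> W"
    and r: "\<And>y. y \<in> W \<Longrightarrow> regular D1 y" "\<And>y. y \<in> W \<Longrightarrow> regular D2 y"
    and p: "\<And>K y. K \<in> A \<Longrightarrow> y \<in> fst K \<Longrightarrow> y \<in> W \<Longrightarrow> pure_trace (bconn K D1) (bconn K D2) y"
    and t: "E.ls x t"
  shows "D1 t x = D2 t x"
proof -
  obtain K where K: "K \<in> A" "x \<in> fst K" using pts_chart[OF mopen_pts[OF W]] by blast
  let ?G = "gamE K D1" and ?H = "gamE K D2"
  have ev: "eventually (\<lambda>y. y \<in> fst K \<and> y \<in> W) (NH x)"
    using eventually_chart[OF K] eventually_mopen[OF W] by (rule eventually_conj)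
  have tr: "(\<Sum>j\<in>UNIV. G (Some i) (Some j) (Some j) y) = 0" if "normal G y" for G i y
  proof -
    have "(\<Sum>b\<in>UNIV. G a b b y) = (if a = None then - 1 else 0)" for a using that unfolding normal_def by blast
    then have "(\<Sum>b\<in>UNIV. G (Some i) b b y) = 0" by simp
    then show ?thesis unfolding sum_option normalD(2)[OF that] by simp
  qed
  have eq: "?G (Some i) (Some j) (Some k) y = ?H (Some i) (Some j) (Some k) y" if y: "y \<in> fst K \<and> y \<in> W" for i j k y
  proof -
    have yk: "y \<in> fst K" and yW: "y \<in> W" using y by blast+
    note a = regularD[OF r(1)[OF yW] K(1) yk] and b = regularD[OF r(2)[OF yW] K(1) yk]
    obtain \<psi> where \<psi>: "\<And>i j k. ?G (Some i) (Some j) (Some k) y - ?H (Some i) (Some j) (Some k) y = (if j = k then \<psi> i else 0) + (if i = k then \<psi> j else 0)"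
      using p[OF K(1) yk yW]
      unfolding pure_trace_iff[OF K(1) yk bconn_christoffel[OF K(1) yk a(1,3)] bconn_christoffel[OF K(1) yk b(1,3)]] by blast
    have "\<psi> i = 0" for i
    proof -
      have "(\<Sum>j\<in>UNIV. ?G (Some i) (Some j) (Some j) y - ?H (Some i) (Some j) (Some j) y) = 0"
        unfolding sum_subtractf tr[OF a(3)] tr[OF b(3)] by simp
      then have "((of_nat CARD('n) :: complex) + 1) * \<psi> i = 0" unfolding \<psi> by (simp add: sum.distrib algebra_simps)
      then show ?thesis using dimc_nz(1) by simp
    qed
    note z = this
    have "?G (Some i) (Some j) (Some k) y - ?H (Some i) (Some j) (Some k) y = 0" unfolding \<psi> z by simp
    then show ?thesis by simp
  qed
  note a = regularD[OF r(1)[OF W(2)] K] and b = regularD[OF r(2)[OF W(2)] K]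
  have n: "eventually (\<lambda>y. normal ?G y) (NH x)" "eventually (\<lambda>y. normal ?H y) (NH x)"
    by (rule eventually_mono[OF ev], use regularD(3)[OF r(1) K(1)] regularD(3)[OF r(2) K(1)] in blast)+
  have "?G a b c x = ?H a b c x" for a b c
  proof (rule normal_unique[OF n2 K n])
    show "hn x (?G a b c)" "hn x (?H a b c)" for a b c by (rule a(2), rule b(2))
    show "(\<Sum>a\<in>UNIV. E.riem K ?G a b c a x) = 0" "(\<Sum>a\<in>UNIV. E.riem K ?H a b c a x) = 0" for b c by (rule a(4), rule b(4))
    show "eventually (\<lambda>y. ?G (Some i) (Some j) (Some k) y = ?H (Some i) (Some j) (Some k) y) (NH x)" for i j k
      by (rule eventually_mono[OF ev]) (rule eq)
  qed
  then show ?thesis by (rule E.christoffel_unique[OF a(1) b(1) _ t])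
qed

section \<open>Projective coverings as pointwise conditions\<close>

definition compatible :: "'m connection_family \<Rightarrow> 'm connection_family \<Rightarrow> bool" where
  "compatible C C' \<longleftrightarrow> (\<forall>U D U' D' x. (U, D) \<in> C \<longrightarrow> (U', D') \<in> C' \<longrightarrow> x \<in> U \<longrightarrow> x \<in> U' \<longrightarrow> pure_trace D D' x)"

definition affine_family :: "'m connection_family \<Rightarrow> bool" where
  "affine_family C \<longleftrightarrow> (\<Union>(U, D)\<in>C. U) = pts \<and> (\<forall>(U, D)\<in>C. mopen U \<and>
        connection_on A (tangent_bundle A) (tangent_bundle A) U D \<and> torsion_free_on A (tangent_bundle A) U D)"

lemma affine_family_at: "affine_family C \<Longrightarrow> (U, D) \<in> C \<Longrightarrow> x \<in> U \<Longrightarrow> affine_at D x"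
  using connection_affine_at[of U D x] unfolding affine_family_def by blast

lemma affine_family_open: "affine_family C \<Longrightarrow> (U, D) \<in> C \<Longrightarrow> mopen U"
  unfolding affine_family_def by blast

lemma affine_family_ex: "affine_family C \<Longrightarrow> x \<in> pts \<Longrightarrow> \<exists>U D. (U, D) \<in> C \<and> x \<in> U"
  unfolding affine_family_def by blast

text \<open>Weyl's theorem replaces projective equivalence on overlaps by a condition at each common
  point, in which geodesics no longer occur.\<close>

lemma covering_iff: "projective_covering A C \<longleftrightarrow> affine_family C \<and> compatible C C"
proof -
  have "projectively_equivalent_on A (U \<inter> V) D D' \<longleftrightarrow> (\<forall>x\<in>U \<inter> V. pure_trace D D' x)"
    if C: "affine_family C" and m: "(U, D) \<in> C" "(V, D') \<in> C" for U D V D'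
    by (rule projectively_equivalent_iff)
      (use affine_family_at[OF C m(1)] affine_family_at[OF C m(2)] affine_family_open[OF C m(1)] affine_family_open[OF C m(2)]
        in \<open>auto intro: openin_Int\<close>)
  note p = this
  show ?thesis
  proof
    assume c: "projective_covering A C"
    then have a: "affine_family C" unfolding projective_covering_def affine_family_def by blast
    have "pure_trace D D' x" if "(U, D) \<in> C" "(U', D') \<in> C" "x \<in> U" "x \<in> U'" for U D U' D' x
    proof -
      have "projectively_equivalent_on A (U \<inter> U') D D'" using c that(1,2) unfolding projective_covering_def by blast
      then show ?thesis using p[OF a that(1,2)] that(3,4) by blast
    qed
    then show "affine_family C \<and> compatible C C" using a unfolding compatible_def by blast
  next
    assume c: "affine_family C \<and> compatible C C"
    have "projectively_equivalent_on A (U \<inter> U') D D'" if "(U, D) \<in> C" "(U', D') \<in> C" for U D U' D'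
      unfolding p[OF conjunct1[OF c] that] using c that unfolding compatible_def by blast
    then show "projective_covering A C" using c unfolding projective_covering_def affine_family_def by blast
  qed
qed

lemma compatible_sym: "compatible C C' \<Longrightarrow> compatible C' C"
  unfolding compatible_def using pure_trace_sym by blast

lemma covering_rel_iff:
  "(C, C') \<in> projective_covering_rel A \<longleftrightarrow> projective_covering A C \<and> projective_covering A C' \<and> compatible C C'"
proof -
  have "compatible (C \<union> C') (C \<union> C') \<longleftrightarrow> compatible C C \<and> compatible C' C' \<and> compatible C C'"
    using compatible_sym[of C C'] unfolding compatible_def by blast
  moreover have "affine_family (C \<union> C')" if "affine_family C" "affine_family C'"
    using that unfolding affine_family_def UN_Un ball_Un
    by (elim conjE) (intro conjI; (assumption | simp only: Un_absorb))
  ultimately show ?thesis unfolding projective_covering_rel_def mem_Collect_eq case_prod_conv covering_iff by blast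
qed

text \<open>For transitivity a member of the middle covering around the given point is inserted; the
  pointwise condition asks for no common domain.\<close>

lemma covering_rel_equiv: "equiv {C. projective_covering A C} (projective_covering_rel A)"
proof (rule equivI)
  show "refl_on {C. projective_covering A C} (projective_covering_rel A)"
    by (rule refl_onI) (use covering_rel_iff covering_iff in auto)
  show "sym (projective_covering_rel A)"
    by (rule symI) (use covering_rel_iff compatible_sym in blast)
  show "trans (projective_covering_rel A)"
  proof (rule transI)
    fix C C' C'' assume "(C, C') \<in> projective_covering_rel A" "(C', C'') \<in> projective_covering_rel A"
    then have c: "projective_covering A C" "projective_covering A C'" "projective_covering A C''" "compatible C C'" "compatible C' C''"
      unfolding covering_rel_iff by blast+
    have "pure_trace D D'' x" if m: "(U, D) \<in> C" "(U'', D'') \<in> C''" "x \<in> U" "x \<in> U''" for U D U'' D'' x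
    proof -
      have a: "affine_family C" "affine_family C'" using c(1,2) unfolding covering_iff by blast+
      have "x \<in> pts" by (rule mopen_pts[OF affine_family_open[OF a(1) m(1)] m(3)])
      then obtain U' D' where m': "(U', D') \<in> C'" "x \<in> U'" using affine_family_ex[OF a(2)] by blast
      have "pure_trace D D' x" "pure_trace D' D'' x" using c(4,5) m m' unfolding compatible_def by blast+
      then show ?thesis by (rule pure_trace_trans)
    qed
    then show "(C, C'') \<in> projective_covering_rel A" using c(1,3) unfolding covering_rel_iff compatible_def by blast
  qed
qed (auto simp: projective_covering_rel_def)

text \<open>The symbols of \<open>induced_christoffel\<close> are holomorphic and symmetric, so they
  belong to torsion free connections. The charts with their \<open>csplit\<close> show that the
  domains cover the manifold.\<close>

lemma induced_covering:
  assumes r: "\<And>x. x \<in> pts \<Longrightarrow> regular D x"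
  shows "projective_covering A (induced_covering A D)"
    and "K \<in> A \<Longrightarrow> (fst K, bconn K D) \<in> induced_covering A D"
proof -
  show b: "(fst K, bconn K D) \<in> induced_covering A D" if "K \<in> A" for K
    unfolding induced_covering_def using csplit(1)[OF that] mopen_chart[OF that] by blast
  have conn: "connection_on A (tangent_bundle A) (tangent_bundle A) U (induced_connection A U c D) \<and>
      torsion_free_on A (tangent_bundle A) U (induced_connection A U c D)"
    if U: "mopen U" and c: "c \<in> anchor_splittings A U" for U c
  proof -
    let ?I = "induced_connection A U c D"
    define H where "H K i j k y = gamE K D (Some i) (Some j) (Some k) y + (- 1 / ((of_nat CARD('n) :: complex) + 1)) *
      ((if j = k then cE K None y (c y (dd K i y)) else 0) + (if i = k then cE K None y (c y (dd K j y)) else 0))" for K i j k y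
    have H': "(\<lambda>i j k y. gamE K D (Some i) (Some j) (Some k) y + (- 1 / ((of_nat CARD('n) :: complex) + 1)) *
      ((if j = k then cE K None y (c y (dd K i y)) else 0) + (if i = k then cE K None y (c y (dd K j y)) else 0))) = H K" for K
      by (simp only: H_def[abs_def])
    have ch: "TM.christoffel K ?I (H K) y" if K: "K \<in> A" "y \<in> fst K" and y: "y \<in> U" for K y
      using induced_christoffel[OF c U y K regularD(1,3)[OF r[OF chart_pts[OF K]] K]] unfolding H' .
    have hH: "hn y (H K i j k)" if K: "K \<in> A" "y \<in> fst K" and y: "y \<in> U" for K y i j k
    proof -
      have "hn y (\<lambda>y. cE K None y (c y (dd K i y)))" for i
        by (rule E.ls_hn[OF splittingD(4)[OF c U y TM.ls_fr[OF K]] K])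
      then have "hn y (\<lambda>y. if P then cE K None y (c y (dd K i y)) else 0)" for i P
        using hn_const[OF chart_pts[OF K]] by (cases P) simp_all
      then show ?thesis unfolding H_def[abs_def]
        by (intro hn_add hn_mult hn_const chart_pts[OF K] regularD(2)[OF r[OF chart_pts[OF K]] K])
    qed
    have "connection_on A (tangent_bundle A) (tangent_bundle A) U ?I"
    proof (rule TM.christoffel_connection[OF _ U])
      show "?I t x = 0" if "\<not> (x \<in> U \<and> TM.ls x t)" for t x
        using that by (auto simp: induced_connection_def fun_eq_iff)
      fix x assume x: "x \<in> U"
      obtain K where K: "K \<in> A" "x \<in> fst K" using pts_chart[OF mopen_pts[OF U x]] by blast
      have "eventually (\<lambda>y. TM.christoffel K ?I (H K) y) (NH x)"
        using eventually_chart[OF K] eventually_mopen[OF U x] by eventually_elim (rule ch[OF K(1)])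
      then show "\<exists>K\<in>A. x \<in> fst K \<and> (\<exists>G. eventually (\<lambda>y. TM.christoffel K ?I G y) (NH x) \<and> (\<forall>a b c. hn x (G a b c)))"
        using K hH[OF K x] by (intro bexI[of _ K] conjI exI[of _ "H K"] allI)
    qed
    moreover have "torsion_free_on A (tangent_bundle A) U ?I"
      unfolding TM.torsion_free_on_iff[OF U]
    proof
      fix x assume x: "x \<in> U"
      obtain K where K: "K \<in> A" "x \<in> fst K" using pts_chart[OF mopen_pts[OF U x]] by blast
      have "\<forall>a b c. gamE K D a b c x = gamE K D b a c x"
        using regularD(3)[OF r[OF chart_pts[OF K]] K] unfolding normal_def by blast
      then have "\<forall>i j k. H K i j k x = H K j i k x" unfolding H_def by (simp add: add.commute)
      then show "\<forall>s1 s2. TM.ls x s1 \<longrightarrow> TM.ls x s2 \<longrightarrow> ?I s2 x (s1 x) - ?I s1 x (s2 x) - bracket (tangent_bundle A) s1 s2 x = 0"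
        unfolding TM.torsion_christoffel[OF ch[OF K x] K] .
    qed
    ultimately show ?thesis by blast
  qed
  have un: "(\<Union>(U, D')\<in>induced_covering A D. U) = pts"
  proof
    show "(\<Union>(U, D')\<in>induced_covering A D. U) \<subseteq> pts" unfolding induced_covering_def using mopen_pts by blast
    show "pts \<subseteq> (\<Union>(U, D')\<in>induced_covering A D. U)"
    proof
      fix x assume "x \<in> pts"
      then obtain K where "K \<in> A" "x \<in> fst K" using pts_chart by blast
      then show "x \<in> (\<Union>(U, D')\<in>induced_covering A D. U)" using b by blast
    qed
  qed
  have "affine_family (induced_covering A D)" unfolding affine_family_def un
    unfolding induced_covering_def using conn by blast
  moreover have "compatible (induced_covering A D) (induced_covering A D)"
    unfolding compatible_def
  proof (intro allI impI)
    fix U D1 U' D2 x assume "(U, D1) \<in> induced_covering A D" "(U', D2) \<in> induced_covering A D" and x: "x \<in> U" "x \<in> U'"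
    then obtain c c' where c: "D1 = induced_connection A U c D" "c \<in> anchor_splittings A U" "mopen U"
      "D2 = induced_connection A U' c' D" "c' \<in> anchor_splittings A U'" "mopen U'" unfolding induced_covering_def by blast
    show "pure_trace D1 D2 x" unfolding c(1,4)
      by (rule regular_pure_trace[OF r[OF mopen_pts[OF c(3) x(1)]] c(2,3) x(1) c(5,6) x(2)])
  qed
  ultimately show "projective_covering A (induced_covering A D)" unfolding covering_iff by blast
qed

section \<open>Solving for the connection and gluing\<close>

text \<open>The comparison with \<open>C\<close> uses the coordinate splittings only; by
  \<open>regular_pure_trace\<close> every other splitting differs from them by pure trace
  terms.\<close>

definition adapted :: "'m connection_family \<Rightarrow> ('m, ('m, 'n) atiyah, ('m, 'n) atiyah) conn \<Rightarrow> 'm \<Rightarrow> bool" where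
  "adapted C D x \<longleftrightarrow> regular D x \<and> (\<forall>K U D0. K \<in> A \<longrightarrow> x \<in> fst K \<longrightarrow> (U, D0) \<in> C \<longrightarrow> x \<in> U \<longrightarrow> pure_trace (bconn K D) D0 x)"

lemma adapted_unique:
  assumes n2: "CARD('n) \<ge> 2" and C: "affine_family C" and W: "mopen W" "x \<in> W"
    and a: "\<And>y. y \<in> W \<Longrightarrow> adapted C D1 y" "\<And>y. y \<in> W \<Longrightarrow> adapted C D2 y" and t: "E.ls x t"
  shows "D1 t x = D2 t x"
proof (rule regular_unique[where ?D1.0 = D1 and ?D2.0 = D2, OF n2 W _ _ _ t])
  show "regular D1 y" "regular D2 y" if "y \<in> W" for y using a[OF that] unfolding adapted_def by blast+
  fix K y assume K: "K \<in> A" "y \<in> fst K" and y: "y \<in> W"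
  obtain U D0 where U: "(U, D0) \<in> C" "y \<in> U" using affine_family_ex[OF C mopen_pts[OF W(1) y]] by blast
  have "pure_trace (bconn K D1) D0 y" "pure_trace (bconn K D2) D0 y"
    using a[OF y] K U unfolding adapted_def by blast+
  then show "pure_trace (bconn K D1) (bconn K D2) y" using pure_trace_sym pure_trace_trans by blast
qed

text \<open>Removing the trace from the symbols of one member of \<open>C\<close> leaves Thomas's
  parameters, which \<open>thomas\<close> completes to a solution. The other members of
  \<open>C\<close> and the other charts are reached through chains of pure trace
  differences.\<close>

lemma adapted_exists:
  assumes n2: "CARD('n) \<ge> 2" and C: "projective_covering A C" and x: "x \<in> pts"
  shows "\<exists>V D. mopen V \<and> x \<in> V \<and> connection_on A (atiyah_bundle A) (atiyah_bundle A) V D \<and> (\<forall>y\<in>V. adapted C D y)"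
proof -
  have af: "affine_family C" and cp: "compatible C C" using C unfolding covering_iff by blast+
  obtain K where K: "K \<in> A" "x \<in> fst K" using pts_chart[OF x] by blast
  obtain U D0 where U: "(U, D0) \<in> C" "x \<in> U" using affine_family_ex[OF af x] by blast
  let ?V = "U \<inter> fst K"
  have V: "mopen ?V" by (rule openin_Int[OF affine_family_open[OF af U(1)] mopen_chart[OF K(1)]])
  define T where "T j y = (\<Sum>k\<in>UNIV. gam K D0 j k k y)" for j y
  \<comment> \<open>The bracket contracts to (n + 1) times \<open>T i\<close>, so the factor -1/(n +
    1) makes \<open>P\<close> trace free.\<close>
  define P where "P i j k y = gam K D0 i j k y + (- 1 / ((of_nat CARD('n) :: complex) + 1)) *
     ((if j = k then T i y else 0) + (if i = k then T j y else 0))" for i j k y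
  have aff: "affine_at D0 y" if "y \<in> ?V" for y using affine_family_at[OF af U(1)] that by blast
  have hP: "hn y (P i j k)" if y: "y \<in> ?V" for y i j k
  proof -
    have yk: "y \<in> fst K" using y by blast
    have "hn y (\<lambda>y. T i y)" for i unfolding T_def
      by (intro hn_sum chart_pts[OF K(1) yk] affine_atD(2)[OF aff[OF y] K(1) yk])
    then have "hn y (\<lambda>y. if Q then T i y else 0)" for i Q
      using hn_const[OF chart_pts[OF K(1) yk]] by (cases Q) simp_all
    then show ?thesis unfolding P_def[abs_def]
      by (intro hn_add hn_mult hn_const chart_pts[OF K(1) yk] affine_atD(2)[OF aff[OF y] K(1) yk])
  qed
  have symP: "P i j k y = P j i k y" if y: "y \<in> ?V" for y i j k
  proof -
    have yk: "y \<in> fst K" using y by blast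
    show ?thesis unfolding P_def affine_atD(5)[OF aff[OF y] K(1) yk, of i j k] by (simp add: add.commute)
  qed
  have trP: "(\<Sum>j\<in>UNIV. P i j j y) = 0" for i y
  proof -
    have "(\<Sum>j\<in>UNIV. P i j j y) = T i y + (- 1 / ((of_nat CARD('n) :: complex) + 1)) * (((of_nat CARD('n) :: complex) + 1) * T i y)"
      unfolding P_def sum.distrib sum_distrib_left[symmetric] T_def[symmetric] by (simp add: algebra_simps)
    then show ?thesis using dimc_nz(1) by simp
  qed
  have evV: "eventually (\<lambda>y. y \<in> ?V) (NH y)" if "y \<in> ?V" for y by (rule eventually_mopen[OF V that])
  have evs: "eventually (\<lambda>y. \<forall>i j k. P i j k y = P j i k y) (NH y)" if "y \<in> ?V" for y
    by (rule eventually_mono[OF evV[OF that]]) (use symP in blast)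
  have evt: "eventually (\<lambda>y. \<forall>i. (\<Sum>j\<in>UNIV. P i j j y) = 0) (NH y)" if "y \<in> ?V" for y
    by (rule eventually_mono[OF evV[OF that]]) (use trP in blast)
  let ?G = "thomas K P"
  \<comment> \<open>The formula of \<open>christoffel\<close>, with the value zero that
    \<open>connection_on\<close> prescribes elsewhere.\<close>
  define D where "D t y = (if y \<in> ?V \<and> E.ls y t then (\<lambda>v. if v \<in> fibre (atiyah_bundle A) y then
     \<Sum>c\<in>UNIV. (anchor (atiyah_bundle A) y v (\<lambda>z. cE K c z (t z)) +
       (\<Sum>a\<in>UNIV. \<Sum>b\<in>UNIV. cE K a y v * cE K b y (t y) * ?G a b c y)) *\<^sub>C fE K c y else 0) else 0)" for t y
  have ch: "E.christoffel K D ?G y" if y: "y \<in> ?V" for y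
    unfolding E.christoffel_def
  proof (intro allI impI)
    fix t assume t: "E.ls y t"
    show "D t y = (\<lambda>v. if v \<in> fibre (atiyah_bundle A) y then
      \<Sum>c\<in>UNIV. (anchor (atiyah_bundle A) y v (\<lambda>z. cE K c z (t z)) +
       (\<Sum>a\<in>UNIV. \<Sum>b\<in>UNIV. cE K a y v * cE K b y (t y) * ?G a b c y)) *\<^sub>C fE K c y else 0)"
      unfolding D_def by (rule if_P) (use y t in blast)
  qed
  have chev: "eventually (\<lambda>y. E.christoffel K D ?G y) (NH y)" if "y \<in> ?V" for y
    by (rule eventually_mono[OF evV[OF that]]) (rule ch)
  have yk: "y \<in> fst K" if "y \<in> ?V" for y using that by blast
  have tn: "hn y (?G a b c)" "eventually (\<lambda>y. normal ?G y) (NH y)" "(\<Sum>a\<in>UNIV. E.riem K ?G a b c a y) = 0" if y: "y \<in> ?V" for y a b c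
    by (rule thomas_normal[OF n2 K(1) yk[OF y] hP[OF y] evs[OF y] evt[OF y]])+
  have conn: "connection_on A (atiyah_bundle A) (atiyah_bundle A) ?V D"
  proof (rule E.christoffel_connection[OF _ V])
    show "D t y = 0" if "\<not> (y \<in> ?V \<and> E.ls y t)" for t y using that unfolding D_def by (simp only: if_False)
    show "\<exists>K\<in>A. y \<in> fst K \<and> (\<exists>G. eventually (\<lambda>y. E.christoffel K D G y) (NH y) \<and> (\<forall>a b c. hn y (G a b c)))" if y: "y \<in> ?V" for y
      by (intro bexI[of _ K] conjI exI[of _ ?G] allI yk[OF y] chev[OF y] tn(1)[OF y] K(1))
  qed
  have "adapted C D y" if y: "y \<in> ?V" for y
  proof -
    have ny: "normal ?G y" by (rule NH_self[OF tn(2)[OF y] chart_pts[OF K(1) yk[OF y]]])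
    have "good_at D y" unfolding good_at_iff[OF K(1) yk[OF y] chev[OF y] tn(1)[OF y]] using ny tn(3)[OF y] by blast
    then have r: "regular D y" by (rule connection_regular[OF conn V y])
    have e: "(\<lambda>i j k. ?G (Some i) (Some j) (Some k)) = P" by (simp add: thomas_def fun_eq_iff)
    have bP: "TM.christoffel K (bconn K D) P y" using bconn_christoffel[OF K(1) yk[OF y] ch[OF y] ny] unfolding e .
    have b0: "pure_trace (bconn K D) D0 y"
      unfolding pure_trace_iff[OF K(1) yk[OF y] bP affine_atD(4)[OF aff[OF y] K(1) yk[OF y]]]
      by (intro exI[of _ "\<lambda>i. (- 1 / ((of_nat CARD('n) :: complex) + 1)) * T i y"]) (simp add: P_def distrib_left)
    have "pure_trace (bconn \<mu> D) D1 y" if m: "\<mu> \<in> A" "y \<in> fst \<mu>" "(U1, D1) \<in> C" "y \<in> U1" for \<mu> U1 D1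
    proof -
      have 1: "pure_trace (bconn \<mu> D) (bconn K D) y"
        by (rule regular_pure_trace[OF r csplit(1)[OF m(1)] mopen_chart[OF m(1)] m(2) csplit(1)[OF K(1)] mopen_chart[OF K(1)] yk[OF y]])
      have yU: "y \<in> U" using y by blast
      have "pure_trace D0 D1 y" using cp U(1) m(3,4) yU unfolding compatible_def by blast
      then show ?thesis by (rule pure_trace_trans[OF pure_trace_trans[OF 1 b0]])
    qed
    then show ?thesis using r unfolding adapted_def by blast
  qed
  then show ?thesis using V K(2) U(2) conn by blast
qed

text \<open>At each point some local solution is chosen and used there. By
  \<open>adapted_unique\<close> local solutions agree on overlaps, so near every point the result
  coincides with a single one of them and inherits its properties.\<close>

lemma adapted_global:
  assumes n2: "CARD('n) \<ge> 2" and C: "projective_covering A C"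
  shows "\<exists>D. rho_connection A D \<and> (\<forall>x\<in>pts. adapted C D x)"
proof -
  have af: "affine_family C" using C unfolding covering_iff by blast
  have "\<forall>x. \<exists>VD. x \<in> pts \<longrightarrow> (mopen (fst VD) \<and> x \<in> fst VD \<and>
      connection_on A (atiyah_bundle A) (atiyah_bundle A) (fst VD) (snd VD) \<and> (\<forall>y\<in>fst VD. adapted C (snd VD) y))"
  proof
    fix x
    show "\<exists>VD. x \<in> pts \<longrightarrow> (mopen (fst VD) \<and> x \<in> fst VD \<and>
      connection_on A (atiyah_bundle A) (atiyah_bundle A) (fst VD) (snd VD) \<and> (\<forall>y\<in>fst VD. adapted C (snd VD) y))"
    proof (cases "x \<in> pts")
      case True
      obtain V D where "mopen V \<and> x \<in> V \<and> connection_on A (atiyah_bundle A) (atiyah_bundle A) V D \<and> (\<forall>y\<in>V. adapted C D y)"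
        using adapted_exists[OF n2 C True] by blast
      then show ?thesis by (intro exI[of _ "(V, D)"]) simp
    qed blast
  qed
  from choice[OF this] obtain F where F: "\<And>x. x \<in> pts \<Longrightarrow> mopen (fst (F x)) \<and> x \<in> fst (F x) \<and>
      connection_on A (atiyah_bundle A) (atiyah_bundle A) (fst (F x)) (snd (F x)) \<and> (\<forall>y\<in>fst (F x). adapted C (snd (F x)) y)" by blast
  define D where "D t x = (if x \<in> pts \<and> E.ls x t then snd (F x) t x else 0)" for t x
  \<comment> \<open>Uniqueness is applied at \<open>y\<close>, on the overlap of the neighbourhoods
    chosen for \<open>x\<close> and for \<open>y\<close>. Where \<open>t\<close> is not a local
    section both sides are zero.\<close>
  have eq: "D t y = snd (F x) t y" if x: "x \<in> pts" and y: "y \<in> fst (F x)" for t x y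
  proof (cases "E.ls y t")
    case True
    have py: "y \<in> pts" using mopen_pts F[OF x] y by blast
    have "snd (F y) t y = snd (F x) t y"
    proof (rule adapted_unique[where W = "fst (F y) \<inter> fst (F x)" and ?D1.0 = "snd (F y)" and ?D2.0 = "snd (F x)", OF n2 af _ _ _ _ True])
      show "mopen (fst (F y) \<inter> fst (F x))" using F[OF x] F[OF py] by blast
      show "y \<in> fst (F y) \<inter> fst (F x)" using F[OF py] y by blast
      show "adapted C (snd (F y)) z" "adapted C (snd (F x)) z" if "z \<in> fst (F y) \<inter> fst (F x)" for z
        using F[OF x] F[OF py] that by blast+
    qed
    then show ?thesis using True py unfolding D_def by simp
  next
    case False
    have "snd (F x) t y = 0" using F[OF x] False unfolding connection_on_def by blast
    then show ?thesis using False unfolding D_def by simp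
  qed
  have chE: "E.christoffel K D G y \<longleftrightarrow> E.christoffel K (snd (F x)) G y" if x: "x \<in> pts" and y: "y \<in> fst (F x)" for K G x y
    unfolding E.christoffel_def eq[OF x y] ..
  have R: "regular (snd (F x)) x" if "x \<in> pts" for x using F[OF that] unfolding adapted_def by blast
  have ev: "eventually (\<lambda>y. E.christoffel K D (gamE K (snd (F x))) y) (NH x)" if x: "x \<in> pts" and K: "K \<in> A" "x \<in> fst K" for x K
  proof -
    have "eventually (\<lambda>y. y \<in> fst (F x)) (NH x)" using eventually_mopen F[OF x] by blast
    moreover have "eventually (E.christoffel K (snd (F x)) (gamE K (snd (F x)))) (NH x)" using R[OF x] K unfolding regular_def by blast
    ultimately show ?thesis by eventually_elim (simp only: chE[OF x])
  qed
  have conn: "connection_on A (atiyah_bundle A) (atiyah_bundle A) pts D"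
  proof (rule E.christoffel_connection[OF _ mopen_pts_all])
    show "D t x = 0" if "\<not> (x \<in> pts \<and> E.ls x t)" for t x using that unfolding D_def by (simp only: if_False)
    fix x assume x: "x \<in> pts"
    obtain K where K: "K \<in> A" "x \<in> fst K" using pts_chart[OF x] by blast
    show "\<exists>K\<in>A. x \<in> fst K \<and> (\<exists>G. eventually (\<lambda>y. E.christoffel K D G y) (NH x) \<and> (\<forall>a b c. hn x (G a b c)))"
      by (intro bexI[of _ K] conjI exI[of _ "gamE K (snd (F x))"] allI K ev[OF x K] regularD(2)[OF R[OF x] K])
  qed
  have "adapted C D x" if x: "x \<in> pts" for x
  proof -
    obtain K where K: "K \<in> A" "x \<in> fst K" using pts_chart[OF x] by blast
    have xF: "x \<in> fst (F x)" using F[OF x] by blast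
    have "good_at D x" unfolding good_at_iff[OF K ev[OF x K] regularD(2)[OF R[OF x] K]]
      using regularD(3,4)[OF R[OF x] K] by blast
    then have "regular D x" by (rule connection_regular[OF conn mopen_pts_all x])
    moreover have "pure_trace (bconn \<mu> D) D0 x" if m: "\<mu> \<in> A" "x \<in> fst \<mu>" "(U, D0) \<in> C" "x \<in> U" for \<mu> U D0
    proof -
      have "pure_trace (bconn \<mu> (snd (F x))) D0 x" using F[OF x] xF m unfolding adapted_def by blast
      then show ?thesis unfolding pure_trace_def induced_connection_def eq[OF x xF] .
    qed
    ultimately show ?thesis unfolding adapted_def by blast
  qed
  then show ?thesis using conn unfolding rho_connection_def by blast
qed

section \<open>The correspondence\<close>

lemma normalized_iff:
  "rho_connection A D \<and> torsion_free_on A (atiyah_bundle A) pts D \<and> euler_normalized A D \<and>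
     induces_canonical_connection A D \<and> ricci_flat A D \<longleftrightarrow> rho_connection A D \<and> (\<forall>x\<in>pts. good_at D x)"
proof -
  have t: "torsion_free_on A (atiyah_bundle A) pts D \<longleftrightarrow> (\<forall>x\<in>pts. \<forall>s1 s2. E.ls x s1 \<longrightarrow> E.ls x s2 \<longrightarrow>
      D s2 x (s1 x) - D s1 x (s2 x) - bracket (atiyah_bundle A) s1 s2 x = 0)"
    by (rule E.torsion_free_on_iff[OF mopen_pts_all])
  have e: "euler_normalized A D \<longleftrightarrow> (\<forall>x\<in>pts. \<forall>s. E.ls x s \<longrightarrow>
      D s x (euler_section A x) = (- 1 / ((of_nat CARD('n) :: complex) + 1)) *\<^sub>C s x)"
    unfolding euler_normalized_def local_section_def E_simps using mopen_pts by blast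
  have c: "induces_canonical_connection A D \<longleftrightarrow> (\<forall>x\<in>pts. canonical_at D x)"
    unfolding induces_canonical_connection_def canonical_at_def local_section_def using mopen_pts by blast
  show ?thesis unfolding t e c ricci_flat_def good_at_def by blast
qed

lemma normalized_regular:
  assumes r: "rho_connection A D" and g: "\<forall>x\<in>pts. good_at D x" and x: "x \<in> pts"
  shows "regular D x"
  by (rule connection_regular[OF r[unfolded rho_connection_def] mopen_pts_all x bspec[OF g x]])

lemma projective_structure_eq_iff:
  assumes "projective_covering A C" "projective_covering A C'"
  shows "projective_covering_rel A `` {C} = projective_covering_rel A `` {C'} \<longleftrightarrow> compatible C C'"
  using eq_equiv_class_iff[OF covering_rel_equiv, of C C'] assms covering_rel_iff[of C C'] by simp

text \<open>Equal structures make the connections induced by the coordinate splittings pure trace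
  equivalent, and \<open>regular_unique\<close> gives injectivity. For surjectivity, an adapted
  connection induces a covering compatible with the given one; splittings over arbitrary open sets
  are compared through those of the charts.\<close>

lemma correspondence:
  assumes n2: "CARD('n) \<ge> 2"
  shows "bij_betw (projective_structure_given_by A) {D. rho_connection A D \<and> (\<forall>x\<in>pts. good_at D x)} (projective_structures A)"
  unfolding bij_betw_def
proof
  show "inj_on (projective_structure_given_by A) {D. rho_connection A D \<and> (\<forall>x\<in>pts. good_at D x)}"
  proof (rule inj_onI)
    fix D1 D2 assume "D1 \<in> {D. rho_connection A D \<and> (\<forall>x\<in>pts. good_at D x)}" "D2 \<in> {D. rho_connection A D \<and> (\<forall>x\<in>pts. good_at D x)}"
      and eq: "projective_structure_given_by A D1 = projective_structure_given_by A D2"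
    then have D: "rho_connection A D1" "\<forall>x\<in>pts. good_at D1 x" "rho_connection A D2" "\<forall>x\<in>pts. good_at D2 x" by blast+
    note r1 = normalized_regular[OF D(1,2)] and r2 = normalized_regular[OF D(3,4)]
    have i1: "projective_covering A (induced_covering A D1)" by (rule induced_covering(1)[OF r1])
    have i2: "projective_covering A (induced_covering A D2)" by (rule induced_covering(1)[OF r2])
    have cp: "compatible (induced_covering A D1) (induced_covering A D2)"
      using eq unfolding projective_structure_given_by_def projective_structure_eq_iff[OF i1 i2] .
    show "D1 = D2"
    proof (rule ext, rule ext, rule ext)
      fix t x e
      show "D1 t x e = D2 t x e"
      proof (cases "x \<in> pts \<and> E.ls x t")
        case True
        have "D1 t x = D2 t x"
        proof (rule regular_unique[where ?D1.0 = D1 and ?D2.0 = D2, OF n2 mopen_pts_all _ r1 r2])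
          show "pure_trace (bconn K D1) (bconn K D2) y" if K: "K \<in> A" "y \<in> fst K" for K y
            using cp induced_covering(2)[OF r1 K(1)] induced_covering(2)[OF r2 K(1)] K(2) unfolding compatible_def by blast
        qed (use True in auto)
        then show ?thesis by simp
      next
        case False
        \<comment> \<open>Outside the local sections both connections are zero by convention, so
          they are equal as functions.\<close>
        have "D1 t x = 0" by (rule D(1)[unfolded rho_connection_def connection_on_def, THEN conjunct1, rule_format, OF False])
        moreover have "D2 t x = 0" by (rule D(3)[unfolded rho_connection_def connection_on_def, THEN conjunct1, rule_format, OF False])
        ultimately show ?thesis by simp
      qed
    qed
  qed
  show "projective_structure_given_by A ` {D. rho_connection A D \<and> (\<forall>x\<in>pts. good_at D x)} = projective_structures A"
  proof
    show "projective_structure_given_by A ` {D. rho_connection A D \<and> (\<forall>x\<in>pts. good_at D x)} \<subseteq> projective_structures A"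
    proof
      fix X assume "X \<in> projective_structure_given_by A ` {D. rho_connection A D \<and> (\<forall>x\<in>pts. good_at D x)}"
      then obtain D where D: "X = projective_structure_given_by A D" "rho_connection A D" "\<forall>x\<in>pts. good_at D x" by blast
      have "induced_covering A D \<in> {C. projective_covering A C}" using induced_covering(1)[OF normalized_regular[OF D(2,3)]] by blast
      then show "X \<in> projective_structures A" unfolding D(1) projective_structure_given_by_def projective_structures_def by (rule quotientI)
    qed
    show "projective_structures A \<subseteq> projective_structure_given_by A ` {D. rho_connection A D \<and> (\<forall>x\<in>pts. good_at D x)}"
    proof
      fix X assume "X \<in> projective_structures A"
      then obtain C where C: "projective_covering A C" "X = projective_covering_rel A `` {C}"
        unfolding projective_structures_def by (auto elim: quotientE)
      obtain D where D: "rho_connection A D" "\<forall>x\<in>pts. adapted C D x" using adapted_global[OF n2 C(1)] by blast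
      have r: "regular D x" if "x \<in> pts" for x using D(2) that unfolding adapted_def by blast
      have "compatible (induced_covering A D) C" unfolding compatible_def
      proof (intro allI impI)
        fix U D1 U' D0 x assume m: "(U, D1) \<in> induced_covering A D" "(U', D0) \<in> C" "x \<in> U" "x \<in> U'"
        obtain c where c: "D1 = induced_connection A U c D" "c \<in> anchor_splittings A U" "mopen U"
          using m(1) unfolding induced_covering_def by blast
        have x: "x \<in> pts" by (rule mopen_pts[OF c(3) m(3)])
        obtain K where K: "K \<in> A" "x \<in> fst K" using pts_chart[OF x] by blast
        have "pure_trace D1 (bconn K D) x" unfolding c(1)
          by (rule regular_pure_trace[OF r[OF x] c(2,3) m(3) csplit(1)[OF K(1)] mopen_chart[OF K(1)] K(2)])
        moreover have "pure_trace (bconn K D) D0 x" using D(2) x K m(2,4) unfolding adapted_def by blast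
        ultimately show "pure_trace D1 D0 x" by (rule pure_trace_trans)
      qed
      then have "X = projective_structure_given_by A D"
        unfolding C(2) projective_structure_given_by_def
        using projective_structure_eq_iff[OF induced_covering(1)[OF r] C(1)] by blast
      moreover have "\<forall>x\<in>pts. good_at D x" using r unfolding regular_def by blast
      ultimately show "X \<in> projective_structure_given_by A ` {D. rho_connection A D \<and> (\<forall>x\<in>pts. good_at D x)}" using D(1) by blast
    qed
  qed
qed

end

theorem theorem2p1:
  fixes A :: "('m, 'n::finite) atlas"
  assumes "complex_manifold A"
    and "CARD('n) \<ge> 2"
  shows "bij_betw (projective_structure_given_by A)
           {D. rho_connection A D \<and>
               torsion_free_on A (atiyah_bundle A) (manifold_points A) D \<and>
               euler_normalized A D \<and>
               induces_canonical_connection A D \<and>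
               ricci_flat A D}
           (projective_structures A)"
proof -
  interpret base_atlas A using assms(1) unfolding complex_manifold_def by unfold_locales blast
  show ?thesis unfolding normalized_iff by (rule correspondence[OF assms(2)])
qed

end
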